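(* Let $k$ be a field and let $r\ge 1$, $d\ge 0$ be integers with $r+1+d\le 2r+2$. A general set $\Gamma\subset\mathbf{P}^r_k$ of $\gamma=r+1+d$ points can be extended to an arithmetically Gorenstein set $\Gamma\cup\Gamma'\subset\mathbf{P}^r_k$ of $2r+2$ points if and only if $\binom{d}{2}\le r$. Moreover, in case $\binom{d}{2}=r$, there is a unique linear subspace $L\subset\mathbf{P}^r$ of dimension $r-d$ such that if $\Gamma\cup\Gamma'$ is arithmetically Gorenstein then $\Gamma'$ spans $L$.
   Context: A finite set of points (reduced finite scheme) in $\mathbf{P}^r$ is arithmetically Gorenstein if its homogeneous coordinate ring is Gorenstein. "General" means: for $\Gamma$ corresponding to a point of a suitable dense Zariski open subset of the space $(\mathbf{P}^r)^\gamma$ of ordered $\gamma$-tuples of points. In the second part $\Gamma\cup\Gamma'$ is again a set of $2r+2$ points. A linear subspace of dimension $-1$ is empty. *)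

theory Defs
  imports
    "HOL-Analysis.Cartesian_Space"
    "HOL-Algebra.QuotRing"
    "HOL-Algebra.Ring_Divisibility"
    "HOL-Library.Poly_Mapping"
begin

section \<open>Gorenstein rings\<close>

text \<open>
  Rings are \<^theory>\<open>HOL-Algebra.Ring\<close> records. The complement of a prime ideal \<open>P\<close> is inverted;
  fractions are equivalence classes of pairs (numerator, denominator).
\<close>

definition frac_rel :: "('a, 'm) ring_scheme \<Rightarrow> 'a set \<Rightarrow> (('a \<times> 'a) \<times> ('a \<times> 'a)) set" where
  "frac_rel R P =
     {((a, s), (b, t)). a \<in> carrier R \<and> b \<in> carrier R \<and> s \<in> carrier R - P \<and> t \<in> carrier R - P \<and>
        (\<exists>u \<in> carrier R - P. u \<otimes>\<^bsub>R\<^esub> (a \<otimes>\<^bsub>R\<^esub> t) = u \<otimes>\<^bsub>R\<^esub> (b \<otimes>\<^bsub>R\<^esub> s))}"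

definition localization :: "('a, 'm) ring_scheme \<Rightarrow> 'a set \<Rightarrow> ('a \<times> 'a) set ring" where
  "localization R P =
     \<lparr>carrier = (carrier R \<times> (carrier R - P)) // frac_rel R P,
      mult = (\<lambda>X Y. \<Union>(a, s) \<in> X. \<Union>(b, t) \<in> Y. frac_rel R P `` {(a \<otimes>\<^bsub>R\<^esub> b, s \<otimes>\<^bsub>R\<^esub> t)}),
      one = frac_rel R P `` {(\<one>\<^bsub>R\<^esub>, \<one>\<^bsub>R\<^esub>)},
      zero = frac_rel R P `` {(\<zero>\<^bsub>R\<^esub>, \<one>\<^bsub>R\<^esub>)},
      add = (\<lambda>X Y. \<Union>(a, s) \<in> X. \<Union>(b, t) \<in> Y.
               frac_rel R P `` {(a \<otimes>\<^bsub>R\<^esub> t \<oplus>\<^bsub>R\<^esub> b \<otimes>\<^bsub>R\<^esub> s, s \<otimes>\<^bsub>R\<^esub> t)})\<rparr>"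

definition noetherian_local_ring :: "('a, 'm) ring_scheme \<Rightarrow> 'a set \<Rightarrow> bool" where
  "noetherian_local_ring A m \<longleftrightarrow> cring A \<and> noetherian_ring A \<and> {I. maximalideal I A} = {m}"

text \<open>
  A zero-dimensional local ring is Gorenstein if its socle \<open>(0 : m)\<close> is simple, that is, a
  one-dimensional vector space over the residue field.
\<close>

definition socle :: "('a, 'm) ring_scheme \<Rightarrow> 'a set \<Rightarrow> 'a set" where
  "socle A m = {a \<in> carrier A. \<forall>x \<in> m. x \<otimes>\<^bsub>A\<^esub> a = \<zero>\<^bsub>A\<^esub>}"

definition gorenstein_local_dim0 :: "('a, 'm) ring_scheme \<Rightarrow> bool" where
  "gorenstein_local_dim0 A \<longleftrightarrow>
     (\<exists>m. noetherian_local_ring A m \<and> (\<forall>P. primeideal P A \<longrightarrow> P = m) \<and>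
          (\<exists>a \<in> carrier A. a \<noteq> \<zero>\<^bsub>A\<^esub> \<and> socle A m = PIdl\<^bsub>A\<^esub> a))"

definition regular_sequence :: "('a, 'm) ring_scheme \<Rightarrow> 'a list \<Rightarrow> bool" where
  "regular_sequence A xs \<longleftrightarrow>
     set xs \<subseteq> carrier A \<and> Idl\<^bsub>A\<^esub> (set xs) \<noteq> carrier A \<and>
     (\<forall>i < length xs. \<forall>a \<in> carrier A.
        xs ! i \<otimes>\<^bsub>A\<^esub> a \<in> Idl\<^bsub>A\<^esub> (set (take i xs)) \<longrightarrow> a \<in> Idl\<^bsub>A\<^esub> (set (take i xs)))"

text \<open>
  A Noetherian local ring is Gorenstein if it has a regular sequence modulo which it becomes a
  zero-dimensional Gorenstein local ring (in other words, it is Cohen-Macaulay of type one).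
  In a local ring, properness of the ideal generated by the sequence says that the sequence lies in
  the maximal ideal.
\<close>

definition gorenstein_local :: "('a, 'm) ring_scheme \<Rightarrow> bool" where
  "gorenstein_local A \<longleftrightarrow>
     (\<exists>m. noetherian_local_ring A m) \<and>
     (\<exists>xs. regular_sequence A xs \<and> gorenstein_local_dim0 (A Quot (Idl\<^bsub>A\<^esub> (set xs))))"

definition gorenstein_ring :: "('a, 'm) ring_scheme \<Rightarrow> bool" where
  "gorenstein_ring R \<longleftrightarrow>
     cring R \<and> noetherian_ring R \<and> (\<forall>m. maximalideal m R \<longrightarrow> gorenstein_local (localization R m))"


section \<open>Polynomials\<close>

text \<open>
  The polynomial ring over \<open>'a\<close> in variables indexed by the finite type \<open>'v\<close>. A polynomial maps
  exponent vectors to coefficients; \<open>Poly_Mapping\<close> provides the ring operations.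
\<close>

type_synonym ('v, 'a) mpoly = "('v \<Rightarrow>\<^sub>0 nat) \<Rightarrow>\<^sub>0 'a"

definition type_ring :: "'a::comm_ring_1 ring" where
  "type_ring = \<lparr>carrier = UNIV, mult = (*), one = 1, zero = 0, add = (+)\<rparr>"

text \<open>Evaluation at \<open>x\<close> after mapping the coefficients along \<open>\<phi>\<close>.\<close>

definition eval_mpoly ::
  "('k::zero \<Rightarrow> 'a::comm_semiring_1) \<Rightarrow> ('v::finite, 'k) mpoly \<Rightarrow> ('v \<Rightarrow> 'a) \<Rightarrow> 'a" where
  "eval_mpoly \<phi> f x =
     (\<Sum>m \<in> Poly_Mapping.keys f. \<phi> (Poly_Mapping.lookup f m) * (\<Prod>v \<in> UNIV. x v ^ Poly_Mapping.lookup m v))"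

definition homogeneous :: "('v::finite, 'k::zero) mpoly \<Rightarrow> bool" where
  "homogeneous f \<longleftrightarrow>
     (\<exists>e. \<forall>m \<in> Poly_Mapping.keys f. (\<Sum>v \<in> UNIV. Poly_Mapping.lookup m v) = e)"

text \<open>Homogeneous separately in each block of variables \<open>(j, _)\<close>.\<close>

definition multihomogeneous :: "('g \<times> 'n::finite, 'k::zero) mpoly \<Rightarrow> bool" where
  "multihomogeneous f \<longleftrightarrow>
     (\<exists>e. \<forall>m \<in> Poly_Mapping.keys f. \<forall>j. (\<Sum>i \<in> UNIV. Poly_Mapping.lookup m (j, i)) = e j)"


section \<open>Projective space\<close>

text \<open>
  Projective space of dimension \<open>CARD('n) - 1\<close>: its points are the lines through the origin of
  \<open>'a ^ 'n\<close>, and a projective linear subspace is given by the linear subspace of \<open>'a ^ 'n\<close> over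
  it, the zero subspace being the empty one, of dimension \<open>-1\<close>.
\<close>

definition proj_points :: "('a::field ^ 'n) set set" where
  "proj_points = {vec.span {v} | v. v \<noteq> 0}"

definition proj_subspace :: "('a::field ^ 'n) set \<Rightarrow> int \<Rightarrow> bool" where
  "proj_subspace L e \<longleftrightarrow> vec.subspace L \<and> int (vec.dim L) - 1 = e"

definition proj_span :: "('a::field ^ 'n) set set \<Rightarrow> ('a ^ 'n) set" where
  "proj_span X = vec.span (\<Union>X)"

text \<open>
  The homogeneous ideal of a set of points is generated by the forms vanishing on it. (Over a finite
  field it is smaller than the ideal of all polynomials vanishing on the lines.)
\<close>

definition homogeneous_ideal :: "('a::field ^ 'n::finite) set set \<Rightarrow> ('n, 'a) mpoly set" where
  "homogeneous_ideal X =
     Idl\<^bsub>type_ring\<^esub> {f. homogeneous f \<and> (\<forall>p \<in> X. \<forall>v \<in> p. eval_mpoly id f (($) v) = 0)}"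

definition homogeneous_coordinate_ring ::
  "('a::field ^ 'n::finite) set set \<Rightarrow> ('n, 'a) mpoly set ring" where
  "homogeneous_coordinate_ring X = type_ring Quot homogeneous_ideal X"

definition arithmetically_gorenstein :: "('a::field ^ 'n::finite) set set \<Rightarrow> bool" where
  "arithmetically_gorenstein X \<longleftrightarrow> gorenstein_ring (homogeneous_coordinate_ring X)"


section \<open>General tuples of points\<close>

text \<open>
  For a field embedding \<open>\<phi> : k \<rightarrow> K\<close>, the \<open>K\<close>-rational points of the open subset, defined over
  \<open>k\<close>, of the product of projective spaces with factors indexed by \<open>'g\<close> on which the
  multihomogeneous forms in \<open>F\<close> do not all vanish. Because the forms are multihomogeneous,
  non-vanishing does not depend on the choice of homogeneous coordinates \<open>v\<close>.
\<close>

definition nonvanishing_locus ::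
  "('k::field \<Rightarrow> 'a::field) \<Rightarrow> ('g::finite \<times> 'n::finite, 'k) mpoly set \<Rightarrow> ('g \<Rightarrow> ('a ^ 'n) set) set" where
  "nonvanishing_locus \<phi> F =
     {p. (\<forall>j. p j \<in> proj_points) \<and>
         (\<exists>f \<in> F. \<exists>v. (\<forall>j. v j \<in> p j \<and> v j \<noteq> 0) \<and> eval_mpoly \<phi> f (\<lambda>(j, i). v j $ i) \<noteq> 0)}"

text \<open>
  The product of projective spaces is an integral scheme, so an open subscheme is dense if and only
  if it is nonempty, if and only if one of the defining forms is a nonzero polynomial. Density is
  not tested on \<open>K\<close>-rational points, which would be wrong for finite \<open>K\<close>.
\<close>

definition zariski_dense_open ::
  "('k::field \<Rightarrow> 'a::field) \<Rightarrow> ('g::finite \<Rightarrow> ('a ^ 'n::finite) set) set \<Rightarrow> bool" where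
  "zariski_dense_open \<phi> U \<longleftrightarrow>
     (\<exists>F :: ('g \<times> 'n, 'k) mpoly set.
        (\<forall>f \<in> F. multihomogeneous f) \<and> (\<exists>f \<in> F. f \<noteq> 0) \<and> U = nonvanishing_locus \<phi> F)"

text \<open>\<open>X\<close> is extended by the new points \<open>Y\<close> to an arithmetically Gorenstein set of \<open>N\<close> points.\<close>

definition gorenstein_extension ::
  "nat \<Rightarrow> ('a::field ^ 'n::finite) set set \<Rightarrow> ('a ^ 'n) set set \<Rightarrow> bool" where
  "gorenstein_extension N X Y \<longleftrightarrow>
     Y \<subseteq> proj_points \<and> X \<inter> Y = {} \<and> finite (X \<union> Y) \<and> card (X \<union> Y) = N \<and>
     arithmetically_gorenstein (X \<union> Y)"

end

theory Submission
  imports Defs "HOL-Computational_Algebra.Polynomial" "HOL-Analysis.Determinants"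
begin

text \<open>
  A set of \<open>2 r + 2\<close> points with representatives \<open>v_j\<close> is arithmetically Gorenstein only if there is a
  relation \<open>\<Sum> c_j v_j v_j\<^sup>T = 0\<close> with all \<open>c_j\<close> nonzero; it makes the values of linear forms a self-dual
  space, and conversely, for spanning points that cannot be split, the Artinian reduction then has
  Hilbert function \<open>1, r, r, 1\<close> and a simple socle. Choose coordinates in which \<open>\<Gamma>\<close> consists of the
  coordinate points \<open>e_i\<close> and of points \<open>a_l\<close>, \<open>l < d\<close>. With \<open>b_i = 1 / c_i\<close>, a relation exists if and only
  if the form \<open>Q = \<Sum> e_i e_i\<^sup>T / b_i - \<Sum> a_l a_l\<^sup>T / s_l\<close> has rank \<open>r + 1 - d\<close>, in which case \<open>\<Gamma>'\<close>
  diagonalizes it and spans its image. The rank condition says that \<open>\<Sum>\<^sub>i b_i a_l_i a_m_i\<close> vanishes for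
  \<open>l \<noteq> m\<close> and equals \<open>s_l\<close> for \<open>l = m\<close>. These are \<open>d choose 2\<close> linear conditions on \<open>b\<close>, independent
  for general \<open>\<Gamma>\<close>, so a solution exists if and only if \<open>d choose 2 \<le> r\<close>, and if equality holds it is
  unique up to a scalar, which does not change the image of \<open>Q\<close>.
\<close>

section \<open>Localization at a prime ideal\<close>

text \<open>A Gorenstein ring has some regular sequence, not a chosen one, so the socle is moved to
  the quotient by a linear form, where it can be read off degree by degree. There a simple socle
  says that the values of forms in the last deficient degree are a hyperplane, and its equation is
  the relation. The coefficients are nonzero because the indicator of a point would otherwise give a
  second socle element; the count \<open>2 r + 2 > r + 2\<close> puts the degree at two or more. Two
  obstacles shape the converse. In characteristic two a nonzero alternating form has no
  diagonalization, so besides all \<open>b_i\<close> and \<open>s_l\<close> some diagonal entry of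
  \<open>Q\<close> must be nonzero. And generality must be expressed by multihomogeneous forms over
  \<open>k\<close>: frame coordinates become Cramer determinants and \<open>b\<close> a vector of
  cofactors, so that each condition is a form to be tested at one explicit tuple. The delicate case
  is \<open>d choose 2 = r\<close>, where \<open>b\<close> leaves no freedom. For finite
  \<open>K\<close> there is nothing to prove about points, since a dense open set may have no
  rational ones.\<close>

locale localized = cring R + primeideal P R for R (structure) and P
begin

abbreviation fr :: "'a \<Rightarrow> 'a \<Rightarrow> ('a \<times> 'a) set"
  where "fr a s \<equiv> frac_rel R P `` {(a, s)}"

abbreviation "D \<equiv> carrier R - P"

abbreviation "L \<equiv> localization R P"

lemma one_D: "\<one> \<in> D"
  using I_notcarr one_imp_carrier by auto

lemma mult_D: "s \<in> D \<Longrightarrow> t \<in> D \<Longrightarrow> s \<otimes> t \<in> D"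
  using I_prime by auto

lemma equiv_frac_rel: "equiv (carrier R \<times> D) (frac_rel R P)"
proof (rule equivI)
  show "frac_rel R P \<subseteq> (carrier R \<times> D) \<times> carrier R \<times> D"
    by (auto simp: frac_rel_def)
  show "refl_on (carrier R \<times> D) (frac_rel R P)"
    using one_D by (auto simp: refl_on_def frac_rel_def)
  show "sym (frac_rel R P)"
  proof (rule symI)
    fix x y assume "(x, y) \<in> frac_rel R P"
    then show "(y, x) \<in> frac_rel R P"
      unfolding frac_rel_def by clarsimp (metis Diff_iff)
  qed
  show "trans (frac_rel R P)"
  proof (rule transI)
    fix x y z assume xy: "(x, y) \<in> frac_rel R P" and yz: "(y, z) \<in> frac_rel R P"
    obtain a s b t c r where e: "x = (a, s)" "y = (b, t)" "z = (c, r)"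
      by (metis prod.exhaust)
    obtain u w where c: "a \<in> carrier R" "b \<in> carrier R" "c \<in> carrier R" "s \<in> D" "t \<in> D" "r \<in> D"
      "u \<in> D" "w \<in> D" and u: "u \<otimes> (a \<otimes> t) = u \<otimes> (b \<otimes> s)" and w: "w \<otimes> (b \<otimes> r) = w \<otimes> (c \<otimes> t)"
      using xy yz by (auto simp: frac_rel_def e)
    have c': "s \<in> carrier R" "t \<in> carrier R" "r \<in> carrier R" "u \<in> carrier R" "w \<in> carrier R"
      using c by auto
    \<comment> \<open>The middle denominator \<open>t\<close> joins the two multipliers, so that
      either relation can be applied inside the product.\<close>
    have "(u \<otimes> w \<otimes> t) \<otimes> (a \<otimes> r) = w \<otimes> r \<otimes> (u \<otimes> (a \<otimes> t))"
      using c c' by (simp add: m_ac)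
    also have "\<dots> = u \<otimes> s \<otimes> (w \<otimes> (b \<otimes> r))"
      using c c' by (simp add: u, simp add: m_ac)
    also have "\<dots> = (u \<otimes> w \<otimes> t) \<otimes> (c \<otimes> s)"
      using c c' by (simp add: w, simp add: m_ac)
    finally show "(x, z) \<in> frac_rel R P"
      using c mult_D[OF mult_D[of u w], of t] by (auto simp: frac_rel_def e)
  qed
qed

lemma fr_eq_iff:
  assumes "a \<in> carrier R" "s \<in> D" "b \<in> carrier R" "t \<in> D"
  shows "fr a s = fr b t \<longleftrightarrow> (\<exists>u\<in>D. u \<otimes> (a \<otimes> t) = u \<otimes> (b \<otimes> s))"
proof -
  have "fr a s = fr b t \<longleftrightarrow> ((a, s), (b, t)) \<in> frac_rel R P"
    using eq_equiv_class_iff[OF equiv_frac_rel] assms by blast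
  then show ?thesis
    using assms by (auto simp: frac_rel_def)
qed

lemma fr_eqI:
  assumes "a \<in> carrier R" "s \<in> D" "b \<in> carrier R" "t \<in> D" "a \<otimes> t = b \<otimes> s"
  shows "fr a s = fr b t"
  using fr_eq_iff[OF assms(1-4)] one_D assms(5) by auto

lemma carrier_L: "carrier L = {fr a s | a s. a \<in> carrier R \<and> s \<in> D}"
  by (auto simp: localization_def quotient_def)

lemma fr_closed: "a \<in> carrier R \<Longrightarrow> s \<in> D \<Longrightarrow> fr a s \<in> carrier L"
  by (auto simp: carrier_L)

lemma L_cases:
  assumes "x \<in> carrier L"
  obtains a s where "a \<in> carrier R" "s \<in> D" "x = fr a s"
  using assms by (auto simp: carrier_L)

text \<open>Sum and product of classes are unions over all representatives. If every choice of
  representatives gives the same class \<open>C\<close>, the union is \<open>C\<close>; this is the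
  well-definedness principle for both operations.\<close>

lemma UN_fr:
  assumes "a \<in> carrier R" "s \<in> D" "b \<in> carrier R" "t \<in> D"
    and "\<And>a' s' b' t'. a' \<in> carrier R \<Longrightarrow> s' \<in> D \<Longrightarrow> b' \<in> carrier R \<Longrightarrow> t' \<in> D \<Longrightarrow>
      fr a' s' = fr a s \<Longrightarrow> fr b' t' = fr b t \<Longrightarrow> F a' s' b' t' = C"
  shows "(\<Union>(a', s') \<in> fr a s. \<Union>(b', t') \<in> fr b t. F a' s' b' t') = C"
proof -
  have 1: "(a', s') \<in> fr a s \<Longrightarrow> a' \<in> carrier R \<and> s' \<in> D \<and> fr a' s' = fr a s" for a s a' s'
    using equiv_class_eq[OF equiv_frac_rel, of "(a, s)" "(a', s')"]
    by (auto simp: frac_rel_def)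
  have 2: "(a, s) \<in> fr a s" "(b, t) \<in> fr b t"
    using equiv_class_self[OF equiv_frac_rel] assms(1-4) by auto
  have 3: "F a' s' b' t' = C" if "(a', s') \<in> fr a s" "(b', t') \<in> fr b t" for a' s' b' t'
    using assms(5) 1[OF that(1)] 1[OF that(2)] by blast
  show ?thesis
    using 2 3 by fast
qed

lemma mult_fr:
  assumes "a \<in> carrier R" "s \<in> D" "b \<in> carrier R" "t \<in> D"
  shows "fr a s \<otimes>\<^bsub>L\<^esub> fr b t = fr (a \<otimes> b) (s \<otimes> t)"
  unfolding localization_def monoid.simps ring.simps
proof (rule UN_fr[OF assms])
  fix a' s' b' t'
  assume c: "a' \<in> carrier R" "s' \<in> D" "b' \<in> carrier R" "t' \<in> D"
    and e: "fr a' s' = fr a s" "fr b' t' = fr b t"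
  obtain u w where u: "u \<in> D" "u \<otimes> (a' \<otimes> s) = u \<otimes> (a \<otimes> s')"
    and w: "w \<in> D" "w \<otimes> (b' \<otimes> t) = w \<otimes> (b \<otimes> t')"
    using e fr_eq_iff c assms by metis
  have c': "s \<in> carrier R" "t \<in> carrier R" "s' \<in> carrier R" "t' \<in> carrier R" "u \<in> carrier R" "w \<in> carrier R"
    using c assms u w by auto
  have "(u \<otimes> w) \<otimes> ((a' \<otimes> b') \<otimes> (s \<otimes> t)) = (u \<otimes> (a' \<otimes> s)) \<otimes> (w \<otimes> (b' \<otimes> t))"
    using c c' assms by (simp add: m_ac)
  also have "\<dots> = (u \<otimes> w) \<otimes> ((a \<otimes> b) \<otimes> (s' \<otimes> t'))"
    using c c' assms by (simp add: u w, simp add: m_ac)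
  finally show "fr (a' \<otimes> b') (s' \<otimes> t') = fr (a \<otimes> b) (s \<otimes> t)"
    using c c' assms u w mult_D by (subst fr_eq_iff) auto
qed

lemma add_fr:
  assumes "a \<in> carrier R" "s \<in> D" "b \<in> carrier R" "t \<in> D"
  shows "fr a s \<oplus>\<^bsub>L\<^esub> fr b t = fr (a \<otimes> t \<oplus> b \<otimes> s) (s \<otimes> t)"
  unfolding localization_def monoid.simps ring.simps
proof (rule UN_fr[OF assms])
  fix a' s' b' t'
  assume c: "a' \<in> carrier R" "s' \<in> D" "b' \<in> carrier R" "t' \<in> D"
    and e: "fr a' s' = fr a s" "fr b' t' = fr b t"
  obtain u w where u: "u \<in> D" "u \<otimes> (a' \<otimes> s) = u \<otimes> (a \<otimes> s')"
    and w: "w \<in> D" "w \<otimes> (b' \<otimes> t) = w \<otimes> (b \<otimes> t')"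
    using e fr_eq_iff c assms by metis
  have c': "s \<in> carrier R" "t \<in> carrier R" "s' \<in> carrier R" "t' \<in> carrier R" "u \<in> carrier R" "w \<in> carrier R"
    using c assms u w by auto
  have "(u \<otimes> w) \<otimes> ((a' \<otimes> t' \<oplus> b' \<otimes> s') \<otimes> (s \<otimes> t))
      = (u \<otimes> (a' \<otimes> s)) \<otimes> (w \<otimes> t \<otimes> t') \<oplus> (w \<otimes> (b' \<otimes> t)) \<otimes> (u \<otimes> s \<otimes> s')"
    using c c' assms by (simp add: m_ac l_distr r_distr)
  also have "\<dots> = (u \<otimes> w) \<otimes> ((a \<otimes> t \<oplus> b \<otimes> s) \<otimes> (s' \<otimes> t'))"
    using c c' assms by (simp add: u w, simp add: m_ac l_distr r_distr)
  finally show "fr (a' \<otimes> t' \<oplus> b' \<otimes> s') (s' \<otimes> t') = fr (a \<otimes> t \<oplus> b \<otimes> s) (s \<otimes> t)"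
    using c c' assms u w mult_D by (subst fr_eq_iff) auto
qed

lemma one_L: "\<one>\<^bsub>L\<^esub> = fr \<one> \<one>" and zero_L: "\<zero>\<^bsub>L\<^esub> = fr \<zero> \<one>"
  by (simp_all add: localization_def)

lemma cring_L: "cring L"
proof (rule cringI)
  note D = one_D mult_D fr_closed
  show "abelian_group L"
  proof (rule abelian_groupI)
    show "\<zero>\<^bsub>L\<^esub> \<in> carrier L"
      using D by (simp add: zero_L)
  next
    fix x y assume "x \<in> carrier L" "y \<in> carrier L"
    then show "x \<oplus>\<^bsub>L\<^esub> y \<in> carrier L"
      by (elim L_cases) (use D in \<open>simp add: add_fr\<close>)
  next
    fix x y z assume "x \<in> carrier L" "y \<in> carrier L" "z \<in> carrier L"
    then show "x \<oplus>\<^bsub>L\<^esub> y \<oplus>\<^bsub>L\<^esub> z = x \<oplus>\<^bsub>L\<^esub> (y \<oplus>\<^bsub>L\<^esub> z)"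
    proof (elim L_cases)
      fix a s b t c r assume *: "a \<in> carrier R" "s \<in> D" "b \<in> carrier R" "t \<in> D" "c \<in> carrier R" "r \<in> D"
        and e: "x = fr a s" "y = fr b t" "z = fr c r"
      have st: "s \<otimes> t \<in> D" "t \<otimes> r \<in> D" "s \<otimes> t \<otimes> r \<in> D" "s \<otimes> (t \<otimes> r) \<in> D"
        by (intro D(2) *)+
      show ?thesis
        unfolding e using * st by (simp add: add_fr) (rule fr_eqI, auto simp: m_ac a_ac l_distr r_distr)
    qed
  next
    fix x y assume "x \<in> carrier L" "y \<in> carrier L"
    then show "x \<oplus>\<^bsub>L\<^esub> y = y \<oplus>\<^bsub>L\<^esub> x"
      by (elim L_cases) (use D in \<open>simp add: add_fr m_comm a_comm\<close>)
  next
    fix x assume "x \<in> carrier L"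
    then show "\<zero>\<^bsub>L\<^esub> \<oplus>\<^bsub>L\<^esub> x = x"
      by (elim L_cases) (use D in \<open>simp add: zero_L add_fr\<close>)
  next
    fix x assume "x \<in> carrier L"
    then show "\<exists>y\<in>carrier L. y \<oplus>\<^bsub>L\<^esub> x = \<zero>\<^bsub>L\<^esub>"
    proof (elim L_cases)
      fix a s assume *: "a \<in> carrier R" "s \<in> D" "x = fr a s"
      have "fr (\<ominus> a) s \<oplus>\<^bsub>L\<^esub> x = \<zero>\<^bsub>L\<^esub>"
        using * D unfolding zero_L by (simp add: add_fr) (rule fr_eqI, auto simp: l_minus l_neg)
      then show ?thesis
        using fr_closed[OF add.inv_closed[OF *(1)] *(2)] by (rule rev_bexI[rotated])
    qed
  qed
  show "comm_monoid L"
  proof (rule comm_monoidI)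
    show "\<one>\<^bsub>L\<^esub> \<in> carrier L"
      using D by (simp add: one_L)
  next
    fix x y assume "x \<in> carrier L" "y \<in> carrier L"
    then show "x \<otimes>\<^bsub>L\<^esub> y \<in> carrier L"
      by (elim L_cases) (use D in \<open>simp add: mult_fr\<close>)
  next
    fix x y z assume "x \<in> carrier L" "y \<in> carrier L" "z \<in> carrier L"
    then show "x \<otimes>\<^bsub>L\<^esub> y \<otimes>\<^bsub>L\<^esub> z = x \<otimes>\<^bsub>L\<^esub> (y \<otimes>\<^bsub>L\<^esub> z)"
    proof (elim L_cases)
      fix a s b t c r assume *: "a \<in> carrier R" "s \<in> D" "b \<in> carrier R" "t \<in> D" "c \<in> carrier R" "r \<in> D"
        and e: "x = fr a s" "y = fr b t" "z = fr c r"
      have st: "s \<otimes> t \<in> D" "t \<otimes> r \<in> D"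
        by (intro D(2) *)+
      show ?thesis
        unfolding e using * st by (simp add: mult_fr m_assoc)
    qed
  next
    fix x assume "x \<in> carrier L"
    then show "\<one>\<^bsub>L\<^esub> \<otimes>\<^bsub>L\<^esub> x = x"
      by (elim L_cases) (use D in \<open>simp add: one_L mult_fr\<close>)
  next
    fix x y assume "x \<in> carrier L" "y \<in> carrier L"
    then show "x \<otimes>\<^bsub>L\<^esub> y = y \<otimes>\<^bsub>L\<^esub> x"
      by (elim L_cases) (use D in \<open>simp add: mult_fr m_comm\<close>)
  qed
  fix x y z assume "x \<in> carrier L" "y \<in> carrier L" "z \<in> carrier L"
  then show "(x \<oplus>\<^bsub>L\<^esub> y) \<otimes>\<^bsub>L\<^esub> z = x \<otimes>\<^bsub>L\<^esub> z \<oplus>\<^bsub>L\<^esub> y \<otimes>\<^bsub>L\<^esub> z"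
  proof (elim L_cases)
    fix a s b t c r assume *: "a \<in> carrier R" "s \<in> D" "b \<in> carrier R" "t \<in> D" "c \<in> carrier R" "r \<in> D"
      and e: "x = fr a s" "y = fr b t" "z = fr c r"
    have st: "s \<otimes> t \<in> D" "s \<otimes> r \<in> D" "t \<otimes> r \<in> D" "s \<otimes> t \<otimes> r \<in> D" "s \<otimes> r \<otimes> (t \<otimes> r) \<in> D"
      by (intro D(2) *)+
    show ?thesis
      unfolding e using * st by (simp add: mult_fr add_fr) (rule fr_eqI, auto simp: m_ac l_distr r_distr)
  qed
qed

definition loc :: "'a \<Rightarrow> ('a \<times> 'a) set" where "loc a = fr a \<one>"

lemma loc_closed: "a \<in> carrier R \<Longrightarrow> loc a \<in> carrier L"
  unfolding loc_def using fr_closed one_D by auto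

lemma loc_ring_hom: "loc \<in> ring_hom R L"
  by (rule ring_hom_memI) (use one_D in \<open>auto simp: loc_def mult_fr add_fr one_L intro!: fr_closed\<close>)

lemma loc_mult: "a \<in> carrier R \<Longrightarrow> b \<in> carrier R \<Longrightarrow> loc (a \<otimes> b) = loc a \<otimes>\<^bsub>L\<^esub> loc b"
  using ring_hom_mult[OF loc_ring_hom] .

lemma loc_add: "a \<in> carrier R \<Longrightarrow> b \<in> carrier R \<Longrightarrow> loc (a \<oplus> b) = loc a \<oplus>\<^bsub>L\<^esub> loc b"
  using ring_hom_add[OF loc_ring_hom] .

lemma loc_eq_iff:
  "a \<in> carrier R \<Longrightarrow> b \<in> carrier R \<Longrightarrow> loc a = loc b \<longleftrightarrow> (\<exists>u\<in>D. u \<otimes> a = u \<otimes> b)"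
  unfolding loc_def using one_D by (subst fr_eq_iff) auto

lemma loc_one: "loc \<one> = \<one>\<^bsub>L\<^esub>" and loc_zero: "loc \<zero> = \<zero>\<^bsub>L\<^esub>"
  by (simp_all add: loc_def one_L zero_L)

lemma loc_Units: "s \<in> D \<Longrightarrow> loc s \<in> Units L"
proof -
  assume s: "s \<in> D"
  interpret L: cring L by (rule cring_L)
  have "loc s \<otimes>\<^bsub>L\<^esub> fr \<one> s = \<one>\<^bsub>L\<^esub>"
    unfolding loc_def one_L using s one_D mult_D by (simp add: mult_fr) (rule fr_eqI, auto)
  then show ?thesis
    using s fr_closed[of \<one> s] loc_closed[of s] L.m_comm[of "loc s" "fr \<one> s"]
    unfolding Units_def by auto
qed

text \<open>\<open>y\<close> is an inverse of \<open>loc s\<close>. Later arguments clear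
  denominators with the last equation and do not return to classes of pairs.\<close>

lemma L_cases_loc:
  assumes "x \<in> carrier L"
  obtains a s y where "a \<in> carrier R" "s \<in> D" "y \<in> carrier L" "y \<otimes>\<^bsub>L\<^esub> loc s = \<one>\<^bsub>L\<^esub>"
    "x = loc a \<otimes>\<^bsub>L\<^esub> y" "loc a = x \<otimes>\<^bsub>L\<^esub> loc s"
proof -
  obtain a s where *: "a \<in> carrier R" "s \<in> D" "x = fr a s"
    using assms by (rule L_cases)
  show ?thesis
  proof (rule that[of a s "fr \<one> s"])
    show "fr \<one> s \<in> carrier L" using * by (auto intro: fr_closed)
    show "fr \<one> s \<otimes>\<^bsub>L\<^esub> loc s = \<one>\<^bsub>L\<^esub>"
      unfolding loc_def one_L using * one_D mult_D by (simp add: mult_fr) (rule fr_eqI, auto)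
    show "x = loc a \<otimes>\<^bsub>L\<^esub> fr \<one> s"
      unfolding loc_def * using * one_D by (simp add: mult_fr)
    show "loc a = x \<otimes>\<^bsub>L\<^esub> loc s"
      unfolding loc_def * using * one_D mult_D by (simp add: mult_fr) (rule fr_eqI, auto simp: m_comm)
  qed (use * in auto)
qed

end

section \<open>The socle of a one-dimensional Gorenstein local ring\<close>

lemma (in ring) genideal_empty: "Idl {} = {\<zero>}"
proof
  show "Idl {} \<subseteq> {\<zero>}"
    by (rule genideal_minimal[OF zeroideal]) auto
  show "{\<zero>} \<subseteq> Idl {}"
    using additive_subgroup.zero_closed[OF ideal.axioms(1)[OF genideal_ideal[of "{}"]]] by auto
qed

locale surj_ring_hom_cring = ring_hom_cring A B h for A (structure) and B (structure) and h +
  assumes surj: "h ` carrier A = carrier B"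
begin

lemma surj_cases:
  assumes "y \<in> carrier B"
  obtains x where "x \<in> carrier A" "y = h x"
  using assms surj by blast

lemma is_ring_hom_ring: "ring_hom_ring A B h"
  by (rule ring_hom_ringI2[OF R.ring_axioms S.ring_axioms homh])

lemma surj_ex: "y \<in> carrier B \<Longrightarrow> \<exists>x\<in>carrier A. y = h x"
  using surj by blast

lemma image_ideal:
  assumes "ideal I A"
  shows "ideal (h ` I) B"
proof (rule idealI)
  interpret I: ideal I A by fact
  show "ring B" by (rule S.ring_axioms)
  show "subgroup (h ` I) (add_monoid B)"
    by (rule ring_hom_ring.img_is_add_subgroup[OF is_ring_hom_ring I.a_subgroup])
  fix a x assume a: "a \<in> h ` I" and x: "x \<in> carrier B"
  obtain i where "i \<in> I" "a = h i" using a by auto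
  moreover obtain r where "r \<in> carrier A" "x = h r" using x by (rule surj_cases)
  moreover have "h (r \<otimes>\<^bsub>A\<^esub> i) = h r \<otimes>\<^bsub>B\<^esub> h i" "h (i \<otimes>\<^bsub>A\<^esub> r) = h i \<otimes>\<^bsub>B\<^esub> h r"
    using calculation I.Icarr by (simp_all add: hom_mult)
  ultimately show "x \<otimes>\<^bsub>B\<^esub> a \<in> h ` I" "a \<otimes>\<^bsub>B\<^esub> x \<in> h ` I"
    using I.I_l_closed[of i r] I.I_r_closed[of i r] by (metis imageI)+
qed

lemma vimage_ideal:
  assumes "ideal I B"
  shows "ideal {x \<in> carrier A. h x \<in> I} A"
  by (rule ring_hom_ring.ideal_vimage[OF is_ring_hom_ring assms])

lemma noetherian_image:
  assumes "noetherian_ring A"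
  shows "noetherian_ring B"
proof (rule S.noetherian_ringI)
  interpret A: noetherian_ring A by fact
  fix I assume I: "ideal I B"
  obtain X where X: "X \<subseteq> carrier A" "finite X" "{x \<in> carrier A. h x \<in> I} = Idl\<^bsub>A\<^esub> X"
    using A.finetely_gen[OF vimage_ideal[OF I]] by auto
  have XB: "h ` X \<subseteq> carrier B" using X by auto
  have "I = Idl\<^bsub>B\<^esub> (h ` X)"
  proof
    show "Idl\<^bsub>B\<^esub> (h ` X) \<subseteq> I"
      by (rule S.genideal_minimal[OF I]) (use X R.genideal_self[OF X(1)] in auto)
    have "Idl\<^bsub>A\<^esub> X \<subseteq> {x \<in> carrier A. h x \<in> Idl\<^bsub>B\<^esub> (h ` X)}"
      by (rule R.genideal_minimal[OF vimage_ideal[OF S.genideal_ideal[OF XB]]])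
        (use X(1) S.genideal_self[OF XB] in auto)
    then show "I \<subseteq> Idl\<^bsub>B\<^esub> (h ` X)"
      using X(3) surj ideal.Icarr[OF I] by (smt (verit) image_iff mem_Collect_eq subset_eq)
  qed
  then show "\<exists>X\<subseteq>carrier B. finite X \<and> I = Idl\<^bsub>B\<^esub> X"
    using XB X(2) by blast
qed

section \<open>Images of a local ring under surjections\<close>

context
  fixes m
  assumes m: "ideal m A" and one_m: "\<one>\<^bsub>A\<^esub> \<notin> m"
    and units: "\<And>x. x \<in> carrier A \<Longrightarrow> x \<notin> m \<Longrightarrow> x \<in> Units A"
    and ker: "\<And>x. x \<in> carrier A \<Longrightarrow> h x = \<zero>\<^bsub>B\<^esub> \<Longrightarrow> x \<in> m"
begin

interpretation m: ideal m A by (rule m)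

lemma image_notin: "\<one>\<^bsub>B\<^esub> \<notin> h ` m"
proof
  assume "\<one>\<^bsub>B\<^esub> \<in> h ` m"
  then obtain y where y: "y \<in> m" "h y = \<one>\<^bsub>B\<^esub>" by auto
  then have yA: "y \<in> carrier A" using m.Icarr by auto
  then have "h (\<one>\<^bsub>A\<^esub> \<ominus>\<^bsub>A\<^esub> y) = \<zero>\<^bsub>B\<^esub>"
    using y by (simp add: a_minus_def S.r_neg)
  then have "\<one>\<^bsub>A\<^esub> \<ominus>\<^bsub>A\<^esub> y \<in> m" using ker yA by simp
  then have "(\<one>\<^bsub>A\<^esub> \<ominus>\<^bsub>A\<^esub> y) \<oplus>\<^bsub>A\<^esub> y \<in> m" using y m.a_closed by blast
  moreover have "(\<one>\<^bsub>A\<^esub> \<ominus>\<^bsub>A\<^esub> y) \<oplus>\<^bsub>A\<^esub> y = \<one>\<^bsub>A\<^esub>"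
    using yA by (simp add: a_minus_def R.a_assoc R.l_neg)
  ultimately show False using one_m by simp
qed

lemma proper_ideal_subset:
  assumes I: "ideal I B" "I \<noteq> carrier B"
  shows "I \<subseteq> h ` m"
proof
  fix z assume z: "z \<in> I"
  then obtain x where x: "x \<in> carrier A" "z = h x"
    using surj_ex[OF ideal.Icarr[OF I(1) z]] by blast
  show "z \<in> h ` m"
  proof (rule ccontr)
    assume "z \<notin> h ` m"
    then have "x \<in> Units A" using x units by auto
    then have "inv\<^bsub>A\<^esub> x \<in> carrier A" "h (inv\<^bsub>A\<^esub> x \<otimes>\<^bsub>A\<^esub> x) = \<one>\<^bsub>B\<^esub>" by auto
    then have "\<one>\<^bsub>B\<^esub> \<in> I" using ideal.I_l_closed[OF I(1) z, of "h (inv\<^bsub>A\<^esub> x)"] x by auto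
    then show False using ideal.one_imp_carrier[OF I(1)] I(2) by simp
  qed
qed

lemma maximal_image: "{I. maximalideal I B} = {h ` m}"
proof -
  have hm: "ideal (h ` m) B" by (rule image_ideal[OF m])
  have ne: "carrier B \<noteq> h ` m" using image_notin by auto
  have "maximalideal (h ` m) B"
  proof (rule maximalidealI[OF hm ne])
    fix J assume "ideal J B" "h ` m \<subseteq> J"
    then show "J = h ` m \<or> J = carrier B" using proper_ideal_subset by blast
  qed
  moreover have "I = h ` m" if "maximalideal I B" for I
  proof -
    interpret I: maximalideal I B by fact
    have "I \<subseteq> h ` m" using proper_ideal_subset[OF I.is_ideal] I.I_notcarr by auto
    then show ?thesis
      using I.I_maximal[OF hm] ne ideal.Icarr[OF hm] by blast
  qed
  ultimately show ?thesis by blast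
qed

lemma noetherian_local_image:
  "noetherian_ring A \<Longrightarrow> noetherian_local_ring B (h ` m)"
  unfolding noetherian_local_ring_def by (intro conjI S.is_cring noetherian_image maximal_image)

text \<open>By \<open>nil\<close> every prime of \<open>B\<close> contains the image of
  \<open>m\<close>, so there is only one. The conditions on \<open>a\<close> and \<open>soc\<close>
  describe the socle by representatives in \<open>A\<close>, where the computations are
  done.\<close>

lemma gorenstein_dim0_image:
  assumes "noetherian_ring A"
    and nil: "\<And>y. y \<in> m \<Longrightarrow> \<exists>n::nat. h (y [^]\<^bsub>A\<^esub> n) = \<zero>\<^bsub>B\<^esub>"
    and a: "a \<in> carrier A" "h a \<noteq> \<zero>\<^bsub>B\<^esub>" "\<And>y. y \<in> m \<Longrightarrow> h (y \<otimes>\<^bsub>A\<^esub> a) = \<zero>\<^bsub>B\<^esub>"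
    and soc: "\<And>b. b \<in> carrier A \<Longrightarrow> (\<And>y. y \<in> m \<Longrightarrow> h (y \<otimes>\<^bsub>A\<^esub> b) = \<zero>\<^bsub>B\<^esub>) \<Longrightarrow>
      \<exists>r\<in>carrier A. h b = h (r \<otimes>\<^bsub>A\<^esub> a)"
  shows "gorenstein_local_dim0 B"
  unfolding gorenstein_local_dim0_def
proof (intro exI[of _ "h ` m"] conjI allI impI)
  show "noetherian_local_ring B (h ` m)" using assms(1) by (rule noetherian_local_image)
next
  fix P assume P: "primeideal P B"
  interpret P: primeideal P B by fact
  have pow: "x [^]\<^bsub>B\<^esub> n \<in> P \<Longrightarrow> x \<in> P" if x: "x \<in> carrier B" for x and n :: nat
  proof (induction n)
    case 0
    then show ?case using P.I_notcarr P.one_imp_carrier by auto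
  next
    case (Suc n)
    then show ?case using P.I_prime[of "x [^]\<^bsub>B\<^esub> n" x] x by auto
  qed
  show "P = h ` m"
  proof
    show "P \<subseteq> h ` m" using proper_ideal_subset[OF P.is_ideal] P.I_notcarr by auto
    show "h ` m \<subseteq> P"
    proof (rule image_subsetI)
      fix y assume y: "y \<in> m"
      then obtain n :: nat where "h (y [^]\<^bsub>A\<^esub> n) = \<zero>\<^bsub>B\<^esub>" using nil by blast
      then have "h y [^]\<^bsub>B\<^esub> n \<in> P"
        using y m.Icarr P.zero_closed by (simp add: hom_nat_pow)
      then show "h y \<in> P" using pow y m.Icarr by blast
    qed
  qed
next
  have "socle B (h ` m) = PIdl\<^bsub>B\<^esub> (h a)"
  proof
    show "socle B (h ` m) \<subseteq> PIdl\<^bsub>B\<^esub> (h a)"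
    proof
      fix z assume z: "z \<in> socle B (h ` m)"
      then obtain b where b: "b \<in> carrier A" "z = h b"
        using surj_ex[of z] unfolding socle_def by blast
      have "h (y \<otimes>\<^bsub>A\<^esub> b) = \<zero>\<^bsub>B\<^esub>" if "y \<in> m" for y
        using z that b m.Icarr[OF that] by (auto simp: socle_def)
      then show "z \<in> PIdl\<^bsub>B\<^esub> (h a)"
        using soc[OF b(1)] b a by (auto simp: cgenideal_def)
    qed
    show "PIdl\<^bsub>B\<^esub> (h a) \<subseteq> socle B (h ` m)"
    proof
      fix z assume "z \<in> PIdl\<^bsub>B\<^esub> (h a)"
      then obtain r where r: "r \<in> carrier B" "z = r \<otimes>\<^bsub>B\<^esub> h a" by (auto simp: cgenideal_def)
      have "h y \<otimes>\<^bsub>B\<^esub> z = \<zero>\<^bsub>B\<^esub>" if "y \<in> m" for y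
      proof -
        have "h y \<otimes>\<^bsub>B\<^esub> z = r \<otimes>\<^bsub>B\<^esub> (h y \<otimes>\<^bsub>B\<^esub> h a)"
          using r a m.Icarr[OF that] by (simp add: S.m_ac)
        then show ?thesis using a(3)[OF that] a(1) r m.Icarr[OF that] by simp
      qed
      then show "z \<in> socle B (h ` m)" using r a by (auto simp: socle_def)
    qed
  qed
  then show "\<exists>a\<in>carrier B. a \<noteq> \<zero>\<^bsub>B\<^esub> \<and> socle B (h ` m) = PIdl\<^bsub>B\<^esub> a"
    using a by auto
qed

end

end

lemma (in cring) quot_surj_hom:
  assumes "ideal J R"
  shows "surj_ring_hom_cring R (R Quot J) ((+>) J)"
proof -
  interpret J: ideal J R by fact
  interpret ring_hom_cring R "R Quot J" "(+>) J" by (rule J.rcos_ring_hom_cring[OF is_cring])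
  show ?thesis
  proof unfold_locales
    show "(+>) J ` carrier R = carrier (R Quot J)"
      by (simp only: FactRing_def A_RCOSETS_def' partial_object.simps) blast
  qed
qed

lemma (in cring) quot_eq_zero_iff:
  assumes "ideal J R" "x \<in> carrier R"
  shows "J +> x = \<zero>\<^bsub>R Quot J\<^esub> \<longleftrightarrow> x \<in> J"
  using ideal.rcos_const_imp_mem[OF assms(1)] ideal.Icarr[OF assms(1)] a_rcos_zero[OF assms(1)] assms(2)
  by (auto simp: FactRing_def)

lemma (in cring) quot_eq_iff:
  assumes "ideal J R" "x \<in> carrier R" "y \<in> carrier R"
  shows "J +> x = J +> y \<longleftrightarrow> x \<ominus> y \<in> J"
  using quotient_eq_iff_same_a_r_cos[OF assms] by auto

lemma (in cring) mem_Idl_singleton: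
  "x \<in> carrier R \<Longrightarrow> y \<in> Idl {x} \<longleftrightarrow> (\<exists>r\<in>carrier R. y = r \<otimes> x)"
  by (auto simp: cgenideal_eq_genideal[symmetric] cgenideal_def)

context cring begin

text \<open>
  The regular sequence has length one, and if \<open>x z = l z'\<close> then \<open>z \<mapsto> z'\<close> carries the socle of
  \<open>R/(l)\<close> to the socle of \<open>R/(x)\<close>.
\<close>

lemma gorenstein_local_socle:
  assumes m: "ideal m R" "\<one> \<notin> m" and units: "\<And>x. x \<in> carrier R \<Longrightarrow> x \<notin> m \<Longrightarrow> x \<in> Units R"
    and l: "l \<in> m" "\<And>a. a \<in> carrier R \<Longrightarrow> l \<otimes> a = \<zero> \<Longrightarrow> a = \<zero>"
    and z: "z \<in> carrier R" "z \<notin> Idl {l}" "\<And>y. y \<in> m \<Longrightarrow> y \<otimes> z \<in> Idl {l}"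
    and G: "gorenstein_local R"
  obtains a where "a \<in> carrier R" "\<And>y. y \<in> m \<Longrightarrow> y \<otimes> a \<in> Idl {l}"
    "\<And>b. b \<in> carrier R \<Longrightarrow> (\<And>y. y \<in> m \<Longrightarrow> y \<otimes> b \<in> Idl {l}) \<Longrightarrow>
      \<exists>r\<in>carrier R. \<exists>s\<in>carrier R. b = r \<otimes> a \<oplus> s \<otimes> l"
proof -
  interpret m: ideal m R by fact
  have lc: "l \<in> carrier R" using l m.Icarr by auto
  obtain xs where xs: "regular_sequence R xs" and Q: "gorenstein_local_dim0 (R Quot (Idl (set xs)))"
    using G unfolding gorenstein_local_def by auto
  define J where "J = Idl (set xs)"
  have xsc: "set xs \<subseteq> carrier R" and J1: "J \<noteq> carrier R"
    using xs by (auto simp: regular_sequence_def J_def)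
  have J: "ideal J R" unfolding J_def by (rule genideal_ideal[OF xsc])
  interpret J: ideal J R by (rule J)
  interpret Q: surj_ring_hom_cring R "R Quot J" "(+>) J" by (rule quot_surj_hom[OF J])
  have Jm: "x \<in> m" if "x \<in> J" for x
  proof (rule ccontr)
    assume "x \<notin> m"
    then have "x \<in> Units R" using units that J.Icarr by auto
    then have "inv x \<otimes> x \<in> J" "inv x \<otimes> x = \<one>" using that J.I_l_closed[of x "inv x"] by auto
    then show False using J1 J.one_imp_carrier by auto
  qed
  have ker: "\<And>x. x \<in> carrier R \<Longrightarrow> J +> x = \<zero>\<^bsub>R Quot J\<^esub> \<Longrightarrow> x \<in> m"
    using quot_eq_zero_iff[OF J] Jm by auto
  have max: "{I. maximalideal I (R Quot J)} = {(+>) J ` m}"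
    by (rule Q.maximal_image[OF m units ker])
  obtain mq a where mq: "noetherian_local_ring (R Quot J) mq" and a: "a \<in> carrier (R Quot J)"
    "a \<noteq> \<zero>\<^bsub>R Quot J\<^esub>" "socle (R Quot J) mq = PIdl\<^bsub>R Quot J\<^esub> a"
    using Q by (auto simp: gorenstein_local_dim0_def J_def)
  have mq': "mq = (+>) J ` m" using mq max by (auto simp: noetherian_local_ring_def)
  obtain a0 where a0: "a0 \<in> carrier R" "a = J +> a0" using a(1) by (rule Q.surj_cases)
  have a0J: "a0 \<notin> J" using a a0 quot_eq_zero_iff[OF J] by auto
  have "a \<in> socle (R Quot J) mq" using Q.S.cgenideal_self[OF a(1)] a(3) by auto
  then have ma0: "y \<otimes> a0 \<in> J" if "y \<in> m" for y
  proof -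
    have "(J +> y) \<otimes>\<^bsub>R Quot J\<^esub> (J +> a0) = \<zero>\<^bsub>R Quot J\<^esub>"
      using \<open>a \<in> socle (R Quot J) mq\<close> that unfolding socle_def mq' a0(2) by blast
    then show ?thesis
      using Q.hom_mult[OF m.Icarr[OF that] a0(1)] m.Icarr[OF that] a0(1)
        quot_eq_zero_iff[OF J, of "y \<otimes> a0"] by simp
  qed
  have soc: "\<exists>r\<in>carrier R. b \<ominus> r \<otimes> a0 \<in> J"
    if b: "b \<in> carrier R" "\<And>y. y \<in> m \<Longrightarrow> y \<otimes> b \<in> J" for b
  proof -
    have "(J +> y) \<otimes>\<^bsub>R Quot J\<^esub> (J +> b) = \<zero>\<^bsub>R Quot J\<^esub>" if "y \<in> m" for y
      using Q.hom_mult[OF m.Icarr[OF that] b(1)] m.Icarr[OF that] b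
        quot_eq_zero_iff[OF J, of "y \<otimes> b"] that by simp
    then have "J +> b \<in> socle (R Quot J) mq"
      using Q.hom_closed[OF b(1)] unfolding socle_def mq' by blast
    then obtain r where r: "r \<in> carrier R" "J +> b = (J +> r) \<otimes>\<^bsub>R Quot J\<^esub> (J +> a0)"
      using Q.surj_ex unfolding a(3) a0(2) cgenideal_def by blast
    then have "J +> b = J +> (r \<otimes> a0)" using a0 by simp
    then show ?thesis using quot_eq_iff[OF J, of b "r \<otimes> a0"] r b a0 by auto
  qed
  consider "xs = []" | x where "xs = [x]" | x y ys where "xs = x # y # ys"
    by (metis neq_Nil_conv)
  then show ?thesis
  proof cases
    \<comment> \<open>Length zero: \<open>a0\<close> is then a socle element of the ring itself and
      is killed by the nonzerodivisor \<open>l\<close>.\<close>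
    case 1
    then have "J = {\<zero>}" by (simp add: J_def genideal_empty)
    then have "l \<otimes> a0 = \<zero>" using ma0[OF l(1)] by auto
    then have "a0 = \<zero>" using l(2) a0 by auto
    then show ?thesis using a0J \<open>J = {\<zero>}\<close> by auto
  next
    case 2
    have x: "x \<in> carrier R" using xsc 2 by auto
    have J': "J = Idl {x}" using 2 by (simp add: J_def)
    have Jx: "y \<in> J \<longleftrightarrow> (\<exists>r\<in>carrier R. y = r \<otimes> x)" for y
      unfolding J' by (rule mem_Idl_singleton[OF x])
    have xr: "c = \<zero>" if "c \<in> carrier R" "x \<otimes> c = \<zero>" for c
      using xs that 2 by (auto simp: regular_sequence_def genideal_empty)
    have xJ: "x \<in> J" using Jx x by (metis l_one one_closed)
    have xm: "x \<in> m" using Jm xJ .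
    \<comment> \<open>The correspondence is read backwards: \<open>a'\<close> is the socle element
      modulo \<open>l\<close> whose partner is the generator \<open>a0\<close> modulo
      \<open>x\<close>.\<close>
    obtain a' where a': "a' \<in> carrier R" "l \<otimes> a0 = a' \<otimes> x"
      using ma0[OF l(1)] Jx by auto
    show ?thesis
    proof (rule that[of a'])
      show "a' \<in> carrier R" by fact
      fix y assume y: "y \<in> m"
      have yc: "y \<in> carrier R" using y m.Icarr by auto
      obtain w where w: "w \<in> carrier R" "y \<otimes> a0 = w \<otimes> x" using ma0[OF y] Jx by auto
      have "x \<otimes> (y \<otimes> a') = l \<otimes> (y \<otimes> a0)" using a' a0 x lc yc
        by (simp add: m_lcomm[of l y a0]) (simp add: m_ac)
      also have "\<dots> = x \<otimes> (w \<otimes> l)" using w x lc by (simp add: m_ac)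
      finally have "x \<otimes> (y \<otimes> a' \<ominus> w \<otimes> l) = \<zero>"
        using x yc a' w lc by (simp add: a_minus_def r_distr r_minus r_neg)
      then have "y \<otimes> a' \<ominus> w \<otimes> l = \<zero>" using xr yc a' w lc by simp
      then have "y \<otimes> a' = w \<otimes> l" using yc a' w lc by (simp add: r_right_minus_eq)
      then show "y \<otimes> a' \<in> Idl {l}" using mem_Idl_singleton[OF lc] w by auto
    next
      fix b assume b: "b \<in> carrier R" "\<And>y. y \<in> m \<Longrightarrow> y \<otimes> b \<in> Idl {l}"
      \<comment> \<open>The partner \<open>b'\<close> of \<open>b\<close> is a multiple of
        \<open>a0\<close> modulo \<open>x\<close>; after multiplication by \<open>l\<close> the
        factor \<open>x\<close> cancels.\<close>
      obtain b' where b': "b' \<in> carrier R" "x \<otimes> b = b' \<otimes> l"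
        using b(2)[OF xm] mem_Idl_singleton[OF lc] by auto
      have "y \<otimes> b' \<in> J" if y: "y \<in> m" for y
      proof -
        have yc: "y \<in> carrier R" using y m.Icarr by auto
        obtain w where w: "w \<in> carrier R" "y \<otimes> b = w \<otimes> l" using b(2)[OF y] mem_Idl_singleton[OF lc] by auto
        have "l \<otimes> (y \<otimes> b') = x \<otimes> (y \<otimes> b)" using b' b x lc yc
          by (simp add: m_lcomm[of x y b]) (simp add: m_ac)
        also have "\<dots> = l \<otimes> (w \<otimes> x)" using w x lc by (simp add: m_ac)
        finally have "l \<otimes> (y \<otimes> b' \<ominus> w \<otimes> x) = \<zero>"
          using x yc b' w lc by (simp add: a_minus_def r_distr r_minus r_neg)
        then have "y \<otimes> b' \<ominus> w \<otimes> x = \<zero>" using l(2) yc b' w x by simp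
        then have "y \<otimes> b' = w \<otimes> x" using yc b' w x by (simp add: r_right_minus_eq)
        then show ?thesis using Jx w by auto
      qed
      then obtain r where r: "r \<in> carrier R" "b' \<ominus> r \<otimes> a0 \<in> J" using soc[OF b'(1)] by blast
      then obtain s where s: "s \<in> carrier R" "b' \<ominus> r \<otimes> a0 = s \<otimes> x" using Jx by auto
      have "b' = (b' \<ominus> r \<otimes> a0) \<oplus> r \<otimes> a0"
        using b' r a0 by (simp add: a_minus_def a_assoc l_neg)
      then have b'': "b' = s \<otimes> x \<oplus> r \<otimes> a0" using s by simp
      have "x \<otimes> b = l \<otimes> b'" using b' lc by (simp add: m_comm)
      also have "\<dots> = l \<otimes> (s \<otimes> x) \<oplus> r \<otimes> (l \<otimes> a0)"
        unfolding b'' using s r a0 x lc by (simp add: r_distr m_lcomm)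
      also have "\<dots> = x \<otimes> (r \<otimes> a' \<oplus> s \<otimes> l)"
        unfolding a'(2) using s r a' x lc by (simp add: r_distr m_ac a_ac)
      finally have "x \<otimes> (b \<ominus> (r \<otimes> a' \<oplus> s \<otimes> l)) = \<zero>"
        using x b a' s r lc by (simp add: a_minus_def r_distr[of _ _ x] r_minus r_neg)
      then have "b \<ominus> (r \<otimes> a' \<oplus> s \<otimes> l) = \<zero>" using xr b a' s r lc by simp
      then have "b = r \<otimes> a' \<oplus> s \<otimes> l" using b a' s r lc by (simp add: r_right_minus_eq)
      then show "\<exists>r\<in>carrier R. \<exists>s\<in>carrier R. b = r \<otimes> a' \<oplus> s \<otimes> l" using r s by auto
    qed
  next
    \<comment> \<open>A socle element modulo \<open>l\<close> bounds the depth by one. From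
      \<open>x z = w l\<close> and \<open>y z = v l\<close> follows \<open>y w = v x\<close>;
      regularity of \<open>y\<close> modulo \<open>x\<close> makes \<open>x\<close> divide
      \<open>w\<close>, and cancelling \<open>x\<close> makes \<open>l\<close> divide
      \<open>z\<close>, a contradiction.\<close>
    case 3
    have x: "x \<in> carrier R" "y \<in> carrier R" using xsc 3 by auto
    have xy: "x \<in> m" "y \<in> m"
      using Jm genideal_self[OF xsc] 3 by (auto simp: J_def)
    have xr: "c = \<zero>" if "c \<in> carrier R" "x \<otimes> c = \<zero>" for c
      using xs that 3 by (auto simp: regular_sequence_def genideal_empty)
    have yr: "c \<in> Idl {x}" if "c \<in> carrier R" "y \<otimes> c \<in> Idl {x}" for c
      using xs that 3 unfolding regular_sequence_def
      by (auto dest!: spec[of _ "1::nat"])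
    obtain w where w: "w \<in> carrier R" "x \<otimes> z = w \<otimes> l"
      using z(3)[OF xy(1)] mem_Idl_singleton[OF lc] by auto
    obtain v where v: "v \<in> carrier R" "y \<otimes> z = v \<otimes> l"
      using z(3)[OF xy(2)] mem_Idl_singleton[OF lc] by auto
    have "l \<otimes> (y \<otimes> w) = y \<otimes> (x \<otimes> z)" using w x lc by (simp add: m_ac)
    also have "\<dots> = x \<otimes> (y \<otimes> z)" using x z by (simp add: m_lcomm)
    also have "\<dots> = l \<otimes> (v \<otimes> x)" using v x lc by (simp add: m_ac)
    finally have "l \<otimes> (y \<otimes> w \<ominus> v \<otimes> x) = \<zero>"
      using x v w lc by (simp add: a_minus_def r_distr r_minus r_neg)
    then have "y \<otimes> w \<ominus> v \<otimes> x = \<zero>" using l(2) x v w by simp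
    then have "y \<otimes> w = v \<otimes> x" using x v w by (simp add: r_right_minus_eq)
    then have "w \<in> Idl {x}" using yr[OF w(1)] v mem_Idl_singleton[OF x(1)] by auto
    then obtain u where u: "u \<in> carrier R" "w = u \<otimes> x" using mem_Idl_singleton[OF x(1)] by auto
    have "x \<otimes> z = x \<otimes> (u \<otimes> l)" using w u x lc by (simp add: m_ac)
    then have "x \<otimes> (z \<ominus> u \<otimes> l) = \<zero>"
      using x z u lc by (simp add: a_minus_def r_distr r_minus r_neg)
    then have "z \<ominus> u \<otimes> l = \<zero>" using xr z u lc by simp
    then have "z = u \<otimes> l" using z u lc by (simp add: r_right_minus_eq)
    then show ?thesis using z(2) mem_Idl_singleton[OF lc] u by auto
  qed
qed

end

section \<open>Comparison of a ring with its localization\<close>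

context localized
begin

interpretation L: cring L by (rule cring_L)

definition PL :: "('a \<times> 'a) set set"
  where "PL = {loc a \<otimes>\<^bsub>L\<^esub> y | a y. a \<in> P \<and> y \<in> carrier L}"

lemma P_carrier: "a \<in> P \<Longrightarrow> a \<in> carrier R"
  by (rule Icarr)

lemma PL_carrier: "x \<in> PL \<Longrightarrow> x \<in> carrier L"
  unfolding PL_def using loc_closed P_carrier by auto

lemma loc_mem_PL: "a \<in> P \<Longrightarrow> loc a \<in> PL"
  unfolding PL_def using L.r_one[OF loc_closed[OF P_carrier]] L.one_closed by force

lemma loc_in_PL_iff:
  assumes "a \<in> carrier R"
  shows "loc a \<in> PL \<longleftrightarrow> a \<in> P"
proof
  assume "loc a \<in> PL"
  then obtain p y where p: "p \<in> P" "y \<in> carrier L" "loc a = loc p \<otimes>\<^bsub>L\<^esub> y"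
    unfolding PL_def by auto
  obtain b s z where y: "b \<in> carrier R" "s \<in> D" "z \<in> carrier L" "z \<otimes>\<^bsub>L\<^esub> loc s = \<one>\<^bsub>L\<^esub>"
    "y = loc b \<otimes>\<^bsub>L\<^esub> z" "loc b = y \<otimes>\<^bsub>L\<^esub> loc s"
    using p(2) by (rule L_cases_loc)
  have s: "s \<in> carrier R" and pc: "p \<in> carrier R" using y p P_carrier by auto
  have "loc (a \<otimes> s) = loc (p \<otimes> b)"
    unfolding loc_mult[OF assms s] loc_mult[OF pc y(1)] p(3) y(6)
    using p(2) s pc loc_closed by (simp add: L.m_assoc)
  then obtain u where u: "u \<in> D" "u \<otimes> (a \<otimes> s) = u \<otimes> (p \<otimes> b)"
    using loc_eq_iff s pc assms y by auto
  have "u \<otimes> (p \<otimes> b) \<in> P"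
    using I_l_closed[OF I_r_closed[OF p(1) y(1)]] u by auto
  then have "u \<otimes> (a \<otimes> s) \<in> P" using u by simp
  then have "a \<otimes> s \<in> P" using I_prime[of u "a \<otimes> s"] u s assms by auto
  then show "a \<in> P" using I_prime[of a s] s assms y by auto
qed (rule loc_mem_PL)

lemma PL_ideal: "ideal PL L"
proof (rule idealI[OF L.ring_axioms])
  have closed: "x \<oplus>\<^bsub>L\<^esub> y \<in> PL" if xy: "x \<in> PL" "y \<in> PL" for x y
  proof -
    obtain a u b v where *: "a \<in> P" "u \<in> carrier L" "x = loc a \<otimes>\<^bsub>L\<^esub> u" "b \<in> P" "v \<in> carrier L" "y = loc b \<otimes>\<^bsub>L\<^esub> v"
      using xy unfolding PL_def by auto
    obtain c s z where u: "c \<in> carrier R" "s \<in> D" "z \<in> carrier L" "z \<otimes>\<^bsub>L\<^esub> loc s = \<one>\<^bsub>L\<^esub>"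
      "u = loc c \<otimes>\<^bsub>L\<^esub> z" "loc c = u \<otimes>\<^bsub>L\<^esub> loc s"
      using *(2) by (rule L_cases_loc)
    obtain d t w where v: "d \<in> carrier R" "t \<in> D" "w \<in> carrier L" "w \<otimes>\<^bsub>L\<^esub> loc t = \<one>\<^bsub>L\<^esub>"
      "v = loc d \<otimes>\<^bsub>L\<^esub> w" "loc d = v \<otimes>\<^bsub>L\<^esub> loc t"
      using *(5) by (rule L_cases_loc)
    have car: "a \<in> carrier R" "b \<in> carrier R" "s \<in> carrier R" "t \<in> carrier R"
      using P_carrier[OF *(1)] P_carrier[OF *(4)] u(2) v(2) by simp_all
    let ?n = "(a \<otimes> c) \<otimes> t \<oplus> (b \<otimes> d) \<otimes> s"
    have P1: "a \<otimes> c \<in> P" "b \<otimes> d \<in> P" by (rule I_r_closed[OF *(1) u(1)], rule I_r_closed[OF *(4) v(1)])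
    have P2: "(a \<otimes> c) \<otimes> t \<in> P" "(b \<otimes> d) \<otimes> s \<in> P" by (rule I_r_closed[OF P1(1) car(4)], rule I_r_closed[OF P1(2) car(3)])
    have nP: "?n \<in> P" using P2 a_closed by blast
    have 1: "loc t \<otimes>\<^bsub>L\<^esub> w = \<one>\<^bsub>L\<^esub>" "loc s \<otimes>\<^bsub>L\<^esub> z = \<one>\<^bsub>L\<^esub>"
      using u v car L.m_comm loc_closed by metis+
    have "loc ?n \<otimes>\<^bsub>L\<^esub> (z \<otimes>\<^bsub>L\<^esub> w)
       = loc a \<otimes>\<^bsub>L\<^esub> (loc c \<otimes>\<^bsub>L\<^esub> z) \<otimes>\<^bsub>L\<^esub> (loc t \<otimes>\<^bsub>L\<^esub> w) \<oplus>\<^bsub>L\<^esub> loc b \<otimes>\<^bsub>L\<^esub> (loc d \<otimes>\<^bsub>L\<^esub> w) \<otimes>\<^bsub>L\<^esub> (loc s \<otimes>\<^bsub>L\<^esub> z)"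
      using u(1-3) v(1-3) car by (simp add: loc_mult loc_add loc_closed L.l_distr L.r_distr L.m_ac)
    also have "\<dots> = x \<oplus>\<^bsub>L\<^esub> y"
      unfolding 1 *(3) *(6) u(5) v(5) using u(1-3) v(1-3) car by (simp add: loc_closed)
    finally show ?thesis
      unfolding PL_def using nP u(3) v(3) by (metis (mono_tags, lifting) L.m_closed mem_Collect_eq)
  qed
  have mult: "x \<otimes>\<^bsub>L\<^esub> y \<in> PL" if xy: "x \<in> PL" "y \<in> carrier L" for x y
  proof -
    obtain a u where *: "a \<in> P" "u \<in> carrier L" "x = loc a \<otimes>\<^bsub>L\<^esub> u"
      using xy unfolding PL_def by auto
    have "x \<otimes>\<^bsub>L\<^esub> y = loc a \<otimes>\<^bsub>L\<^esub> (u \<otimes>\<^bsub>L\<^esub> y)"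
      unfolding * using * xy P_carrier by (simp add: L.m_assoc loc_closed)
    then show ?thesis unfolding PL_def using * xy by blast
  qed
  show "subgroup PL (add_monoid L)"
  proof (rule L.add.subgroupI)
    show "PL \<subseteq> carrier L" using PL_carrier by auto
    show "PL \<noteq> {}" using loc_mem_PL additive_subgroup.zero_closed[OF is_additive_subgroup] by blast
    fix x assume x: "x \<in> PL"
    have xc: "x \<in> carrier L" using PL_carrier[OF x] .
    have "x \<otimes>\<^bsub>L\<^esub> (\<ominus>\<^bsub>L\<^esub> \<one>\<^bsub>L\<^esub>) \<in> PL" by (rule mult[OF x]) simp
    moreover have "x \<otimes>\<^bsub>L\<^esub> (\<ominus>\<^bsub>L\<^esub> \<one>\<^bsub>L\<^esub>) = \<ominus>\<^bsub>L\<^esub> x" using xc by (simp add: L.r_minus)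
    ultimately show "\<ominus>\<^bsub>L\<^esub> x \<in> PL" by simp
  next
    fix x y assume "x \<in> PL" "y \<in> PL"
    then show "x \<oplus>\<^bsub>L\<^esub> y \<in> PL" by (rule closed)
  qed
  fix a x assume "a \<in> PL" "x \<in> carrier L"
  then show "x \<otimes>\<^bsub>L\<^esub> a \<in> PL" "a \<otimes>\<^bsub>L\<^esub> x \<in> PL"
    using mult L.m_comm[OF _ PL_carrier] by metis+
qed

lemma one_notin_PL: "\<one>\<^bsub>L\<^esub> \<notin> PL"
  using loc_in_PL_iff[of \<one>] one_D loc_one by auto

lemma Units_L:
  assumes "x \<in> carrier L" "x \<notin> PL"
  shows "x \<in> Units L"
proof -
  obtain a s y where *: "a \<in> carrier R" "s \<in> D" "y \<in> carrier L" "y \<otimes>\<^bsub>L\<^esub> loc s = \<one>\<^bsub>L\<^esub>"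
    "x = loc a \<otimes>\<^bsub>L\<^esub> y" "loc a = x \<otimes>\<^bsub>L\<^esub> loc s"
    using assms(1) by (rule L_cases_loc)
  have "a \<in> D" using assms(2) * unfolding PL_def by blast
  then have "loc a \<in> Units L" by (rule loc_Units)
  moreover have "y \<in> Units L"
    using *(2,3,4) loc_closed[of s] L.m_comm[of y "loc s"] unfolding Units_def by auto
  ultimately show ?thesis using *(5) L.Units_m_closed by simp
qed

text \<open>An ideal of the localization is generated by its contraction, so generators of the
  contraction suffice.\<close>

lemma noetherian_L:
  assumes "noetherian_ring R"
  shows "noetherian_ring L"
proof (rule L.noetherian_ringI)
  interpret N: noetherian_ring R by fact
  interpret H: ring_hom_ring R L loc
    by (rule ring_hom_ringI2[OF ring_axioms L.ring_axioms loc_ring_hom])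
  fix I assume I: "ideal I L"
  obtain X where X: "X \<subseteq> carrier R" "finite X" "{r \<in> carrier R. loc r \<in> I} = Idl X"
    using N.finetely_gen[OF H.ideal_vimage[OF I]] by auto
  have XL: "loc ` X \<subseteq> carrier L" using X loc_closed by auto
  have J: "ideal (Idl\<^bsub>L\<^esub> (loc ` X)) L" by (rule L.genideal_ideal[OF XL])
  have "Idl X \<subseteq> {r \<in> carrier R. loc r \<in> Idl\<^bsub>L\<^esub> (loc ` X)}"
    by (rule genideal_minimal[OF H.ideal_vimage[OF J]]) (use X L.genideal_self[OF XL] in auto)
  then have sub: "loc r \<in> Idl\<^bsub>L\<^esub> (loc ` X)" if "r \<in> carrier R" "loc r \<in> I" for r
    using that X(3) by auto
  have "I \<subseteq> Idl\<^bsub>L\<^esub> (loc ` X)"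
  proof
    fix x assume x: "x \<in> I"
    have "x \<in> carrier L" using x ideal.Icarr[OF I] by auto
    then obtain a s y where *: "a \<in> carrier R" "s \<in> D" "y \<in> carrier L" "y \<otimes>\<^bsub>L\<^esub> loc s = \<one>\<^bsub>L\<^esub>"
      "x = loc a \<otimes>\<^bsub>L\<^esub> y" "loc a = x \<otimes>\<^bsub>L\<^esub> loc s"
      by (rule L_cases_loc)
    have "loc a \<in> I" using ideal.I_r_closed[OF I x, of "loc s"] *(2,6) loc_closed[of s] by simp
    then have "loc a \<in> Idl\<^bsub>L\<^esub> (loc ` X)" using sub *(1) by simp
    then show "x \<in> Idl\<^bsub>L\<^esub> (loc ` X)" using ideal.I_r_closed[OF J _ *(3)] *(5) by auto
  qed
  moreover have "Idl\<^bsub>L\<^esub> (loc ` X) \<subseteq> I"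
    by (rule L.genideal_minimal[OF I]) (use X genideal_self[OF X(1)] in auto)
  ultimately show "\<exists>X\<subseteq>carrier L. finite X \<and> I = Idl\<^bsub>L\<^esub> X"
    using XL X(2) by blast
qed

lemma noetherian_local_L:
  assumes "noetherian_ring R"
  shows "noetherian_local_ring L PL"
proof -
  \<comment> \<open>The identity is a surjection with kernel inside \<open>PL\<close>, so the result
    on images of local rings describes \<open>L\<close> itself.\<close>
  have S: "surj_ring_hom_cring L L (\<lambda>x. x)"
    by (intro surj_ring_hom_cring.intro ring_hom_cring.intro ring_hom_cring_axioms.intro cring_L
        surj_ring_hom_cring_axioms.intro ring_hom_memI) simp_all
  have "x \<in> PL" if "x = \<zero>\<^bsub>L\<^esub>" for x
    using that additive_subgroup.zero_closed[OF ideal.axioms(1)[OF PL_ideal]] by simp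
  then have "noetherian_local_ring L ((\<lambda>x. x) ` PL)"
    using surj_ring_hom_cring.noetherian_local_image[OF S PL_ideal one_notin_PL Units_L _ noetherian_L[OF assms]]
    by blast
  then show ?thesis by simp
qed

text \<open>\<open>J0\<close> is the contraction of the principal ideal of \<open>loc x\<close>: by
  \<open>J0x\<close> it becomes principal after localization, and by \<open>inv\<close> the
  denominators are already invertible modulo \<open>J0\<close>, so contracting adds nothing. The
  conditions on the zero-dimensional quotient can therefore be stated in \<open>R\<close>, for the
  regular sequence \<open>[loc x]\<close>.\<close>

lemma gorenstein_localI:
  assumes N: "noetherian_ring R" and x: "x \<in> P"
    and J0: "ideal J0 R" "J0 \<subseteq> P" "x \<in> J0"
    and inv: "\<And>s. s \<in> D \<Longrightarrow> \<exists>u\<in>carrier R. \<exists>j\<in>J0. \<one> = u \<otimes> s \<oplus> j"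
    and J0x: "\<And>a. a \<in> J0 \<Longrightarrow> \<exists>s\<in>D. \<exists>r\<in>carrier R. s \<otimes> a = r \<otimes> x"
    and reg: "\<And>s a. s \<in> D \<Longrightarrow> a \<in> carrier R \<Longrightarrow> s \<otimes> (x \<otimes> a) = \<zero> \<Longrightarrow> \<exists>s'\<in>D. s' \<otimes> a = \<zero>"
    and nil: "\<And>y. y \<in> P \<Longrightarrow> \<exists>n::nat. y [^] n \<in> J0"
    and a: "a \<in> carrier R" "a \<notin> J0" "\<And>y. y \<in> P \<Longrightarrow> y \<otimes> a \<in> J0"
    and soc: "\<And>b. b \<in> carrier R \<Longrightarrow> (\<And>y. y \<in> P \<Longrightarrow> y \<otimes> b \<in> J0) \<Longrightarrow>
      \<exists>r\<in>carrier R. \<exists>j\<in>J0. b = r \<otimes> a \<oplus> j"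
  shows "gorenstein_local L"
proof -
  have xc: "x \<in> carrier R" using x P_carrier by auto
  have lx: "loc x \<in> carrier L" using loc_closed xc by auto
  interpret J0: ideal J0 R by (rule J0)
  define J where "J = Idl\<^bsub>L\<^esub> {loc x}"
  have J: "ideal J L" unfolding J_def by (rule L.genideal_ideal) (use lx in auto)
  interpret J: ideal J L by (rule J)
  have JI: "y \<in> J \<longleftrightarrow> (\<exists>r\<in>carrier L. y = r \<otimes>\<^bsub>L\<^esub> loc x)" for y
    unfolding J_def by (rule L.mem_Idl_singleton[OF lx])
  have J_PL: "J \<subseteq> PL"
    unfolding J_def by (rule L.genideal_minimal[OF PL_ideal]) (use loc_mem_PL x in auto)
  interpret Q: surj_ring_hom_cring L "L Quot J" "(+>\<^bsub>L\<^esub>) J" by (rule L.quot_surj_hom[OF J])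
  note zero_iff = L.quot_eq_zero_iff[OF J]
  have J0_J: "loc b \<in> J" if b: "b \<in> J0" for b
  proof -
    obtain s r where s: "s \<in> D" "r \<in> carrier R" "s \<otimes> b = r \<otimes> x" using J0x[OF b] by auto
    have bc: "b \<in> carrier R" using b J0.Icarr by auto
    obtain w where w: "w \<in> carrier L" "w \<otimes>\<^bsub>L\<^esub> loc s = \<one>\<^bsub>L\<^esub>"
      using loc_Units[OF s(1)] by (auto simp: Units_def)
    have "loc b = (w \<otimes>\<^bsub>L\<^esub> loc s) \<otimes>\<^bsub>L\<^esub> loc b" unfolding w using bc by (simp add: loc_closed)
    also have "\<dots> = w \<otimes>\<^bsub>L\<^esub> loc (s \<otimes> b)"
      using s(1) bc w(1) by (simp add: loc_mult L.m_assoc loc_closed)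
    also have "\<dots> = (w \<otimes>\<^bsub>L\<^esub> loc r) \<otimes>\<^bsub>L\<^esub> loc x"
      unfolding s(3) using s(2) xc w(1) by (simp add: loc_mult L.m_assoc loc_closed)
    finally show ?thesis using JI w s loc_closed by auto
  qed
  have J_J0: "b \<in> J0" if b: "loc b \<in> J" "b \<in> carrier R" for b
  proof -
    obtain c where c: "c \<in> carrier L" "loc b = c \<otimes>\<^bsub>L\<^esub> loc x" using JI b by auto
    obtain r s y where *: "r \<in> carrier R" "s \<in> D" "y \<in> carrier L" "y \<otimes>\<^bsub>L\<^esub> loc s = \<one>\<^bsub>L\<^esub>"
      "c = loc r \<otimes>\<^bsub>L\<^esub> y" "loc r = c \<otimes>\<^bsub>L\<^esub> loc s"
      using c(1) by (rule L_cases_loc)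
    have sc: "s \<in> carrier R" using * by auto
    have "loc (s \<otimes> b) = loc (r \<otimes> x)"
      using sc *(1) xc b(2) c by (simp add: loc_mult *(6) L.m_ac loc_closed)
    then obtain u where u: "u \<in> D" "u \<otimes> (s \<otimes> b) = u \<otimes> (r \<otimes> x)"
      using loc_eq_iff sc b *(1) xc by auto
    have us: "u \<otimes> s \<in> D" using mult_D u * by auto
    have "(u \<otimes> s) \<otimes> b = (u \<otimes> r) \<otimes> x" using u sc b *(1) xc by (simp add: m_assoc)
    then have usb: "(u \<otimes> s) \<otimes> b \<in> J0" using J0.I_l_closed[OF J0(3), of "u \<otimes> r"] u *(1) by auto
    obtain v j where v: "v \<in> carrier R" "j \<in> J0" "\<one> = v \<otimes> (u \<otimes> s) \<oplus> j"
      using inv[OF us] by auto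
    have jc: "j \<in> carrier R" using v J0.Icarr by auto
    have "b = (v \<otimes> (u \<otimes> s) \<oplus> j) \<otimes> b" by (simp only: v(3)[symmetric] l_one[OF b(2)])
    also have "\<dots> = v \<otimes> ((u \<otimes> s) \<otimes> b) \<oplus> j \<otimes> b"
      using v u sc b jc by (simp add: l_distr m_assoc)
    finally have e: "b = v \<otimes> ((u \<otimes> s) \<otimes> b) \<oplus> j \<otimes> b" .
    show ?thesis
      by (subst e, rule J0.a_closed[OF J0.I_l_closed[OF usb v(1)] J0.I_r_closed[OF v(2) b(2)]])
  qed
  have kerPL: "\<And>y. y \<in> carrier L \<Longrightarrow> J +>\<^bsub>L\<^esub> y = \<zero>\<^bsub>L Quot J\<^esub> \<Longrightarrow> y \<in> PL"
    using zero_iff J_PL by auto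
  have "gorenstein_local_dim0 (L Quot J)"
  proof (rule Q.gorenstein_dim0_image[OF PL_ideal one_notin_PL Units_L kerPL noetherian_L[OF N]])
    fix y assume "y \<in> PL"
    then obtain p w where p: "p \<in> P" "w \<in> carrier L" "y = loc p \<otimes>\<^bsub>L\<^esub> w" by (auto simp: PL_def)
    have pc: "p \<in> carrier R" using p P_carrier by auto
    obtain n :: nat where n: "p [^] n \<in> J0" using nil[OF p(1)] by auto
    have "loc (p [^] n) = loc p [^]\<^bsub>L\<^esub> n"
      by (induction n) (simp_all add: loc_one loc_mult pc)
    then have "y [^]\<^bsub>L\<^esub> n = loc (p [^] n) \<otimes>\<^bsub>L\<^esub> w [^]\<^bsub>L\<^esub> n"
      using p pc by (simp add: L.nat_pow_distrib loc_closed)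
    then have "y [^]\<^bsub>L\<^esub> n \<in> J" using J.I_r_closed[OF J0_J[OF n]] p by auto
    then show "\<exists>n::nat. J +>\<^bsub>L\<^esub> (y [^]\<^bsub>L\<^esub> n) = \<zero>\<^bsub>L Quot J\<^esub>"
      using zero_iff J.Icarr by blast
  next
    show "loc a \<in> carrier L" using a loc_closed by auto
    show "J +>\<^bsub>L\<^esub> loc a \<noteq> \<zero>\<^bsub>L Quot J\<^esub>" using zero_iff[OF loc_closed[OF a(1)]] J_J0 a by auto
    fix y assume y: "y \<in> PL"
    then obtain p w where p: "p \<in> P" "w \<in> carrier L" "y = loc p \<otimes>\<^bsub>L\<^esub> w" by (auto simp: PL_def)
    have pc: "p \<in> carrier R" using p P_carrier by auto
    have "y \<otimes>\<^bsub>L\<^esub> loc a = loc (p \<otimes> a) \<otimes>\<^bsub>L\<^esub> w"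
      using p pc a by (simp add: loc_mult loc_closed L.m_ac)
    then have "y \<otimes>\<^bsub>L\<^esub> loc a \<in> J" using J.I_r_closed[OF J0_J[OF a(3)[OF p(1)]] p(2)] by auto
    then show "J +>\<^bsub>L\<^esub> (y \<otimes>\<^bsub>L\<^esub> loc a) = \<zero>\<^bsub>L Quot J\<^esub>" using zero_iff J.Icarr by auto
  next
    fix b assume b: "b \<in> carrier L" and k: "\<And>y. y \<in> PL \<Longrightarrow> J +>\<^bsub>L\<^esub> (y \<otimes>\<^bsub>L\<^esub> b) = \<zero>\<^bsub>L Quot J\<^esub>"
    obtain b0 s w where *: "b0 \<in> carrier R" "s \<in> D" "w \<in> carrier L" "w \<otimes>\<^bsub>L\<^esub> loc s = \<one>\<^bsub>L\<^esub>"
      "b = loc b0 \<otimes>\<^bsub>L\<^esub> w" "loc b0 = b \<otimes>\<^bsub>L\<^esub> loc s"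
      using b by (rule L_cases_loc)
    have sc: "s \<in> carrier R" using * by auto
    have "y \<otimes> b0 \<in> J0" if y: "y \<in> P" for y
    proof -
      have yc: "y \<in> carrier R" using y P_carrier by auto
      have "loc y \<otimes>\<^bsub>L\<^esub> b \<in> J"
        using zero_iff[of "loc y \<otimes>\<^bsub>L\<^esub> b"] k[OF loc_mem_PL[OF y]] b yc loc_closed by auto
      then have "loc y \<otimes>\<^bsub>L\<^esub> b \<otimes>\<^bsub>L\<^esub> loc s \<in> J" using J.I_r_closed loc_closed sc by auto
      moreover have "loc (y \<otimes> b0) = loc y \<otimes>\<^bsub>L\<^esub> b \<otimes>\<^bsub>L\<^esub> loc s"
        using *(1) yc b sc by (simp add: loc_mult *(6) loc_closed L.m_assoc)
      ultimately show ?thesis using J_J0 *(1) yc by auto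
    qed
    then obtain r j where r: "r \<in> carrier R" "j \<in> J0" "b0 = r \<otimes> a \<oplus> j"
      using soc[OF *(1)] by blast
    have jc: "j \<in> carrier R" using r J0.Icarr by auto
    have car: "loc r \<in> carrier L" "loc a \<in> carrier L" "loc j \<in> carrier L" using r a jc loc_closed by auto
    have "b = (w \<otimes>\<^bsub>L\<^esub> loc r) \<otimes>\<^bsub>L\<^esub> loc a \<oplus>\<^bsub>L\<^esub> w \<otimes>\<^bsub>L\<^esub> loc j"
      unfolding *(5) r(3) using r(1) a(1) jc *(3) car
      by (simp add: loc_mult loc_add L.m_ac L.r_distr L.l_distr)
    then have "b \<ominus>\<^bsub>L\<^esub> (w \<otimes>\<^bsub>L\<^esub> loc r) \<otimes>\<^bsub>L\<^esub> loc a = w \<otimes>\<^bsub>L\<^esub> loc j"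
      using *(3) car by (simp add: a_minus_def L.a_ac L.r_neg2 L.r_neg)
    then have "J +>\<^bsub>L\<^esub> b = J +>\<^bsub>L\<^esub> ((w \<otimes>\<^bsub>L\<^esub> loc r) \<otimes>\<^bsub>L\<^esub> loc a)"
      using L.quot_eq_iff[OF J b L.m_closed[OF L.m_closed[OF *(3) car(1)] car(2)]]
        J.I_l_closed[OF J0_J[OF r(2)] *(3)] by (simp del: Q.hom_mult)
    then show "\<exists>r\<in>carrier L. J +>\<^bsub>L\<^esub> b = J +>\<^bsub>L\<^esub> (r \<otimes>\<^bsub>L\<^esub> loc a)"
      using *(3) car by (intro bexI[of _ "w \<otimes>\<^bsub>L\<^esub> loc r"]) auto
  qed
  moreover have "regular_sequence L [loc x]"
    unfolding regular_sequence_def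
  proof (intro conjI allI impI ballI)
    show "set [loc x] \<subseteq> carrier L" using lx by auto
    show "Idl\<^bsub>L\<^esub> (set [loc x]) \<noteq> carrier L"
      using J_PL one_notin_PL L.one_closed by (auto simp: J_def)
    fix i c assume i: "i < length [loc x]" and c: "c \<in> carrier L"
      and e: "[loc x] ! i \<otimes>\<^bsub>L\<^esub> c \<in> Idl\<^bsub>L\<^esub> (set (take i [loc x]))"
    have e0: "loc x \<otimes>\<^bsub>L\<^esub> c = \<zero>\<^bsub>L\<^esub>" using e i by (auto simp: L.genideal_empty)
    obtain r s y where *: "r \<in> carrier R" "s \<in> D" "y \<in> carrier L" "y \<otimes>\<^bsub>L\<^esub> loc s = \<one>\<^bsub>L\<^esub>"
      "c = loc r \<otimes>\<^bsub>L\<^esub> y" "loc r = c \<otimes>\<^bsub>L\<^esub> loc s"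
      using c by (rule L_cases_loc)
    have sc: "s \<in> carrier R" using * by auto
    have "loc (x \<otimes> r) = loc x \<otimes>\<^bsub>L\<^esub> c \<otimes>\<^bsub>L\<^esub> loc s"
      using *(1) xc c sc by (simp add: loc_mult *(6) L.m_assoc loc_closed)
    then have "loc (x \<otimes> r) = loc \<zero>" using e0 sc by (simp add: loc_zero loc_closed)
    then obtain u where u: "u \<in> D" "u \<otimes> (x \<otimes> r) = \<zero>"
      using loc_eq_iff[of "x \<otimes> r" \<zero>] xc *(1) by auto
    obtain v where v: "v \<in> D" "v \<otimes> r = \<zero>" using reg[OF u(1) *(1) u(2)] by auto
    have "loc r = loc \<zero>" using loc_eq_iff[of r \<zero>] v *(1) by force
    then have "c = \<zero>\<^bsub>L\<^esub>" unfolding *(5) using *(3) by (simp add: loc_zero)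
    then show "c \<in> Idl\<^bsub>L\<^esub> (set (take i [loc x]))" using i by (auto simp: L.genideal_empty)
  qed
  moreover have "noetherian_local_ring L PL" by (rule noetherian_local_L[OF N])
  ultimately show ?thesis
    unfolding gorenstein_local_def J_def by (metis list.set(1) list.set(2))
qed

text \<open>By \<open>inv\<close> the elements outside \<open>P\<close> are invertible modulo
  \<open>l\<close>, so being a multiple of \<open>l\<close> means the same in \<open>R\<close> and
  in \<open>L\<close>. This lets the socle statement descend from the localization.\<close>

lemma gorenstein_local_socle_R:
  assumes l: "l \<in> P" "\<And>a. a \<in> carrier R \<Longrightarrow> l \<otimes> a = \<zero> \<Longrightarrow> a = \<zero>"
    and inv: "\<And>s. s \<in> D \<Longrightarrow> \<exists>u\<in>carrier R. \<exists>j\<in>carrier R. \<one> = u \<otimes> s \<oplus> j \<otimes> l"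
    and z: "z \<in> carrier R" "\<And>r. r \<in> carrier R \<Longrightarrow> z \<noteq> r \<otimes> l"
      "\<And>y. y \<in> P \<Longrightarrow> \<exists>r\<in>carrier R. y \<otimes> z = r \<otimes> l"
    and G: "gorenstein_local L"
  obtains a where "a \<in> carrier R"
    "\<And>b. b \<in> carrier R \<Longrightarrow> (\<And>y. y \<in> P \<Longrightarrow> \<exists>r\<in>carrier R. y \<otimes> b = r \<otimes> l) \<Longrightarrow>
      \<exists>r\<in>carrier R. \<exists>s\<in>carrier R. b = r \<otimes> a \<oplus> s \<otimes> l"
    "\<And>y. y \<in> P \<Longrightarrow> \<exists>r\<in>carrier R. y \<otimes> a = r \<otimes> l"
proof -
  have lc: "l \<in> carrier R" using l P_carrier by auto
  have llc: "loc l \<in> carrier L" using lc loc_closed by auto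
  note mem = L.mem_Idl_singleton[OF llc]
  interpret I: ideal "Idl\<^bsub>L\<^esub> {loc l}" L by (rule L.genideal_ideal) (use llc in auto)
  have loc_mem: "(loc b \<in> Idl\<^bsub>L\<^esub> {loc l}) = (\<exists>r\<in>carrier R. b = r \<otimes> l)" if b: "b \<in> carrier R" for b
  proof
    assume "loc b \<in> Idl\<^bsub>L\<^esub> {loc l}"
    then obtain c where c: "c \<in> carrier L" "loc b = c \<otimes>\<^bsub>L\<^esub> loc l" using mem by auto
    obtain r s y where *: "r \<in> carrier R" "s \<in> D" "y \<in> carrier L" "y \<otimes>\<^bsub>L\<^esub> loc s = \<one>\<^bsub>L\<^esub>"
      "c = loc r \<otimes>\<^bsub>L\<^esub> y" "loc r = c \<otimes>\<^bsub>L\<^esub> loc s"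
      using c(1) by (rule L_cases_loc)
    have sc: "s \<in> carrier R" using * by auto
    have "loc (s \<otimes> b) = loc (r \<otimes> l)"
      using sc *(1) lc b c by (simp add: loc_mult *(6) L.m_ac loc_closed)
    then obtain u where u: "u \<in> D" "u \<otimes> (s \<otimes> b) = u \<otimes> (r \<otimes> l)"
      using loc_eq_iff sc b *(1) lc by auto
    have us: "u \<otimes> s \<in> D" using mult_D u * by auto
    obtain v j where v: "v \<in> carrier R" "j \<in> carrier R" "\<one> = v \<otimes> (u \<otimes> s) \<oplus> j \<otimes> l"
      using inv[OF us] by auto
    have uc: "u \<in> carrier R" using u by auto
    have "b = (v \<otimes> (u \<otimes> s) \<oplus> j \<otimes> l) \<otimes> b" by (simp only: v(3)[symmetric] l_one[OF b])
    also have "\<dots> = v \<otimes> (u \<otimes> (s \<otimes> b)) \<oplus> j \<otimes> l \<otimes> b"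
      using v(1,2) uc sc b lc by (simp add: l_distr m_assoc)
    also have "\<dots> = (v \<otimes> (u \<otimes> r) \<oplus> j \<otimes> b) \<otimes> l"
      unfolding u(2) using v(1,2) uc sc b lc *(1) by (simp add: l_distr r_distr m_ac)
    finally show "\<exists>r\<in>carrier R. b = r \<otimes> l"
      using v(1,2) uc b *(1) by (intro bexI[of _ "v \<otimes> (u \<otimes> r) \<oplus> j \<otimes> b"]) auto
  next
    assume "\<exists>r\<in>carrier R. b = r \<otimes> l"
    then show "loc b \<in> Idl\<^bsub>L\<^esub> {loc l}" using mem lc by (auto simp: loc_mult loc_closed)
  qed
  have up: "y \<otimes>\<^bsub>L\<^esub> loc b \<in> Idl\<^bsub>L\<^esub> {loc l}"
    if b: "b \<in> carrier R" "\<And>y. y \<in> P \<Longrightarrow> \<exists>r\<in>carrier R. y \<otimes> b = r \<otimes> l" and y: "y \<in> PL" for y b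
  proof -
    obtain p w where p: "p \<in> P" "w \<in> carrier L" "y = loc p \<otimes>\<^bsub>L\<^esub> w"
      using y by (auto simp: PL_def)
    have pc: "p \<in> carrier R" using p P_carrier by auto
    have "y \<otimes>\<^bsub>L\<^esub> loc b = loc (p \<otimes> b) \<otimes>\<^bsub>L\<^esub> w"
      using p pc b(1) by (simp add: loc_mult loc_closed L.m_ac)
    moreover have "loc (p \<otimes> b) \<in> Idl\<^bsub>L\<^esub> {loc l}"
      using loc_mem[of "p \<otimes> b"] b(2)[OF p(1)] pc b(1) by auto
    ultimately show ?thesis using I.I_r_closed p by simp
  qed
  have reg: "c = \<zero>\<^bsub>L\<^esub>" if c: "c \<in> carrier L" and e0: "loc l \<otimes>\<^bsub>L\<^esub> c = \<zero>\<^bsub>L\<^esub>" for c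
  proof -
    obtain r s y where *: "r \<in> carrier R" "s \<in> D" "y \<in> carrier L" "y \<otimes>\<^bsub>L\<^esub> loc s = \<one>\<^bsub>L\<^esub>"
      "c = loc r \<otimes>\<^bsub>L\<^esub> y" "loc r = c \<otimes>\<^bsub>L\<^esub> loc s"
      using c by (rule L_cases_loc)
    have sc: "s \<in> carrier R" using * by auto
    have "loc (l \<otimes> r) = loc l \<otimes>\<^bsub>L\<^esub> c \<otimes>\<^bsub>L\<^esub> loc s"
      using *(1) lc c sc by (simp add: loc_mult *(6) L.m_assoc loc_closed)
    then have "loc (l \<otimes> r) = loc \<zero>" using e0 sc by (simp add: loc_zero loc_closed)
    then obtain u where u: "u \<in> D" "u \<otimes> (l \<otimes> r) = \<zero>"
      using loc_eq_iff[of "l \<otimes> r" \<zero>] lc *(1) by auto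
    have "l \<otimes> (u \<otimes> r) = \<zero>" using u lc *(1) by (simp add: m_lcomm)
    then have "u \<otimes> r = \<zero>" using l(2) u *(1) by simp
    then have "loc r = loc \<zero>" using loc_eq_iff[of r \<zero>] u *(1) by force
    then show ?thesis unfolding *(5) using *(3) by (simp add: loc_zero)
  qed
  have z1: "loc z \<notin> Idl\<^bsub>L\<^esub> {loc l}" using loc_mem[OF z(1)] z(2) by auto
  obtain \<alpha> where \<alpha>: "\<alpha> \<in> carrier L" "\<And>y. y \<in> PL \<Longrightarrow> y \<otimes>\<^bsub>L\<^esub> \<alpha> \<in> Idl\<^bsub>L\<^esub> {loc l}"
    "\<And>b. b \<in> carrier L \<Longrightarrow> (\<And>y. y \<in> PL \<Longrightarrow> y \<otimes>\<^bsub>L\<^esub> b \<in> Idl\<^bsub>L\<^esub> {loc l}) \<Longrightarrow>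
      \<exists>r\<in>carrier L. \<exists>s\<in>carrier L. b = r \<otimes>\<^bsub>L\<^esub> \<alpha> \<oplus>\<^bsub>L\<^esub> s \<otimes>\<^bsub>L\<^esub> loc l"
    using L.gorenstein_local_socle[OF PL_ideal one_notin_PL Units_L loc_mem_PL[OF l(1)] reg
        loc_closed[OF z(1)] z1 up[OF z(1,3)] G] by blast
  obtain a s y where *: "a \<in> carrier R" "s \<in> D" "y \<in> carrier L" "y \<otimes>\<^bsub>L\<^esub> loc s = \<one>\<^bsub>L\<^esub>"
    "\<alpha> = loc a \<otimes>\<^bsub>L\<^esub> y" "loc a = \<alpha> \<otimes>\<^bsub>L\<^esub> loc s"
    using \<alpha>(1) by (rule L_cases_loc)
  have sc: "s \<in> carrier R" using * by auto
  show ?thesis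
  proof (rule that[of a])
    show "a \<in> carrier R" by fact
    fix p assume p: "p \<in> P"
    have pc: "p \<in> carrier R" using p P_carrier by auto
    have "loc (p \<otimes> a) = (loc p \<otimes>\<^bsub>L\<^esub> \<alpha>) \<otimes>\<^bsub>L\<^esub> loc s"
      using pc *(1) sc \<alpha>(1) by (simp add: loc_mult *(6) L.m_assoc loc_closed)
    then have "loc (p \<otimes> a) \<in> Idl\<^bsub>L\<^esub> {loc l}"
      using I.I_r_closed[OF \<alpha>(2)[OF loc_mem_PL[OF p]]] sc loc_closed by simp
    then show "\<exists>r\<in>carrier R. p \<otimes> a = r \<otimes> l" using loc_mem pc *(1) by auto
  next
    fix b assume b: "b \<in> carrier R" "\<And>y. y \<in> P \<Longrightarrow> \<exists>r\<in>carrier R. y \<otimes> b = r \<otimes> l"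
    obtain \<rho> \<sigma> where r: "\<rho> \<in> carrier L" "\<sigma> \<in> carrier L" "loc b = \<rho> \<otimes>\<^bsub>L\<^esub> \<alpha> \<oplus>\<^bsub>L\<^esub> \<sigma> \<otimes>\<^bsub>L\<^esub> loc l"
      using \<alpha>(3)[OF loc_closed[OF b(1)] up[OF b]] by auto
    have ry: "\<rho> \<otimes>\<^bsub>L\<^esub> y \<in> carrier L" using r *(3) by auto
    obtain r1 s1 y1 where 1: "r1 \<in> carrier R" "s1 \<in> D" "y1 \<in> carrier L" "y1 \<otimes>\<^bsub>L\<^esub> loc s1 = \<one>\<^bsub>L\<^esub>"
      "\<rho> \<otimes>\<^bsub>L\<^esub> y = loc r1 \<otimes>\<^bsub>L\<^esub> y1" "loc r1 = (\<rho> \<otimes>\<^bsub>L\<^esub> y) \<otimes>\<^bsub>L\<^esub> loc s1"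
      using ry by (rule L_cases_loc)
    obtain r2 s2 y2 where 2: "r2 \<in> carrier R" "s2 \<in> D" "y2 \<in> carrier L" "y2 \<otimes>\<^bsub>L\<^esub> loc s2 = \<one>\<^bsub>L\<^esub>"
      "\<sigma> = loc r2 \<otimes>\<^bsub>L\<^esub> y2" "loc r2 = \<sigma> \<otimes>\<^bsub>L\<^esub> loc s2"
      using r(2) by (rule L_cases_loc)
    have sc: "s1 \<in> carrier R" "s2 \<in> carrier R" using 1(2) 2(2) by auto
    have cl: "loc s1 \<in> carrier L" "loc s2 \<in> carrier L" "loc a \<in> carrier L"
      using sc *(1) loc_closed by auto
    have gen: "(e \<otimes>\<^bsub>L\<^esub> t) \<otimes>\<^bsub>L\<^esub> (v \<otimes>\<^bsub>L\<^esub> c \<oplus>\<^bsub>L\<^esub> w \<otimes>\<^bsub>L\<^esub> k) = (v \<otimes>\<^bsub>L\<^esub> e) \<otimes>\<^bsub>L\<^esub> t \<otimes>\<^bsub>L\<^esub> c \<oplus>\<^bsub>L\<^esub> (w \<otimes>\<^bsub>L\<^esub> t) \<otimes>\<^bsub>L\<^esub> e \<otimes>\<^bsub>L\<^esub> k"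
      if "e \<in> carrier L" "t \<in> carrier L" "v \<in> carrier L" "w \<in> carrier L" "c \<in> carrier L" "k \<in> carrier L"
      for e t v w c k
      using that by (simp add: L.r_distr L.m_ac)
    have b': "loc b = (\<rho> \<otimes>\<^bsub>L\<^esub> y) \<otimes>\<^bsub>L\<^esub> loc a \<oplus>\<^bsub>L\<^esub> \<sigma> \<otimes>\<^bsub>L\<^esub> loc l"
      unfolding r(3) *(5) using r(1,2) *(3) cl llc by (simp add: L.m_ac)
    have "loc ((s1 \<otimes> s2) \<otimes> b) = (loc s1 \<otimes>\<^bsub>L\<^esub> loc s2) \<otimes>\<^bsub>L\<^esub> loc b"
      using sc b(1) by (simp add: loc_mult)
    also have "\<dots> = ((\<rho> \<otimes>\<^bsub>L\<^esub> y) \<otimes>\<^bsub>L\<^esub> loc s1) \<otimes>\<^bsub>L\<^esub> loc s2 \<otimes>\<^bsub>L\<^esub> loc a \<oplus>\<^bsub>L\<^esub> (\<sigma> \<otimes>\<^bsub>L\<^esub> loc s2) \<otimes>\<^bsub>L\<^esub> loc s1 \<otimes>\<^bsub>L\<^esub> loc l"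
      unfolding b' by (rule gen[OF cl(1,2) ry r(2) cl(3) llc])
    also have "\<dots> = loc (r1 \<otimes> s2 \<otimes> a \<oplus> r2 \<otimes> s1 \<otimes> l)"
      unfolding 1(6)[symmetric] 2(6)[symmetric] using 1(1) 2(1) sc *(1) lc
      by (simp add: loc_mult loc_add)
    finally have "loc ((s1 \<otimes> s2) \<otimes> b) = loc (r1 \<otimes> s2 \<otimes> a \<oplus> r2 \<otimes> s1 \<otimes> l)" .
    then obtain u where u: "u \<in> D" "u \<otimes> ((s1 \<otimes> s2) \<otimes> b) = u \<otimes> (r1 \<otimes> s2 \<otimes> a \<oplus> r2 \<otimes> s1 \<otimes> l)"
      using loc_eq_iff sc 1(1) 2(1) lc *(1) b(1) by auto
    have us: "u \<otimes> (s1 \<otimes> s2) \<in> D" by (intro mult_D u(1) 1(2) 2(2))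
    obtain v j where v: "v \<in> carrier R" "j \<in> carrier R" "\<one> = v \<otimes> (u \<otimes> (s1 \<otimes> s2)) \<oplus> j \<otimes> l"
      using inv[OF us] by auto
    have uc: "u \<in> carrier R" using u by auto
    have "b = (v \<otimes> (u \<otimes> (s1 \<otimes> s2)) \<oplus> j \<otimes> l) \<otimes> b" by (simp only: v(3)[symmetric] l_one[OF b(1)])
    also have "\<dots> = v \<otimes> (u \<otimes> ((s1 \<otimes> s2) \<otimes> b)) \<oplus> j \<otimes> l \<otimes> b"
      using v(1,2) uc sc b(1) lc by (simp add: l_distr m_assoc)
    also have "\<dots> = (v \<otimes> u \<otimes> r1 \<otimes> s2) \<otimes> a \<oplus> (v \<otimes> u \<otimes> r2 \<otimes> s1 \<oplus> j \<otimes> b) \<otimes> l"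
      unfolding u(2) using v(1,2) uc sc b(1) lc 1(1) 2(1) *(1)
      by (simp add: l_distr r_distr m_ac a_ac)
    finally show "\<exists>r\<in>carrier R. \<exists>s\<in>carrier R. b = r \<otimes> a \<oplus> s \<otimes> l"
      by (intro bexI[of _ "v \<otimes> u \<otimes> r1 \<otimes> s2"] bexI[of _ "v \<otimes> u \<otimes> r2 \<otimes> s1 \<oplus> j \<otimes> b"]) (use v(1,2) uc sc b(1) 1(1) 2(1) in simp_all)
  qed
qed

end

section \<open>Transfer of ring records to type classes\<close>

definition typed_ideal :: "'b::comm_ring_1 set \<Rightarrow> 'b set \<Rightarrow> bool" where
  "typed_ideal T J \<longleftrightarrow> J \<subseteq> T \<and> 0 \<in> J \<and> (\<forall>a\<in>J. \<forall>b\<in>J. a + b \<in> J) \<and> (\<forall>t\<in>T. \<forall>a\<in>J. t * a \<in> J)"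

text \<open>
  A ring record together with an isomorphism onto a subring \<open>T\<close> of a commutative ring given by
  type classes, where the arithmetic is more convenient.
\<close>

locale ring_model = cring R for R (structure) +
  fixes h :: "'a \<Rightarrow> 't::comm_ring_1" and T :: "'t set"
  assumes bij: "bij_betw h (carrier R) T"
    and h_add: "\<And>a b. a \<in> carrier R \<Longrightarrow> b \<in> carrier R \<Longrightarrow> h (a \<oplus> b) = h a + h b"
    and h_mult: "\<And>a b. a \<in> carrier R \<Longrightarrow> b \<in> carrier R \<Longrightarrow> h (a \<otimes> b) = h a * h b"
    and h_one: "h \<one> = 1"
begin

lemma h_closed: "a \<in> carrier R \<Longrightarrow> h a \<in> T"
  using bij by (auto simp: bij_betw_def)

lemma h_inj: "a \<in> carrier R \<Longrightarrow> b \<in> carrier R \<Longrightarrow> h a = h b \<Longrightarrow> a = b"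
  using bij by (auto simp: bij_betw_def inj_on_def)

lemma T_cases: 
  assumes "t \<in> T" obtains a where "a \<in> carrier R" "t = h a"
  using assms bij by (auto simp: bij_betw_def)

lemma h_zero: "h \<zero> = 0"
  using h_add[of \<zero> \<zero>] by simp

lemma h_minus: "a \<in> carrier R \<Longrightarrow> h (\<ominus> a) = - h a"
  using h_add[of a "\<ominus> a"] by (simp add: r_neg h_zero eq_neg_iff_add_eq_0 add.commute)

lemma h_pow: "a \<in> carrier R \<Longrightarrow> h (a [^] (n::nat)) = h a ^ n"
  by (induction n) (simp_all add: h_one h_mult mult.commute)

lemma uminus_T: "t \<in> T \<Longrightarrow> - t \<in> T"
  by (metis T_cases add.inv_closed h_closed h_minus)

lemma one_T: "1 \<in> T"
  using h_closed[of \<one>] by (simp add: h_one)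

lemma typed_ideal_uminus: "typed_ideal T J \<Longrightarrow> a \<in> J \<Longrightarrow> - a \<in> J"
  unfolding typed_ideal_def using uminus_T[OF one_T] by (metis mult_minus1)

lemma image_typed_ideal:
  assumes "ideal I R"
  shows "typed_ideal T (h ` I)"
proof -
  interpret I: ideal I R by fact
  have c: "a \<in> I \<Longrightarrow> a \<in> carrier R" for a by (rule I.Icarr)
  have 1: "h a + h b \<in> h ` I" if "a \<in> I" "b \<in> I" for a b
    using that h_add[OF c c] I.a_closed by (metis imageI)
  have 2: "t * h a \<in> h ` I" if "t \<in> T" "a \<in> I" for t a
    using that(1) by (rule T_cases) (metis that(2) I.I_l_closed c h_mult imageI)
  have "0 \<in> h ` I" using I.zero_closed h_zero by (metis imageI)
  then show ?thesis
    unfolding typed_ideal_def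
  proof (intro conjI ballI)
    show "h ` I \<subseteq> T" using c h_closed by auto
    fix a b assume "a \<in> h ` I" "b \<in> h ` I"
    then show "a + b \<in> h ` I" using 1 by auto
  next
    fix t a assume "t \<in> T" "a \<in> h ` I"
    then show "t * a \<in> h ` I" using 2 by auto
  qed
qed

lemma vimage_ideal:
  assumes J: "typed_ideal T J"
  shows "ideal {r \<in> carrier R. h r \<in> J} R"
proof (rule idealI[OF ring_axioms])
  show "subgroup {r \<in> carrier R. h r \<in> J} (add_monoid R)"
  proof (rule add.subgroupI)
    show "{r \<in> carrier R. h r \<in> J} \<noteq> {}" using J h_zero zero_closed unfolding typed_ideal_def by (metis (mono_tags, lifting) empty_iff mem_Collect_eq)
  next
    fix a assume "a \<in> {r \<in> carrier R. h r \<in> J}"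
    then show "\<ominus> a \<in> {r \<in> carrier R. h r \<in> J}"
      using typed_ideal_uminus[OF J] by (simp add: h_minus)
  next
    fix a b assume "a \<in> {r \<in> carrier R. h r \<in> J}" "b \<in> {r \<in> carrier R. h r \<in> J}"
    then show "a \<oplus> b \<in> {r \<in> carrier R. h r \<in> J}"
      using J by (simp add: h_add typed_ideal_def)
  qed auto
  fix a x assume a: "a \<in> {r \<in> carrier R. h r \<in> J}" and x: "x \<in> carrier R"
  then show "x \<otimes> a \<in> {r \<in> carrier R. h r \<in> J}"
    using J by (simp add: h_mult typed_ideal_def h_closed)
  then show "a \<otimes> x \<in> {r \<in> carrier R. h r \<in> J}"
    using a x by (simp add: m_comm)
qed

lemma typed_ideal_sum:
  assumes "typed_ideal T J" "finite A" "\<And>a. a \<in> A \<Longrightarrow> f a \<in> J"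
  shows "sum f A \<in> J"
  using assms(2,3)
  by (induction A) (use assms(1) in \<open>auto simp: typed_ideal_def\<close>)

lemma noetherian_ringI_typed:
  assumes fg: "\<And>J. typed_ideal T J \<Longrightarrow>
    \<exists>A. finite A \<and> A \<subseteq> J \<and> (\<forall>x\<in>J. \<exists>q. (\<forall>a\<in>A. q a \<in> T) \<and> x = (\<Sum>a\<in>A. q a * a))"
  shows "noetherian_ring R"
proof (rule noetherian_ringI)
  fix I assume I: "ideal I R"
  note J = image_typed_ideal[OF I]
  obtain A where A: "finite A" "A \<subseteq> h ` I"
    "\<forall>x\<in>h ` I. \<exists>q. (\<forall>a\<in>A. q a \<in> T) \<and> x = (\<Sum>a\<in>A. q a * a)"
    using fg[OF J] by blast
  obtain B where B: "B \<subseteq> I" "finite B" "A = h ` B"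
    using finite_subset_image[OF A(1,2)] by blast
  have Bc: "B \<subseteq> carrier R" using B ideal.Icarr[OF I] by auto
  have IB: "ideal (Idl B) R" by (rule genideal_ideal[OF Bc])
  have "I \<subseteq> Idl B"
  proof
    fix x assume x: "x \<in> I"
    have tB: "typed_ideal T (h ` (Idl B))" by (rule image_typed_ideal[OF IB])
    obtain q where q: "\<forall>a\<in>A. q a \<in> T" "h x = (\<Sum>a\<in>A. q a * a)" using A(3) x by blast
    have "h x \<in> h ` (Idl B)"
      unfolding q(2)
    proof (rule typed_ideal_sum[OF tB A(1)])
      fix a assume a: "a \<in> A"
      then have "a \<in> h ` (Idl B)" using B genideal_self[OF Bc] by auto
      then show "q a * a \<in> h ` (Idl B)" using tB q(1) a unfolding typed_ideal_def by blast
    qed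
    then obtain y where y: "y \<in> Idl B" "h x = h y" by auto
    then have "x = y" using h_inj ideal.Icarr[OF I x] ideal.Icarr[OF IB] by auto
    then show "x \<in> Idl B" using y by simp
  qed
  moreover have "Idl B \<subseteq> I" by (rule genideal_minimal[OF I B(1)])
  ultimately show "\<exists>A\<subseteq>carrier R. finite A \<and> I = Idl A" using B Bc by blast
qed

lemma maximal_localized: "maximalideal m R \<Longrightarrow> localized R m"
  by (intro localized.intro is_cring maximalideal_prime)

lemma h_mem_iff: "ideal I R \<Longrightarrow> a \<in> carrier R \<Longrightarrow> h a \<in> h ` I \<longleftrightarrow> a \<in> I"
  using h_inj ideal.Icarr by (metis imageE imageI)

lemma maximal_image_inverse:
  assumes m: "maximalideal m R" and s: "s \<in> T" "s \<notin> h ` m"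
  shows "\<exists>u\<in>T. 1 - u * s \<in> h ` m"
proof -
  interpret m: maximalideal m R by fact
  obtain a where a: "a \<in> carrier R" "s = h a" using s(1) by (rule T_cases)
  have am: "a \<notin> m" using s a by auto
  \<comment> \<open>\<open>K\<close> is the ideal generated by the image of \<open>m\<close> and
    \<open>s\<close>. It is strictly larger than that image, hence contains 1.\<close>
  define K where "K = {x. \<exists>u\<in>T. \<exists>w\<in>h ` m. x = w + u * s}"
  have tm: "typed_ideal T (h ` m)" by (rule image_typed_ideal[OF m.is_ideal])
  have T_add: "x + y \<in> T" and T_mult: "x * y \<in> T" if "x \<in> T" "y \<in> T" for x y
    using that by (metis T_cases add.m_closed h_add h_closed, metis T_cases m_closed h_mult h_closed)
  have zT: "0 \<in> T" using h_closed[OF zero_closed] h_zero by simp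
  have tK: "typed_ideal T K"
    unfolding typed_ideal_def
  proof (intro conjI ballI)
    show "K \<subseteq> T" using T_add T_mult s(1) tm by (auto simp: K_def typed_ideal_def subset_iff)
    show "0 \<in> K" unfolding K_def using zT tm by (auto simp: typed_ideal_def intro!: bexI[of _ 0])
    fix x y assume "x \<in> K" "y \<in> K"
    then obtain u w u' w' where *: "u \<in> T" "u' \<in> T" "w \<in> h ` m" "w' \<in> h ` m" "x = w + u * s" "y = w' + u' * s"
      unfolding K_def by blast
    then have "x + y = (w + w') + (u + u') * s" by (simp add: algebra_simps)
    moreover have "w + w' \<in> h ` m" "u + u' \<in> T" using * tm T_add unfolding typed_ideal_def by blast+
    ultimately show "x + y \<in> K" unfolding K_def by blast
  next
    fix t x assume t: "t \<in> T" "x \<in> K"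
    then obtain u w where *: "u \<in> T" "w \<in> h ` m" "x = w + u * s" unfolding K_def by blast
    then have "t * x = t * w + (t * u) * s" by (simp add: algebra_simps)
    moreover have "t * w \<in> h ` m" "t * u \<in> T" using * t tm T_mult unfolding typed_ideal_def by blast+
    ultimately show "t * x \<in> K" unfolding K_def by blast
  qed
  note J = vimage_ideal[OF tK]
  have sub: "m \<subseteq> {r \<in> carrier R. h r \<in> K}"
  proof
    fix r assume r: "r \<in> m"
    have "h r = h r + 0 * s" by simp
    then have "h r \<in> K" unfolding K_def using zT r by blast
    then show "r \<in> {r \<in> carrier R. h r \<in> K}" using r m.Icarr by auto
  qed
  have "0 + 1 * s = s" by simp
  then have "s \<in> K" unfolding K_def using one_T tm unfolding typed_ideal_def by (metis (mono_tags, lifting) mem_Collect_eq)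
  then have "a \<in> {r \<in> carrier R. h r \<in> K}" using a by auto
  then have "{r \<in> carrier R. h r \<in> K} = carrier R" using m.I_maximal[OF J sub] am by blast
  then have "h \<one> \<in> K" by auto
  then obtain u w where "u \<in> T" "w \<in> h ` m" "1 = w + u * s" unfolding K_def h_one by blast
  then have "1 - u * s = w" by (metis add_diff_cancel_right')
  then have "1 - u * s \<in> h ` m" using \<open>w \<in> h ` m\<close> by simp
  then show ?thesis using \<open>u \<in> T\<close> by blast
qed

lemma maximal_image_prime:
  assumes m: "maximalideal m R" and "s \<in> T" "t \<in> T" "s * t \<in> h ` m"
  shows "s \<in> h ` m \<or> t \<in> h ` m"
proof -
  interpret m: primeideal m R by (rule maximalideal_prime[OF m])
  obtain a where a: "a \<in> carrier R" "s = h a" using assms(2) by (rule T_cases)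
  obtain b where b: "b \<in> carrier R" "t = h b" using assms(3) by (rule T_cases)
  have "a \<otimes> b \<in> m" using assms(4) a b h_mem_iff[OF m.is_ideal, of "a \<otimes> b"] by (simp add: h_mult)
  then show ?thesis using m.I_prime[OF a(1) b(1)] a b by blast
qed

lemma gorenstein_localI_typed:
  assumes N: "noetherian_ring R" and m: "maximalideal m R" and M: "M = h ` m" and x: "x \<in> M"
    and J0: "typed_ideal T J0" "J0 \<subseteq> M" "x \<in> J0"
    and inv: "\<And>s. s \<in> T - M \<Longrightarrow> \<exists>u\<in>T. 1 - u * s \<in> J0"
    and J0x: "\<And>a. a \<in> J0 \<Longrightarrow> \<exists>s\<in>T - M. \<exists>r\<in>T. s * a = r * x"
    and reg: "\<And>s a. s \<in> T - M \<Longrightarrow> a \<in> T \<Longrightarrow> s * (x * a) = 0 \<Longrightarrow> \<exists>s'\<in>T - M. s' * a = 0"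
    and nil: "\<And>y. y \<in> M \<Longrightarrow> \<exists>n::nat. y ^ n \<in> J0"
    and a: "a \<in> T" "a \<notin> J0" "\<And>y. y \<in> M \<Longrightarrow> y * a \<in> J0"
    and soc: "\<And>b. b \<in> T \<Longrightarrow> (\<And>y. y \<in> M \<Longrightarrow> y * b \<in> J0) \<Longrightarrow> \<exists>r\<in>T. b - r * a \<in> J0"
  shows "gorenstein_local (localization R m)"
proof -
  interpret L: localized R m by (rule maximal_localized[OF m])
  let ?J = "{r \<in> carrier R. h r \<in> J0}"
  have hm: "h r \<in> M \<longleftrightarrow> r \<in> m" if "r \<in> carrier R" for r
    unfolding M by (rule h_mem_iff[OF L.is_ideal that])
  have D: "h r \<in> T - M \<longleftrightarrow> r \<in> carrier R - m" if "r \<in> carrier R" for r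
    using hm that h_closed by auto
  have exT: "\<exists>r\<in>carrier R. t = h r" if "t \<in> T" for t
    using that by (rule T_cases) auto
  have exD: "\<exists>r\<in>carrier R - m. t = h r" if "t \<in> T - M" for t
    using that exT[of t] D by auto
  have exJ: "\<exists>r\<in>?J. t = h r" if "t \<in> J0" for t
    using that exT[of t] J0 by (auto simp: typed_ideal_def)
  obtain x' where x': "x' \<in> carrier R" "x = h x'" using exJ[OF J0(3)] by auto
  obtain a' where a': "a' \<in> carrier R" "a = h a'" using exT[OF a(1)] by auto
  show ?thesis
  proof (rule L.gorenstein_localI[OF N _ vimage_ideal[OF J0(1)], of x' a'])
    show "x' \<in> m" using x x' hm by auto
    show "?J \<subseteq> m" using J0(2) hm by auto
    show "x' \<in> ?J" using x' J0(3) by auto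
    show "a' \<in> carrier R" "a' \<notin> ?J" using a' a by auto
  next
    fix s assume s: "s \<in> carrier R - m"
    then have "h s \<in> T - M" using D by auto
    then obtain u where u: "u \<in> T" "1 - u * h s \<in> J0" using inv by blast
    obtain u' where u': "u' \<in> carrier R" "u = h u'" using exT u by blast
    obtain j where j: "j \<in> ?J" "1 - u * h s = h j" using exJ[OF u(2)] by blast
    have "h \<one> = h (u' \<otimes> s \<oplus> j)"
      using s j u' by (simp add: h_one h_add h_mult flip: j(2))
    then have "\<one> = u' \<otimes> s \<oplus> j" using s j u' by (intro h_inj) auto
    then show "\<exists>u\<in>carrier R. \<exists>j\<in>?J. \<one> = u \<otimes> s \<oplus> j" using u' j by blast
  next
    fix b assume b: "b \<in> ?J"
    obtain s r where sr: "s \<in> T - M" "r \<in> T" "s * h b = r * x" using J0x[of "h b"] b by blast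
    obtain s' where s': "s' \<in> carrier R - m" "s = h s'" using exD sr by blast
    obtain r' where r': "r' \<in> carrier R" "r = h r'" using exT sr by blast
    have "h (s' \<otimes> b) = h (r' \<otimes> x')" using sr s' r' b x' by (simp add: h_mult)
    then have "s' \<otimes> b = r' \<otimes> x'" using s' r' b x' by (intro h_inj) auto
    then show "\<exists>s\<in>carrier R - m. \<exists>r\<in>carrier R. s \<otimes> b = r \<otimes> x'" using s' r' by blast
  next
    fix s b assume s: "s \<in> carrier R - m" and b: "b \<in> carrier R" and e: "s \<otimes> (x' \<otimes> b) = \<zero>"
    have "h s * (x * h b) = 0" using arg_cong[OF e, of h] s b x' by (simp add: h_mult h_zero)
    moreover have "h s \<in> T - M" using D s by auto
    ultimately obtain t where t: "t \<in> T - M" "t * h b = 0" using reg b h_closed by blast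
    obtain t' where t': "t' \<in> carrier R - m" "t = h t'" using exD t by blast
    have "h (t' \<otimes> b) = h \<zero>" using t t' b by (simp add: h_mult h_zero)
    then have "t' \<otimes> b = \<zero>" using t' b by (intro h_inj) auto
    then show "\<exists>s'\<in>carrier R - m. s' \<otimes> b = \<zero>" using t' by blast
  next
    fix y assume y: "y \<in> m"
    have yc: "y \<in> carrier R" using L.Icarr y .
    obtain n where "h y ^ n \<in> J0" using nil[of "h y"] hm yc y by blast
    then show "\<exists>n::nat. y [^] n \<in> ?J" using yc by (intro exI[of _ n]) (simp add: h_pow)
  next
    fix y assume y: "y \<in> m"
    have yc: "y \<in> carrier R" using L.Icarr y .
    have "h y * a \<in> J0" using a(3) hm yc y by auto
    then show "y \<otimes> a' \<in> ?J" using yc a' by (simp add: h_mult)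
  next
    fix b assume b: "b \<in> carrier R" and k: "\<And>y. y \<in> m \<Longrightarrow> y \<otimes> b \<in> ?J"
    have "y * h b \<in> J0" if y: "y \<in> M" for y
    proof -
      obtain y' where y': "y' \<in> m" "y = h y'" using y M by auto
      have "y' \<in> carrier R" using L.Icarr y'(1) .
      then show ?thesis using k[OF y'(1)] b y' by (simp add: h_mult)
    qed
    then obtain r where r: "r \<in> T" "h b - r * a \<in> J0" using soc[OF h_closed[OF b]] by blast
    obtain r' where r': "r' \<in> carrier R" "r = h r'" using exT r by blast
    obtain j where j: "j \<in> ?J" "h b - r * a = h j" using exJ[OF r(2)] by blast
    have "h b = h (r' \<otimes> a' \<oplus> j)"
      using b j r' a' by (simp add: h_add h_mult flip: j(2))
    then have "b = r' \<otimes> a' \<oplus> j" using b j r' a' by (intro h_inj) auto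
    then show "\<exists>r\<in>carrier R. \<exists>j\<in>?J. b = r \<otimes> a' \<oplus> j" using r' j by blast
  qed
qed

lemma gorenstein_local_socle_typed:
  assumes m: "maximalideal m R" and M: "M = h ` m"
    and l: "l \<in> M" "\<And>a. a \<in> T \<Longrightarrow> l * a = 0 \<Longrightarrow> a = 0"
    and inv: "\<And>s. s \<in> T - M \<Longrightarrow> \<exists>u\<in>T. \<exists>j\<in>T. 1 = u * s + j * l"
    and z: "z \<in> T" "\<And>r. r \<in> T \<Longrightarrow> z \<noteq> r * l" "\<And>y. y \<in> M \<Longrightarrow> \<exists>r\<in>T. y * z = r * l"
    and G: "gorenstein_local (localization R m)"
  obtains a where "a \<in> T"
    "\<And>b. b \<in> T \<Longrightarrow> (\<And>y. y \<in> M \<Longrightarrow> \<exists>r\<in>T. y * b = r * l) \<Longrightarrow>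
      \<exists>r\<in>T. \<exists>s\<in>T. b = r * a + s * l"
    "\<And>y. y \<in> M \<Longrightarrow> \<exists>r\<in>T. y * a = r * l"
proof -
  interpret L: localized R m by (rule maximal_localized[OF m])
  have hm: "h r \<in> M \<longleftrightarrow> r \<in> m" if "r \<in> carrier R" for r
    unfolding M by (rule h_mem_iff[OF L.is_ideal that])
  have exT: "\<exists>r\<in>carrier R. t = h r" if "t \<in> T" for t
    using that by (rule T_cases) auto
  have dvd: "(\<exists>r\<in>carrier R. b = r \<otimes> c) \<longleftrightarrow> (\<exists>r\<in>T. h b = r * h c)"
    if "b \<in> carrier R" "c \<in> carrier R" for b c
  proof
    assume "\<exists>r\<in>T. h b = r * h c"
    then obtain r where "r \<in> carrier R" "h b = h r * h c" using exT by blast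
    then have "r \<in> carrier R" "h b = h (r \<otimes> c)" using that by (simp_all add: h_mult)
    then show "\<exists>r\<in>carrier R. b = r \<otimes> c" using that h_inj[of b "r \<otimes> c"] by auto
  qed (use that h_closed in \<open>auto simp: h_mult\<close>)
  have Mcases: "\<exists>y'\<in>m. y = h y'" if "y \<in> M" for y using that M by auto
  obtain l' where l': "l' \<in> m" "l = h l'" using Mcases[OF l(1)] by auto
  have lc: "l' \<in> carrier R" by (rule L.Icarr[OF l'(1)])
  obtain z' where z': "z' \<in> carrier R" "z = h z'" using exT[OF z(1)] by auto
  have P1: "a = \<zero>" if "a \<in> carrier R" "l' \<otimes> a = \<zero>" for a
  proof -
    have "l * h a = 0" using arg_cong[OF that(2), of h] that(1) lc l'(2) by (simp add: h_mult h_zero)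
    then have "h a = h \<zero>" using l(2) h_closed that by (simp add: h_zero)
    then show ?thesis using h_inj that(1) by blast
  qed
  have P2: "\<exists>u\<in>carrier R. \<exists>j\<in>carrier R. \<one> = u \<otimes> s \<oplus> j \<otimes> l'" if s: "s \<in> carrier R - m" for s
  proof -
    have "h s \<in> T - M" using s hm h_closed by auto
    then obtain u j where "u \<in> T" "j \<in> T" "1 = u * h s + j * l" using inv by blast
    then obtain u' j' where u: "u' \<in> carrier R" "j' \<in> carrier R" "1 = h u' * h s + h j' * l"
      using exT[of u] exT[of j] by auto
    then have "h \<one> = h (u' \<otimes> s \<oplus> j' \<otimes> l')" using s lc l'(2) by (simp add: h_one h_add h_mult)
    then have "\<one> = u' \<otimes> s \<oplus> j' \<otimes> l'" using u s lc by (intro h_inj) auto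
    then show ?thesis using u by blast
  qed
  have P3: "z' \<noteq> r \<otimes> l'" if "r \<in> carrier R" for r
    using z(2)[OF h_closed[OF that]] that lc l' z' by (auto simp: h_mult)
  have P4: "\<exists>r\<in>carrier R. y \<otimes> z' = r \<otimes> l'" if y: "y \<in> m" for y
  proof -
    have yc: "y \<in> carrier R" by (rule L.Icarr[OF y])
    then show ?thesis
      using dvd[of "y \<otimes> z'" l'] z(3)[of "h y"] hm[OF yc] y z' lc l' by (simp add: h_mult)
  qed
  obtain a where a: "a \<in> carrier R"
    "\<And>b. b \<in> carrier R \<Longrightarrow> (\<And>y. y \<in> m \<Longrightarrow> \<exists>r\<in>carrier R. y \<otimes> b = r \<otimes> l') \<Longrightarrow>
      \<exists>r\<in>carrier R. \<exists>s\<in>carrier R. b = r \<otimes> a \<oplus> s \<otimes> l'"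
    "\<And>y. y \<in> m \<Longrightarrow> \<exists>r\<in>carrier R. y \<otimes> a = r \<otimes> l'"
    using L.gorenstein_local_socle_R[OF l'(1) P1 P2 z'(1) P3 P4 G] by blast
  show ?thesis
  proof (rule that[of "h a"])
    show "h a \<in> T" using a h_closed by auto
  next
    fix y assume "y \<in> M"
    then obtain y' where y: "y' \<in> m" "y = h y'" using Mcases by auto
    have yc: "y' \<in> carrier R" by (rule L.Icarr[OF y(1)])
    show "\<exists>r\<in>T. y * h a = r * l"
      using a(3)[OF y(1)] dvd[of "y' \<otimes> a" l'] yc a(1) lc l' y by (simp add: h_mult)
  next
    fix b assume b: "b \<in> T" "\<And>y. y \<in> M \<Longrightarrow> \<exists>r\<in>T. y * b = r * l"
    obtain b' where b': "b' \<in> carrier R" "b = h b'" using exT b by auto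
    have "\<exists>r\<in>carrier R. y \<otimes> b' = r \<otimes> l'" if y: "y \<in> m" for y
    proof -
      have yc: "y \<in> carrier R" by (rule L.Icarr[OF y])
      then show ?thesis
        using dvd[of "y \<otimes> b'" l'] b(2)[of "h y"] hm[OF yc] y b' lc l' by (simp add: h_mult)
    qed
    then obtain r s where rs: "r \<in> carrier R" "s \<in> carrier R" "b' = r \<otimes> a \<oplus> s \<otimes> l'"
      using a(2)[OF b'(1)] by blast
    then have "b = h r * h a + h s * l" using b' a lc l' by (simp add: h_mult h_add)
    then show "\<exists>r\<in>T. \<exists>s\<in>T. b = r * h a + s * l" using rs h_closed by blast
  qed
qed

lemma maximalideal_vimage:
  assumes M: "typed_ideal T M" "1 \<notin> M" and inv: "\<And>s. s \<in> T - M \<Longrightarrow> \<exists>u\<in>T. 1 - u * s \<in> M"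
  shows "maximalideal {r \<in> carrier R. h r \<in> M} R"
proof (rule maximalidealI[OF vimage_ideal[OF M(1)]])
  show "carrier R \<noteq> {r \<in> carrier R. h r \<in> M}" using M(2) one_closed h_one by force
  fix J assume J: "ideal J R" "{r \<in> carrier R. h r \<in> M} \<subseteq> J" "J \<subseteq> carrier R"
  show "J = {r \<in> carrier R. h r \<in> M} \<or> J = carrier R"
  proof (rule disjCI)
    assume "J \<noteq> carrier R"
    then have nJ: "\<one> \<notin> J" using ideal.one_imp_carrier[OF J(1)] by auto
    have tJ: "typed_ideal T (h ` J)" by (rule image_typed_ideal[OF J(1)])
    have MJ: "M \<subseteq> h ` J"
    proof
      fix x assume x: "x \<in> M"
      then have "x \<in> T" using M by (auto simp: typed_ideal_def)
      then obtain r where "r \<in> carrier R" "x = h r" by (rule T_cases)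
      then show "x \<in> h ` J" using J(2) x by auto
    qed
    have "h r \<in> M" if r: "r \<in> J" for r
    proof (rule ccontr)
      assume n: "h r \<notin> M"
      have "h r \<in> T" using h_closed J(3) r by auto
      then obtain u where u: "u \<in> T" "1 - u * h r \<in> M" using inv n by blast
      then have "1 - u * h r \<in> h ` J" "u * h r \<in> h ` J"
        using MJ tJ r unfolding typed_ideal_def by blast+
      then have "(1 - u * h r) + u * h r \<in> h ` J" using tJ unfolding typed_ideal_def by blast
      then have "h \<one> \<in> h ` J" by (simp add: h_one)
      then show False using h_mem_iff[OF J(1) one_closed] nJ by simp
    qed
    then show "J = {r \<in> carrier R. h r \<in> M}" using J(2,3) by blast
  qed
qed

end

section \<open>Coordinate rings of points\<close>

lemma vec_fun_eqI: "(\<And>i. f $ i = g $ i) \<Longrightarrow> f = (g :: 'a ^ 'm::finite)"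
  by (simp add: vec_eq_iff)

text \<open>
  A form is determined modulo the ideal of the points by its values at the representatives \<open>v i\<close>;
  \<open>form_vals v n\<close> consists of the values of the forms of degree \<open>n\<close>. The homogeneous coordinate ring becomes
  the subring \<open>line_ring v\<close> of \<open>K[t]^m\<close> by restricting polynomials to the lines through the \<open>v i\<close>.
\<close>

definition coordf :: "('m::finite \<Rightarrow> 'K::field ^ 'n::finite) \<Rightarrow> 'n \<Rightarrow> 'K ^ 'm"
  where "coordf v j = (\<chi> i. v i $ j)"

primrec form_vals :: "('m::finite \<Rightarrow> 'K::field ^ 'n::finite) \<Rightarrow> nat \<Rightarrow> ('K ^ 'm) set" where
  "form_vals v 0 = {c *s 1 | c. True}"
| "form_vals v (Suc n) = {\<Sum>j\<in>UNIV. coordf v j * g j | g. \<forall>j. g j \<in> form_vals v n}"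

definition coeff_vec :: "'K::field poly ^ 'm::finite \<Rightarrow> nat \<Rightarrow> 'K ^ 'm"
  where "coeff_vec F n = (\<chi> i. coeff (F $ i) n)"

definition line_ring :: "('m::finite \<Rightarrow> 'K::field ^ 'n::finite) \<Rightarrow> ('K poly ^ 'm) set"
  where "line_ring v = {F. \<forall>n. coeff_vec F n \<in> form_vals v n}"

definition vmono :: "'K::field ^ 'm::finite \<Rightarrow> nat \<Rightarrow> 'K poly ^ 'm"
  where "vmono g n = (\<chi> i. monom (g $ i) n)"

lemma scale_mult: "(c *s f) * g = c *s (f * g)" "f * (c *s g) = c *s (f * g)"
  for f :: "'K::field ^ 'm::finite"
  by (simp_all add: vec_eq_iff)

lemma form_vals_zero: "0 \<in> form_vals v n"
proof (induction n)
  case 0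
  show ?case by (auto intro!: exI[of _ 0])
next
  case (Suc n)
  then show ?case by (simp, intro exI[of _ "\<lambda>_. 0"]) simp
qed

lemma form_vals_add: "f \<in> form_vals v n \<Longrightarrow> g \<in> form_vals v n \<Longrightarrow> f + g \<in> form_vals v n"
proof (induction n arbitrary: f g)
  case 0
  then show ?case by (auto simp: vec.scale_left_distrib[symmetric])
next
  case (Suc n)
  then obtain a b where ab: "f = (\<Sum>j\<in>UNIV. coordf v j * a j)" "\<forall>j. a j \<in> form_vals v n"
    "g = (\<Sum>j\<in>UNIV. coordf v j * b j)" "\<forall>j. b j \<in> form_vals v n" by auto
  have "f + g = (\<Sum>j\<in>UNIV. coordf v j * (a j + b j))"
    by (simp add: ab sum.distrib distrib_left)
  moreover have "\<forall>j. a j + b j \<in> form_vals v n" using ab Suc.IH by blast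
  ultimately show ?case by auto
qed

lemma form_vals_scale: "f \<in> form_vals v n \<Longrightarrow> c *s f \<in> form_vals v n"
proof (induction n arbitrary: f)
  case 0
  then show ?case by auto
next
  case (Suc n)
  then obtain a where a: "f = (\<Sum>j\<in>UNIV. coordf v j * a j)" "\<forall>j. a j \<in> form_vals v n" by auto
  have "c *s f = (\<Sum>j\<in>UNIV. coordf v j * (c *s a j))"
    by (simp add: a scale_mult vec.scale_sum_right)
  moreover have "\<forall>j. c *s a j \<in> form_vals v n" using a Suc.IH by blast
  ultimately show ?case by auto
qed

lemma form_vals_subspace: "vec.subspace (form_vals v n)"
  by (simp add: vec.subspace_def form_vals_zero form_vals_add form_vals_scale)

lemma form_vals_diff: "f \<in> form_vals v n \<Longrightarrow> g \<in> form_vals v n \<Longrightarrow> f - g \<in> form_vals v n"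
  using vec.subspace_diff[OF form_vals_subspace] .

lemma form_vals_sum: "(\<And>i. i \<in> I \<Longrightarrow> f i \<in> form_vals v n) \<Longrightarrow> sum f I \<in> form_vals v n"
  using vec.subspace_sum[OF form_vals_subspace] .

lemma coordf_mult: "f \<in> form_vals v n \<Longrightarrow> coordf v j * f \<in> form_vals v (Suc n)"
  by (simp, intro exI[of _ "\<lambda>i. if i = j then f else 0"])
    (simp add: form_vals_zero if_distrib[of "\<lambda>x. _ * x"] cong: if_cong)

lemma one_W0: "1 \<in> form_vals v 0"
  by (simp, rule exI[of _ 1]) simp

lemma form_vals_mult: "f \<in> form_vals v a \<Longrightarrow> g \<in> form_vals v b \<Longrightarrow> f * g \<in> form_vals v (a + b)"
proof (induction a arbitrary: f)
  case 0
  then obtain c where "f = c *s 1" by auto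
  then show ?case using form_vals_scale[OF 0(2)] by (simp add: scale_mult)
next
  case (Suc a)
  then obtain u where u: "f = (\<Sum>j\<in>UNIV. coordf v j * u j)" "\<forall>j. u j \<in> form_vals v a" by auto
  have "f * g = (\<Sum>j\<in>UNIV. coordf v j * (u j * g))"
    by (simp add: u sum_distrib_right mult.assoc)
  moreover have "\<forall>j. u j * g \<in> form_vals v (a + b)" using u Suc by blast
  ultimately show ?case by auto
qed

lemma form_vals_1: "form_vals v 1 = {(\<chi> i. \<Sum>j\<in>UNIV. a $ j * v i $ j) | a. True}"
proof -
  have "(\<Sum>j\<in>UNIV. coordf v j * (c j *s 1)) = (\<chi> i. \<Sum>j\<in>UNIV. c j * v i $ j)" for c
    by (simp add: vec_eq_iff coordf_def mult.commute)
  note e = this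
  show ?thesis
  proof (intro equalityI subsetI)
    fix f assume "f \<in> form_vals v 1"
    then obtain g where g: "f = (\<Sum>j\<in>UNIV. coordf v j * g j)" "\<forall>j. \<exists>c. g j = c *s 1" by auto
    obtain c where c: "g j = c j *s 1" for j using g(2) by metis
    have "f = (\<chi> i. \<Sum>j\<in>UNIV. (\<chi> j. c j) $ j * v i $ j)" using e[of c] by (simp add: g(1) c)
    then show "f \<in> {(\<chi> i. \<Sum>j\<in>UNIV. a $ j * v i $ j) | a. True}" by blast
  next
    fix f assume "f \<in> {(\<chi> i. \<Sum>j\<in>UNIV. a $ j * v i $ j) | a. True}"
    then obtain a where "f = (\<Sum>j\<in>UNIV. coordf v j * ((a $ j) *s 1))" using e by auto
    then show "f \<in> form_vals v 1" by (simp, intro exI[of _ "\<lambda>j. (a $ j) *s 1"]) auto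
  qed
qed

lemma coeff_vec_mult: "coeff_vec (F * G) n = (\<Sum>k\<le>n. coeff_vec F k * coeff_vec G (n - k))"
  by (simp add: coeff_vec_def vec_eq_iff coeff_mult)

lemma coeff_vec_add: "coeff_vec (F + G) n = coeff_vec F n + coeff_vec G n"
  by (simp add: coeff_vec_def vec_eq_iff)

lemma coeff_vec_diff: "coeff_vec (F - G) n = coeff_vec F n - coeff_vec G n"
  by (simp add: coeff_vec_def vec_eq_iff)

lemma coeff_vec_zero: "coeff_vec 0 n = 0"
  by (simp add: coeff_vec_def vec_eq_iff)

lemma coeff_vec_one: "coeff_vec 1 n = (if n = 0 then 1 else 0)"
  by (simp add: coeff_vec_def vec_eq_iff)

lemma coeff_vec_vmono: "coeff_vec (vmono g m) n = (if n = m then g else 0)"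
  by (simp add: coeff_vec_def vmono_def vec_eq_iff)

lemma line_ring_add: "F \<in> line_ring v \<Longrightarrow> G \<in> line_ring v \<Longrightarrow> F + G \<in> line_ring v"
  by (simp add: line_ring_def coeff_vec_add form_vals_add)

lemma line_ring_diff: "F \<in> line_ring v \<Longrightarrow> G \<in> line_ring v \<Longrightarrow> F - G \<in> line_ring v"
  by (simp add: line_ring_def coeff_vec_diff form_vals_diff)

lemma line_ring_zero: "0 \<in> line_ring v"
  by (simp add: line_ring_def coeff_vec_zero form_vals_zero)

lemma line_ring_one: "1 \<in> line_ring v"
  using one_W0[of v] by (simp add: line_ring_def coeff_vec_one form_vals_zero del: form_vals.simps)

lemma line_ring_mult: "F \<in> line_ring v \<Longrightarrow> G \<in> line_ring v \<Longrightarrow> F * G \<in> line_ring v"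
proof -
  assume F: "F \<in> line_ring v" "G \<in> line_ring v"
  have "coeff_vec F k * coeff_vec G (n - k) \<in> form_vals v n" if "k \<le> n" for n k
    using form_vals_mult[of "coeff_vec F k" v k "coeff_vec G (n - k)" "n - k"] F that by (simp add: line_ring_def)
  then show ?thesis by (auto simp: line_ring_def coeff_vec_mult intro!: form_vals_sum)
qed

lemma line_ring_sum: "(\<And>i. i \<in> I \<Longrightarrow> f i \<in> line_ring v) \<Longrightarrow> sum f I \<in> line_ring v"
  by (induction I rule: infinite_finite_induct) (auto simp: line_ring_zero line_ring_add)

lemma line_ring_pow: "F \<in> line_ring v \<Longrightarrow> F ^ n \<in> line_ring v"
  by (induction n) (auto simp: line_ring_one line_ring_mult)

lemma vmono_line_ring: "g \<in> form_vals v n \<Longrightarrow> vmono g n \<in> line_ring v"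
  by (simp add: line_ring_def coeff_vec_vmono form_vals_zero)

lemma vmono_mult: "vmono f a * vmono g b = vmono (f * g) (a + b)"
  by (simp add: vmono_def vec_eq_iff mult_monom)

lemma vmono_add: "vmono (f + g) n = vmono f n + vmono g n"
  by (simp add: vmono_def vec_eq_iff add_monom)

lemma vmono_sum: "vmono (sum f I) n = (\<Sum>i\<in>I. vmono (f i) n)"
proof (induction I rule: infinite_finite_induct)
  case (insert x F)
  then show ?case by (simp add: vmono_add)
qed (simp_all add: vmono_def vec_eq_iff)

lemma coeff_vec_eqI: "(\<And>n. coeff_vec F n = coeff_vec G n) \<Longrightarrow> F = G"
  by (simp add: coeff_vec_def vec_eq_iff poly_eq_iff)

lemma vec_poly_expansion:
  assumes "\<And>i. degree (F $ i) \<le> N"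
  shows "F = (\<Sum>n\<le>N. vmono (coeff_vec F n) n)"
proof (rule vec_fun_eqI)
  fix i
  have "F $ i = (\<Sum>n\<le>N. monom (coeff (F $ i) n) n)"
    by (subst poly_as_sum_of_monoms'[OF assms]) simp
  then show "F $ i = (\<Sum>n\<le>N. vmono (coeff_vec F n) n) $ i"
    by (simp add: vmono_def coeff_vec_def)
qed

text \<open>The variable \<open>t\<close> on all lines at once. It is the restriction of a linear
  form with value 1 at every representative, and the Artinian reduction is the quotient by
  it.\<close>

definition line_var :: "'K::field poly ^ 'm::finite" where "line_var = vmono 1 1"

lemma coeff_vec_line_var_mult: "coeff_vec (line_var * F) n = (if n = 0 then 0 else coeff_vec F (n - 1))"
  by (cases n) (simp_all add: line_var_def vmono_def coeff_vec_def vec_eq_iff monom_altdef coeff_pCons)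

lemma line_var_cancel: "line_var * F = 0 \<Longrightarrow> F = 0"
  by (rule coeff_vec_eqI) (metis coeff_vec_line_var_mult coeff_vec_zero diff_Suc_1 nat.distinct(1))

lemma line_var_factor:
  assumes "coeff_vec F 0 = 0"
  obtains G where "F = line_var * G" "\<And>n. coeff_vec G n = coeff_vec F (Suc n)"
proof (rule that)
  let ?G = "\<chi> i. poly_shift 1 (F $ i)"
  show c: "coeff_vec ?G n = coeff_vec F (Suc n)" for n
    by (simp add: coeff_vec_def vec_eq_iff coeff_poly_shift)
  show "F = line_var * ?G"
  proof (rule coeff_vec_eqI)
    show "coeff_vec F n = coeff_vec (line_var * ?G) n" for n
      using c by (cases n) (simp_all add: coeff_vec_line_var_mult assms)
  qed
qed

text \<open>The condition says that some linear form takes the value \<open>1\<close> at all \<open>v i\<close>.\<close>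

locale affine_points =
  fixes v :: "'m::finite \<Rightarrow> 'K::field ^ 'n::finite" and l :: "'K ^ 'n"
  assumes l: "\<And>i. (\<Sum>j\<in>UNIV. l $ j * v i $ j) = 1"
    and inj_v: "inj v"
begin

lemma one_W1: "1 \<in> form_vals v 1"
  unfolding form_vals_1 by (auto simp: vec_eq_iff l intro!: exI[of _ l])

lemma form_vals_Suc: "f \<in> form_vals v n \<Longrightarrow> f \<in> form_vals v (Suc n)"
  using form_vals_mult[OF one_W1, of f n] by simp

lemma form_vals_le: "f \<in> form_vals v n \<Longrightarrow> n \<le> m \<Longrightarrow> f \<in> form_vals v m"
  by (induction m) (auto simp: le_Suc_eq form_vals_Suc simp del: form_vals.simps)

lemma line_var_line_ring: "line_var \<in> line_ring v"
  unfolding line_var_def by (rule vmono_line_ring[OF one_W1])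

text \<open>Multiplication by \<open>line_var\<close> only shifts coefficients. Hence the degree
  \<open>Suc n\<close> part of the Artinian reduction is \<open>form_vals v (Suc n)\<close> modulo
  \<open>form_vals v n\<close>, and computations modulo \<open>line_var\<close> become membership in
  \<open>form_vals\<close>.\<close>

lemma line_var_multiple_iff:
  "(\<exists>G\<in>line_ring v. F = G * line_var) \<longleftrightarrow> F \<in> line_ring v \<and> coeff_vec F 0 = 0 \<and> (\<forall>n. coeff_vec F (Suc n) \<in> form_vals v n)"
proof
  assume "\<exists>G\<in>line_ring v. F = G * line_var"
  then obtain G where G: "G \<in> line_ring v" "F = line_var * G" by (auto simp: mult.commute)
  then show "F \<in> line_ring v \<and> coeff_vec F 0 = 0 \<and> (\<forall>n. coeff_vec F (Suc n) \<in> form_vals v n)"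
    using line_ring_mult[OF line_var_line_ring G(1)] by (simp add: coeff_vec_line_var_mult line_ring_def)
next
  assume F: "F \<in> line_ring v \<and> coeff_vec F 0 = 0 \<and> (\<forall>n. coeff_vec F (Suc n) \<in> form_vals v n)"
  then obtain G where "F = line_var * G" "\<And>n. coeff_vec G n = coeff_vec F (Suc n)" using line_var_factor by blast
  then show "\<exists>G\<in>line_ring v. F = G * line_var" using F by (intro bexI[of _ G]) (auto simp: line_ring_def mult.commute)
qed

text \<open>Subtract a constant from a coordinate in which the two representatives differ, and
  rescale. Constants are allowed because 1 is the value vector of a linear form.\<close>

lemma separating:
  assumes "i \<noteq> k"
  obtains f where "f \<in> form_vals v 1" "f $ i = 1" "f $ k = 0"
proof -
  obtain j where j: "v i $ j \<noteq> v k $ j" using assms inj_v by (metis injD vec_fun_eqI)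
  let ?f = "(1 / (v i $ j - v k $ j)) *s (coordf v j - (v k $ j) *s 1)"
  have "coordf v j \<in> form_vals v 1" using coordf_mult[OF one_W0, of v j] by simp
  then have "?f \<in> form_vals v 1" using form_vals_scale form_vals_diff one_W1 by metis
  moreover have "?f $ i = 1" "?f $ k = 0" using j by (simp_all add: coordf_def)
  ultimately show ?thesis by (rule that)
qed

text \<open>Multiply one separating linear form for each point other than \<open>i\<close>; this
  needs one degree less than stated, and \<open>form_vals\<close> increases with the degree.\<close>

lemma axis_form_vals: "axis i 1 \<in> form_vals v (CARD('m))"
proof -
  have "\<exists>f\<in>form_vals v (card A). f $ i = 1 \<and> (\<forall>k\<in>A. f $ k = 0)" if "finite A" "i \<notin> A" for A
    using that
  proof (induction A)
    case empty
    show ?case using one_W0[of v] by (intro bexI[of _ 1]) auto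
  next
    case (insert k A)
    then obtain f where f: "f \<in> form_vals v (card A)" "f $ i = 1" "\<forall>k\<in>A. f $ k = 0" by auto
    obtain g where g: "g \<in> form_vals v 1" "g $ i = 1" "g $ k = 0" using separating[of i k] insert by auto
    have "g * f \<in> form_vals v (card (insert k A))" using form_vals_mult[OF g(1) f(1)] insert by simp
    then show ?case using f g by (intro bexI[of _ "g * f"]) auto
  qed
  from this[of "UNIV - {i}"] obtain f where f: "f \<in> form_vals v (card (UNIV - {i}))" "f $ i = 1" "\<forall>k\<noteq>i. f $ k = 0"
    by auto
  have "f = axis i 1" using f by (auto simp: vec_eq_iff axis_def)
  then show ?thesis using form_vals_le[OF f(1)] card_mono[of "UNIV :: 'm set" "UNIV - {i}"] by auto
qed

lemma form_vals_top:
  assumes "\<And>i. axis i 1 \<in> form_vals v n"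
  shows "form_vals v n = UNIV"
proof -
  have "f \<in> form_vals v n" for f
  proof -
    have "f = (\<Sum>i\<in>UNIV. (f $ i) *s axis i 1)" by (simp add: vec_eq_iff axis_def if_distrib cong: if_cong)
    then show ?thesis using form_vals_sum[of UNIV "\<lambda>i. (f $ i) *s axis i 1"] form_vals_scale assms by metis
  qed
  then show ?thesis by auto
qed

lemma form_vals_top_le: "form_vals v n = UNIV \<Longrightarrow> n \<le> m \<Longrightarrow> form_vals v m = UNIV"
  using form_vals_le by blast

lemma ex_top: "\<exists>n. form_vals v n = UNIV"
  using form_vals_top[OF axis_form_vals] by blast

text \<open>The power has no terms below degree \<open>Suc s\<close>, and from there on every
  coefficient vector already comes from a form of one degree less.\<close>

lemma pow_line_var_multiple:
  assumes s: "form_vals v s = UNIV" and F: "F \<in> line_ring v" "coeff_vec F 0 = 0"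
  shows "\<exists>G\<in>line_ring v. F ^ Suc s = G * line_var"
  unfolding line_var_multiple_iff
proof (intro conjI allI)
  show "F ^ Suc s \<in> line_ring v" by (rule line_ring_pow[OF F(1)])
  have low: "coeff_vec (F ^ k) n = 0" if "n < k" for k n
    using that
  proof (induction k arbitrary: n)
    case (Suc k)
    have "coeff_vec F j * coeff_vec (F ^ k) (n - j) = 0" if "j \<le> n" for j
      using F(2) Suc that by (cases "j = 0") auto
    then show ?case by (simp add: coeff_vec_mult)
  qed simp
  show "coeff_vec (F ^ Suc s) 0 = 0" by (rule low) simp
  show "coeff_vec (F ^ Suc s) (Suc n) \<in> form_vals v n" for n
  proof (cases "n < s")
    case True
    then show ?thesis using low[of "Suc n" "Suc s"] by (simp add: form_vals_zero del: power_Suc)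
  next
    case False
    then show ?thesis using form_vals_top_le[OF s, of n] by simp
  qed
qed

definition irrelevant where "irrelevant = {F \<in> line_ring v. coeff_vec F 0 = 0}"

lemma coeff_vec_0_line_ring: "F \<in> line_ring v \<Longrightarrow> \<exists>c. coeff_vec F 0 = c *s 1"
  using form_vals.simps(1)[of v] unfolding line_ring_def by blast

lemma const_line_ring: "vmono (c *s 1) 0 \<in> line_ring v"
  by (rule vmono_line_ring) auto

lemma typed_ideal_irrelevant: "typed_ideal (line_ring v) irrelevant"
  unfolding typed_ideal_def irrelevant_def
  by (auto simp: line_ring_zero line_ring_add line_ring_mult coeff_vec_zero coeff_vec_add coeff_vec_mult)

lemma irrelevant_cases:
  assumes "F \<in> line_ring v"
  obtains c where "F - vmono (c *s 1) 0 \<in> irrelevant" "coeff_vec F 0 = c *s 1"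
  using coeff_vec_0_line_ring[OF assms] that const_line_ring
  by (auto simp: irrelevant_def coeff_vec_diff coeff_vec_vmono line_ring_diff assms)

text \<open>After division by its constant term, \<open>F\<close> becomes \<open>1 - y\<close> with
  \<open>y\<close> in the irrelevant ideal. As \<open>y\<close> is nilpotent modulo
  \<open>line_var\<close>, a finite geometric series inverts it.\<close>

lemma inverse_mod_line_var:
  assumes s: "form_vals v s = UNIV" and F: "F \<in> line_ring v" "F \<notin> irrelevant"
  shows "\<exists>u\<in>line_ring v. \<exists>j\<in>line_ring v. 1 = u * F + j * line_var"
proof -
  obtain c where c: "F - vmono (c *s 1) 0 \<in> irrelevant" "coeff_vec F 0 = c *s 1" using irrelevant_cases F(1) by blast
  have c0: "c \<noteq> 0" using c F by (auto simp: irrelevant_def)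
  let ?C = "vmono (c *s 1) 0" and ?I = "vmono ((1/c) *s 1) 0"
  have CI: "?I * ?C = 1"
    using c0 by (simp add: vmono_mult scale_mult) (simp add: vmono_def vec_eq_iff)
  have IT: "?I \<in> line_ring v" by (rule const_line_ring)
  define y where "y = 1 - ?I * F"
  have y: "y \<in> irrelevant"
  proof -
    have "y = (- ?I) * (F - ?C)" using CI by (simp add: y_def algebra_simps)
    moreover have "- ?I \<in> line_ring v" using line_ring_diff[OF line_ring_zero IT] by simp
    ultimately show ?thesis using typed_ideal_irrelevant c unfolding typed_ideal_def by metis
  qed
  obtain G where G: "G \<in> line_ring v" "y ^ Suc s = G * line_var" using pow_line_var_multiple[OF s] y by (auto simp: irrelevant_def)
  have "1 - y ^ Suc s = (1 - y) * (\<Sum>i<Suc s. y ^ i)"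
    by (simp only: one_diff_power_eq)
  also have "\<dots> = (?I * (\<Sum>i<Suc s. y ^ i)) * F" by (simp add: y_def algebra_simps)
  finally have "1 = (?I * (\<Sum>i<Suc s. y ^ i)) * F + G * line_var" using G by (simp add: algebra_simps)
  moreover have "?I * (\<Sum>i<Suc s. y ^ i) \<in> line_ring v"
    using y by (intro line_ring_mult IT line_ring_sum line_ring_pow) (auto simp: irrelevant_def)
  ultimately show ?thesis using G by blast
qed

end

section \<open>Evaluation of polynomials on lines\<close>

text \<open>For polynomials this is the diagonal embedding of \<open>K[t]\<close>, which turns
  ideals of \<open>line_ring v\<close> into submodules of a free \<open>K[t]\<close>-module.\<close>

definition cst :: "'a \<Rightarrow> 'a ^ 'm::finite" where "cst q = (\<chi> i. q)"

text \<open>Division with remainder, one coordinate at a time: an element whose entry at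
  \<open>j\<close> is nonzero of least degree reduces all others to elements vanishing at
  \<open>j\<close>, so the support \<open>C\<close> shrinks. Coordinate rings of points become
  Noetherian this way, without the basis theorem of Hilbert.\<close>

lemma poly_submodule_finite_generators:
  fixes M :: "('K::field poly ^ 'm::finite) set"
  assumes "finite C" and "0 \<in> M" and add: "\<And>x y. x \<in> M \<Longrightarrow> y \<in> M \<Longrightarrow> x + y \<in> M"
    and smult: "\<And>q x. x \<in> M \<Longrightarrow> cst q * x \<in> M"
    and "\<And>x i. x \<in> M \<Longrightarrow> i \<notin> C \<Longrightarrow> x $ i = 0"
  shows "\<exists>A. finite A \<and> A \<subseteq> M \<and> (\<forall>x\<in>M. \<exists>q. x = (\<Sum>a\<in>A. cst (q a) * a))"
  using assms
proof (induction C arbitrary: M)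
  case empty
  then have "M \<subseteq> {0}" by (auto simp: vec_eq_iff)
  then show ?case by (intro exI[of _ "{}"]) auto
next
  case (insert j C)
  note add = insert.prems(2) and smult = insert.prems(3)
  show ?case
  proof (cases "\<forall>x\<in>M. x $ j = 0")
    case True
    show ?thesis
    proof (rule insert.IH)
      show "x $ i = 0" if "x \<in> M" "i \<notin> C" for x i
        using insert.prems(4)[of x i] that True by (cases "i = j") auto
    qed (use insert.prems in auto)
  next
    case False
    then obtain x1 where x1: "x1 \<in> M" "x1 $ j \<noteq> 0" by auto
    obtain x0 where x0: "x0 \<in> M" "x0 $ j \<noteq> 0"
      and min: "\<And>x. x \<in> M \<Longrightarrow> x $ j \<noteq> 0 \<Longrightarrow> degree (x0 $ j) \<le> degree (x $ j)"
      using ex_has_least_nat[of "\<lambda>x. x \<in> M \<and> x $ j \<noteq> 0" x1 "\<lambda>x. degree (x $ j)"] x1 by blast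
    have red: "x - cst (x $ j div x0 $ j) * x0 \<in> M \<and> (x - cst (x $ j div x0 $ j) * x0) $ j = 0"
      if x: "x \<in> M" for x
    proof -
      let ?y = "x - cst (x $ j div x0 $ j) * x0"
      have "?y = x + cst (- (x $ j div x0 $ j)) * x0" by (simp add: vec_eq_iff cst_def)
      then have yM: "?y \<in> M" using add smult x x0 by metis
      have yj: "?y $ j = x $ j mod x0 $ j"
        by (simp add: cst_def minus_div_mult_eq_mod)
      have "?y $ j = 0"
      proof (rule ccontr)
        assume n: "?y $ j \<noteq> 0"
        then have "degree (?y $ j) < degree (x0 $ j)"
          using degree_mod_less[OF x0(2), of "x $ j"] unfolding yj by auto
        then show False using min[OF yM n] by simp
      qed
      then show ?thesis using yM by simp
    qed
    let ?M = "{x \<in> M. x $ j = 0}"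
    have "\<exists>A. finite A \<and> A \<subseteq> ?M \<and> (\<forall>x\<in>?M. \<exists>q. x = (\<Sum>a\<in>A. cst (q a) * a))"
    proof (rule insert.IH)
      show "0 \<in> ?M" using insert.prems(1) by auto
      show "x $ i = 0" if "x \<in> ?M" "i \<notin> C" for x i
        using insert.prems(4)[of x i] that by (cases "i = j") auto
    qed (use add smult in auto)
    then obtain A where A: "finite A" "A \<subseteq> ?M" "\<forall>x\<in>?M. \<exists>q. x = (\<Sum>a\<in>A. cst (q a) * a)" by blast
    have x0A: "x0 \<notin> A" using A x0 by auto
    have "\<exists>q. x = (\<Sum>a\<in>insert x0 A. cst (q a) * a)" if x: "x \<in> M" for x
    proof -
      obtain q where q: "x - cst (x $ j div x0 $ j) * x0 = (\<Sum>a\<in>A. cst (q a) * a)"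
        using A(3) red[OF x] by blast
      have "(\<Sum>a\<in>A. cst ((q(x0 := x $ j div x0 $ j)) a) * a) = (\<Sum>a\<in>A. cst (q a) * a)"
        by (rule sum.cong) (use x0A in auto)
      then have "x = (\<Sum>a\<in>insert x0 A. cst ((q(x0 := x $ j div x0 $ j)) a) * a)"
        using A(1) x0A q by (simp add: algebra_simps)
      then show ?thesis by blast
    qed
    then show ?thesis using A x0 by (intro exI[of _ "insert x0 A"]) auto
  qed
qed

lemma coeff_vec_sum: "coeff_vec (sum F I) n = (\<Sum>k\<in>I. coeff_vec (F k) n)"
  by (induction I rule: infinite_finite_induct) (simp_all add: coeff_vec_zero coeff_vec_add)

lemma (in affine_points) cst_line_ring: "cst q \<in> line_ring v"
proof -
  have "coeff_vec (cst q :: 'K poly ^ 'm) n = coeff q n *s 1" for n by (simp add: coeff_vec_def cst_def vec_eq_iff)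
  moreover have "coeff q n *s 1 \<in> form_vals v n" for n by (rule form_vals_scale[OF form_vals_le[OF one_W0 le0]])
  ultimately show ?thesis by (simp add: line_ring_def)
qed

lemma (in affine_points) typed_ideal_generators:
  assumes J: "typed_ideal (line_ring v) J"
  shows "\<exists>A. finite A \<and> A \<subseteq> J \<and> (\<forall>x\<in>J. \<exists>q. (\<forall>a\<in>A. q a \<in> line_ring v) \<and> x = (\<Sum>a\<in>A. q a * a))"
proof -
  have "\<exists>A. finite A \<and> A \<subseteq> J \<and> (\<forall>x\<in>J. \<exists>q. x = (\<Sum>a\<in>A. cst (q a) * a))"
    by (rule poly_submodule_finite_generators[of UNIV])
      (use J cst_line_ring in \<open>auto simp: typed_ideal_def\<close>)
  then obtain A where A: "finite A" "A \<subseteq> J" "\<forall>x\<in>J. \<exists>q. x = (\<Sum>a\<in>A. cst (q a) * a)" by blast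
  show ?thesis
  proof (intro exI[of _ A] conjI ballI)
    fix x assume "x \<in> J"
    then obtain q where "x = (\<Sum>a\<in>A. cst (q a) * a)" using A by blast
    then show "\<exists>q. (\<forall>a\<in>A. q a \<in> line_ring v) \<and> x = (\<Sum>a\<in>A. q a * a)"
      using cst_line_ring by (intro exI[of _ "\<lambda>a. cst (q a)"]) auto
  qed (use A in auto)
qed

section \<open>Polynomial evaluation and the kernel of restriction to lines\<close>

lemma poly_mapping_sum_monomials:
  "(\<Sum>m\<in>Poly_Mapping.keys f. Poly_Mapping.single m (Poly_Mapping.lookup f m)) = f"
  by (rule poly_mapping_eqI) (simp add: lookup_sum lookup_single when_def in_keys_iff)

locale coeff_hom =
  fixes \<phi> :: "'k::comm_ring_1 \<Rightarrow> 'a::comm_ring_1"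
  assumes zero: "\<phi> 0 = 0" and one: "\<phi> 1 = 1" and add: "\<phi> (a + b) = \<phi> a + \<phi> b"
    and mult: "\<phi> (a * b) = \<phi> a * \<phi> b"
begin

abbreviation mon :: "('v::finite \<Rightarrow>\<^sub>0 nat) \<Rightarrow> ('v \<Rightarrow> 'a) \<Rightarrow> 'a"
  where "mon m x \<equiv> \<Prod>v\<in>UNIV. x v ^ Poly_Mapping.lookup m v"

lemma eval_superset:
  assumes "finite S" "Poly_Mapping.keys f \<subseteq> S"
  shows "eval_mpoly \<phi> f x = (\<Sum>m\<in>S. \<phi> (Poly_Mapping.lookup f m) * mon m x)"
  unfolding eval_mpoly_def
  by (rule sum.mono_neutral_left) (use assms in \<open>auto simp: zero in_keys_iff\<close>)

lemma eval_zero: "eval_mpoly \<phi> 0 x = 0"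
  by (simp add: eval_mpoly_def)

lemma eval_add: "eval_mpoly \<phi> (f + g) x = eval_mpoly \<phi> f x + eval_mpoly \<phi> g x"
proof -
  let ?S = "Poly_Mapping.keys f \<union> Poly_Mapping.keys g"
  have "finite ?S" by simp
  then show ?thesis
    using eval_superset[of ?S f] eval_superset[of ?S g] eval_superset[of ?S "f + g"] keys_add[of f g]
    by (simp add: lookup_add add distrib_right sum.distrib)
qed

lemma eval_sum: "eval_mpoly \<phi> (sum f I) x = (\<Sum>i\<in>I. eval_mpoly \<phi> (f i) x)"
  by (induction I rule: infinite_finite_induct) (simp_all add: eval_zero eval_add)

lemma eval_single: "eval_mpoly \<phi> (Poly_Mapping.single m c) x = \<phi> c * mon m x"
  using eval_superset[of "{m}" "Poly_Mapping.single m c" x] by simp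

lemma eval_one: "eval_mpoly \<phi> 1 x = 1"
  using eval_single[of 0 1 x] by (simp add: one)

lemma eval_mult: "eval_mpoly \<phi> (f * g) x = eval_mpoly \<phi> f x * eval_mpoly \<phi> g x"
proof -
  have single: "eval_mpoly \<phi> (Poly_Mapping.single a c * Poly_Mapping.single b d) x =
      eval_mpoly \<phi> (Poly_Mapping.single a c) x * eval_mpoly \<phi> (Poly_Mapping.single b d) x" for a b c d
    by (simp add: mult_single eval_single mult lookup_add power_add prod.distrib)
  have "eval_mpoly \<phi> (f * g) x = eval_mpoly \<phi> ((\<Sum>a\<in>Poly_Mapping.keys f. Poly_Mapping.single a (Poly_Mapping.lookup f a)) *
     (\<Sum>b\<in>Poly_Mapping.keys g. Poly_Mapping.single b (Poly_Mapping.lookup g b))) x"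
    by (simp only: poly_mapping_sum_monomials)
  also have "\<dots> = eval_mpoly \<phi> (\<Sum>a\<in>Poly_Mapping.keys f. Poly_Mapping.single a (Poly_Mapping.lookup f a)) x *
     eval_mpoly \<phi> (\<Sum>b\<in>Poly_Mapping.keys g. Poly_Mapping.single b (Poly_Mapping.lookup g b)) x"
    by (simp only: sum_product eval_sum single)
  finally show ?thesis by (simp only: poly_mapping_sum_monomials)
qed

end

lemma cring_type_ring: "cring (type_ring :: 'a::comm_ring_1 ring)"
proof (rule cringI)
  show "abelian_group (type_ring :: 'a ring)"
  proof (rule abelian_groupI)
    fix x :: 'a
    show "\<exists>y\<in>carrier type_ring. y \<oplus>\<^bsub>type_ring\<^esub> x = \<zero>\<^bsub>type_ring\<^esub>"
      by (rule bexI[of _ "- x"]) (auto simp: type_ring_def)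
  qed (auto simp: type_ring_def add_ac)
  show "comm_monoid (type_ring :: 'a ring)"
    by (rule comm_monoidI) (auto simp: type_ring_def mult_ac)
qed (auto simp: type_ring_def distrib_right)

lemma type_ring_simps [simp]:
  "carrier type_ring = UNIV" "mult type_ring = (*)" "one type_ring = 1" "zero type_ring = 0"
  "add type_ring = (+)"
  by (simp_all add: type_ring_def)

text \<open>The exponent of \<open>t\<close> records the degree of a monomial, so the values of all
  homogeneous components are kept apart in a single map.\<close>

definition ev :: "('m::finite \<Rightarrow> 'K::field ^ 'n::finite) \<Rightarrow> ('n, 'K) mpoly \<Rightarrow> 'K poly ^ 'm"
  where "ev v f = (\<chi> i. eval_mpoly (\<lambda>c. [:c:]) f (\<lambda>j. monom (v i $ j) 1))"

interpretation const_hom: coeff_hom "\<lambda>c :: 'K::field. [:c:]"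
  by unfold_locales (simp_all add: one_pCons)

interpretation id_hom: coeff_hom "id :: 'K::field \<Rightarrow> 'K"
  by unfold_locales simp_all

lemma ev_add: "ev v (f + g) = ev v f + ev v g" and ev_mult: "ev v (f * g) = ev v f * ev v g"
  and ev_one: "ev v 1 = 1" and ev_zero: "ev v 0 = 0"
  by (simp_all add: ev_def vec_eq_iff const_hom.eval_add const_hom.eval_mult const_hom.eval_one
      const_hom.eval_zero)

lemma ev_sum: "ev v (sum f I) = (\<Sum>i\<in>I. ev v (f i))"
  by (induction I rule: infinite_finite_induct) (simp_all add: ev_zero ev_add)

lemma prod_monom: "finite I \<Longrightarrow> (\<Prod>i\<in>I. monom (c i) (e i)) = monom (\<Prod>i\<in>I. c i) (\<Sum>i\<in>I. e i)"
  by (induction I rule: finite_induct) (simp_all add: mult_monom)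

definition mdeg :: "('n::finite \<Rightarrow>\<^sub>0 nat) \<Rightarrow> nat" where "mdeg m = (\<Sum>j\<in>UNIV. Poly_Mapping.lookup m j)"

definition mval :: "('m::finite \<Rightarrow> 'K::field ^ 'n::finite) \<Rightarrow> ('n \<Rightarrow>\<^sub>0 nat) \<Rightarrow> 'K ^ 'm"
  where "mval v m = (\<Prod>j\<in>UNIV. coordf v j ^ Poly_Mapping.lookup m j)"

lemma vec_power_nth: "((x :: 'a::comm_ring_1 ^ 'm::finite) ^ n) $ i = x $ i ^ n"
  by (induction n) simp_all

lemma vec_prod_nth: "(\<Prod>j\<in>I. f j :: 'a::comm_ring_1 ^ 'm::finite) $ i = (\<Prod>j\<in>I. f j $ i)"
  by (induction I rule: infinite_finite_induct) simp_all

lemma mval_nth: "mval v m $ i = (\<Prod>j\<in>UNIV. v i $ j ^ Poly_Mapping.lookup m j)"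
  by (simp add: mval_def vec_prod_nth vec_power_nth coordf_def)

lemma ev_single: "ev v (Poly_Mapping.single m c) = vmono (c *s mval v m) (mdeg m)"
proof (rule vec_fun_eqI)
  fix i
  have "(\<Prod>j\<in>UNIV. monom (v i $ j) 1 ^ Poly_Mapping.lookup m j) = monom (mval v m $ i) (mdeg m)"
    by (simp add: monom_power prod_monom mval_nth mdeg_def)
  then show "ev v (Poly_Mapping.single m c) $ i = vmono (c *s mval v m) (mdeg m) $ i"
    by (simp add: ev_def const_hom.eval_single vmono_def smult_monom)
qed

lemma coordf_pow_form_vals: "coordf v j ^ n \<in> form_vals v n"
  by (induction n) (simp_all only: power_0 one_W0 power_Suc coordf_mult)

lemma mval_form_vals: "mval v m \<in> form_vals v (mdeg m)"
proof -
  have "finite I \<Longrightarrow> (\<Prod>j\<in>I. coordf v j ^ Poly_Mapping.lookup m j) \<in> form_vals v (\<Sum>j\<in>I. Poly_Mapping.lookup m j)" for I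
    by (induction I rule: finite_induct)
      (simp_all only: prod.empty sum.empty prod.insert sum.insert one_W0 form_vals_mult[OF coordf_pow_form_vals] not_False_eq_True)
  then show ?thesis unfolding mval_def mdeg_def by simp
qed

lemma ev_expand: "ev v f = (\<Sum>m\<in>Poly_Mapping.keys f. vmono (Poly_Mapping.lookup f m *s mval v m) (mdeg m))"
  by (subst poly_mapping_sum_monomials[of f, symmetric]) (simp only: ev_sum ev_single)

lemma ev_line_ring: "ev v f \<in> line_ring v"
  unfolding ev_expand by (intro line_ring_sum vmono_line_ring form_vals_scale mval_form_vals)

lemma ev_X: "ev v (Poly_Mapping.single (Poly_Mapping.single j 1) 1) = vmono (coordf v j) 1"
proof -
  have "coordf v k ^ Poly_Mapping.lookup (Poly_Mapping.single j 1) k = (if j = k then coordf v k else 1)" for k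
    by (simp add: lookup_single when_def)
  then have "mval v (Poly_Mapping.single j 1) = coordf v j"
    unfolding mval_def by simp
  moreover have "mdeg (Poly_Mapping.single j 1) = 1"
    by (simp add: mdeg_def lookup_single when_def)
  ultimately show ?thesis by (simp add: ev_single)
qed

lemma vmono_range_ev: "g \<in> form_vals v n \<Longrightarrow> vmono g n \<in> range (ev v)"
proof (induction n arbitrary: g)
  case 0
  then obtain c where "g = c *s 1" by auto
  moreover have "ev v (Poly_Mapping.single 0 c) = vmono (c *s 1) 0"
    by (simp add: ev_single mval_def mdeg_def)
  ultimately show ?case by (metis rangeI)
next
  case (Suc n)
  then obtain a where a: "g = (\<Sum>j\<in>UNIV. coordf v j * a j)" "\<forall>j. a j \<in> form_vals v n" by auto
  have "\<forall>j. \<exists>f. vmono (a j) n = ev v f" using Suc.IH a(2) by blast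
  then obtain f where f: "\<And>j. vmono (a j) n = ev v (f j)" by metis
  have "vmono g (Suc n) = (\<Sum>j\<in>UNIV. vmono (coordf v j) 1 * vmono (a j) n)"
    by (simp add: a(1) vmono_sum vmono_mult)
  also have "\<dots> = ev v (\<Sum>j\<in>UNIV. Poly_Mapping.single (Poly_Mapping.single j 1) 1 * f j)"
    by (simp only: ev_sum ev_mult f ev_X)
  finally show ?case by blast
qed

lemma range_ev: "range (ev v) = line_ring v"
proof
  show "range (ev v) \<subseteq> line_ring v" using ev_line_ring by auto
  show "line_ring v \<subseteq> range (ev v)"
  proof
    fix F assume F: "F \<in> line_ring v"
    define N where "N = Max (range (\<lambda>i. degree (F $ i)))"
    have "F = (\<Sum>n\<le>N. vmono (coeff_vec F n) n)"
      by (rule vec_poly_expansion) (simp add: N_def)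
    moreover have "\<forall>n. \<exists>f. vmono (coeff_vec F n) n = ev v f"
      using vmono_range_ev F by (fastforce simp: line_ring_def)
    then obtain f where "\<And>n. vmono (coeff_vec F n) n = ev v (f n)" by metis
    ultimately have "F = ev v (\<Sum>n\<le>N. f n)" by (simp add: ev_sum)
    then show "F \<in> range (ev v)" by blast
  qed
qed

lemma eval_homogeneous:
  assumes "\<forall>m\<in>Poly_Mapping.keys f. mdeg m = e"
  shows "ev v f = vmono (\<chi> i. eval_mpoly id f (($) (v i))) e"
    and "eval_mpoly id f (($) (c *s w)) = c ^ e * eval_mpoly id f (($) w)"
proof -
  show "ev v f = vmono (\<chi> i. eval_mpoly id f (($) (v i))) e"
    using assms by (simp add: ev_expand eval_mpoly_def vmono_sum[symmetric])
      (rule arg_cong[of _ _ "\<lambda>x. vmono x e"], simp add: vec_eq_iff mval_nth)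
  show "eval_mpoly id f (($) (c *s w)) = c ^ e * eval_mpoly id f (($) w)"
    unfolding eval_mpoly_def sum_distrib_left
  proof (rule sum.cong[OF refl])
    fix m assume "m \<in> Poly_Mapping.keys f"
    then have "c ^ e = (\<Prod>j\<in>UNIV. c ^ Poly_Mapping.lookup m j)"
      using assms by (auto simp: mdeg_def power_sum)
    then show "id (Poly_Mapping.lookup f m) * (\<Prod>j\<in>UNIV. (c *s w) $ j ^ Poly_Mapping.lookup m j) =
        c ^ e * (id (Poly_Mapping.lookup f m) * (\<Prod>j\<in>UNIV. w $ j ^ Poly_Mapping.lookup m j))"
      by (simp add: power_mult_distrib prod.distrib)
  qed
qed

definition hcomp :: "('n::finite, 'K::field) mpoly \<Rightarrow> nat \<Rightarrow> ('n, 'K) mpoly"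
  where "hcomp f n = (\<Sum>m\<in>{m \<in> Poly_Mapping.keys f. mdeg m = n}. Poly_Mapping.single m (Poly_Mapping.lookup f m))"

lemma keys_hcomp: "m \<in> Poly_Mapping.keys (hcomp f n) \<Longrightarrow> mdeg m = n"
  unfolding hcomp_def using keys_sum[of _ "{m \<in> Poly_Mapping.keys f. mdeg m = n}"]
  by (fastforce split: if_splits)

lemma sum_hcomp: "f = (\<Sum>n\<in>mdeg ` Poly_Mapping.keys f. hcomp f n)"
proof -
  have "(\<Sum>n\<in>mdeg ` Poly_Mapping.keys f. hcomp f n) =
    (\<Sum>m\<in>Poly_Mapping.keys f. Poly_Mapping.single m (Poly_Mapping.lookup f m))"
    unfolding hcomp_def by (rule sum.image_gen[symmetric]) simp
  then show ?thesis by (simp only: poly_mapping_sum_monomials)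
qed

lemma coeff_vec_ev: "coeff_vec (ev v f) n = (\<chi> i. eval_mpoly id (hcomp f n) (($) (v i)))"
proof -
  have "ev v (hcomp f k) = vmono (\<chi> i. eval_mpoly id (hcomp f k) (($) (v i))) k" for k
    by (rule eval_homogeneous(1)) (use keys_hcomp in auto)
  then have "ev v f = (\<Sum>k\<in>mdeg ` Poly_Mapping.keys f. vmono (\<chi> i. eval_mpoly id (hcomp f k) (($) (v i))) k)"
    by (subst sum_hcomp) (simp add: ev_sum)
  then have "coeff_vec (ev v f) n = (\<Sum>k\<in>mdeg ` Poly_Mapping.keys f.
      if n = k then (\<chi> i. eval_mpoly id (hcomp f k) (($) (v i))) else 0)"
    by (simp only: coeff_vec_sum coeff_vec_vmono)
  also have "\<dots> = (\<chi> i. eval_mpoly id (hcomp f n) (($) (v i)))"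
  proof (cases "n \<in> mdeg ` Poly_Mapping.keys f")
    case False
    then have e: "{m \<in> Poly_Mapping.keys f. mdeg m = n} = {}" by auto
    have "hcomp f n = 0" by (simp only: hcomp_def e sum.empty)
    then show ?thesis using False by (simp add: id_hom.eval_zero vec_eq_iff)
  qed simp
  finally show ?thesis .
qed

text \<open>As \<open>t\<close> is an indeterminate, \<open>ev v f = 0\<close> means that every
  homogeneous component vanishes at the representatives, and a form vanishing at \<open>v i\<close>
  vanishes on its whole line. This is why the ideal has to be generated by forms, and why the field
  may be finite here.\<close>

lemma kernel_ev:
  fixes v :: "'m::finite \<Rightarrow> 'K::field ^ 'n::finite"
  shows "homogeneous_ideal (range (\<lambda>i. vec.span {v i})) = {f. ev v f = 0}"
proof -
  interpret S: cring "type_ring :: ('n, 'K) mpoly ring" by (rule cring_type_ring)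
  let ?G = "{f. homogeneous f \<and> (\<forall>p\<in>range (\<lambda>i. vec.span {v i}). \<forall>w\<in>p. eval_mpoly id f (($) w) = 0)}"
  have hom: "homogeneous f \<longleftrightarrow> (\<exists>e. \<forall>m\<in>Poly_Mapping.keys f. mdeg m = e)" for f :: "('n, 'K) mpoly"
    by (simp add: homogeneous_def mdeg_def)
  have ker: "ideal {f. ev v f = 0} (type_ring :: ('n, 'K) mpoly ring)"
  proof (rule idealI[OF S.ring_axioms])
    show "subgroup {f. ev v f = 0} (add_monoid (type_ring :: ('n, 'K) mpoly ring))"
    proof (rule S.add.subgroupI)
      show "{f. ev v f = 0} \<noteq> {}" using ev_zero by blast
      fix f assume f: "f \<in> {f. ev v f = 0}"
      have "\<ominus>\<^bsub>type_ring\<^esub> f = - f"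
        by (rule S.minus_equality) auto
      moreover have "ev v (- f) + ev v f = ev v 0" by (simp only: ev_add[symmetric]) simp
      ultimately show "\<ominus>\<^bsub>type_ring\<^esub> f \<in> {f. ev v f = 0}" using f by (simp add: ev_zero)
    qed (auto simp: ev_add)
  qed (auto simp: ev_mult)
  show ?thesis
    unfolding homogeneous_ideal_def
  proof
    show "Idl\<^bsub>type_ring\<^esub> ?G \<subseteq> {f. ev v f = 0}"
    proof (rule S.genideal_minimal[OF ker], safe)
      fix f assume h: "homogeneous f" and z: "\<forall>p\<in>range (\<lambda>i. vec.span {v i}). \<forall>w\<in>p. eval_mpoly id f (($) w) = 0"
      obtain e where e: "\<forall>m\<in>Poly_Mapping.keys f. mdeg m = e" using h hom by blast
      have "eval_mpoly id f (($) (v i)) = 0" for i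
        using z vec.span_base[of "v i" "{v i}"] by auto
      then show "ev v f = 0" by (simp add: eval_homogeneous(1)[OF e] vmono_def vec_eq_iff)
    qed
    show "{f. ev v f = 0} \<subseteq> Idl\<^bsub>type_ring\<^esub> ?G"
    proof safe
      fix f assume f: "ev v f = 0"
      interpret I: ideal "Idl\<^bsub>type_ring\<^esub> ?G" "type_ring :: ('n, 'K) mpoly ring"
        by (rule S.genideal_ideal) simp
      have "hcomp f n \<in> ?G" for n
      proof -
        have e: "\<forall>m\<in>Poly_Mapping.keys (hcomp f n). mdeg m = n" using keys_hcomp by auto
        have 0: "eval_mpoly id (hcomp f n) (($) (v i)) = 0" for i
          using coeff_vec_ev[of v f n] f by (simp add: coeff_vec_zero vec_eq_iff)
        have "eval_mpoly id (hcomp f n) (($) w) = 0" if "w \<in> vec.span {v i}" for i w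
          using that 0 by (auto simp: vec.span_singleton eval_homogeneous(2)[OF e])
        then show ?thesis using e hom by auto
      qed
      moreover have "?G \<subseteq> Idl\<^bsub>type_ring\<^esub> ?G" by (rule S.genideal_self) simp
      ultimately have G: "hcomp f n \<in> Idl\<^bsub>type_ring\<^esub> ?G" for n by blast
      define J where "J = Idl\<^bsub>type_ring\<^esub> ?G"
      have J: "hcomp f n \<in> J" "0 \<in> J" "a \<in> J \<Longrightarrow> b \<in> J \<Longrightarrow> a + b \<in> J" for n a b
        unfolding J_def using G I.zero_closed I.a_closed[of a b] by (simp_all only: type_ring_simps)
      have "(\<Sum>n\<in>I. hcomp f n) \<in> J" for I
        by (induction I rule: infinite_finite_induct) (auto intro: J)
      then have "(\<Sum>n\<in>I. hcomp f n) \<in> Idl\<^bsub>type_ring\<^esub> ?G" for I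
        unfolding J_def .
      from this[of "mdeg ` Poly_Mapping.keys f"] show "f \<in> Idl\<^bsub>type_ring\<^esub> ?G"
        by (simp only: sum_hcomp[symmetric])
    qed
  qed
qed

lemma homogeneous_coordinate_ring_model:
  fixes v :: "'m::finite \<Rightarrow> 'K::field ^ 'n::finite"
  shows "\<exists>h. ring_model (homogeneous_coordinate_ring (range (\<lambda>i. vec.span {v i}))) h (line_ring v)"
proof -
  let ?P = "type_ring :: ('n, 'K) mpoly ring"
  let ?V = "type_ring :: ('K poly ^ 'm) ring"
  let ?S = "?V\<lparr>carrier := line_ring v\<rparr>"
  interpret P: cring ?P by (rule cring_type_ring)
  interpret V: cring ?V by (rule cring_type_ring)
  have hom: "ev v \<in> ring_hom ?P ?V"
    by (rule ring_hom_memI) (auto simp: ev_mult ev_add ev_one)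
  interpret H: ring_hom_ring ?P ?V "ev v"
    by (rule ring_hom_ringI2[OF P.ring_axioms V.ring_axioms hom])
  have S: "ring ?S" using H.img_is_ring by (simp add: range_ev)
  have homS: "ev v \<in> ring_hom ?P ?S"
    unfolding type_ring_def by (rule ring_hom_memI) (simp_all add: ev_mult ev_add ev_one ev_line_ring)
  interpret HS: ring_hom_ring ?P ?S "ev v"
    by (rule ring_hom_ringI2[OF P.ring_axioms S homS])
  have ker: "a_kernel ?P ?S (ev v) = homogeneous_ideal (range (\<lambda>i. vec.span {v i}))"
    unfolding kernel_ev a_kernel_def' by (simp add: type_ring_def)
  let ?R = "homogeneous_coordinate_ring (range (\<lambda>i. vec.span {v i}))"
  define h where "h = (\<lambda>X. the_elem (ev v ` X))"
  have iso: "h \<in> ring_iso ?R ?S"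
    unfolding homogeneous_coordinate_ring_def ker[symmetric] h_def
    by (rule HS.FactRing_iso_set) (simp add: range_ev)
  have "cring ?R"
    unfolding homogeneous_coordinate_ring_def ker[symmetric]
    by (rule ideal.quotient_is_cring[OF HS.kernel_is_ideal P.is_cring])
  then have "ring_model ?R h (line_ring v)"
    using ring_iso_memE[OF iso] by (intro ring_model.intro ring_model_axioms.intro) auto
  then show ?thesis by blast
qed

section \<open>Gorenstein coordinate rings and quadratic relations\<close>

declare form_vals.simps [simp del]

text \<open>The functional is the coordinate of \<open>f\<close> in a basis of the whole space that
  extends a basis of \<open>S\<close> enlarged by \<open>f\<close>.\<close>

lemma separating_functional:
  fixes S :: "('K::field ^ 'm::finite) set"
  assumes S: "vec.subspace S" and f: "f \<notin> S"
  obtains c where "\<And>g. g \<in> S \<Longrightarrow> (\<Sum>i\<in>UNIV. c i * g $ i) = 0" "(\<Sum>i\<in>UNIV. c i * f $ i) \<noteq> 0"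
proof -
  obtain B where B: "B \<subseteq> S" "vec.independent B" "S \<subseteq> vec.span B"
    using vec.basis_exists by metis
  have SB: "vec.span B = S" using B vec.span_minimal[OF B(1) S] by auto
  have fB: "vec.independent (insert f B)" using vec.independent_insertI[OF _ B(2), of f] f SB by auto
  define C where "C = vec.extend_basis (insert f B)"
  have C: "vec.independent C" "vec.span C = UNIV" "insert f B \<subseteq> C"
    unfolding C_def using vec.independent_extend_basis[OF fB] vec.span_extend_basis[OF fB]
      vec.extend_basis_superset[OF fB] by auto
  define c where "c i = vec.representation C (axis i 1) f" for i
  have rep: "vec.representation C g f = (\<Sum>i\<in>UNIV. c i * g $ i)" for g
  proof -
    have "g = (\<Sum>i\<in>UNIV. (g $ i) *s axis i 1)" by (simp add: vec_eq_iff axis_def if_distrib cong: if_cong)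
    then have "vec.representation C g f = vec.representation C (\<Sum>i\<in>UNIV. (g $ i) *s axis i 1) f" by simp
    also have "\<dots> = (\<Sum>i\<in>UNIV. vec.representation C ((g $ i) *s axis i 1) f)"
      using C by (subst vec.representation_sum) auto
    also have "\<dots> = (\<Sum>i\<in>UNIV. c i * g $ i)"
      using C by (simp add: vec.representation_scale c_def mult.commute)
    finally show ?thesis .
  qed
  show ?thesis
  proof (rule that[of c])
    fix g assume "g \<in> S"
    then have "vec.representation C g = vec.representation B g"
      using vec.representation_extend[OF C(1), of g B] C(3) SB by auto
    moreover have "vec.representation B g f = 0"
      using vec.representation_ne_zero[of B g f] f B by auto
    ultimately show "(\<Sum>i\<in>UNIV. c i * g $ i) = 0" by (simp add: rep[symmetric])
  next
    show "(\<Sum>i\<in>UNIV. c i * f $ i) \<noteq> 0"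
      using vec.representation_basis[OF C(1), of f] C(3) by (simp add: rep[symmetric])
  qed
qed

context affine_points
begin

lemma not_all_const:
  fixes i k :: 'm
  assumes "i \<noteq> k"
  shows "\<exists>x\<in>form_vals v 1. \<nexists>c. x = c *s 1"
proof -
  obtain f where "f \<in> form_vals v 1" "f $ i = 1" "f $ k = 0" using separating assms by blast
  moreover have "f \<noteq> c *s 1" for c
    using calculation(2,3) by (metis vector_smult_component one_index mult.right_neutral zero_neq_one)
  ultimately show ?thesis by blast
qed

text \<open>Products with the irrelevant ideal start in degree \<open>Suc s\<close>, where every
  coefficient vector comes from a form of one degree less.\<close>

lemma top_socle:
  assumes s: "form_vals v s = UNIV" and y: "y \<in> irrelevant"
  shows "\<exists>G\<in>line_ring v. y * vmono a s = G * line_var"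
  unfolding line_var_multiple_iff
proof (intro conjI allI)
  have c: "coeff_vec (y * vmono a s) n = (if s \<le> n then coeff_vec y (n - s) * a else 0)" for n
  proof -
    have "coeff_vec (y * vmono a s) n = (\<Sum>k\<le>n. if s \<le> n \<and> k = n - s then coeff_vec y k * a else 0)"
      unfolding coeff_vec_mult by (rule sum.cong) (auto simp: coeff_vec_vmono)
    then show ?thesis by simp
  qed
  show "y * vmono a s \<in> line_ring v" using y s by (intro line_ring_mult vmono_line_ring) (auto simp: irrelevant_def)
  have y0: "coeff_vec y 0 = 0" using y by (simp add: irrelevant_def)
  show "coeff_vec (y * vmono a s) 0 = 0" using y0 by (simp add: c)
  fix n
  show "coeff_vec (y * vmono a s) (Suc n) \<in> form_vals v n"
  proof (cases "s \<le> n")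
    case True
    then show ?thesis using form_vals_top_le[OF s, of n] by simp
  next
    case False
    then have "coeff_vec (y * vmono a s) (Suc n) = 0" unfolding c by (cases "s = Suc n") (auto simp: y0)
    then show ?thesis by (simp add: form_vals_zero)
  qed
qed

text \<open>The irrelevant ideal is generated by linear forms, so the socle condition need only be
  tested on \<open>form_vals v 1\<close>.\<close>

lemma irrelevant_mult_vmono:
  assumes g: "g \<in> form_vals v n" "\<And>x. x \<in> form_vals v 1 \<Longrightarrow> x * g \<in> form_vals v n" and y: "y \<in> irrelevant"
  shows "\<exists>G\<in>line_ring v. y * vmono g n = G * line_var"
  unfolding line_var_multiple_iff
proof (intro conjI allI)
  have c: "coeff_vec (y * vmono g n) k = (if n \<le> k then coeff_vec y (k - n) * g else 0)" for k
  proof -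
    have "coeff_vec (y * vmono g n) k = (\<Sum>j\<le>k. if n \<le> k \<and> j = k - n then coeff_vec y j * g else 0)"
      unfolding coeff_vec_mult by (rule sum.cong) (auto simp: coeff_vec_vmono)
    then show ?thesis by simp
  qed
  have y0: "coeff_vec y 0 = 0" using y by (simp add: irrelevant_def)
  have yW: "coeff_vec y j \<in> form_vals v j" for j using y by (simp add: irrelevant_def line_ring_def)
  show "y * vmono g n \<in> line_ring v" using y g by (intro line_ring_mult vmono_line_ring) (auto simp: irrelevant_def)
  show "coeff_vec (y * vmono g n) 0 = 0" using y0 by (simp add: c)
  fix k
  show "coeff_vec (y * vmono g n) (Suc k) \<in> form_vals v k"
  proof (cases "n \<le> k")
    case True
    define j where "j = k - n"
    have j: "Suc k - n = Suc j" "j + n = k" using True by (auto simp: j_def)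
    obtain u where u: "coeff_vec y (Suc j) = (\<Sum>i\<in>UNIV. coordf v i * u i)" "\<forall>i. u i \<in> form_vals v j"
      using yW[of "Suc j"] by (auto simp: form_vals.simps(2))
    have "u i * (coordf v i * g) \<in> form_vals v k" for i
    proof -
      have "coordf v i \<in> form_vals v 1" using coordf_mult[OF one_W0, of v i] by simp
      then show ?thesis using form_vals_mult[of "u i" v j "coordf v i * g" n] u g(2) j by auto
    qed
    then have "(\<Sum>i\<in>UNIV. u i * (coordf v i * g)) \<in> form_vals v k" by (intro form_vals_sum)
    moreover have "coeff_vec (y * vmono g n) (Suc k) = (\<Sum>i\<in>UNIV. u i * (coordf v i * g))"
      using True by (simp add: c j u(1) sum_distrib_right sum_distrib_left mult_ac)
    ultimately show ?thesis by simp
  next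
    case False
    then have "coeff_vec (y * vmono g n) (Suc k) = 0" unfolding c by (cases "n = Suc k") (auto simp: y0)
    then show ?thesis by (simp add: form_vals_zero)
  qed
qed

text \<open>The indicator of the point \<open>i\<close>, placed in degree 3 because
  \<open>form_vals v 3 = UNIV\<close> wherever it is used.\<close>

definition E :: "'m \<Rightarrow> 'K poly ^ 'm" where "E i = vmono (axis i 1) 3"

lemma E_mult_nth: "(E i * F) $ k = (if k = i then monom 1 3 * F $ k else 0)"
  by (simp add: E_def vmono_def axis_def)

lemma typed_ideal_line_var: "typed_ideal (line_ring v) {F. \<exists>G\<in>line_ring v. F = G * line_var}"
  unfolding typed_ideal_def
proof (intro conjI ballI)
  show "{F. \<exists>G\<in>line_ring v. F = G * line_var} \<subseteq> line_ring v" using line_ring_mult line_var_line_ring by auto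
  show "0 \<in> {F. \<exists>G\<in>line_ring v. F = G * line_var}" using line_ring_zero by (auto intro!: bexI[of _ 0])
next
  fix a b assume "a \<in> {F. \<exists>G\<in>line_ring v. F = G * line_var}" "b \<in> {F. \<exists>G\<in>line_ring v. F = G * line_var}"
  then obtain G H where "G \<in> line_ring v" "H \<in> line_ring v" "a = G * line_var" "b = H * line_var" by auto
  then show "a + b \<in> {F. \<exists>G\<in>line_ring v. F = G * line_var}"
    by (auto simp: distrib_right intro!: bexI[of _ "G + H"] line_ring_add)
next
  fix t a assume "t \<in> line_ring v" "a \<in> {F. \<exists>G\<in>line_ring v. F = G * line_var}"
  then obtain G where "t \<in> line_ring v" "G \<in> line_ring v" "a = G * line_var" by auto
  then show "t * a \<in> {F. \<exists>G\<in>line_ring v. F = G * line_var}"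
    by (auto simp: mult.assoc intro!: bexI[of _ "t * G"] line_ring_mult)
qed

lemma noetherian_model: "ring_model R h (line_ring v) \<Longrightarrow> noetherian_ring R"
  by (rule ring_model.noetherian_ringI_typed) (auto intro: typed_ideal_generators)

text \<open>
  Away from the irrelevant ideal the coordinate ring is locally a polynomial ring in one variable:
  inverting \<open>E i\<close> leaves only the line over the point \<open>i\<close>.
\<close>

lemma gorenstein_off_vertex:
  assumes R: "ring_model R h (line_ring v)" and W3: "form_vals v 3 = UNIV"
    and m: "maximalideal m R" and tm: "line_var \<notin> h ` m"
  shows "gorenstein_local (localization R m)"
proof -
  interpret R: ring_model R h "line_ring v" by (rule R)
  define M where "M = h ` m"
  interpret m: maximalideal m R by (rule m)
  have tM: "typed_ideal (line_ring v) M" unfolding M_def by (rule R.image_typed_ideal[OF m.is_ideal])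
  have M_add: "a + b \<in> M" if "a \<in> M" "b \<in> M" for a b using tM that by (auto simp: typed_ideal_def)
  have M_mult: "t * a \<in> M" if "t \<in> line_ring v" "a \<in> M" for t a using tM that by (auto simp: typed_ideal_def)
  have M_line_ring: "a \<in> line_ring v" if "a \<in> M" for a using tM that by (auto simp: typed_ideal_def)
  have irrelevant: "0 \<in> M" using tM by (auto simp: typed_ideal_def)
  note prime = R.maximal_image_prime[OF m, folded M_def]
  have oneM: "1 \<notin> M"
    using R.h_mem_iff[OF m.is_ideal R.one_closed] m.I_notcarr m.one_imp_carrier
    by (auto simp: M_def R.h_one)
  have E_line_ring: "E i \<in> line_ring v" for i unfolding E_def by (rule vmono_line_ring) (simp add: W3)
  \<comment> \<open>The sum is \<open>t^3\<close>, which lies outside the prime \<open>M\<close>;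
    hence some \<open>E i\<close> does too.\<close>
  have sumE: "(\<Sum>i\<in>UNIV. E i) = line_var * (line_var * line_var)"
  proof -
    have "(\<Sum>i\<in>UNIV. axis i 1) = (1 :: 'K ^ 'm)" by (simp add: vec_eq_iff axis_def)
    then show ?thesis by (simp add: E_def line_var_def vmono_mult vmono_sum[symmetric] eval_nat_numeral)
  qed
  have "line_var * (line_var * line_var) \<notin> M"
    using prime[OF line_var_line_ring line_ring_mult[OF line_var_line_ring line_var_line_ring]] prime[OF line_var_line_ring line_var_line_ring] tm M_def by auto
  then have "\<exists>i. E i \<notin> M"
    using R.typed_ideal_sum[OF tM finite_class.finite_UNIV, of E] by (auto simp: sumE)
  then obtain i where i: "E i \<notin> M" by blast
  have Ei: "E i \<in> line_ring v - M" using i E_line_ring by auto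
  have nz: "s $ i \<noteq> 0" if s: "s \<in> line_ring v - M" for s
  proof
    assume "s $ i = 0"
    then have "E i * s = 0" by (simp add: vec_eq_iff E_mult_nth del: vector_mult_component)
    then show False using prime[OF E_line_ring, of s i] s i irrelevant by auto
  qed
  \<comment> \<open>An element of \<open>M\<close> with nonzero entry at \<open>i\<close>: the
    constant coefficient of \<open>1 - u * line_var\<close> is 1.\<close>
  obtain u where u: "u \<in> line_ring v" "1 - u * line_var \<in> M"
    using R.maximal_image_inverse[OF m line_var_line_ring tm] unfolding M_def by blast
  have "coeff_vec (1 - u * line_var) 0 = 1" by (simp add: coeff_vec_diff coeff_vec_one coeff_vec_line_var_mult mult.commute[of u])
  then have "coeff ((1 - u * line_var) $ i) 0 = 1" by (simp add: coeff_vec_def vec_eq_iff)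
  then have x1: "(1 - u * line_var) $ i \<noteq> 0" by (metis coeff_0 zero_neq_one)
  \<comment> \<open>By division with remainder, an entry of least degree generates the ideal of all
    entries at \<open>i\<close> of elements of \<open>M\<close>.\<close>
  obtain x where x: "x \<in> M" "x $ i \<noteq> 0"
    and min: "\<And>y. y \<in> M \<Longrightarrow> y $ i \<noteq> 0 \<Longrightarrow> degree (x $ i) \<le> degree (y $ i)"
    using ex_has_least_nat[of "\<lambda>x. x \<in> M \<and> x $ i \<noteq> 0" "1 - u * line_var" "\<lambda>x. degree (x $ i)"] u x1 by blast
  have dvd: "y $ i = (y $ i div x $ i) * x $ i" if y: "y \<in> M" for y
  proof -
    let ?y = "y + cst (- (y $ i div x $ i)) * x"
    have yM: "?y \<in> M" by (intro M_add M_mult y x cst_line_ring)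
    have yi: "?y $ i = y $ i mod x $ i"
      by (simp add: cst_def minus_div_mult_eq_mod)
    have "?y $ i = 0"
    proof (rule ccontr)
      assume n: "?y $ i \<noteq> 0"
      then have "degree (?y $ i) < degree (x $ i)"
        using degree_mod_less[OF x(2), of "y $ i"] unfolding yi by auto
      then show False using min[OF yM n] by simp
    qed
    then show ?thesis unfolding yi by (metis add.right_neutral div_mult_mod_eq)
  qed
  show ?thesis
  \<comment> \<open>Here \<open>J0 = M\<close>: locally the nonzerodivisor \<open>x\<close>
    generates the maximal ideal, the quotient is a field, and 1 generates its socle.\<close>
  proof (rule R.gorenstein_localI_typed[OF noetherian_model[OF R] m M_def x(1) tM subset_refl x(1)])
    fix s assume "s \<in> line_ring v - M"
    then show "\<exists>u\<in>line_ring v. 1 - u * s \<in> M" using R.maximal_image_inverse[OF m] M_def by auto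
  next
    fix a assume a: "a \<in> M"
    have "E i * a = (E i * cst (a $ i div x $ i)) * x"
    proof (rule vec_fun_eqI)
      fix k
      show "(E i * a) $ k = ((E i * cst (a $ i div x $ i)) * x) $ k"
        using dvd[OF a] by (simp add: mult.assoc E_mult_nth del: vector_mult_component) (simp add: cst_def mult.assoc)
    qed
    then show "\<exists>s\<in>line_ring v - M. \<exists>r\<in>line_ring v. s * a = r * x"
      using Ei line_ring_mult[OF E_line_ring cst_line_ring] by blast
  next
    fix s a assume s: "s \<in> line_ring v - M" and a: "a \<in> line_ring v" and "s * (x * a) = 0"
    then have "s $ i * (x $ i * a $ i) = 0" by (metis vector_mult_component zero_index)
    then have "a $ i = 0" using nz[OF s] x by auto
    then have "E i * a = 0" by (simp add: vec_eq_iff E_mult_nth del: vector_mult_component)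
    then show "\<exists>s'\<in>line_ring v - M. s' * a = 0" using Ei by blast
  next
    show "\<exists>n::nat. y ^ n \<in> M" if "y \<in> M" for y using that by (intro exI[of _ 1]) simp
    show "1 \<in> line_ring v" by (rule line_ring_one)
    show "1 \<notin> M" by (rule oneM)
    show "y * 1 \<in> M" if "y \<in> M" for y using that by simp
    show "\<exists>r\<in>line_ring v. b - r * 1 \<in> M" if "b \<in> line_ring v" for b
      using that irrelevant by (intro bexI[of _ b]) auto
  qed
qed

text \<open>By \<open>rel\<close> and \<open>perp\<close> the space \<open>form_vals v 1\<close> is
  its own orthogonal complement for the pairing with weights \<open>c\<close>. \<open>indec\<close>
  says that only constants multiply this space into itself, that is, the points do not split.
  Together they force the quadratic values to be the hyperplane orthogonal to \<open>c\<close> and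
  the cubic values to be everything.\<close>

theorem gorenstein_if_relation:
  assumes R: "ring_model R h (line_ring v)"
    and c: "\<And>i. c i \<noteq> 0" and rel: "\<And>f. f \<in> form_vals v 2 \<Longrightarrow> (\<Sum>i\<in>UNIV. c i * f $ i) = 0"
    and perp: "\<And>f. (\<And>g. g \<in> form_vals v 1 \<Longrightarrow> (\<Sum>i\<in>UNIV. c i * (f * g) $ i) = 0) \<Longrightarrow> f \<in> form_vals v 1"
    and indec: "\<And>g. (\<And>x. x \<in> form_vals v 1 \<Longrightarrow> x * g \<in> form_vals v 1) \<Longrightarrow> \<exists>k. g = k *s 1"
    and two: "\<exists>i k :: 'm. i \<noteq> k"
  shows "gorenstein_ring R"
proof -
  interpret R: ring_model R h "line_ring v" by (rule R)
  have W11: "x * y \<in> form_vals v 2" if "x \<in> form_vals v 1" "y \<in> form_vals v 1" for x y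
    using form_vals_mult[OF that] by (simp add: eval_nat_numeral)
  have W12: "x * y \<in> form_vals v 3" if "x \<in> form_vals v 1" "y \<in> form_vals v 2" for x y
    using form_vals_mult[OF that] by (simp add: eval_nat_numeral)
  \<comment> \<open>A vector orthogonal to all products of linear values multiplies
    \<open>form_vals v 1\<close> into its own complement, which is itself.\<close>
  have const2: "\<exists>k. g = k *s 1" if g: "\<And>f. f \<in> form_vals v 2 \<Longrightarrow> (\<Sum>i\<in>UNIV. c i * (g * f) $ i) = 0" for g
  proof (rule indec)
    fix x assume x: "x \<in> form_vals v 1"
    show "x * g \<in> form_vals v 1"
    proof (rule perp)
      fix y assume y: "y \<in> form_vals v 1"
      show "(\<Sum>i\<in>UNIV. c i * (x * g * y) $ i) = 0"
        using g[OF W11[OF x y]] by (simp add: mult_ac)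
    qed
  qed
  \<comment> \<open>Another functional \<open>b\<close> vanishing on quadratic values would give the
    vector \<open>b / c\<close>, which is constant by \<open>const2\<close>; so \<open>b\<close> is
    a multiple of \<open>c\<close>.\<close>
  have W2: "f \<in> form_vals v 2" if f: "(\<Sum>i\<in>UNIV. c i * f $ i) = 0" for f
  proof (rule ccontr)
    assume "f \<notin> form_vals v 2"
    then obtain b where b: "\<And>g. g \<in> form_vals v 2 \<Longrightarrow> (\<Sum>i\<in>UNIV. b i * g $ i) = 0" "(\<Sum>i\<in>UNIV. b i * f $ i) \<noteq> 0"
      using separating_functional[OF form_vals_subspace] by metis
    have "\<exists>k. (\<chi> i. b i / c i) = k *s 1"
      by (rule const2) (use b c in simp)
    then obtain k where "\<And>i. b i / c i = k" by (auto simp: vec_eq_iff)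
    then have "b i = k * c i" for i using c[of i] by (metis nonzero_eq_divide_eq)
    then have "(\<Sum>i\<in>UNIV. b i * f $ i) = k * (\<Sum>i\<in>UNIV. c i * f $ i)"
      by (simp add: sum_distrib_left mult.assoc)
    then show False using b f by simp
  qed
  \<comment> \<open>For a functional \<open>b\<close> vanishing on cubic values,
    \<open>x * (b / c)\<close> is constant for every linear \<open>x\<close>. Taking
    \<open>x = 1\<close> first, all linear forms would be constant on the points.\<close>
  have W3: "form_vals v 3 = UNIV"
  proof (rule ccontr)
    assume "form_vals v 3 \<noteq> UNIV"
    then obtain f where "f \<notin> form_vals v 3" by auto
    then obtain b where b: "\<And>g. g \<in> form_vals v 3 \<Longrightarrow> (\<Sum>i\<in>UNIV. b i * g $ i) = 0" "(\<Sum>i\<in>UNIV. b i * f $ i) \<noteq> 0"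
      using separating_functional[OF form_vals_subspace] by metis
    have bx: "\<exists>k. x * (\<chi> i. b i / c i) = k *s 1" if x: "x \<in> form_vals v 1" for x
    proof (rule const2)
      fix f assume f: "f \<in> form_vals v 2"
      show "(\<Sum>i\<in>UNIV. c i * (x * (\<chi> i. b i / c i) * f) $ i) = 0"
        using b(1)[OF W12[OF x f]] c by (simp add: mult_ac)
    qed
    obtain k where k: "(\<chi> i. b i / c i) = k *s 1" using bx[OF one_W1] by auto
    then have bk: "b i / c i = k" for i by (auto simp: vec_eq_iff)
    have k0: "k \<noteq> 0"
    proof
      assume "k = 0"
      then have "b i = 0" for i using bk[of i] c[of i] by simp
      then show False using b(2) by simp
    qed
    have "\<exists>k. x = k *s 1" if x: "x \<in> form_vals v 1" for x
    proof -
      obtain k' where "x * (k *s 1) = k' *s 1" using bx[OF x] k by auto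
      then have "x = (k' / k) *s 1" using k0 by (auto simp: vec_eq_iff field_simps)
      then show ?thesis by blast
    qed
    then show False using two not_all_const by blast
  qed
  obtain i0 :: 'm where True by blast
  \<comment> \<open>Any vector off the hyperplane serves as socle generator in degree 3; an
    indicator is off it because \<open>c i0\<close> is nonzero.\<close>
  define a where "a = (axis i0 1 :: 'K ^ 'm)"
  have ca: "(\<Sum>i\<in>UNIV. c i * a $ i) = c i0"
    by (simp add: a_def axis_def if_distrib cong: if_cong)
  have aW2: "a \<notin> form_vals v 2" using rel[of a] ca c by auto
  have "gorenstein_local (localization R m)" if m: "maximalideal m R" for m
  proof (cases "line_var \<in> h ` m")
    case False
    then show ?thesis by (rule gorenstein_off_vertex[OF R W3 m])
  next
    case True
    interpret m: maximalideal m R by (rule m)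
    have tM: "typed_ideal (line_ring v) (h ` m)" by (rule R.image_typed_ideal[OF m.is_ideal])
    have oneM: "1 \<notin> h ` m"
      using R.h_mem_iff[OF m.is_ideal R.one_closed] m.I_notcarr m.one_imp_carrier
      by (auto simp: R.h_one)
    have pow: "F \<in> line_ring v \<Longrightarrow> F ^ n \<in> h ` m \<Longrightarrow> F \<in> h ` m" for F n
    proof (induction n)
      case (Suc n)
      then show ?case using R.maximal_image_prime[OF m Suc(2) line_ring_pow[OF Suc(2)], of n] by auto
    qed (use oneM in auto)
    have ttm: "G * line_var \<in> h ` m" if "G \<in> line_ring v" for G
      using tM True that unfolding typed_ideal_def by blast
    \<comment> \<open>Elements of the irrelevant ideal are nilpotent modulo \<open>line_var\<close>,
      and all others are units modulo it. So exactly one maximal ideal contains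
      \<open>line_var\<close>.\<close>
    have M: "irrelevant = h ` m"
    proof
      show "irrelevant \<subseteq> h ` m"
      proof
        fix F assume F: "F \<in> irrelevant"
        then obtain G where "G \<in> line_ring v" "F ^ Suc 3 = G * line_var" using pow_line_var_multiple[OF W3] by (auto simp: irrelevant_def)
        then show "F \<in> h ` m" using pow[of F "Suc 3"] ttm F by (auto simp: irrelevant_def)
      qed
      show "h ` m \<subseteq> irrelevant"
      proof
        fix F assume F: "F \<in> h ` m"
        have FT: "F \<in> line_ring v" using F tM by (auto simp: typed_ideal_def)
        show "F \<in> irrelevant"
        proof (rule ccontr)
          assume "F \<notin> irrelevant"
          then obtain u j where "u \<in> line_ring v" "j \<in> line_ring v" "1 = u * F + j * line_var"
            using inverse_mod_line_var[OF W3 FT] by blast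
          moreover have "u * F \<in> h ` m" "j * line_var \<in> h ` m"
            using tM F ttm calculation by (auto simp: typed_ideal_def)
          ultimately have "1 \<in> h ` m" using tM unfolding typed_ideal_def by metis
          then show False using oneM by simp
        qed
      qed
    qed
    let ?J = "{F. \<exists>G\<in>line_ring v. F = G * line_var}"
    have J: "F \<in> ?J \<longleftrightarrow> F \<in> line_ring v \<and> coeff_vec F 0 = 0 \<and> (\<forall>n. coeff_vec F (Suc n) \<in> form_vals v n)" for F
      using line_var_multiple_iff[of F] by simp
    have tM0: "line_var \<in> irrelevant" using True M by simp
    have aTT: "vmono a 3 \<in> line_ring v" by (rule vmono_line_ring) (simp add: W3)
    show ?thesis
    proof (rule R.gorenstein_localI_typed[OF noetherian_model[OF R] m M tM0 typed_ideal_line_var])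
      show "?J \<subseteq> irrelevant" using ttm M by auto
      show "line_var \<in> ?J" using line_ring_one by (auto intro!: bexI[of _ 1])
    next
      fix s assume "s \<in> line_ring v - irrelevant"
      then obtain u j where "u \<in> line_ring v" "j \<in> line_ring v" "1 = u * s + j * line_var"
        using inverse_mod_line_var[OF W3] by blast
      then have "u \<in> line_ring v" "1 - u * s = j * line_var" by (simp_all add: diff_eq_eq add.commute)
      then show "\<exists>u\<in>line_ring v. 1 - u * s \<in> ?J" using \<open>j \<in> line_ring v\<close> by blast
    next
      fix b assume "b \<in> ?J"
      then obtain G where "G \<in> line_ring v" "1 * b = G * line_var" by auto
      moreover have "1 \<in> line_ring v - irrelevant" using line_ring_one oneM M by auto
      ultimately show "\<exists>s\<in>line_ring v - irrelevant. \<exists>r\<in>line_ring v. s * b = r * line_var" by blast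
    next
      fix s b assume s: "s \<in> line_ring v - irrelevant" and "s * (line_var * b) = 0"
      then have "line_var * (s * b) = 0" by (simp add: mult_ac)
      then have "s * b = 0" by (rule line_var_cancel)
      then show "\<exists>s'\<in>line_ring v - irrelevant. s' * b = 0" using s by blast
    next
      fix y assume "y \<in> irrelevant"
      then show "\<exists>n::nat. y ^ n \<in> ?J" using pow_line_var_multiple[OF W3, of y] unfolding irrelevant_def by blast
    next
      show "vmono a 3 \<in> line_ring v" by (rule aTT)
      show "vmono a 3 \<notin> ?J"
      proof
        assume "vmono a 3 \<in> ?J"
        then have "coeff_vec (vmono a 3) (Suc 2) \<in> form_vals v 2" using J by blast
        then show False using aW2 by (simp add: coeff_vec_vmono)
      qed
      fix y assume "y \<in> irrelevant"
      then show "y * vmono a 3 \<in> ?J" using top_socle[OF W3] by blast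
    next
      fix b assume b: "b \<in> line_ring v" and k: "\<And>y. y \<in> irrelevant \<Longrightarrow> y * b \<in> ?J"
      \<comment> \<open>Multiplying \<open>b\<close> by a linear form in degree 1 shows what the
        socle condition means in each degree. Degrees 0 to 2 then contribute nothing by
        \<open>two\<close>, \<open>indec\<close> and \<open>perp\<close>, and degree 3 a
        line.\<close>
      have bW: "x * coeff_vec b n \<in> form_vals v n" if x: "x \<in> form_vals v 1" for x n
      proof -
        have "vmono x 1 \<in> irrelevant" using vmono_line_ring[OF x] by (simp add: irrelevant_def coeff_vec_vmono)
        then have "coeff_vec (vmono x 1 * b) (Suc n) \<in> form_vals v n" using k J by blast
        moreover have "coeff_vec (vmono x 1 * b) (Suc n) = (\<Sum>j\<le>Suc n. if j = 1 then x * coeff_vec b n else 0)"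
          unfolding coeff_vec_mult by (rule sum.cong) (auto simp: coeff_vec_vmono)
        ultimately show ?thesis by (cases "n = 0") simp_all
      qed
      have bT: "coeff_vec b n \<in> form_vals v n" for n using b by (simp add: line_ring_def)
      obtain k0 where k0: "coeff_vec b 0 = k0 *s 1" using coeff_vec_0_line_ring[OF b] by blast
      have b0: "coeff_vec b 0 = 0"
      proof (rule ccontr)
        assume "coeff_vec b 0 \<noteq> 0"
        then have n: "k0 \<noteq> 0" using k0 by auto
        have "\<exists>k. x = k *s 1" if x: "x \<in> form_vals v 1" for x
        proof -
          obtain k' where "x * (k0 *s 1) = k' *s 1" using bW[OF x, of 0] k0 by (auto simp: form_vals.simps(1))
          then have "x = (k' / k0) *s 1" using n by (auto simp: vec_eq_iff field_simps)
          then show ?thesis by blast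
        qed
        then show False using two not_all_const by blast
      qed
      have b1: "coeff_vec b 1 \<in> form_vals v 0" using indec[of "coeff_vec b 1"] bW by (auto simp: form_vals.simps(1))
      have b2: "coeff_vec b 2 \<in> form_vals v 1"
      proof (rule perp)
        fix g assume g: "g \<in> form_vals v 1"
        show "(\<Sum>i\<in>UNIV. c i * (coeff_vec b 2 * g) $ i) = 0"
          using rel[OF bW[OF g, of 2]] by (simp add: mult_ac)
      qed
      \<comment> \<open>\<open>k\<close> makes the degree 3 coefficient of the difference orthogonal
        to \<open>c\<close>, so that \<open>W2\<close> applies to it.\<close>
      define k where "k = (\<Sum>i\<in>UNIV. c i * coeff_vec b 3 $ i) / c i0"
      have b3: "coeff_vec b 3 - k *s a \<in> form_vals v 2"
      proof (rule W2)
        have "(\<Sum>i\<in>UNIV. c i * (coeff_vec b 3 - k *s a) $ i) = (\<Sum>i\<in>UNIV. c i * coeff_vec b 3 $ i) - k * (\<Sum>i\<in>UNIV. c i * a $ i)"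
          by (simp add: right_diff_distrib sum_subtractf sum_distrib_left mult_ac)
        then show "(\<Sum>i\<in>UNIV. c i * (coeff_vec b 3 - k *s a) $ i) = 0" using c[of i0] by (simp add: ca k_def)
      qed
      let ?r = "vmono (k *s 1) 0"
      have ra: "?r * vmono a 3 = vmono (k *s a) 3" by (simp add: vmono_mult scale_mult)
      have "b - ?r * vmono a 3 \<in> ?J"
        unfolding J
      proof (intro conjI allI)
        show "b - ?r * vmono a 3 \<in> line_ring v" by (intro line_ring_diff b line_ring_mult const_line_ring aTT)
        show "coeff_vec (b - ?r * vmono a 3) 0 = 0" by (simp add: ra coeff_vec_diff coeff_vec_vmono b0)
        fix n
        have cn: "coeff_vec (b - ?r * vmono a 3) (Suc n) = coeff_vec b (Suc n) - (if n = 2 then k *s a else 0)"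
          by (simp only: ra coeff_vec_diff coeff_vec_vmono) (simp add: eval_nat_numeral)
        consider "n = 0" | "n = 1" | "n = 2" | "n \<ge> 3" by linarith
        then show "coeff_vec (b - ?r * vmono a 3) (Suc n) \<in> form_vals v n"
        proof cases
          case 1
          then show ?thesis using b1 unfolding cn by simp
        next
          case 2
          then show ?thesis using b2 unfolding cn by (simp add: eval_nat_numeral)
        next
          case 3
          then show ?thesis using b3 unfolding cn by (simp add: eval_nat_numeral)
        next
          case 4
          then show ?thesis using form_vals_top_le[OF W3] by auto
        qed
      qed
      then show "\<exists>r\<in>line_ring v. b - r * vmono a 3 \<in> ?J" using const_line_ring by blast
    qed
  qed
  then show ?thesis
    unfolding gorenstein_ring_def using R.is_cring noetherian_model[OF R] by blast
qed

text \<open>Let \<open>s\<close> be the first degree in which forms take all values, and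
  \<open>s = Suc p\<close>. All of degree \<open>s\<close> is socle, so a socle with one generator
  makes \<open>form_vals v p\<close> a hyperplane. Its equation restricts to quadratic values once
  \<open>p\<close> is at least 2.\<close>

theorem relation_if_gorenstein:
  assumes R: "ring_model R h (line_ring v)" and G: "gorenstein_ring R"
    and card: "CARD('m) > CARD('n) + 1"
  obtains c where "\<And>i. c i \<noteq> 0" "\<And>f. f \<in> form_vals v 2 \<Longrightarrow> (\<Sum>i\<in>UNIV. c i * f $ i) = 0"
proof -
  interpret R: ring_model R h "line_ring v" by (rule R)
  obtain s0 where s0: "form_vals v s0 = UNIV" using ex_top by blast
  define s where "s = (LEAST n. form_vals v n = UNIV)"
  have s: "form_vals v s = UNIV" unfolding s_def by (rule LeastI[of _ s0]) (rule s0)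
  have less: "form_vals v n \<noteq> UNIV" if "n < s" for n using that not_less_Least unfolding s_def by blast
  have "\<exists>i k :: 'm. i \<noteq> k"
  proof (rule ccontr)
    assume "\<not> ?thesis"
    then have "is_singleton (UNIV :: 'm set)" by (metis UNIV_I is_singletonI' empty_iff)
    then show False using card by (simp add: is_singleton_altdef)
  qed
  then obtain x where x: "x \<in> form_vals v 1" "\<nexists>c. x = c *s 1" using not_all_const by blast
  have "x \<notin> form_vals v 0" using x(2) by (auto simp: form_vals.simps(1))
  then have "s \<noteq> 0" using s by (cases "s = 0") auto
  then obtain p where p: "s = Suc p" by (cases s) auto
  \<comment> \<open>Placed in degree \<open>s\<close>, this \<open>a\<close> is the nonzero socle
    element that bounds the length of the unknown regular sequence.\<close>
  obtain a where a: "a \<notin> form_vals v p" using less[of p] p by auto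
  let ?m = "{r \<in> carrier R. h r \<in> irrelevant}"
  have one0: "1 \<notin> irrelevant" by (simp add: irrelevant_def coeff_vec_one)
  have ttM0: "G * line_var \<in> irrelevant" if "G \<in> line_ring v" for G
    using line_var_multiple_iff[of "G * line_var"] that by (auto simp: irrelevant_def)
  have m: "maximalideal ?m R"
  proof (rule R.maximalideal_vimage[OF typed_ideal_irrelevant one0])
    fix s' assume "s' \<in> line_ring v - irrelevant"
    then obtain u j where "u \<in> line_ring v" "j \<in> line_ring v" "1 = u * s' + j * line_var"
      using inverse_mod_line_var[OF s] by blast
    then have "u \<in> line_ring v" "1 - u * s' = j * line_var" by (simp_all add: diff_eq_eq add.commute)
    then show "\<exists>u\<in>line_ring v. 1 - u * s' \<in> irrelevant"
      using ttM0[OF \<open>j \<in> line_ring v\<close>] by (intro bexI[of _ u]) auto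
  qed
  have M: "irrelevant = h ` ?m"
  proof
    show "irrelevant \<subseteq> h ` ?m"
    proof
      fix F assume F: "F \<in> irrelevant"
      then have "F \<in> line_ring v" by (simp add: irrelevant_def)
      then obtain r where "r \<in> carrier R" "F = h r" by (rule R.T_cases)
      then show "F \<in> h ` ?m" using F by auto
    qed
  qed auto
  have G': "gorenstein_local (localization R ?m)" using G m by (auto simp: gorenstein_ring_def)
  have tt0: "line_var \<in> irrelevant" using ttM0[OF line_ring_one] by simp
  have z2: "vmono a s \<noteq> r * line_var" if "r \<in> line_ring v" for r
  proof
    assume "vmono a s = r * line_var"
    then have "coeff_vec (vmono a s) (Suc p) \<in> form_vals v p" using line_var_multiple_iff[of "vmono a s"] that by blast
    then show False using a by (simp add: coeff_vec_vmono p)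
  qed
  obtain \<alpha> where \<alpha>: "\<alpha> \<in> line_ring v"
    "\<And>b. b \<in> line_ring v \<Longrightarrow> (\<And>y. y \<in> irrelevant \<Longrightarrow> \<exists>r\<in>line_ring v. y * b = r * line_var) \<Longrightarrow>
      \<exists>r\<in>line_ring v. \<exists>s\<in>line_ring v. b = r * \<alpha> + s * line_var"
    "\<And>y. y \<in> irrelevant \<Longrightarrow> \<exists>r\<in>line_ring v. y * \<alpha> = r * line_var"
  proof (rule R.gorenstein_local_socle_typed[OF m M, of line_var "vmono a s"])
    show "F = 0" if "F \<in> line_ring v" "line_var * F = 0" for F using that(2) by (rule line_var_cancel)
    show "\<exists>u\<in>line_ring v. \<exists>j\<in>line_ring v. 1 = u * F + j * line_var" if "F \<in> line_ring v - irrelevant" for F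
      using inverse_mod_line_var[OF s] that by blast
    show "vmono a s \<in> line_ring v" by (rule vmono_line_ring) (simp add: s)
    show "\<exists>r\<in>line_ring v. y * vmono a s = r * line_var" if "y \<in> irrelevant" for y using top_socle[OF s that] .
  qed (use tt0 z2 G' in \<open>blast | assumption\<close>)+
  \<comment> \<open>Only the constant term \<open>k\<close> of the multiplier \<open>r\<close>
    matters: its remaining part lies in the irrelevant ideal and sends \<alpha> to a multiple of
    \<open>line_var\<close>.\<close>
  have soc: "\<exists>k. \<forall>j. coeff_vec (vmono g n) j - k *s coeff_vec \<alpha> j \<in> (if j = 0 then {0} else form_vals v (j - 1))"
    if g: "g \<in> form_vals v n" "\<And>x. x \<in> form_vals v 1 \<Longrightarrow> x * g \<in> form_vals v n" for g n
  proof -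
    obtain r t where rt: "r \<in> line_ring v" "t \<in> line_ring v" "vmono g n = r * \<alpha> + t * line_var"
      using \<alpha>(2)[OF vmono_line_ring[OF g(1)] irrelevant_mult_vmono[OF g]] by blast
    obtain k where k: "r - vmono (k *s 1) 0 \<in> irrelevant" using irrelevant_cases[OF rt(1)] by blast
    obtain w where w: "w \<in> line_ring v" "(r - vmono (k *s 1) 0) * \<alpha> = w * line_var" using \<alpha>(3)[OF k] by blast
    have "vmono g n - vmono (k *s 1) 0 * \<alpha> = (w + t) * line_var"
      using w rt by (simp add: algebra_simps)
    then have "\<exists>G\<in>line_ring v. vmono g n - vmono (k *s 1) 0 * \<alpha> = G * line_var" using w rt line_ring_add by blast
    then have *: "coeff_vec (vmono g n - vmono (k *s 1) 0 * \<alpha>) 0 = 0"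
      "\<And>j. coeff_vec (vmono g n - vmono (k *s 1) 0 * \<alpha>) (Suc j) \<in> form_vals v j" unfolding line_var_multiple_iff by auto
    have "coeff_vec (vmono (k *s 1) 0 * \<alpha>) j = k *s coeff_vec \<alpha> j" for j
    proof -
      have "coeff_vec (vmono (k *s 1) 0 * \<alpha>) j = (\<Sum>i\<le>j. if i = 0 then k *s coeff_vec \<alpha> j else 0)"
        unfolding coeff_vec_mult by (rule sum.cong) (auto simp: coeff_vec_vmono scale_mult)
      then show ?thesis by simp
    qed
    then have "coeff_vec (vmono g n) j - k *s coeff_vec \<alpha> j \<in> (if j = 0 then {0} else form_vals v (j - 1))" for j
      using * by (cases j) (auto simp: coeff_vec_diff)
    then show ?thesis by blast
  qed
  define b where "b = coeff_vec \<alpha> s"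
  obtain k where k: "\<forall>j. coeff_vec (vmono a s) j - k *s coeff_vec \<alpha> j \<in> (if j = 0 then {0} else form_vals v (j - 1))"
    using soc[of a s] s by auto
  have kb: "a - k *s b \<in> form_vals v p" using k[rule_format, of s] by (simp add: coeff_vec_vmono p b_def)
  have k0: "k \<noteq> 0" using kb a by auto
  have bp: "b \<notin> form_vals v p"
  proof
    assume "b \<in> form_vals v p"
    then have "(a - k *s b) + k *s b \<in> form_vals v p" using kb form_vals_add form_vals_scale by blast
    then show False using a by simp
  qed
  \<comment> \<open>The element \<open>a\<close> in degree \<open>s\<close> equals \<open>k\<close>
    times \<alpha> with \<open>k\<close> nonzero, so modulo \<open>line_var\<close> the generator
    \<alpha> has no component of degree below \<open>s\<close>.\<close>
  have low: "coeff_vec \<alpha> j \<in> form_vals v (j - 1)" "j = 0 \<Longrightarrow> coeff_vec \<alpha> j = 0" if "j < s" for j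
  proof -
    have *: "- (k *s coeff_vec \<alpha> j) \<in> (if j = 0 then {0} else form_vals v (j - 1))"
      using k[rule_format, of j] that by (simp add: coeff_vec_vmono)
    have e: "coeff_vec \<alpha> j = (- 1 / k) *s (- (k *s coeff_vec \<alpha> j))" using k0 by (simp add: vec_eq_iff)
    show "j = 0 \<Longrightarrow> coeff_vec \<alpha> j = 0" using * k0 by (auto simp: vec_eq_iff)
    show "coeff_vec \<alpha> j \<in> form_vals v (j - 1)"
      using * by (subst e, intro form_vals_scale) (auto simp: form_vals_zero split: if_splits)
  qed
  \<comment> \<open>Consequently no nonzero socle element lives in a degree below
    \<open>s\<close>.\<close>
  have low_soc: "g \<in> form_vals v (n - 1) \<and> (n = 0 \<longrightarrow> g = 0)"
    if n: "n < s" and g: "g \<in> form_vals v n" "\<And>x. x \<in> form_vals v 1 \<Longrightarrow> x * g \<in> form_vals v n" for g n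
  proof -
    obtain k where k: "\<forall>j. coeff_vec (vmono g n) j - k *s coeff_vec \<alpha> j \<in> (if j = 0 then {0} else form_vals v (j - 1))"
      using soc[OF g] by blast
    have *: "g - k *s coeff_vec \<alpha> n \<in> (if n = 0 then {0} else form_vals v (n - 1))"
      using k[rule_format, of n] by (simp add: coeff_vec_vmono)
    show ?thesis
    proof (cases n)
      case 0
      then show ?thesis using * low(2)[OF n] form_vals_zero by auto
    next
      case (Suc n')
      have "(g - k *s coeff_vec \<alpha> n) + k *s coeff_vec \<alpha> n \<in> form_vals v (n - 1)"
        using * Suc by (intro form_vals_add form_vals_scale low(1)[OF n]) auto
      then show ?thesis using Suc by simp
    qed
  qed
  have top: "\<exists>k. g - k *s b \<in> form_vals v p" for g
  proof -
    obtain k where "\<forall>j. coeff_vec (vmono g s) j - k *s coeff_vec \<alpha> j \<in> (if j = 0 then {0} else form_vals v (j - 1))"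
      using soc[of g s] s by auto
    from this[rule_format, of s] show ?thesis by (auto simp: coeff_vec_vmono p b_def)
  qed
  \<comment> \<open>\<open>c i\<close> is the class of the indicator of \<open>i\<close> in the
    one-dimensional quotient by \<open>form_vals v p\<close>, measured by the class of
    \<open>b\<close>.\<close>
  have "\<forall>i. \<exists>k. axis i 1 - k *s b \<in> form_vals v p" using top by blast
  then obtain c where c: "\<And>i. axis i 1 - c i *s b \<in> form_vals v p" by metis
  have expand: "f - (\<Sum>i\<in>UNIV. c i * f $ i) *s b \<in> form_vals v p" for f
  proof -
    have "(\<Sum>i\<in>UNIV. (f $ i) *s (axis i 1 - c i *s b)) \<in> form_vals v p" by (intro form_vals_sum form_vals_scale c)
    moreover have "(\<Sum>i\<in>UNIV. (f $ i) *s (axis i 1 - c i *s b)) = f - (\<Sum>i\<in>UNIV. c i * f $ i) *s b"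
    proof (rule vec_fun_eqI)
      fix k
      have "(\<Sum>i\<in>UNIV. f $ i * (axis i 1 $ k)) = f $ k"
        by (simp add: axis_def if_distrib cong: if_cong)
      then show "(\<Sum>i\<in>UNIV. (f $ i) *s (axis i 1 - c i *s b)) $ k = (f - (\<Sum>i\<in>UNIV. c i * f $ i) *s b) $ k"
        by (simp add: right_diff_distrib sum_subtractf sum_distrib_right sum_distrib_left mult_ac)
    qed
    ultimately show ?thesis by simp
  qed
  have Wp: "f \<in> form_vals v p \<longleftrightarrow> (\<Sum>i\<in>UNIV. c i * f $ i) = 0" for f
  proof
    assume f: "f \<in> form_vals v p"
    show "(\<Sum>i\<in>UNIV. c i * f $ i) = 0"
    proof (rule ccontr)
      assume n: "(\<Sum>i\<in>UNIV. c i * f $ i) \<noteq> 0" (is "?c \<noteq> 0")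
      have "(1 / ?c) *s (f - (f - ?c *s b)) \<in> form_vals v p" by (intro form_vals_scale form_vals_diff f expand)
      moreover have "(1 / ?c) *s (f - (f - ?c *s b)) = b" using n by (simp add: vec_eq_iff)
      ultimately show False using bp by simp
    qed
  next
    assume "(\<Sum>i\<in>UNIV. c i * f $ i) = 0"
    then show "f \<in> form_vals v p" using expand[of f] by simp
  qed
  have c0: "c i \<noteq> 0" for i
  proof
    assume ci: "c i = 0"
    have "(\<Sum>k\<in>UNIV. c k * (axis i 1 :: 'K ^ 'm) $ k) = 0"
      using ci by (simp add: axis_def if_distrib cong: if_cong)
    then have ip: "axis i 1 \<in> form_vals v p" using Wp by blast
    \<comment> \<open>Multiplication by any linear form scales an indicator. In its least possible
      degree the indicator would therefore be a nonzero socle element of degree below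
      \<open>s\<close>.\<close>
    define n where "n = (LEAST n. axis i (1::'K) \<in> form_vals v n)"
    have n: "axis i 1 \<in> form_vals v n" unfolding n_def by (rule LeastI) (rule ip)
    have np: "n \<le> p" unfolding n_def by (rule Least_le) (rule ip)
    have "x * axis i 1 \<in> form_vals v n" if "x \<in> form_vals v 1" for x
    proof -
      have "x * axis i 1 = (x $ i) *s axis i 1" by (auto simp: vec_eq_iff axis_def)
      then show ?thesis using n form_vals_scale by metis
    qed
    then have *: "axis i 1 \<in> form_vals v (n - 1)" "n = 0 \<longrightarrow> axis i (1::'K) = 0"
      using low_soc[of n "axis i 1"] n np p by auto
    have "axis i (1::'K) \<noteq> 0" by (metis axis_nth zero_index zero_neq_one)
    then have "n \<noteq> 0" using *(2) by blast
    then show False using *(1) not_less_Least[of "n - 1" "\<lambda>n. axis i (1::'K) \<in> form_vals v n"] by (simp add: n_def)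
  qed
  have "2 \<le> p"
  proof (rule ccontr)
    assume "\<not> 2 \<le> p"
    \<comment> \<open>Otherwise the coordinate vectors and \<open>b\<close> span everything, so
      there are at most \<open>CARD('n) + 1\<close> points.\<close>
    then have p1: "form_vals v p \<subseteq> form_vals v 1" using form_vals_le[of _ p 1] by auto
    have "form_vals v 1 \<subseteq> vec.span (range (coordf v))"
    proof
      fix f assume "f \<in> form_vals v 1"
      then obtain a where "f = (\<chi> i. \<Sum>j\<in>UNIV. a $ j * v i $ j)" unfolding form_vals_1 by auto
      then have "f = (\<Sum>j\<in>UNIV. (a $ j) *s coordf v j)" by (simp add: vec_eq_iff coordf_def)
      then show "f \<in> vec.span (range (coordf v))"
        by (simp add: vec.span_sum vec.span_scale vec.span_base)
    qed
    then have sub: "form_vals v p \<subseteq> vec.span (insert b (range (coordf v)))"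
      using p1 vec.span_mono[of "range (coordf v)" "insert b (range (coordf v))"] by blast
    have "g \<in> vec.span (insert b (range (coordf v)))" for g
    proof -
      obtain k where "g - k *s b \<in> form_vals v p" using top by blast
      then have "g - k *s b \<in> vec.span (insert b (range (coordf v)))" using sub by blast
      moreover have "k *s b \<in> vec.span (insert b (range (coordf v)))"
        by (intro vec.span_scale vec.span_base) simp
      ultimately have "(g - k *s b) + k *s b \<in> vec.span (insert b (range (coordf v)))"
        by (rule vec.span_add)
      then show ?thesis by simp
    qed
    then have "vec.dim (UNIV :: ('K ^ 'm) set) \<le> card (insert b (range (coordf v)))"
      by (intro vec.dim_le_card) auto
    also have "\<dots> \<le> Suc (CARD('n))"
      by (rule order_trans[OF card_insert_le_m1]) (auto simp: card_image_le intro: le_SucI)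
    finally show False using card by (simp add: vec_dim_card card_cart_basis)
  qed
  then have "f \<in> form_vals v p" if "f \<in> form_vals v 2" for f using form_vals_le that by blast
  then show ?thesis using that[of c] c0 Wp by blast
qed

end

section \<open>Relations on sets of points\<close>

lemma rank_nullity:
  fixes A :: "'K::field ^ 'm::finite ^ 'n::finite"
  shows "vec.dim {x. A *v x = 0} + vec.dim (range ((*v) A)) = CARD('m)"
proof -
  let ?N = "{x. A *v x = 0}"
  have lin: "Vector_Spaces.linear (*s) (*s) ((*v) A)" by (rule matrix_vector_mul_linear_gen)
  obtain B where B: "B \<subseteq> ?N" "vec.independent B" "?N \<subseteq> vec.span B" "card B = vec.dim ?N"
    using vec.basis_exists by metis
  define C where "C = vec.extend_basis B"
  have C: "vec.independent C" "vec.span C = UNIV" "B \<subseteq> C"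
    unfolding C_def using vec.independent_extend_basis[OF B(2)] vec.span_extend_basis[OF B(2)]
      vec.extend_basis_superset[OF B(2)] by auto
  have finC: "finite C" using C(1) vec.finiteI_independent by blast
  have N: "vec.subspace ?N" by (auto simp: vec.subspace_def matrix_vector_right_distrib vector_scalar_commute)
  have spanB: "vec.span B = ?N" using B vec.span_minimal[OF B(1) N] by auto
  have zero: "x = 0" if x: "x \<in> vec.span (C - B)" "A *v x = 0" for x
  proof -
    have xB: "x \<in> vec.span B" using x spanB by auto
    have "vec.representation C x = vec.representation B x"
      by (rule vec.representation_extend[OF C(1) xB C(3)])
    moreover have "vec.representation C x = vec.representation (C - B) x"
      by (rule vec.representation_extend[OF C(1) x(1)]) auto
    ultimately have "vec.representation C x b = 0" for b
      using vec.representation_ne_zero[of B x b] vec.representation_ne_zero[of "C - B" x b]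
      by (metis DiffD2)
    then show "x = 0"
      using vec.sum_nonzero_representation_eq[OF C(1), of x] C(2) by simp
  qed
  have inj: "inj_on ((*v) A) (vec.span (C - B))"
  proof (rule inj_onI)
    fix x y assume "x \<in> vec.span (C - B)" "y \<in> vec.span (C - B)" "A *v x = A *v y"
    then have "x - y \<in> vec.span (C - B)" "A *v (x - y) = 0"
      by (auto simp: vec.span_diff matrix_vector_mult_diff_distrib)
    then show "x = y" using zero by fastforce
  qed
  have "range ((*v) A) = (*v) A ` vec.span (C - B)"
  proof
    show "range ((*v) A) \<subseteq> (*v) A ` vec.span (C - B)"
    proof safe
      fix x
      have "x \<in> vec.span (B \<union> (C - B))" using C by (simp add: Un_absorb1)
      then obtain y z where "x = y + z" "y \<in> vec.span B" "z \<in> vec.span (C - B)"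
        unfolding vec.span_Un by auto
      then have "A *v x = A *v z" using spanB by (auto simp: matrix_vector_right_distrib)
      then show "A *v x \<in> (*v) A ` vec.span (C - B)" using \<open>z \<in> vec.span (C - B)\<close> by auto
    qed
  qed auto
  then have "vec.dim (range ((*v) A)) = vec.dim (vec.span (C - B))"
    using vec.dim_image_eq[OF lin, of "vec.span (C - B)"] inj by (simp add: vec.span_span)
  also have "\<dots> = card (C - B)"
    using vec.dim_span_eq_card_independent[of "C - B"] vec.independent_mono[OF C(1)] by auto
  finally have "vec.dim (range ((*v) A)) = card C - card B"
    using finC C(3) by (simp add: card_Diff_subset finite_subset)
  moreover have "card C = CARD('m)"
    using vec.dim_span_eq_card_independent[OF C(1)] C(2) by (simp add: vec_dim_card card_cart_basis)
  moreover have "card B \<le> card C" using finC C(3) by (rule card_mono)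
  ultimately show ?thesis using B(4) by simp
qed

lemma subspace_range: "vec.subspace (range ((*v) A))" for A :: "'K::field ^ 'm::finite ^ 'n::finite"
  unfolding vec.subspace_def
proof (intro conjI allI ballI)
  show "0 \<in> range ((*v) A)" by (rule range_eqI[of _ _ 0]) simp
next
  fix x y assume "x \<in> range ((*v) A)" "y \<in> range ((*v) A)"
  then show "x + y \<in> range ((*v) A)" by (auto simp flip: matrix_vector_right_distrib)
next
  fix c x assume "x \<in> range ((*v) A)"
  then show "c *s x \<in> range ((*v) A)" by (auto simp flip: vector_scalar_commute)
qed

lemma subspace_null: "vec.subspace {x. A *v x = 0}" for A :: "'K::field ^ 'm::finite ^ 'n::finite"
  by (auto simp: vec.subspace_def matrix_vector_right_distrib vector_scalar_commute)

lemma finite_poly_roots_avoid: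
  assumes inf: "infinite (UNIV :: 'K::field set)" and "finite S" "\<And>p. p \<in> S \<Longrightarrow> p \<noteq> 0"
  shows "\<exists>t::'K. \<forall>p\<in>S. poly p t \<noteq> 0"
proof -
  have "finite (\<Union>p\<in>S. {t. poly p t = 0})" using assms by (auto intro: poly_roots_finite)
  then obtain t where "t \<notin> (\<Union>p\<in>S. {t. poly p t = 0})" using inf ex_new_if_finite by blast
  then show ?thesis by blast
qed

text \<open>Perturb the form by \<open>t\<close> in one coordinate where the new vector is nonzero:
  every condition becomes a nonzero polynomial of degree at most one in \<open>t\<close>.\<close>

lemma ex_linear_form_nonvanishing:
  fixes V :: "('K::field ^ 'n::finite) set"
  assumes inf: "infinite (UNIV :: 'K set)" and "finite V" "0 \<notin> V"
  shows "\<exists>l :: 'K ^ 'n. \<forall>w\<in>V. (\<Sum>j\<in>UNIV. l $ j * w $ j) \<noteq> 0"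
  using assms(2,3)
proof (induction V)
  case (insert w V)
  then obtain l :: "'K ^ 'n" where l: "\<forall>w\<in>V. (\<Sum>j\<in>UNIV. l $ j * w $ j) \<noteq> 0" by auto
  obtain k where k: "w $ k \<noteq> 0" using insert by (auto simp: vec_eq_iff)
  define q where "q u = [:\<Sum>j\<in>UNIV. l $ j * u $ j, u $ k:]" for u :: "'K ^ 'n"
  have "\<exists>t. \<forall>p\<in>q ` insert w V. poly p t \<noteq> 0"
    by (rule finite_poly_roots_avoid[OF inf]) (use insert l k in \<open>auto simp: q_def\<close>)
  then obtain t where t: "\<forall>u\<in>insert w V. poly (q u) t \<noteq> 0" by blast
  have "(\<Sum>j\<in>UNIV. (l + axis k t) $ j * u $ j) = poly (q u) t" for u
  proof -
    have "(\<Sum>j\<in>UNIV. axis k t $ j * u $ j) = (\<Sum>j\<in>UNIV. if j = k then t * u $ j else 0)"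
      by (rule sum.cong) (auto simp: axis_def)
    then show ?thesis by (simp add: q_def distrib_right sum.distrib)
  qed
  then show ?case using t by (intro exI[of _ "l + axis k t"]) auto
qed auto

text \<open>
  Coordinates on a set of points: \<open>\<nu> p\<close> is a representative of \<open>p\<close>, and the points are indexed by
  the type \<open>'n \<times> bool\<close>, which has the right cardinality.
\<close>

lemma affine_points_exist:
  fixes X :: "('K::field ^ 'n::finite) set set"
  assumes inf: "infinite (UNIV :: 'K set)" and X: "finite X" "card X = 2 * CARD('n)"
    and \<nu>: "\<And>p. p \<in> X \<Longrightarrow> \<nu> p \<noteq> 0 \<and> p = vec.span {\<nu> p}"
  obtains l and \<beta> :: "'n \<times> bool \<Rightarrow> ('K ^ 'n) set" and e where
    "bij_betw \<beta> UNIV X" "\<And>i. e i \<noteq> 0" "affine_points (\<lambda>i. e i *s \<nu> (\<beta> i)) l"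
    "X = range (\<lambda>i. vec.span {e i *s \<nu> (\<beta> i)})"
proof -
  have "card (UNIV :: ('n \<times> bool) set) = card X"
    using X by (simp add: card_cartesian_product UNIV_Times_UNIV[symmetric] del: UNIV_Times_UNIV)
  then obtain \<beta> :: "'n \<times> bool \<Rightarrow> ('K ^ 'n) set" where \<beta>: "bij_betw \<beta> UNIV X"
    using finite_same_card_bij[of "UNIV :: ('n \<times> bool) set" X] X by auto
  have \<beta>X: "\<beta> i \<in> X" for i using \<beta> by (auto simp: bij_betw_def)
  obtain l where l: "\<forall>w\<in>\<nu> ` X. (\<Sum>j\<in>UNIV. l $ j * w $ j) \<noteq> 0"
  proof -
    have "\<nu> p \<noteq> 0" if "p \<in> X" for p using \<nu>[OF that] by (rule conjunct1)
    then have "0 \<notin> \<nu> ` X" by force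
    then show ?thesis using ex_linear_form_nonvanishing[OF inf, of "\<nu> ` X"] X(1) that by blast
  qed
  define e where "e i = 1 / (\<Sum>j\<in>UNIV. l $ j * \<nu> (\<beta> i) $ j)" for i
  have e0: "e i \<noteq> 0" for i using l \<beta>X by (auto simp: e_def)
  have span: "vec.span {e i *s \<nu> (\<beta> i)} = \<beta> i" for i
    using vec.span_image_scale[of "{\<nu> (\<beta> i)}" "\<lambda>_. e i"] e0 \<nu>[OF \<beta>X[of i]] by auto
  have "affine_points (\<lambda>i. e i *s \<nu> (\<beta> i)) l"
  proof
    fix i
    have "(\<Sum>j\<in>UNIV. l $ j * (e i *s \<nu> (\<beta> i)) $ j) = e i * (\<Sum>j\<in>UNIV. l $ j * \<nu> (\<beta> i) $ j)"
      by (simp add: sum_distrib_left mult_ac)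
    then show "(\<Sum>j\<in>UNIV. l $ j * (e i *s \<nu> (\<beta> i)) $ j) = 1"
      using l \<beta>X[of i] by (simp add: e_def)
  next
    show "inj (\<lambda>i. e i *s \<nu> (\<beta> i))"
    proof (rule injI)
      fix i k assume "e i *s \<nu> (\<beta> i) = e k *s \<nu> (\<beta> k)"
      then have "\<beta> i = \<beta> k" using span by metis
      then show "i = k" using injD[OF bij_betw_imp_inj_on[OF \<beta>]] by blast
    qed
  qed
  moreover have "X = range (\<lambda>i. vec.span {e i *s \<nu> (\<beta> i)})" unfolding span using \<beta> by (auto simp: bij_betw_def)
  ultimately show ?thesis using that \<beta> e0 by blast
qed

theorem gorenstein_imp_relation:
  fixes X :: "('K::field ^ 'n::finite) set set"
  assumes inf: "infinite (UNIV :: 'K set)" and n: "CARD('n) \<ge> 2"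
    and X: "finite X" "card X = 2 * CARD('n)"
    and \<nu>: "\<And>p. p \<in> X \<Longrightarrow> \<nu> p \<noteq> 0 \<and> p = vec.span {\<nu> p}"
    and G: "arithmetically_gorenstein X"
  obtains c where "\<And>p. p \<in> X \<Longrightarrow> c p \<noteq> 0" "\<And>x y. (\<Sum>p\<in>X. c p * (\<nu> p $ x * \<nu> p $ y)) = 0"
proof -
  obtain l and \<beta> :: "'n \<times> bool \<Rightarrow> ('K ^ 'n) set" and e where
    \<beta>: "bij_betw \<beta> UNIV X" and e: "\<And>i. e i \<noteq> 0" and v: "affine_points (\<lambda>i. e i *s \<nu> (\<beta> i)) l"
    and Xr: "X = range (\<lambda>i. vec.span {e i *s \<nu> (\<beta> i)})"
    by (rule affine_points_exist[OF inf X \<nu>], assumption, rule that)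
  let ?v = "\<lambda>i. e i *s \<nu> (\<beta> i)"
  interpret v: affine_points ?v l by (rule v)
  obtain h where h: "ring_model (homogeneous_coordinate_ring X) h (line_ring ?v)"
    using homogeneous_coordinate_ring_model[of ?v] Xr by auto
  \<comment> \<open>The inequality \<open>2 (r + 1) > (r + 1) + 1\<close> is where \<open>r\<close>
    has to be positive.\<close>
  have card: "CARD('n \<times> bool) > CARD('n) + 1"
    using n by (simp add: card_cartesian_product UNIV_Times_UNIV[symmetric] del: UNIV_Times_UNIV)
  obtain c where c: "\<And>i. c i \<noteq> 0" "\<And>f. f \<in> form_vals ?v 2 \<Longrightarrow> (\<Sum>i\<in>UNIV. c i * f $ i) = 0"
    using v.relation_if_gorenstein[OF h _ card] G unfolding arithmetically_gorenstein_def by metis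
  \<comment> \<open>The relation is quadratic in the representatives, so undoing the normalization
    by \<open>e\<close> multiplies the coefficients by its square.\<close>
  define c' where "c' p = c (inv_into UNIV \<beta> p) * e (inv_into UNIV \<beta> p) ^ 2" for p
  have c'\<beta>: "c' (\<beta> i) = c i * e i ^ 2" for i
    using \<beta> by (simp add: c'_def bij_betw_def)
  show ?thesis
  proof (rule that[of c'])
    show "c' p \<noteq> 0" if "p \<in> X" for p using c(1) e by (simp add: c'_def)
    fix x y
    have "coordf ?v x * coordf ?v y \<in> form_vals ?v 2"
      using coordf_mult[OF coordf_mult[OF one_W0, of ?v y], of x] by (simp add: eval_nat_numeral)
    from c(2)[OF this] have "0 = (\<Sum>i\<in>UNIV. c i * (coordf ?v x * coordf ?v y) $ i)" by simp
    also have "\<dots> = (\<Sum>i\<in>UNIV. c' (\<beta> i) * (\<nu> (\<beta> i) $ x * \<nu> (\<beta> i) $ y))"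
      by (rule sum.cong) (simp_all add: coordf_def c'\<beta> power2_eq_square)
    also have "\<dots> = (\<Sum>p\<in>X. c' p * (\<nu> p $ x * \<nu> p $ y))"
      by (rule sum.reindex_bij_betw[OF \<beta>])
    finally show "(\<Sum>p\<in>X. c' p * (\<nu> p $ x * \<nu> p $ y)) = 0" by simp
  qed
qed

text \<open>The relation puts \<open>form_vals v 1\<close> into the kernel of the matrix with
  columns \<open>b i *s v i\<close>. As the points span, both have dimension
  \<open>CARD('n)\<close>, hence they agree; this is the required self-duality. A vector multiplying
  linear values into linear values is a matrix for which every point is an eigenvector, which links
  the two forms of indecomposability.\<close>

theorem relation_imp_gorenstein:
  fixes X :: "('K::field ^ 'n::finite) set set"
  assumes inf: "infinite (UNIV :: 'K set)"
    and X: "finite X" "card X = 2 * CARD('n)"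
    and \<nu>: "\<And>p. p \<in> X \<Longrightarrow> \<nu> p \<noteq> 0 \<and> p = vec.span {\<nu> p}"
    and c: "\<And>p. p \<in> X \<Longrightarrow> c p \<noteq> 0" and rel: "\<And>x y. (\<Sum>p\<in>X. c p * (\<nu> p $ x * \<nu> p $ y)) = 0"
    and span: "vec.span (\<nu> ` X) = UNIV"
    and indec: "\<And>(A :: 'K ^ 'n ^ 'n) g. (\<And>p. p \<in> X \<Longrightarrow> A *v \<nu> p = g p *s \<nu> p) \<Longrightarrow> \<exists>k. \<forall>p\<in>X. g p = k"
  shows "arithmetically_gorenstein X"
proof -
  obtain l and \<beta> :: "'n \<times> bool \<Rightarrow> ('K ^ 'n) set" and e where
    \<beta>: "bij_betw \<beta> UNIV X" and e: "\<And>i. e i \<noteq> 0" and v: "affine_points (\<lambda>i. e i *s \<nu> (\<beta> i)) l"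
    and Xr: "X = range (\<lambda>i. vec.span {e i *s \<nu> (\<beta> i)})"
    by (rule affine_points_exist[OF inf X \<nu>], assumption, rule that)
  define v where "v i = e i *s \<nu> (\<beta> i)" for i
  interpret v: affine_points v l using v unfolding v_def[abs_def] .
  obtain h where h: "ring_model (homogeneous_coordinate_ring X) h (line_ring v)"
    using homogeneous_coordinate_ring_model[of v] Xr unfolding v_def by auto
  have \<beta>X: "\<beta> i \<in> X" for i using \<beta> by (auto simp: bij_betw_def)
  define b where "b i = c (\<beta> i) / e i ^ 2" for i
  have b0: "b i \<noteq> 0" for i using c[OF \<beta>X] e by (simp add: b_def)
  have brel: "(\<Sum>i\<in>UNIV. b i * (v i $ x * v i $ y)) = 0" for x y
  proof -
    have "(\<Sum>i\<in>UNIV. b i * (v i $ x * v i $ y)) = (\<Sum>i\<in>UNIV. c (\<beta> i) * (\<nu> (\<beta> i) $ x * \<nu> (\<beta> i) $ y))"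
      by (rule sum.cong) (use e in \<open>simp_all add: v_def b_def power2_eq_square field_simps\<close>)
    also have "\<dots> = (\<Sum>p\<in>X. c p * (\<nu> p $ x * \<nu> p $ y))"
      by (rule sum.reindex_bij_betw[OF \<beta>])
    finally show ?thesis using rel by simp
  qed
  have brel': "(\<Sum>i\<in>UNIV. b i * ((\<Sum>x\<in>UNIV. a x * v i $ x) * v i $ y)) = 0" for a y
  proof -
    have "(\<Sum>i\<in>UNIV. b i * ((\<Sum>x\<in>UNIV. a x * v i $ x) * v i $ y)) =
       (\<Sum>i\<in>UNIV. \<Sum>x\<in>UNIV. a x * (b i * (v i $ x * v i $ y)))"
      by (simp add: sum_distrib_left sum_distrib_right mult_ac)
    also have "\<dots> = (\<Sum>x\<in>UNIV. a x * (\<Sum>i\<in>UNIV. b i * (v i $ x * v i $ y)))"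
      by (subst sum.swap) (simp add: sum_distrib_left)
    finally show ?thesis by (simp add: brel)
  qed
  have vspan: "x \<in> vec.span (range v)" for x
  proof -
    have "\<nu> (\<beta> i) \<in> vec.span (range v)" for i
    proof -
      have "\<nu> (\<beta> i) = (1 / e i) *s v i" using e by (simp add: v_def)
      then show ?thesis by (simp add: vec.span_scale vec.span_base)
    qed
    moreover have "\<nu> ` X = range (\<lambda>i. \<nu> (\<beta> i))" using \<beta> by (auto simp: bij_betw_def)
    ultimately have "vec.span (\<nu> ` X) \<subseteq> vec.span (range v)" by (intro vec.span_minimal) auto
    then show ?thesis using span by auto
  qed
  let ?V = "(\<chi> x i. b i * v i $ x) :: 'K ^ ('n \<times> bool) ^ 'n"
  let ?T = "(\<chi> i x. v i $ x) :: 'K ^ 'n ^ ('n \<times> bool)"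
  have W1: "form_vals v 1 = range ((*v) ?T)"
    unfolding form_vals_1 by (auto simp: matrix_vector_mult_def mult.commute)
  have surj: "range ((*v) ?V) = UNIV"
  proof -
    have "v i \<in> range ((*v) ?V)" for i
    proof (rule range_eqI)
      show "v i = ?V *v axis i (1 / b i)"
        using b0 by (simp add: matrix_vector_mult_def axis_def vec_eq_iff if_distrib cong: if_cong)
    qed
    then have "vec.span (range v) \<subseteq> range ((*v) ?V)"
      by (intro vec.span_minimal subspace_range) auto
    then show ?thesis using vspan by blast
  qed
  have dimker: "vec.dim {x. ?V *v x = 0} = CARD('n)"
    using rank_nullity[of ?V] unfolding surj
    by (simp add: vec_dim_card card_cart_basis card_cartesian_product UNIV_Times_UNIV[symmetric] del: UNIV_Times_UNIV)
  have inj: "inj ((*v) ?T)"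
  proof (rule injI)
    fix y z assume e: "?T *v y = ?T *v z"
    have "(\<Sum>x\<in>UNIV. v i $ x * (y - z) $ x) = 0" for i
    proof -
      have "(?T *v y) $ i = (?T *v z) $ i" by (simp only: e)
      then show ?thesis by (simp add: matrix_vector_mult_def right_diff_distrib sum_subtractf)
    qed
    then have "range v \<subseteq> {w. (\<Sum>x\<in>UNIV. w $ x * (y - z) $ x) = 0}" by auto
    then have "vec.span (range v) \<subseteq> {w. (\<Sum>x\<in>UNIV. w $ x * (y - z) $ x) = 0}"
      by (rule vec.span_minimal)
        (auto simp: vec.subspace_def distrib_right sum.distrib mult.assoc simp flip: sum_distrib_left)
    then have *: "(\<Sum>x\<in>UNIV. axis k 1 $ x * (y - z) $ x) = 0" for k using vspan by blast
    have "(y - z) $ k = 0" for k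
    proof -
      have "(\<Sum>x\<in>UNIV. axis k 1 $ x * (y - z) $ x) = (\<Sum>x\<in>UNIV. if x = k then (y - z) $ x else 0)"
        by (rule sum.cong) (auto simp: axis_def)
      then show ?thesis using *[of k] by simp
    qed
    then show "y = z" by (simp add: vec_eq_iff)
  qed
  have dimW1: "vec.dim (form_vals v 1) = CARD('n)"
  proof -
    have "inj_on ((*v) ?T) (vec.span UNIV)" using inj by (rule inj_on_subset) simp
    then have "vec.dim ((*v) ?T ` UNIV) = vec.dim (UNIV :: ('K ^ 'n) set)"
      by (rule vec.dim_image_eq[OF matrix_vector_mul_linear_gen])
    then show ?thesis unfolding W1 vec_dim_card .
  qed
  have "form_vals v 1 \<subseteq> {x. ?V *v x = 0}"
  proof
    fix f assume "f \<in> form_vals v 1"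
    then obtain a where a: "f = (\<chi> i. \<Sum>j\<in>UNIV. a $ j * v i $ j)" unfolding form_vals_1 by blast
    have "(?V *v f) $ y = 0 $ y" for y
      using brel'[of "($) a" y] by (simp add: a matrix_vector_mult_def mult_ac)
    then have "?V *v f = 0" by (rule vec_fun_eqI)
    then show "f \<in> {x. ?V *v x = 0}" by blast
  qed
  then have W1ker: "form_vals v 1 = {x. ?V *v x = 0}"
    by (intro vec.subspace_dim_equal form_vals_subspace subspace_null) (simp_all only: dimW1 dimker order_refl)
  have coord1: "coordf v y \<in> form_vals v 1" for y using coordf_mult[OF one_W0, of v y] by simp
  show ?thesis
    unfolding arithmetically_gorenstein_def
  proof (rule v.gorenstein_if_relation[OF h, of b])
    show "b i \<noteq> 0" for i by (rule b0)
  next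
    fix f assume "f \<in> form_vals v 2"
    then obtain g where g: "f = (\<Sum>y\<in>UNIV. coordf v y * g y)" "\<And>y. g y \<in> form_vals v 1"
      by (auto simp: form_vals.simps(2) eval_nat_numeral)
    have "\<forall>y. \<exists>a. g y = (\<chi> i. \<Sum>j\<in>UNIV. a $ j * v i $ j)" using g(2) unfolding form_vals_1 by blast
    then obtain a where a: "\<And>y. g y = (\<chi> i. \<Sum>j\<in>UNIV. a y $ j * v i $ j)" by metis
    have "(\<Sum>i\<in>UNIV. b i * f $ i) = (\<Sum>i\<in>UNIV. \<Sum>y\<in>UNIV. b i * ((\<Sum>x\<in>UNIV. a y $ x * v i $ x) * v i $ y))"
      by (simp add: g(1) a coordf_def sum_distrib_left mult_ac)
    also have "\<dots> = 0" by (subst sum.swap) (simp add: brel')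
    finally show "(\<Sum>i\<in>UNIV. b i * f $ i) = 0" .
  next
    fix f assume f: "\<And>g. g \<in> form_vals v 1 \<Longrightarrow> (\<Sum>i\<in>UNIV. b i * (f * g) $ i) = 0"
    have "(\<Sum>i\<in>UNIV. b i * (f * coordf v y) $ i) = 0" for y by (rule f[OF coord1])
    then show "f \<in> form_vals v 1" unfolding W1ker
      by (simp add: matrix_vector_mult_def vec_eq_iff coordf_def mult_ac)
  next
    fix g assume g: "\<And>x. x \<in> form_vals v 1 \<Longrightarrow> x * g \<in> form_vals v 1"
    have "\<forall>y. \<exists>a. coordf v y * g = (\<chi> i. \<Sum>j\<in>UNIV. a $ j * v i $ j)"
      using g[OF coord1] unfolding form_vals_1 by blast
    then obtain a where a: "\<And>y. coordf v y * g = (\<chi> i. \<Sum>j\<in>UNIV. a y $ j * v i $ j)" by metis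
    have A: "(\<chi> y. a y) *v v i = (g $ i) *s v i" for i
    proof (rule vec_fun_eqI)
      fix y
      have "(coordf v y * g) $ i = (\<Sum>j\<in>UNIV. a y $ j * v i $ j)" by (simp only: a vec_lambda_beta)
      then show "((\<chi> y. a y) *v v i) $ y = ((g $ i) *s v i) $ y"
        by (simp add: matrix_vector_mult_def coordf_def mult.commute)
    qed
    have "\<exists>k. \<forall>p\<in>X. g $ (inv_into UNIV \<beta> p) = k"
    proof (rule indec)
      fix p assume "p \<in> X"
      then obtain i where i: "p = \<beta> i" using \<beta> by (auto simp: bij_betw_def)
      have inv: "inv_into UNIV \<beta> p = i" using \<beta> i by (simp add: bij_betw_def)
      have "\<nu> p = (1 / e i) *s v i" using e i by (simp add: v_def)
      then show "(\<chi> y. a y) *v \<nu> p = (g $ (inv_into UNIV \<beta> p)) *s \<nu> p"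
        unfolding inv using A[of i] by (simp add: vector_scalar_commute mult.commute)
    qed
    then obtain k where k: "\<forall>p\<in>X. g $ (inv_into UNIV \<beta> p) = k" by blast
    have "g $ i = k" for i using k[rule_format, OF \<beta>X[of i]] \<beta> by (simp add: bij_betw_def)
    then show "\<exists>k. g = k *s 1" by (intro exI[of _ k]) (simp add: vec_eq_iff)
  next
    show "\<exists>i k :: 'n \<times> bool. i \<noteq> k"
      by (rule exI[of _ "(undefined, True)"], rule exI[of _ "(undefined, False)"]) simp
  qed
qed

section \<open>Diagonalization of quadratic forms\<close>

definition dot_prod :: "'K::field ^ 'n::finite \<Rightarrow> 'K ^ 'n \<Rightarrow> 'K"
  where "dot_prod x y = (\<Sum>i\<in>UNIV. x $ i * y $ i)"

definition gram :: "'i set \<Rightarrow> ('i \<Rightarrow> 'K::field) \<Rightarrow> ('i \<Rightarrow> 'K ^ 'n::finite) \<Rightarrow> 'K ^ 'n ^ 'n"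
  where "gram J c w = (\<chi> x y. \<Sum>j\<in>J. c j * (w j $ x * w j $ y))"

lemma dot_prod_commute: "dot_prod x y = dot_prod y x"
  by (simp add: dot_prod_def mult.commute)

lemma dot_prod_add: "dot_prod (x + y) z = dot_prod x z + dot_prod y z" "dot_prod x (y + z) = dot_prod x y + dot_prod x z"
  by (simp_all add: dot_prod_def distrib_right distrib_left sum.distrib)

lemma dot_prod_diff: "dot_prod (x - y) z = dot_prod x z - dot_prod y z" "dot_prod x (y - z) = dot_prod x y - dot_prod x z"
  by (simp_all add: dot_prod_def left_diff_distrib right_diff_distrib sum_subtractf)

lemma dot_prod_scale: "dot_prod (c *s x) y = c * dot_prod x y" "dot_prod x (c *s y) = c * dot_prod x y"
  by (simp_all add: dot_prod_def sum_distrib_left mult_ac)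

lemma dot_prod_zero: "dot_prod 0 x = 0" "dot_prod x 0 = 0"
  by (simp_all add: dot_prod_def)

lemma dot_prod_sum: "dot_prod x (sum f I) = (\<Sum>i\<in>I. dot_prod x (f i))"
  by (induction I rule: infinite_finite_induct) (simp_all add: dot_prod_zero dot_prod_add)

lemma dot_prod_axis: "dot_prod (axis i 1) x = x $ i"
proof -
  have "dot_prod (axis i 1) x = (\<Sum>k\<in>UNIV. if k = i then x $ k else 0)"
    unfolding dot_prod_def by (rule sum.cong) (auto simp: axis_def)
  then show ?thesis by simp
qed

lemma mult_nth_dot_prod: "(A *v x) $ i = dot_prod (A $ i) x"
  by (simp add: matrix_vector_mult_def dot_prod_def)

lemma mult_axis_nth: "(A *v axis i 1) $ k = A $ k $ i" for A :: "'K::field ^ 'm::finite ^ 'n::finite"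
  unfolding mult_nth_dot_prod by (simp add: dot_prod_commute[of "A $ k"] dot_prod_axis)

lemma gram_mult: "gram J c w *v z = (\<Sum>j\<in>J. (c j * dot_prod (w j) z) *s w j)"
proof (rule vec_fun_eqI)
  fix x
  have "(gram J c w *v z) $ x = (\<Sum>y\<in>UNIV. \<Sum>j\<in>J. c j * (w j $ x * w j $ y) * z $ y)"
    by (simp add: gram_def matrix_vector_mult_def sum_distrib_right)
  also have "\<dots> = (\<Sum>j\<in>J. \<Sum>y\<in>UNIV. c j * (w j $ x * w j $ y) * z $ y)"
    by (rule sum.swap)
  also have "\<dots> = (\<Sum>j\<in>J. (c j * dot_prod (w j) z) *s w j) $ x"
    by (simp add: dot_prod_def sum_distrib_left sum_distrib_right mult_ac)
  finally show "(gram J c w *v z) $ x = (\<Sum>j\<in>J. (c j * dot_prod (w j) z) *s w j) $ x" .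
qed

lemma symmetric_dot_prod:
  assumes "\<And>x y. Q $ x $ y = Q $ y $ x"
  shows "dot_prod x (Q *v y) = dot_prod y (Q *v x)"
proof -
  have "dot_prod x (Q *v y) = (\<Sum>i\<in>UNIV. \<Sum>j\<in>UNIV. x $ i * (Q $ i $ j * y $ j))"
    by (simp add: dot_prod_def matrix_vector_mult_def sum_distrib_left)
  also have "\<dots> = (\<Sum>j\<in>UNIV. \<Sum>i\<in>UNIV. x $ i * (Q $ i $ j * y $ j))"
    by (rule sum.swap)
  also have "\<dots> = (\<Sum>j\<in>UNIV. \<Sum>i\<in>UNIV. y $ j * (Q $ j $ i * x $ i))"
  proof (intro sum.cong refl)
    fix i j
    show "x $ j * (Q $ j $ i * y $ i) = y $ i * (Q $ i $ j * x $ j)"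
      using assms[of i j] by (simp add: mult_ac)
  qed
  also have "\<dots> = dot_prod y (Q *v x)"
    by (simp add: dot_prod_def matrix_vector_mult_def sum_distrib_left)
  finally show ?thesis .
qed

text \<open>One step of the diagonalization of Lagrange: subtracting a form of rank one puts
  \<open>u\<close> into the kernel.\<close>

definition reduce :: "'K::field ^ 'n::finite ^ 'n \<Rightarrow> 'K ^ 'n \<Rightarrow> 'K ^ 'n ^ 'n"
  where "reduce Q u = (\<chi> x y. Q $ x $ y - (Q *v u) $ x * (Q *v u) $ y / dot_prod u (Q *v u))"

lemma reduce_mult: "reduce Q u *v z = Q *v z - (dot_prod (Q *v u) z / dot_prod u (Q *v u)) *s (Q *v u)"
proof (rule vec_fun_eqI)
  fix x
  have "(reduce Q u *v z) $ x = (\<Sum>y\<in>UNIV. Q $ x $ y * z $ y - (Q *v u) $ x / dot_prod u (Q *v u) * ((Q *v u) $ y * z $ y))"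
    unfolding matrix_vector_mult_def[of "reduce Q u"] vec_lambda_beta
    by (rule sum.cong) (simp_all add: reduce_def left_diff_distrib right_diff_distrib mult_ac)
  also have "\<dots> = (Q *v z) $ x - (Q *v u) $ x / dot_prod u (Q *v u) * dot_prod (Q *v u) z"
    by (simp add: sum_subtractf sum_distrib_left[symmetric] sum_divide_distrib[symmetric] dot_prod_def
        matrix_vector_mult_def[of Q z])
  finally show "(reduce Q u *v z) $ x = (Q *v z - (dot_prod (Q *v u) z / dot_prod u (Q *v u)) *s (Q *v u)) $ x"
    by simp
qed

lemma reduce_null:
  assumes sym: "\<And>x y. Q $ x $ y = Q $ y $ x" and q: "dot_prod u (Q *v u) \<noteq> 0"
  shows "vec.dim {x. reduce Q u *v x = 0} = Suc (vec.dim {x. Q *v x = 0})"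
proof -
  let ?N = "{x. Q *v x = 0}"
  have span: "vec.span ?N = ?N" using subspace_null by (simp add: vec.span_eq_iff)
  have dpu: "dot_prod (Q *v u) x = dot_prod u (Q *v x)" for x
    using symmetric_dot_prod[OF sym, of x u] by (simp add: dot_prod_commute)
  have "{x. reduce Q u *v x = 0} = vec.span (insert u ?N)"
  proof
    have "insert u ?N \<subseteq> {x. reduce Q u *v x = 0}"
      using q by (auto simp: reduce_mult dpu dot_prod_zero)
    then show "vec.span (insert u ?N) \<subseteq> {x. reduce Q u *v x = 0}"
      by (rule vec.span_minimal[OF _ subspace_null])
    show "{x. reduce Q u *v x = 0} \<subseteq> vec.span (insert u ?N)"
    proof safe
      fix x assume x: "reduce Q u *v x = 0"
      let ?t = "dot_prod (Q *v u) x / dot_prod u (Q *v u)"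
      have "Q *v (x - ?t *s u) = 0"
        using x by (simp add: reduce_mult matrix_vector_mult_diff_distrib vector_scalar_commute)
      then have "x - ?t *s u \<in> vec.span (insert u ?N)" by (intro vec.span_base) auto
      moreover have "?t *s u \<in> vec.span (insert u ?N)" by (intro vec.span_scale vec.span_base) auto
      ultimately have "(x - ?t *s u) + ?t *s u \<in> vec.span (insert u ?N)" by (rule vec.span_add)
      then show "x \<in> vec.span (insert u ?N)" by simp
    qed
  qed
  moreover have "u \<notin> vec.span ?N" using q unfolding span by (auto simp: dot_prod_zero)
  ultimately show ?thesis by (simp add: vec.dim_insert)
qed

text \<open>
  If the reduced form \<open>C\<close> is nonzero and alternating, choose \<open>e\<close> and \<open>f\<close> orthogonal to \<open>u\<close> with
  \<open>B e f = 1\<close>; then \<open>u + e\<close> can replace \<open>u\<close>, because \<open>u - B u u f\<close> is orthogonal to it and not isotropic.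
\<close>

lemma reduce_nonalternating:
  fixes Q :: "'K::field ^ 'n::finite ^ 'n"
  assumes sym: "\<And>x y. Q $ x $ y = Q $ y $ x" and u: "dot_prod u (Q *v u) \<noteq> 0"
    and rk: "vec.dim {x. Q *v x = 0} + Suc r = CARD('n)"
  shows "\<exists>u. dot_prod u (Q *v u) \<noteq> 0 \<and> (r = 0 \<or> (\<exists>x. dot_prod x (reduce Q u *v x) \<noteq> 0))"
proof (rule ccontr)
  assume n: "\<not> ?thesis"
  define B where "B x y = dot_prod x (Q *v y)" for x y
  have B_sym: "B x y = B y x" for x y unfolding B_def by (rule symmetric_dot_prod[OF sym])
  have B_add: "B (x + y) z = B x z + B y z" "B z (x + y) = B z x + B z y" for x y z
    by (simp_all add: B_def dot_prod_add matrix_vector_right_distrib)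
  have B_diff: "B (x - y) z = B x z - B y z" "B z (x - y) = B z x - B z y" for x y z
    by (simp_all add: B_def dot_prod_diff matrix_vector_mult_diff_distrib)
  have B_scale: "B (c *s x) z = c * B x z" "B z (c *s x) = c * B z x" for c x z
    by (simp_all add: B_def dot_prod_scale vector_scalar_commute)
  have red: "dot_prod x (reduce Q u *v y) = B x y - B u x * B u y / B u u" for x y u
  proof -
    have 1: "dot_prod (Q *v u) y = B u y"
      using B_sym[of u y] by (simp add: B_def dot_prod_commute[of "Q *v u"])
    have 2: "dot_prod x (Q *v u) = B u x" using B_sym[of u x] by (simp add: B_def)
    show ?thesis
      unfolding reduce_mult dot_prod_diff dot_prod_scale 1 2 by (simp add: B_def)
  qed
  \<comment> \<open>The negated claim: for every nonisotropic \<open>u\<close> the reduced form is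
    alternating.\<close>
  have alt: "B x x = B u x * B u x / B u u" if "B u u \<noteq> 0" for u x
    using n that red[of x u x] by (auto simp: B_def)
  have r: "r \<noteq> 0" using n u by auto
  have "{x. reduce Q u *v x = 0} \<noteq> UNIV"
  proof
    assume "{x. reduce Q u *v x = 0} = UNIV"
    then have "vec.dim (UNIV :: ('K ^ 'n) set) = Suc (vec.dim {x. Q *v x = 0})"
      using reduce_null[OF sym u] by simp
    then show False using rk r unfolding vec_dim_card by simp
  qed
  then obtain f0 where "reduce Q u *v f0 \<noteq> 0" by auto
  then obtain k where k: "(reduce Q u *v f0) $ k \<noteq> 0" by (auto simp: vec_eq_iff)
  define e0 :: "'K ^ 'n" where "e0 = axis k 1"
  define t where "t = dot_prod e0 (reduce Q u *v f0)"
  have t: "t \<noteq> 0" using k by (simp add: t_def e0_def dot_prod_axis)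
  define q where "q = B u u"
  have q: "q \<noteq> 0" using u by (simp add: q_def B_def)
  define e where "e = e0 - (B e0 u / q) *s u"
  define f where "f = (1 / t) *s (f0 - (B f0 u / q) *s u)"
  have eu: "B e u = 0" using q by (simp add: e_def B_diff B_scale q_def)
  have fu: "B f u = 0" using q by (simp add: f_def B_diff B_scale q_def)
  have ee: "B e e = 0" and ff: "B f f = 0"
    using alt[of u e] alt[of u f] q eu fu by (simp_all add: q_def B_sym)
  have tB: "t = B e0 f0 - B u e0 * B u f0 / q"
    by (simp add: t_def red q_def)
  have "B e0 f = (1 / t) * (B e0 f0 - B f0 u / q * B e0 u)"
    by (simp add: f_def B_scale B_diff)
  also have "\<dots> = 1" using t unfolding tB B_sym[of f0 u] B_sym[of e0 u] by (simp add: mult_ac)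
  finally have ef: "B e f = 1"
    using fu by (simp add: e_def B_diff B_scale B_sym[of u f])
  have 1: "B (u + e) (u + e) = q" using eu ee by (simp add: B_add B_sym[of u e] q_def)
  have 2: "B (u + e) (u - q *s f) = 0"
    using eu ef fu by (simp add: B_add B_diff B_scale B_sym[of u f] q_def)
  have 3: "B (u - q *s f) (u - q *s f) = q"
    using fu ff by (simp add: B_diff B_scale B_sym[of u f] q_def)
  show False using alt[of "u + e" "u - q *s f"] 1 2 3 q by simp
qed

text \<open>\<open>r\<close> is the rank. The last assumption excludes nonzero alternating forms,
  which are symmetric in characteristic two and cannot be diagonalized.\<close>

lemma diagonalize:
  fixes Q :: "'K::field ^ 'n::finite ^ 'n"
  assumes "\<And>x y. Q $ x $ y = Q $ y $ x" and "vec.dim {x. Q *v x = 0} + r = CARD('n)"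
    and "r = 0 \<or> (\<exists>x. dot_prod x (Q *v x) \<noteq> 0)"
  shows "\<exists>c w. (\<forall>j<r. c j \<noteq> 0) \<and> Q = gram {..<r} c w"
  using assms
proof (induction r arbitrary: Q)
  case 0
  have "{x. Q *v x = 0} = UNIV"
    using vec.subspace_dim_equal[OF subspace_null[of Q] vec.subspace_UNIV] 0(2) unfolding vec_dim_card by auto
  then have "Q *v axis k 1 = 0" for k by blast
  then have "(Q *v axis k 1) $ i = 0" for k i by simp
  then have "Q = 0" by (simp add: vec_eq_iff mult_axis_nth[symmetric])
  then show ?case by (simp add: gram_def vec_eq_iff)
next
  case (Suc r)
  obtain u where u: "dot_prod u (Q *v u) \<noteq> 0" "r = 0 \<or> (\<exists>x. dot_prod x (reduce Q u *v x) \<noteq> 0)"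
    using reduce_nonalternating[OF Suc.prems(1) _ Suc.prems(2)] Suc.prems(3) by blast
  have "\<exists>c w. (\<forall>j<r. c j \<noteq> 0) \<and> reduce Q u = gram {..<r} c w"
  proof (rule Suc.IH[OF _ _ u(2)])
    show "reduce Q u $ x $ y = reduce Q u $ y $ x" for x y
      using Suc.prems(1) by (simp add: reduce_def mult.commute)
    show "vec.dim {x. reduce Q u *v x = 0} + r = CARD('n)"
      using reduce_null[OF Suc.prems(1) u(1)] Suc.prems(2) by simp
  qed
  then obtain c w where cw: "\<forall>j<r. c j \<noteq> 0" "reduce Q u = gram {..<r} c w" by blast
  let ?c = "c(r := 1 / dot_prod u (Q *v u))" and ?w = "w(r := Q *v u)"
  have "Q $ x $ y = gram {..<Suc r} ?c ?w $ x $ y" for x y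
  proof -
    have "reduce Q u $ x $ y = (\<Sum>j<r. c j * (w j $ x * w j $ y))"
      by (simp add: cw(2) gram_def)
    then show ?thesis by (simp add: gram_def reduce_def algebra_simps)
  qed
  then have "Q = gram {..<Suc r} ?c ?w" by (simp add: vec_eq_iff)
  moreover have "\<forall>j<Suc r. ?c j \<noteq> 0" using cw(1) u(1) by (auto simp: less_Suc_eq)
  ultimately show ?case by blast
qed

text \<open>The range lies in the span of \<open>card J\<close> vectors; if its dimension is at
  least that number, every inequality in between is an equality.\<close>

lemma gram_range:
  assumes J: "finite J" and le: "card J \<le> vec.dim (range ((*v) (gram J c w)))"
  shows "range ((*v) (gram J c w)) = vec.span (w ` J)" "inj_on w J" "vec.independent (w ` J)"
    "vec.dim (vec.span (w ` J)) = card J"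
proof -
  have sub: "range ((*v) (gram J c w)) \<subseteq> vec.span (w ` J)"
  proof safe
    fix z
    show "gram J c w *v z \<in> vec.span (w ` J)"
      unfolding gram_mult by (intro vec.span_sum vec.span_scale vec.span_base) auto
  qed
  have 1: "vec.dim (range ((*v) (gram J c w))) \<le> vec.dim (vec.span (w ` J))"
    using sub by (rule vec.dim_subset)
  have 2: "vec.dim (vec.span (w ` J)) \<le> card (w ` J)" using J by (intro vec.dim_le_card) auto
  have 3: "card (w ` J) \<le> card J" using J by (rule card_image_le)
  have eq: "vec.dim (vec.span (w ` J)) = card J" "card (w ` J) = card J"
    using le 1 2 3 by simp_all
  show "range ((*v) (gram J c w)) = vec.span (w ` J)"
    by (rule vec.subspace_dim_equal[OF subspace_range vec.subspace_span sub]) (use le eq in simp)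
  show "inj_on w J" using eq(2) J by (simp add: eq_card_imp_inj_on)
  show "vec.independent (w ` J)"
    using vec.card_eq_dim[of "w ` J" "vec.span (w ` J)"] eq J vec.span_superset[of "w ` J"] by simp
  show "vec.dim (vec.span (w ` J)) = card J" by (rule eq(1))
qed

section \<open>The quadratic form attached to weights on the frame\<close>

locale ortho_data =
  fixes d :: nat and a :: "nat \<Rightarrow> 'K::field ^ 'n::finite" and b :: "'n \<Rightarrow> 'K"
  assumes b: "\<And>i. b i \<noteq> 0"
begin

definition s where "s l m = (\<Sum>i\<in>UNIV. b i * (a l $ i * a m $ i))"

text \<open>These vectors span the kernel of \<open>Q\<close> once the orthogonality conditions
  hold: pairing \<open>a l\<close> with \<open>scaled m\<close> gives \<open>s l m\<close>.\<close>

definition scaled where "scaled m = (\<chi> i. b i * a m $ i)"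

definition Q :: "'K ^ 'n ^ 'n"
  where "Q = (\<chi> x y. (if x = y then 1 / b x else 0) - (\<Sum>l<d. a l $ x * a l $ y / s l l))"

lemma dot_prod_scaled: "dot_prod (a l) (scaled m) = s l m"
  by (simp add: dot_prod_def scaled_def s_def mult_ac)

lemma Q_mult: "(Q *v z) $ x = z $ x / b x - (\<Sum>l<d. a l $ x * (dot_prod (a l) z / s l l))"
proof -
  have "(Q *v z) $ x = (\<Sum>y\<in>UNIV. (if x = y then z $ y / b x else 0) - (\<Sum>l<d. a l $ x * a l $ y / s l l * z $ y))"
    unfolding matrix_vector_mult_def Q_def
    by (simp add: left_diff_distrib sum_distrib_right, rule sum.cong) auto
  also have "\<dots> = z $ x / b x - (\<Sum>y\<in>UNIV. \<Sum>l<d. a l $ x * a l $ y / s l l * z $ y)"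
    by (simp add: sum_subtractf)
  also have "(\<Sum>y\<in>UNIV. \<Sum>l<d. a l $ x * a l $ y / s l l * z $ y) = (\<Sum>l<d. \<Sum>y\<in>UNIV. a l $ x * a l $ y / s l l * z $ y)"
    by (rule sum.swap)
  also have "\<dots> = (\<Sum>l<d. a l $ x * (dot_prod (a l) z / s l l))"
    by (simp add: dot_prod_def sum_distrib_left sum_divide_distrib mult_ac)
  finally show ?thesis .
qed

lemma Q_sym: "Q $ x $ y = Q $ y $ x"
  by (simp add: Q_def mult.commute)

lemma null_subset_span: "{x. Q *v x = 0} \<subseteq> vec.span (scaled ` {..<d})"
proof safe
  fix z assume z: "Q *v z = 0"
  have "z $ x = (\<Sum>l<d. (dot_prod (a l) z / s l l) *s scaled l) $ x" for x
  proof -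
    have "z $ x / b x = (\<Sum>l<d. a l $ x * (dot_prod (a l) z / s l l))" using Q_mult[of z x] z by simp
    then have "z $ x = b x * (\<Sum>l<d. a l $ x * (dot_prod (a l) z / s l l))" using b[of x] by (simp add: field_simps)
    then show ?thesis by (simp add: scaled_def sum_distrib_left mult_ac)
  qed
  then have "z = (\<Sum>l<d. (dot_prod (a l) z / s l l) *s scaled l)" by (simp add: vec_eq_iff)
  then show "z \<in> vec.span (scaled ` {..<d})"
    by (metis (no_types, lifting) imageI vec.span_base vec.span_scale vec.span_sum)
qed

context
  assumes orth: "\<And>l m. l < d \<Longrightarrow> m < d \<Longrightarrow> l \<noteq> m \<Longrightarrow> s l m = 0" and s0: "\<And>l. l < d \<Longrightarrow> s l l \<noteq> 0"
begin

lemma scaled_null: "m < d \<Longrightarrow> Q *v scaled m = 0"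
proof (rule vec_fun_eqI)
  fix x assume m: "m < d"
  have "(\<Sum>l<d. a l $ x * (dot_prod (a l) (scaled m) / s l l)) = (\<Sum>l<d. if l = m then a m $ x else 0)"
    by (rule sum.cong) (use orth s0 m in \<open>auto simp: dot_prod_scaled\<close>)
  then show "(Q *v scaled m) $ x = 0 $ x" using m b[of x] by (simp add: Q_mult scaled_def)
qed

lemma null_eq_span: "{x. Q *v x = 0} = vec.span (scaled ` {..<d})"
  using null_subset_span vec.span_minimal[OF _ subspace_null[of Q], of "scaled ` {..<d}"] scaled_null by auto

lemma dim_null: "vec.dim {x. Q *v x = 0} = d"
proof -
  have z: "\<And>l. l < d \<Longrightarrow> c l = 0" if "(\<Sum>m<d. c m *s scaled m) = 0" for c
  proof -
    fix l assume l: "l < d"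
    have "0 = dot_prod (a l) (\<Sum>m<d. c m *s scaled m)" by (simp add: that dot_prod_zero)
    also have "\<dots> = (\<Sum>m<d. if m = l then c l * s l l else 0)"
      unfolding dot_prod_sum by (rule sum.cong) (use orth l in \<open>auto simp: dot_prod_scale dot_prod_scaled\<close>)
    finally show "c l = 0" using l s0[OF l] by simp
  qed
  have inj: "inj_on scaled {..<d}"
  proof (rule inj_onI)
    fix l m assume *: "l \<in> {..<d}" "m \<in> {..<d}" "scaled l = scaled m"
    then have "dot_prod (a l) (scaled l) = dot_prod (a l) (scaled m)" by simp
    then show "l = m" using * s0 orth unfolding dot_prod_scaled by fastforce
  qed
  have "vec.independent (scaled ` {..<d})"
  proof (rule vec.independent_if_scalars_zero)
    fix f x assume f: "(\<Sum>x\<in>scaled ` {..<d}. f x *s x) = 0" and x: "x \<in> scaled ` {..<d}"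
    then obtain l where l: "l < d" "x = scaled l" by auto
    have "(\<Sum>m<d. f (scaled m) *s scaled m) = 0" using f by (simp add: sum.reindex[OF inj])
    then show "f x = 0" using z[of "\<lambda>m. f (scaled m)"] l by simp
  qed simp
  then show ?thesis
    unfolding null_eq_span using vec.dim_span_eq_card_independent[of "scaled ` {..<d}"] inj
    by (simp add: card_image del: vec.dim_span)
qed

text \<open>The vectors \<open>w j\<close> lie in the image of \<open>Q\<close>, which by symmetry
  is orthogonal to its kernel. The resulting last conclusion is what later separates the new points
  from the given ones.\<close>

lemma extension_vectors:
  assumes "d \<le> CARD('n)" and nonalt: "d = CARD('n) \<or> (\<exists>i. Q $ i $ i \<noteq> 0)"
  obtains c w where "\<And>j. j < CARD('n) - d \<Longrightarrow> c j \<noteq> 0" "Q = gram {..<CARD('n) - d} c w"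
    "inj_on w {..<CARD('n) - d}" "vec.independent (w ` {..<CARD('n) - d})"
    "\<And>j m. j < CARD('n) - d \<Longrightarrow> m < d \<Longrightarrow> dot_prod (w j) (scaled m) = 0"
proof -
  have "CARD('n) - d = 0 \<or> (\<exists>x. dot_prod x (Q *v x) \<noteq> 0)"
  proof (cases "d = CARD('n)")
    case False
    then obtain i where "Q $ i $ i \<noteq> 0" using nonalt by auto
    then have "dot_prod (axis i 1) (Q *v axis i 1) \<noteq> 0"
      by (simp add: dot_prod_axis mult_axis_nth)
    then show ?thesis by blast
  qed simp
  then obtain c w where cw: "\<forall>j<CARD('n) - d. c j \<noteq> 0" "Q = gram {..<CARD('n) - d} c w"
    using diagonalize[OF Q_sym, of "CARD('n) - d"] dim_null assms(1) by auto
  have le: "card {..<CARD('n) - d} \<le> vec.dim (range ((*v) (gram {..<CARD('n) - d} c w)))"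
    using rank_nullity[of Q] dim_null unfolding cw(2)[symmetric] by simp
  have dp0: "dot_prod x (scaled m) = 0" if "x \<in> range ((*v) Q)" "m < d" for x m
    using that scaled_null[OF that(2)] symmetric_dot_prod[OF Q_sym, of "scaled m"]
    by (auto simp: dot_prod_commute[of _ "scaled m"] dot_prod_zero)
  show ?thesis
  proof (rule that[of c w])
    show "inj_on w {..<CARD('n) - d}" "vec.independent (w ` {..<CARD('n) - d})"
      using gram_range[OF finite_lessThan le] by blast+
    fix j m assume j: "j < CARD('n) - d" "m < d"
    have "w j \<in> vec.span (w ` {..<CARD('n) - d})" using j by (intro vec.span_base) auto
    then have "w j \<in> range ((*v) Q)" using gram_range(1)[OF finite_lessThan le] cw(2) by simp
    then show "dot_prod (w j) (scaled m) = 0" using dp0 j by blast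
  qed (use cw in auto)
qed

lemma dim_range: "d \<le> CARD('n) \<Longrightarrow> vec.dim (range ((*v) Q)) = CARD('n) - d"
  using rank_nullity[of Q] dim_null by simp

end

end

text \<open>Moving the \<open>J\<close> part to the other side shows that the form given by the
  first two summands has rank at most \<open>card J\<close>, so its kernel has dimension at least
  \<open>d\<close>. But the kernel lies in the span of the \<open>d\<close> vectors
  \<open>scaled l\<close>. Hence these are independent and lie in the kernel, and comparing
  coefficients gives the values of \<open>s\<close>.\<close>

lemma relation_structure:
  fixes a :: "nat \<Rightarrow> 'K::field ^ 'n::finite"
  assumes c: "\<And>i. c i \<noteq> 0" and g: "\<And>l. l < d \<Longrightarrow> g l \<noteq> 0" and J: "finite J" "card J + d = CARD('n)"
    and rel: "\<And>x y. (if x = y then c x else 0) + (\<Sum>l<d. g l * (a l $ x * a l $ y)) + (\<Sum>j\<in>J. c' j * (w j $ x * w j $ y)) = 0"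
  defines "b \<equiv> \<lambda>i. 1 / c i"
  shows "\<And>l m. l < d \<Longrightarrow> m < d \<Longrightarrow> l \<noteq> m \<Longrightarrow> ortho_data.s a b l m = 0"
    and "\<And>l. l < d \<Longrightarrow> ortho_data.s a b l l = - 1 / g l"
    and "vec.span (w ` J) = range ((*v) (ortho_data.Q d a b))"
proof -
  interpret o: ortho_data d a b by unfold_locales (use c in \<open>simp add: b_def\<close>)
  have bi: "b i = 1 / c i" for i by (simp add: b_def)
  define Q where "Q = gram J (\<lambda>j. - c' j) w"
  have Qxy: "Q $ x $ y = (if x = y then c x else 0) + (\<Sum>l<d. g l * (a l $ x * a l $ y))" for x y
  proof -
    have "Q $ x $ y = - (\<Sum>j\<in>J. c' j * (w j $ x * w j $ y))" by (simp add: Q_def gram_def sum_negf)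
    moreover have "(if x = y then c x else 0) + (\<Sum>l<d. g l * (a l $ x * a l $ y)) = - (\<Sum>j\<in>J. c' j * (w j $ x * w j $ y))"
      using rel[of x y] by (simp only: eq_neg_iff_add_eq_0)
    ultimately show ?thesis by (simp only:)
  qed
  have Qz: "(Q *v z) $ x = c x * z $ x + (\<Sum>l<d. g l * dot_prod (a l) z * a l $ x)" for z x
  proof -
    have "(Q *v z) $ x = (\<Sum>y\<in>UNIV. (if x = y then c x * z $ y else 0) + (\<Sum>l<d. g l * (a l $ x * a l $ y) * z $ y))"
      unfolding matrix_vector_mult_def vec_lambda_beta Qxy
      by (rule sum.cong) (auto simp: distrib_right sum_distrib_right)
    also have "\<dots> = c x * z $ x + (\<Sum>y\<in>UNIV. \<Sum>l<d. g l * (a l $ x * a l $ y) * z $ y)"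
      by (simp add: sum.distrib)
    also have "(\<Sum>y\<in>UNIV. \<Sum>l<d. g l * (a l $ x * a l $ y) * z $ y) = (\<Sum>l<d. \<Sum>y\<in>UNIV. g l * (a l $ x * a l $ y) * z $ y)"
      by (rule sum.swap)
    also have "\<dots> = (\<Sum>l<d. g l * dot_prod (a l) z * a l $ x)"
      by (simp add: dot_prod_def sum_distrib_left sum_distrib_right mult_ac)
    finally show ?thesis .
  qed
  have "range ((*v) Q) \<subseteq> vec.span (w ` J)"
  proof safe
    fix z
    show "Q *v z \<in> vec.span (w ` J)"
      unfolding Q_def gram_mult by (intro vec.span_sum vec.span_scale vec.span_base) auto
  qed
  then have "vec.dim (range ((*v) Q)) \<le> card (w ` J)" using J(1) by (intro vec.dim_le_card) auto
  also have "\<dots> \<le> card J" using J(1) by (rule card_image_le)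
  finally have dN: "d \<le> vec.dim {x. Q *v x = 0}" using rank_nullity[of Q] J(2) by simp
  have N_sub: "{x. Q *v x = 0} \<subseteq> vec.span (o.scaled ` {..<d})"
  proof safe
    fix z assume z: "Q *v z = 0"
    have "z $ x = (\<Sum>l<d. (- g l * dot_prod (a l) z) *s o.scaled l) $ x" for x
    proof -
      have "c x * z $ x + (\<Sum>l<d. g l * dot_prod (a l) z * a l $ x) = 0" using Qz[of z x] z by simp
      then have e: "c x * z $ x = - (\<Sum>l<d. g l * dot_prod (a l) z * a l $ x)" by (simp only: eq_neg_iff_add_eq_0)
      have "z $ x = (c x * z $ x) / c x" using c[of x] by simp
      then have "z $ x = - (\<Sum>l<d. g l * dot_prod (a l) z * a l $ x) / c x" unfolding e .
      then show ?thesis by (simp add: o.scaled_def bi sum_divide_distrib sum_negf)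
    qed
    then have "z = (\<Sum>l<d. (- g l * dot_prod (a l) z) *s o.scaled l)" by (simp add: vec_eq_iff)
    also have "\<dots> \<in> vec.span (o.scaled ` {..<d})"
      by (intro vec.span_sum vec.span_scale vec.span_base) auto
    finally show "z \<in> vec.span (o.scaled ` {..<d})" .
  qed
  have dim_le: "vec.dim (vec.span (o.scaled ` {..<d})) \<le> card (o.scaled ` {..<d})" by (intro vec.dim_le_card) auto
  have card_le: "card (o.scaled ` {..<d}) \<le> d" using card_image_le[of "{..<d}" o.scaled] by simp
  have N: "{x. Q *v x = 0} = vec.span (o.scaled ` {..<d})"
    by (rule vec.subspace_dim_equal[OF subspace_null vec.subspace_span N_sub]) (use dim_le card_le dN in simp)
  have dims: "vec.dim (vec.span (o.scaled ` {..<d})) = d" "card (o.scaled ` {..<d}) = d"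
    using dN dim_le card_le unfolding N by simp_all
  have inj: "inj_on o.scaled {..<d}" using dims(2) by (simp add: eq_card_imp_inj_on)
  have ind: "vec.independent (o.scaled ` {..<d})"
    using vec.card_eq_dim[of "o.scaled ` {..<d}" "vec.span (o.scaled ` {..<d})"] dims
      vec.span_superset[of "o.scaled ` {..<d}"] by simp
  \<comment> \<open>Independence of the vectors \<open>scaled l\<close> is independence of the
    \<open>a l\<close>, because the weights \<open>b\<close> are nonzero.\<close>
  have zero: "f l = 0" if e: "\<And>x. (\<Sum>l<d. f l * a l $ x) = 0" and l: "l < d" for f l
  proof -
    have "(\<Sum>y\<in>o.scaled ` {..<d}. f (inv_into {..<d} o.scaled y) *s y) = (\<Sum>l<d. f l *s o.scaled l)"
      by (simp add: sum.reindex[OF inj] inv_into_f_f[OF inj])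
    also have "\<dots> = 0"
    proof (rule vec_fun_eqI)
      fix x
      have "(\<Sum>l<d. f l *s o.scaled l) $ x = b x * (\<Sum>l<d. f l * a l $ x)"
        by (simp add: o.scaled_def sum_distrib_left mult_ac)
      then show "(\<Sum>l<d. f l *s o.scaled l) $ x = 0 $ x" by (simp add: e)
    qed
    finally have "f (inv_into {..<d} o.scaled (o.scaled l)) = 0"
      using vec.independentD[OF ind, of "o.scaled ` {..<d}" "\<lambda>y. f (inv_into {..<d} o.scaled y)" "o.scaled l"] l by auto
    then show ?thesis using inv_into_f_f[OF inj] l by simp
  qed
  \<comment> \<open>Applying the form to \<open>scaled m\<close> gives \<open>a m\<close> plus a
    combination of the \<open>a l\<close> with coefficients \<open>g l * s l m\<close>; every
    coefficient of the sum must vanish.\<close>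
  have rels: "(if l = m then 1 else 0) + g l * o.s l m = 0" if lm: "l < d" "m < d" for l m
  proof (rule zero[OF _ lm(1)])
    fix x
    have "o.scaled m \<in> {x. Q *v x = 0}" unfolding N using lm by (intro vec.span_base) auto
    then have "(Q *v o.scaled m) $ x = 0" by simp
    then have "a m $ x + (\<Sum>l<d. g l * o.s l m * a l $ x) = 0"
      unfolding Qz o.dot_prod_scaled using c[of x] by (simp add: o.scaled_def bi)
    moreover have "(\<Sum>l<d. (if l = m then 1 else 0) * a l $ x) = (\<Sum>l<d. if l = m then a l $ x else 0)"
      by (rule sum.cong) auto
    ultimately show "(\<Sum>l<d. ((if l = m then 1 else 0) + g l * o.s l m) * a l $ x) = 0"
      using lm by (simp add: distrib_right sum.distrib)
  qed
  show off: "o.s l m = 0" if "l < d" "m < d" "l \<noteq> m" for l m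
    using rels[OF that(1,2)] g[OF that(1)] that(3) by simp
  show diag: "o.s l l = - 1 / g l" if "l < d" for l
  proof -
    have e: "g l * o.s l l = - 1" using rels[OF that that] by (simp add: add_eq_0_iff)
    have "o.s l l = (g l * o.s l l) / g l" using g[OF that] by simp
    then show ?thesis unfolding e .
  qed
  have "Q = o.Q"
  proof -
    have "(\<Sum>l<d. g l * (a l $ x * a l $ y)) = (\<Sum>l<d. - (a l $ x * a l $ y / o.s l l))" for x y
      by (rule sum.cong) (use diag g in auto)
    then show ?thesis by (simp add: vec_eq_iff Qxy o.Q_def bi sum_negf)
  qed
  moreover have "range ((*v) Q) = vec.span (w ` J)"
  proof -
    have "card J \<le> vec.dim (range ((*v) Q))"
      using rank_nullity[of Q] dims(1) J(2) unfolding N by simp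
    then show ?thesis unfolding Q_def by (rule gram_range(1)[OF J(1)])
  qed
  ultimately show "vec.span (w ` J) = range ((*v) o.Q)" by simp
qed

section \<open>Extensions of a frame\<close>

text \<open>Congruence: replacing each \<open>w j\<close> by its image replaces the matrix of the
  relation by its product with \<open>A\<close> on the left and the transpose of \<open>A\<close> on
  the right.\<close>

lemma relation_image:
  fixes w :: "'i \<Rightarrow> 'K::field ^ 'n::finite" and A :: "'K ^ 'n ^ 'm::finite"
  assumes "\<And>x y. (\<Sum>j\<in>J. c j * (w j $ x * w j $ y)) = 0"
  shows "(\<Sum>j\<in>J. c j * ((A *v w j) $ x * (A *v w j) $ y)) = 0"
proof -
  have "c j * ((A *v w j) $ x * (A *v w j) $ y) =
      (\<Sum>p\<in>UNIV. \<Sum>q\<in>UNIV. A $ x $ p * A $ y $ q * (c j * (w j $ p * w j $ q)))" for j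
  proof -
    have "c j * ((A *v w j) $ x * (A *v w j) $ y) =
        (\<Sum>p\<in>UNIV. \<Sum>q\<in>UNIV. c j * ((A $ x $ p * w j $ p) * (A $ y $ q * w j $ q)))"
      unfolding matrix_vector_mult_def vec_lambda_beta sum_product by (simp only: sum_distrib_left)
    also have "\<dots> = (\<Sum>p\<in>UNIV. \<Sum>q\<in>UNIV. A $ x $ p * A $ y $ q * (c j * (w j $ p * w j $ q)))"
      by (intro sum.cong refl) (simp add: mult_ac)
    finally show ?thesis .
  qed
  then have "(\<Sum>j\<in>J. c j * ((A *v w j) $ x * (A *v w j) $ y)) =
      (\<Sum>j\<in>J. \<Sum>p\<in>UNIV. \<Sum>q\<in>UNIV. A $ x $ p * A $ y $ q * (c j * (w j $ p * w j $ q)))" by simp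
  also have "\<dots> = (\<Sum>p\<in>UNIV. \<Sum>j\<in>J. \<Sum>q\<in>UNIV. A $ x $ p * A $ y $ q * (c j * (w j $ p * w j $ q)))"
    by (rule sum.swap)
  also have "\<dots> = (\<Sum>p\<in>UNIV. \<Sum>q\<in>UNIV. \<Sum>j\<in>J. A $ x $ p * A $ y $ q * (c j * (w j $ p * w j $ q)))"
    by (intro sum.cong refl sum.swap)
  also have "\<dots> = 0" by (simp add: sum_distrib_left[symmetric] assms)
  finally show ?thesis .
qed

lemma proj_point_rep: "p \<in> proj_points \<Longrightarrow> \<exists>w. w \<noteq> 0 \<and> p = vec.span {w}"
  by (auto simp: proj_points_def)

lemma span_singleton_eq:
  assumes "vec.span {x} = vec.span {y}"
  obtains t :: "'K::field" where "x = t *s (y :: 'K ^ 'n::finite)"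
proof -
  have "x \<in> vec.span {y}" using assms vec.span_base[of x "{x}"] by auto
  then show ?thesis using that by (auto simp: vec.span_singleton)
qed

lemma card_index: "card ((UNIV :: 'n::finite set) <+> {..<d::nat}) = CARD('n) + d"
  by (simp add: card_Plus)

text \<open>The columns of \<open>P\<close> represent \<open>CARD('n)\<close> of the points and
  \<open>R\<close> is the inverse matrix. In these coordinates the points are the axis vectors
  together with the \<open>a l\<close>.\<close>

locale frame =
  fixes P R :: "'K::field ^ 'n::finite ^ 'n" and d :: nat and a :: "nat \<Rightarrow> 'K ^ 'n"
  assumes RP: "R ** P = mat 1" and PR: "P ** R = mat 1"
    and inf: "infinite (UNIV :: 'K set)" and n2: "CARD('n) \<ge> 2" and d_le: "d \<le> CARD('n)"
begin

lemma RP_cancel: "R *v (P *v x) = x" and PR_cancel: "P *v (R *v x) = x"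
  by (simp_all add: matrix_vector_mul_assoc RP PR)

lemma P_zero: "P *v x = 0 \<Longrightarrow> x = 0"
  using RP_cancel[of x] by simp

definition pt where "pt x = vec.span {P *v x}"

definition G where "G k = (case k of Inl i \<Rightarrow> axis i 1 | Inr l \<Rightarrow> a l)"

abbreviation I0 :: "('n + nat) set" where "I0 \<equiv> UNIV <+> {..<d}"

definition \<Gamma> where "\<Gamma> = (\<lambda>k. pt (G k)) ` I0"

lemma pt_eq:
  assumes "pt x = pt y" obtains t where "x = t *s y"
proof -
  obtain t where "P *v x = t *s (P *v y)" using assms unfolding pt_def by (rule span_singleton_eq)
  then have "R *v (P *v x) = t *s (R *v (P *v y))" by (simp add: vector_scalar_commute)
  then have "x = t *s y" by (simp add: RP_cancel)
  then show ?thesis by (rule that)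
qed

lemma pt_point: "x \<noteq> 0 \<Longrightarrow> pt x \<in> proj_points"
  unfolding pt_def proj_points_def using P_zero by blast

lemma axis_neq_0: "axis i (1::'K) \<noteq> 0"
  by (metis axis_nth zero_index zero_neq_one)

text \<open>Vectors \<open>w\<close> as obtained from diagonalizing \<open>Q\<close> complete the frame to an arithmetically Gorenstein set.\<close>

theorem extension_exists:
  assumes d1: "1 \<le> d" and b: "\<And>i. b i \<noteq> 0" and a0: "\<And>l i. l < d \<Longrightarrow> a l $ i \<noteq> 0"
    and orth: "\<And>l m. l < d \<Longrightarrow> m < d \<Longrightarrow> l \<noteq> m \<Longrightarrow> ortho_data.s a b l m = 0"
    and s0: "\<And>l. l < d \<Longrightarrow> ortho_data.s a b l l \<noteq> 0"
    and nonalt: "d = CARD('n) \<or> (\<exists>i. ortho_data.Q d a b $ i $ i \<noteq> 0)"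
  shows "\<exists>\<Gamma>'. gorenstein_extension (2 * CARD('n)) \<Gamma> \<Gamma>'"
proof -
  interpret o: ortho_data d a b by unfold_locales (rule b)
  obtain c w where c: "\<And>j. j < CARD('n) - d \<Longrightarrow> c j \<noteq> 0" "o.Q = gram {..<CARD('n) - d} c w"
    and w: "inj_on w {..<CARD('n) - d}" "vec.independent (w ` {..<CARD('n) - d})"
    "\<And>j m. j < CARD('n) - d \<Longrightarrow> m < d \<Longrightarrow> dot_prod (w j) (o.scaled m) = 0"
    using o.extension_vectors[OF orth s0 d_le nonalt] by blast
  define K where "K = {..<CARD('n) - d}"
  define I where "I = (UNIV :: 'n set) <+> ({..<d} <+> K)"
  define z where "z k = (case k of Inl i \<Rightarrow> axis i 1 | Inr (Inl l) \<Rightarrow> a l | Inr (Inr j) \<Rightarrow> w j)" for k :: "'n + nat + nat"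
  define e where "e k = (case k of Inl i \<Rightarrow> 1 / b i | Inr (Inl l) \<Rightarrow> - 1 / o.s l l | Inr (Inr j) \<Rightarrow> - c j)" for k :: "'n + nat + nat"
  have a_nz: "a l \<noteq> 0" if "l < d" for l using a0[OF that] by (auto simp: vec_eq_iff)
  have w_nz: "w j \<noteq> 0" if "j \<in> K" for j
    using w(2) that vec.dependent_zero[of "w ` {..<CARD('n) - d}"] by (auto simp: K_def)
  obtain i1 i2 :: 'n where i12: "i1 \<noteq> i2"
  proof -
    have "\<not> is_singleton (UNIV :: 'n set)" using n2 by (auto simp: is_singleton_altdef)
    then show ?thesis using that by (metis UNIV_I is_singletonI' empty_iff)
  qed
  have z_nz: "z k \<noteq> 0" if "k \<in> I" for k
    using that a_nz w_nz axis_neq_0 by (auto simp: I_def z_def)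
  \<comment> \<open>No two of the \<open>2 * CARD('n)\<close> vectors are proportional: the
    \<open>a l\<close> are told apart by orthogonality, the \<open>w j\<close> by independence, and
    vectors of different kinds by entries or by pairing with some \<open>scaled m\<close>.\<close>
  have ne: "z k \<noteq> t *s z k'" if k: "k \<in> I" "k' \<in> I" "k \<noteq> k'" for k k' t
  proof
    assume eq: "z k = t *s z k'"
    then have t0: "t \<noteq> 0" using z_nz[OF k(1)] by auto
    have ax: "axis i 1 \<noteq> t *s axis i' (1::'K)" if "i \<noteq> i'" for i i' :: 'n and t
    proof
      assume "axis i 1 = t *s axis i' (1::'K)"
      then have "axis i 1 $ i = (t *s axis i' (1::'K)) $ i" by simp
      then show False using that by (simp add: axis_def)
    qed
    have aa: "a l \<noteq> t *s a m" if "l < d" "m < d" "l \<noteq> m" for l m t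
    proof
      assume e: "a l = t *s a m"
      have "o.s l m = t * o.s m m" unfolding o.dot_prod_scaled[symmetric] e dot_prod_scale by simp
      then have "t = 0" using orth s0 that by auto
      then show False using e a_nz that by auto
    qed
    have xa: "axis i 1 \<noteq> t *s a l" if "l < d" for i l t
    proof
      assume e: "axis i 1 = t *s a l"
      obtain i' where i': "i' \<noteq> i" using i12 by metis
      have "axis i 1 $ i' = t * a l $ i'" using e by simp
      then have "t = 0" using a0[OF that, of i'] i' by (simp add: axis_def)
      then show False using e axis_neq_0 by auto
    qed
    have ww: "w j \<noteq> t *s w j'" if "j \<in> K" "j' \<in> K" "j \<noteq> j'" for j j' t
    proof
      assume e: "w j = t *s w j'"
      have "w j \<noteq> w j'" using w(1) that by (auto simp: K_def inj_on_def)
      then have "w j' \<in> w ` K - {w j}" using that by auto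
      then have "w j \<in> vec.span (w ` K - {w j})" using e by (metis vec.span_base vec.span_scale)
      then show False using w(2) that by (auto simp: vec.dependent_def K_def)
    qed
    \<comment> \<open>\<open>w j\<close> is orthogonal to \<open>scaled 0\<close>, all of whose
      entries are nonzero; this uses that there is at least one \<open>a l\<close>.\<close>
    have xw: "axis i 1 \<noteq> t *s w j" if "j \<in> K" for i j t
    proof
      assume e: "axis i 1 = t *s w j"
      have "dot_prod (axis i 1) (o.scaled 0) = 0" unfolding e dot_prod_scale using w(3)[of j 0] that d1 by (simp add: K_def)
      then show False using b[of i] a0[of 0 i] d1 by (simp add: dot_prod_axis o.scaled_def)
    qed
    have aw: "a l \<noteq> t *s w j" if "l < d" "j \<in> K" for l j t
    proof
      assume e: "a l = t *s w j"
      have "dot_prod (a l) (o.scaled l) = 0" unfolding e dot_prod_scale using w(3)[of j l] that by (simp add: K_def)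
      then show False using s0 that by (simp add: o.dot_prod_scaled)
    qed
    have rev: "y = (1 / t) *s x" if "x = t *s y" for x y :: "'K ^ 'n" using that t0 by simp
    have ax': "a l \<noteq> t *s axis i 1" if "l < d" for i l
      using rev[of "a l" "axis i 1"] xa[OF that] by blast
    have wx: "w j \<noteq> t *s axis i 1" if "j \<in> K" for i j
      using rev[of "w j" "axis i 1"] xw[OF that] by blast
    have wa: "w j \<noteq> t *s a l" if "l < d" "j \<in> K" for l j
      using rev[of "w j" "a l"] aw[OF that] by blast
    show False
      using k eq ax[of _ _ t] aa[of _ _ t] ww[of _ _ t] xa[of _ _ t] ax' xw[of _ _ t] wx aw[of _ _ t] wa
      unfolding I_def z_def by (elim PlusE) auto
  qed
  have finI: "finite I" by (auto simp: I_def K_def)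
  have cardI: "card I = 2 * CARD('n)" using d_le by (simp add: I_def K_def card_Plus)
  have inj: "inj_on (\<lambda>k. pt (z k)) I"
  proof (rule inj_onI, rule ccontr)
    fix k k' assume kk: "k \<in> I" "k' \<in> I" "pt (z k) = pt (z k')" "k \<noteq> k'"
    obtain t where "z k = t *s z k'" using kk(3) by (rule pt_eq)
    then show False using ne[OF kk(1,2,4)] by blast
  qed
  \<comment> \<open>Frame and \<open>a l\<close> contribute the definition of \<open>Q\<close>, and
    the \<open>w j\<close> contribute its diagonalization with opposite sign.\<close>
  have rel: "(\<Sum>k\<in>I. e k * (z k $ x * z k $ y)) = 0" for x y
  proof -
    have "(\<Sum>k\<in>I. e k * (z k $ x * z k $ y)) = (\<Sum>i\<in>UNIV. 1 / b i * (axis i 1 $ x * axis i 1 $ y))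
      + ((\<Sum>l<d. - 1 / o.s l l * (a l $ x * a l $ y)) + (\<Sum>j\<in>K. - c j * (w j $ x * w j $ y)))"
      by (simp add: I_def K_def sum.Plus e_def z_def o_def)
    also have "(\<Sum>i\<in>UNIV. 1 / b i * (axis i 1 $ x * axis i 1 $ y)) = (\<Sum>i\<in>UNIV. if i = x then (if x = y then 1 / b x else 0) else 0)"
      by (rule sum.cong) (auto simp: axis_def)
    also have "\<dots> = (if x = y then 1 / b x else 0)" by simp
    also have "(\<Sum>l<d. - 1 / o.s l l * (a l $ x * a l $ y)) = - (\<Sum>l<d. a l $ x * a l $ y / o.s l l)"
      by (simp add: sum_negf)
    also have "(\<Sum>j\<in>K. - c j * (w j $ x * w j $ y)) = - o.Q $ x $ y"
      unfolding c(2) by (simp add: gram_def K_def sum_negf)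
    finally show ?thesis by (simp add: o.Q_def)
  qed
  define X where "X = (\<lambda>k. pt (z k)) ` I"
  define \<nu> where "\<nu> p = P *v z (inv_into I (\<lambda>k. pt (z k)) p)" for p
  have \<nu>z: "\<nu> (pt (z k)) = P *v z k" if "k \<in> I" for k
    unfolding \<nu>_def using inv_into_f_f[OF inj that] by simp
  have X: "finite X" "card X = 2 * CARD('n)" using finI cardI card_image[OF inj] by (auto simp: X_def)
  have \<nu>: "\<nu> p \<noteq> 0 \<and> p = vec.span {\<nu> p}" if p: "p \<in> X" for p
  proof -
    obtain k where k: "k \<in> I" "p = pt (z k)" using p by (auto simp: X_def)
    have "\<nu> p = P *v z k" using k \<nu>z by simp
    moreover have "P *v z k \<noteq> 0" using P_zero z_nz[OF k(1)] by blast
    ultimately show ?thesis using k(2) by (simp add: pt_def)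
  qed
  have "arithmetically_gorenstein X"
  proof (rule relation_imp_gorenstein[OF inf X \<nu>, of "\<lambda>p. e (inv_into I (\<lambda>k. pt (z k)) p)"])
    fix p assume "p \<in> X"
    then obtain k where k: "k \<in> I" "inv_into I (\<lambda>k. pt (z k)) p = k"
      using inv_into_f_f[OF inj] by (auto simp: X_def)
    have "e k \<noteq> 0" using k(1) b s0 c(1) by (auto simp: I_def e_def K_def)
    then show "e (inv_into I (\<lambda>k. pt (z k)) p) \<noteq> 0" using k by simp
  next
    fix x y
    have "(\<Sum>p\<in>X. e (inv_into I (\<lambda>k. pt (z k)) p) * (\<nu> p $ x * \<nu> p $ y)) = (\<Sum>k\<in>I. e k * ((P *v z k) $ x * (P *v z k) $ y))"
      unfolding X_def by (simp add: sum.reindex[OF inj] inv_into_f_f[OF inj] \<nu>_def)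
    also have "\<dots> = 0" by (rule relation_image[OF rel])
    finally show "(\<Sum>p\<in>X. e (inv_into I (\<lambda>k. pt (z k)) p) * (\<nu> p $ x * \<nu> p $ y)) = 0" .
  next
    have "P *v axis i 1 \<in> \<nu> ` X" for i
    proof -
      have "Inl i \<in> I" unfolding I_def by (rule InlI[OF UNIV_I])
      moreover from this have "pt (z (Inl i)) \<in> X" unfolding X_def by (rule imageI)
      moreover have "z (Inl i) = axis i 1" by (simp add: z_def)
      ultimately show ?thesis using \<nu>z by (metis imageI)
    qed
    then have base: "P *v axis i 1 \<in> vec.span (\<nu> ` X)" for i by (intro vec.span_base)
    have "x \<in> vec.span (\<nu> ` X)" for x
    proof -
      have "R *v x = (\<Sum>i\<in>UNIV. ((R *v x) $ i) *s axis i 1)" by (simp add: vec_eq_iff axis_def if_distrib cong: if_cong)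
      then have "P *v (R *v x) = P *v (\<Sum>i\<in>UNIV. ((R *v x) $ i) *s axis i 1)" by simp
      also have "\<dots> = (\<Sum>i\<in>UNIV. ((R *v x) $ i) *s (P *v axis i 1))"
        by (simp add: vec.linear_sum[OF matrix_vector_mul_linear_gen] vector_scalar_commute)
      finally have "x = (\<Sum>i\<in>UNIV. ((R *v x) $ i) *s (P *v axis i 1))" by (simp add: PR_cancel)
      moreover have "(\<Sum>i\<in>UNIV. ((R *v x) $ i) *s (P *v axis i 1)) \<in> vec.span (\<nu> ` X)"
        by (intro vec.span_sum vec.span_scale base)
      ultimately show ?thesis by simp
    qed
    then show "vec.span (\<nu> ` X) = UNIV" by blast
  next
    fix A :: "'K ^ 'n ^ 'n" and g assume A: "\<And>p. p \<in> X \<Longrightarrow> A *v \<nu> p = g p *s \<nu> p"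
    \<comment> \<open>\<open>B\<close> is \<open>A\<close> in frame coordinates. It is diagonal
      because the axis vectors are eigenvectors, and the eigenvector \<open>a 0\<close> without zero
      entries makes all eigenvalues equal.\<close>
    define B where "B = R ** A ** P"
    have Bz: "B *v z k = g (pt (z k)) *s z k" if k: "k \<in> I" for k
    proof -
      have "A *v (P *v z k) = g (pt (z k)) *s (P *v z k)"
        using A[of "pt (z k)"] \<nu>z[OF k] k by (simp add: X_def)
      then have "R *v (A *v (P *v z k)) = g (pt (z k)) *s (R *v (P *v z k))"
        by (simp add: vector_scalar_commute)
      then show ?thesis by (simp add: B_def matrix_vector_mul_assoc[symmetric] RP_cancel)
    qed
    have I: "Inl i \<in> I" "Inr (Inl 0) \<in> I" for i using d1 by (auto simp: I_def)
    have Bax: "B $ x $ i = (if x = i then g (pt (z (Inl i))) else 0)" for x i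
    proof -
      have "(B *v axis i 1) $ x = (g (pt (z (Inl i))) *s axis i 1) $ x" using Bz[OF I(1)[of i]] by (simp add: z_def)
      then show ?thesis unfolding mult_axis_nth by (simp add: axis_def)
    qed
    define g0 where "g0 = g (pt (z (Inr (Inl 0))))"
    have gi: "g (pt (z (Inl i))) = g0" for i
    proof -
      have "(B *v a 0) $ i = g0 * a 0 $ i" using Bz[OF I(2)] by (simp add: z_def g0_def)
      moreover have "(B *v a 0) $ i = g (pt (z (Inl i))) * a 0 $ i"
      proof -
        have "(B *v a 0) $ i = (\<Sum>j\<in>UNIV. if i = j then g (pt (z (Inl i))) * a 0 $ j else 0)"
          unfolding matrix_vector_mult_def vec_lambda_beta by (rule sum.cong) (auto simp: Bax)
        then show ?thesis by simp
      qed
      ultimately show ?thesis using a0[of 0 i] d1 by simp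
    qed
    have Bx: "B *v x = g0 *s x" for x
    proof (rule vec_fun_eqI)
      fix i
      have "(B *v x) $ i = (\<Sum>j\<in>UNIV. if i = j then g0 * x $ j else 0)"
        unfolding matrix_vector_mult_def vec_lambda_beta by (rule sum.cong) (auto simp: Bax gi)
      then show "(B *v x) $ i = (g0 *s x) $ i" by simp
    qed
    have "g p = g0" if p: "p \<in> X" for p
    proof -
      obtain k where k: "k \<in> I" "p = pt (z k)" using p by (auto simp: X_def)
      have "g p *s z k = g0 *s z k" unfolding k(2) Bz[OF k(1), symmetric] by (rule Bx)
      then show ?thesis by (rule vec.scale_right_imp_eq[OF z_nz[OF k(1)]])
    qed
    then show "\<exists>k. \<forall>p\<in>X. g p = k" by blast
  qed
  moreover have "X = \<Gamma> \<union> (\<lambda>j. pt (w j)) ` K"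
  proof -
    have "X = (\<lambda>i. pt (axis i 1)) ` UNIV \<union> ((\<lambda>l. pt (a l)) ` {..<d} \<union> (\<lambda>j. pt (w j)) ` K)"
      by (simp add: X_def I_def Plus_def image_Un image_image z_def)
    moreover have "\<Gamma> = (\<lambda>i. pt (axis i 1)) ` UNIV \<union> (\<lambda>l. pt (a l)) ` {..<d}"
      by (simp add: \<Gamma>_def Plus_def image_Un image_image G_def)
    ultimately show ?thesis by auto
  qed
  moreover have "\<Gamma> \<inter> (\<lambda>j. pt (w j)) ` K = {}"
  proof (rule ccontr)
    assume "\<Gamma> \<inter> (\<lambda>j. pt (w j)) ` K \<noteq> {}"
    then obtain k j where kj: "k \<in> I0" "j \<in> K" "pt (G k) = pt (w j)" by (auto simp: \<Gamma>_def)
    define k' where "k' = ((case k of Inl i \<Rightarrow> Inl i | Inr l \<Rightarrow> Inr (Inl l)) :: 'n + nat + nat)"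
    have "k' \<in> I" "z k' = G k" "k' \<noteq> Inr (Inr j)" "Inr (Inr j) \<in> I" "z (Inr (Inr j)) = w j"
      using kj(1,2) by (auto simp: k'_def I_def z_def G_def)
    then show False using inj kj(3) by (metis inj_on_eq_iff)
  qed
  moreover have "(\<lambda>j. pt (w j)) ` K \<subseteq> proj_points" using pt_point w_nz by auto
  ultimately have "gorenstein_extension (2 * CARD('n)) \<Gamma> ((\<lambda>j. pt (w j)) ` K)"
    unfolding gorenstein_extension_def using X by simp
  then show ?thesis by blast
qed

text \<open>The weights \<open>b\<close> are the inverses of the coefficients that a relation on the
  extended set has at the axis points, after the relation is moved to frame coordinates by
  \<open>R\<close>.\<close>

theorem extension_structure:
  assumes a_nz: "\<And>l. l < d \<Longrightarrow> a l \<noteq> 0" and card: "card \<Gamma> = CARD('n) + d"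
    and ext: "gorenstein_extension (2 * CARD('n)) \<Gamma> \<Gamma>'"
  shows "\<exists>b. (\<forall>i. b i \<noteq> 0) \<and>
    (\<forall>l<d. \<forall>m<d. l \<noteq> m \<longrightarrow> ortho_data.s a b l m = 0) \<and> (\<forall>l<d. ortho_data.s a b l l \<noteq> 0) \<and>
    proj_span \<Gamma>' = (*v) P ` range ((*v) (ortho_data.Q d a b))"
proof -
  let ?X = "\<Gamma> \<union> \<Gamma>'"
  have \<Gamma>': "\<Gamma>' \<subseteq> proj_points" "\<Gamma> \<inter> \<Gamma>' = {}" and X: "finite ?X" "card ?X = 2 * CARD('n)"
    and AG: "arithmetically_gorenstein ?X"
    using ext by (auto simp: gorenstein_extension_def)
  have fin: "finite \<Gamma>" "finite \<Gamma>'" using X(1) by auto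
  have card': "card \<Gamma>' + d = CARD('n)" using card_Un_disjoint[OF fin \<Gamma>'(2)] X(2) card by simp
  have inj: "inj_on (\<lambda>k. pt (G k)) I0"
    by (rule eq_card_imp_inj_on) (simp_all add: card_index card[unfolded \<Gamma>_def])
  have G_nz: "G k \<noteq> 0" if "k \<in> I0" for k using that a_nz axis_neq_0 by (auto simp: G_def)
  \<comment> \<open>Points of the frame keep their given vectors; every other point gets an
    arbitrary representative.\<close>
  define \<omega> where "\<omega> p = (if p \<in> \<Gamma> then G (inv_into I0 (\<lambda>k. pt (G k)) p) else R *v (SOME w. w \<noteq> 0 \<and> p = vec.span {w}))" for p
  have \<omega>G: "\<omega> (pt (G k)) = G k" if "k \<in> I0" for k
    using inv_into_f_f[OF inj that] that by (simp add: \<omega>_def \<Gamma>_def)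
  have rep: "P *v \<omega> p \<noteq> 0 \<and> p = vec.span {P *v \<omega> p}" if p: "p \<in> ?X" for p
  proof (cases "p \<in> \<Gamma>")
    case True
    then obtain k where k: "k \<in> I0" "p = pt (G k)" by (auto simp: \<Gamma>_def)
    show ?thesis using \<omega>G[OF k(1)] k(2) G_nz[OF k(1)] P_zero[of "G k"] by (auto simp: pt_def)
  next
    case False
    then have "p \<in> proj_points" using p \<Gamma>'(1) by auto
    define w where "w = (SOME w. w \<noteq> 0 \<and> p = vec.span {w})"
    have w: "w \<noteq> 0 \<and> p = vec.span {w}"
      unfolding w_def by (rule someI_ex[OF proj_point_rep[OF \<open>p \<in> proj_points\<close>]])
    have "\<omega> p = R *v w" using False by (simp only: \<omega>_def w_def if_False)
    then have e: "P *v \<omega> p = w" by (simp only: PR_cancel)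
    show ?thesis unfolding e by (rule w)
  qed
  obtain c where c: "\<And>p. p \<in> ?X \<Longrightarrow> c p \<noteq> 0"
    "\<And>x y. (\<Sum>p\<in>?X. c p * ((P *v \<omega> p) $ x * (P *v \<omega> p) $ y)) = 0"
    by (rule gorenstein_imp_relation[OF inf n2 X rep AG], assumption, rule that)
  have rel: "(\<Sum>p\<in>?X. c p * (\<omega> p $ x * \<omega> p $ y)) = 0" for x y
    using relation_image[OF c(2), of R x y] by (simp add: RP_cancel)
  define e where "e i = c (pt (axis i 1))" for i
  define g where "g l = c (pt (a l))" for l
  have rel': "(if x = y then e x else 0) + (\<Sum>l<d. g l * (a l $ x * a l $ y)) + (\<Sum>p\<in>\<Gamma>'. c p * (\<omega> p $ x * \<omega> p $ y)) = 0" for x y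
  proof -
    have "0 = (\<Sum>p\<in>\<Gamma>. c p * (\<omega> p $ x * \<omega> p $ y)) + (\<Sum>p\<in>\<Gamma>'. c p * (\<omega> p $ x * \<omega> p $ y))"
      using rel[of x y] sum.union_disjoint[OF fin \<Gamma>'(2), of "\<lambda>p. c p * (\<omega> p $ x * \<omega> p $ y)"] by simp
    also have "(\<Sum>p\<in>\<Gamma>. c p * (\<omega> p $ x * \<omega> p $ y)) = (\<Sum>k\<in>I0. c (pt (G k)) * (G k $ x * G k $ y))"
      unfolding \<Gamma>_def by (simp add: sum.reindex[OF inj] \<omega>G)
    also have "\<dots> = (\<Sum>i\<in>UNIV. e i * (axis i 1 $ x * axis i 1 $ y)) + (\<Sum>l<d. g l * (a l $ x * a l $ y))"
      by (simp add: sum.Plus G_def o_def e_def g_def)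
    also have "(\<Sum>i\<in>UNIV. e i * (axis i 1 $ x * axis i 1 $ y)) = (\<Sum>i\<in>UNIV. if i = x then (if x = y then e x else 0) else 0)"
      by (rule sum.cong) (auto simp: axis_def)
    also have "\<dots> = (if x = y then e x else 0)" by simp
    finally show ?thesis by simp
  qed
  have mem: "pt (axis i 1) \<in> ?X" "l < d \<Longrightarrow> pt (a l) \<in> ?X" for i l
  proof -
    have "pt (G (Inl i)) \<in> \<Gamma>" unfolding \<Gamma>_def by (rule imageI[OF InlI[OF UNIV_I]])
    then show "pt (axis i 1) \<in> ?X" by (simp add: G_def)
    assume "l < d"
    then have "pt (G (Inr l)) \<in> \<Gamma>" unfolding \<Gamma>_def by (intro imageI InrI) simp
    then show "pt (a l) \<in> ?X" by (simp add: G_def)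
  qed
  have e0: "e i \<noteq> 0" for i unfolding e_def by (rule c(1)[OF mem(1)])
  have g0: "g l \<noteq> 0" if "l < d" for l unfolding g_def by (rule c(1)[OF mem(2)[OF that]])
  note st = relation_structure[OF e0 g0 fin(2) card' rel']
  show ?thesis
  proof (intro exI[of _ "\<lambda>i. 1 / e i"] conjI allI impI)
    show "1 / e i \<noteq> 0" for i using e0 by simp
    show "ortho_data.s a (\<lambda>i. 1 / e i) l m = 0" if "l < d" "m < d" "l \<noteq> m" for l m
      by (rule st(1)[OF _ that(1) that(2) that(3)])
    show "ortho_data.s a (\<lambda>i. 1 / e i) l l \<noteq> 0" if "l < d" for l
      using st(2)[OF _ that] g0[OF that] by simp
    have "proj_span \<Gamma>' = vec.span ((\<lambda>p. P *v \<omega> p) ` \<Gamma>')"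
    proof -
      have "p = vec.span {P *v \<omega> p}" if "p \<in> \<Gamma>'" for p using rep[of p] that by blast
      then have "\<Union>\<Gamma>' = (\<Union>p\<in>\<Gamma>'. vec.span {P *v \<omega> p})" by blast
      moreover have "vec.span (\<Union>p\<in>\<Gamma>'. vec.span {P *v \<omega> p}) = vec.span ((\<lambda>p. P *v \<omega> p) ` \<Gamma>')"
      proof (rule vec.span_subspace)
        show "(\<Union>p\<in>\<Gamma>'. vec.span {P *v \<omega> p}) \<subseteq> vec.span ((\<lambda>p. P *v \<omega> p) ` \<Gamma>')"
          by (intro UN_least vec.span_mono) auto
        show "vec.span ((\<lambda>p. P *v \<omega> p) ` \<Gamma>') \<subseteq> vec.span (\<Union>p\<in>\<Gamma>'. vec.span {P *v \<omega> p})"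
          by (rule vec.span_mono) (auto intro: vec.span_base)
      qed (rule vec.subspace_span)
      ultimately show ?thesis by (simp add: proj_span_def)
    qed
    also have "\<dots> = (*v) P ` vec.span (\<omega> ` \<Gamma>')"
      using vec.linear_span_image[OF matrix_vector_mul_linear_gen[of P], of "\<omega> ` \<Gamma>'"] by (simp add: image_image)
    also have "vec.span (\<omega> ` \<Gamma>') = range ((*v) (ortho_data.Q d a (\<lambda>i. 1 / e i)))"
      by (rule st(3)) auto
    finally show "proj_span \<Gamma>' = (*v) P ` range ((*v) (ortho_data.Q d a (\<lambda>i. 1 / e i)))" .
  qed
qed

end

text \<open>
  Nonempty open conditions have a common solution over an infinite field: restrict to the line
  joining two points.
\<close>

lemma common_nonzero:
  fixes L :: "'x \<Rightarrow> 'x \<Rightarrow> 'K::field \<Rightarrow> 'x"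
  assumes inf: "infinite (UNIV :: 'K set)" and "finite S" and V: "x0 \<in> V"
    and L: "\<And>x y. L x y 0 = x" "\<And>x y. L x y 1 = y" "\<And>x y t. x \<in> V \<Longrightarrow> y \<in> V \<Longrightarrow> L x y t \<in> V"
    and poly: "\<And>f x y. f \<in> S \<Longrightarrow> \<exists>q. \<forall>t. f (L x y t) = poly q t"
    and nz: "\<And>f. f \<in> S \<Longrightarrow> \<exists>x\<in>V. f x \<noteq> 0"
  shows "\<exists>x\<in>V. \<forall>f\<in>S. f x \<noteq> 0"
  using assms(2) poly nz
proof (induction S)
  case empty
  then show ?case using V by blast
next
  case (insert f S)
  have "\<exists>x\<in>V. \<forall>f\<in>S. f x \<noteq> 0"
    by (rule insert.IH) (use insert.prems in auto)
  then obtain x where x: "x \<in> V" "\<forall>f\<in>S. f x \<noteq> 0" by blast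
  obtain y where y: "y \<in> V" "f y \<noteq> 0" using insert.prems(2) by blast
  have "\<forall>g\<in>insert f S. \<exists>q. \<forall>t. g (L x y t) = poly q t" using insert.prems(1) by blast
  then obtain q where q: "\<And>g t. g \<in> insert f S \<Longrightarrow> g (L x y t) = poly (q g) t" by metis
  have "q g \<noteq> 0" if "g \<in> insert f S" for g
  proof (cases "g = f")
    case True
    then show ?thesis using q[OF that, of 1] y L(2) by auto
  next
    case False
    then show ?thesis using q[OF that, of 0] x that L(1) by auto
  qed
  then have "\<exists>t. \<forall>p\<in>q ` insert f S. poly p t \<noteq> 0"
    by (intro finite_poly_roots_avoid[OF inf]) (use insert.hyps in auto)
  then obtain t where t: "\<forall>p\<in>q ` insert f S. poly p t \<noteq> 0" by blast
  have "\<forall>g\<in>insert f S. g (L x y t) \<noteq> 0" using q t by auto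
  then show ?case using L(3)[OF x(1) y(1)] by blast
qed

text \<open>A diagonal entry of the form \<open>Q\<close> attached to \<open>b\<close>, with denominators cleared.\<close>

definition diag_form :: "nat \<Rightarrow> (nat \<Rightarrow> 'r::comm_ring_1) \<Rightarrow> 'r \<Rightarrow> (nat \<Rightarrow> 'r) \<Rightarrow> 'r"
  where "diag_form d s b a = (\<Prod>l<d. s l) - b * (\<Sum>l<d. a l ^ 2 * (\<Prod>m\<in>{..<d} - {l}. s m))"

context frame
begin

text \<open>The weights satisfying orthogonality form a linear space \<open>V\<close>, on which all
  remaining conditions are nonvanishing conditions on polynomials. It suffices to satisfy each of
  them by its own element of \<open>V\<close>.\<close>

theorem extension_exists_generic:
  assumes d1: "1 \<le> d" and a0: "\<And>l i. l < d \<Longrightarrow> a l $ i \<noteq> 0"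
    and V: "V = {b. \<forall>l<d. \<forall>m<d. l \<noteq> m \<longrightarrow> (\<Sum>i\<in>UNIV. b i * (a l $ i * a m $ i)) = 0}"
    and b: "\<And>i. \<exists>b\<in>V. b i \<noteq> 0"
    and s: "\<And>l. l < d \<Longrightarrow> \<exists>b\<in>V. (\<Sum>i\<in>UNIV. b i * (a l $ i * a l $ i)) \<noteq> 0"
    and H: "d = CARD('n) \<or> (\<exists>i. \<exists>b\<in>V. diag_form d (\<lambda>l. \<Sum>i\<in>UNIV. b i * (a l $ i * a l $ i)) (b i) (\<lambda>l. a l $ i) \<noteq> 0)"
  shows "\<exists>\<Gamma>'. gorenstein_extension (2 * CARD('n)) \<Gamma> \<Gamma>'"
proof -
  define L where "L x y t = (\<lambda>i. x i + t * (y i - x i))" for x y :: "'n \<Rightarrow> 'K" and t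
  define sf where "sf l b = (\<Sum>i\<in>UNIV. b i * (a l $ i * a l $ i))" for l and b :: "'n \<Rightarrow> 'K"
  define cf' where "cf' i b = b i" for i and b :: "'n \<Rightarrow> 'K"
  define hf where "hf i b = diag_form d (\<lambda>l. sf l b) (b i) (\<lambda>l. a l $ i)" for i b
  \<comment> \<open>A single diagonal entry of \<open>Q\<close> is enough, so one index is fixed and
    only its polynomial joins \<open>S\<close>.\<close>
  obtain i where i: "d = CARD('n) \<or> (\<exists>b\<in>V. hf i b \<noteq> 0)" using H unfolding hf_def sf_def by blast
  define S where "S = range cf' \<union> sf ` {..<d} \<union> (if d = CARD('n) then {} else {hf i})"
  have V0: "(\<lambda>_. 0) \<in> V" by (simp add: V)
  have qb: "\<exists>q. \<forall>t. L x y t i = poly q t" for x y i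
    by (rule exI[of _ "[:x i, y i - x i:]"]) (simp add: L_def)
  have qs: "\<exists>q. \<forall>t. sf l (L x y t) = poly q t" for x y l
  proof -
    have "\<forall>i. \<exists>q. \<forall>t. L x y t i = poly q t" using qb by blast
    then obtain q where q: "\<And>i t. L x y t i = poly (q i) t" by metis
    show ?thesis
      by (rule exI[of _ "\<Sum>i\<in>UNIV. q i * [:a l $ i * a l $ i:]"]) (simp add: sf_def q poly_sum mult.commute)
  qed
  have "\<exists>b\<in>V. \<forall>f\<in>S. f b \<noteq> 0"
  proof (rule common_nonzero[where L = L, OF inf _ V0])
    show "finite S" by (auto simp: S_def)
    show "L x y 0 = x" "L x y 1 = y" for x y by (simp_all add: L_def)
    show "L x y t \<in> V" if "x \<in> V" "y \<in> V" for x y t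
    proof -
      have "(\<Sum>i\<in>UNIV. L x y t i * (a l $ i * a m $ i)) =
        (\<Sum>i\<in>UNIV. x i * (a l $ i * a m $ i)) + t * ((\<Sum>i\<in>UNIV. y i * (a l $ i * a m $ i)) - (\<Sum>i\<in>UNIV. x i * (a l $ i * a m $ i)))" for l m
        by (simp add: L_def algebra_simps sum.distrib sum_subtractf sum_distrib_left)
      then show ?thesis using that by (auto simp: V)
    qed
  next
    fix f x y assume "f \<in> S"
    then consider k where "f = cf' k" | l where "f = sf l" | "f = hf i" by (auto simp: S_def split: if_splits)
    then show "\<exists>q. \<forall>t. f (L x y t) = poly q t"
    proof cases
      case 1
      then show ?thesis using qb by (simp add: cf'_def)
    next
      case 2
      then show ?thesis using qs by simp
    next
      case 3
      have "\<forall>l. \<exists>q. \<forall>t. sf l (L x y t) = poly q t" using qs by blast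
      then obtain q where q: "\<And>l t. sf l (L x y t) = poly (q l) t" by metis
      obtain r where r: "\<And>t. L x y t i = poly r t" using qb by blast
      show ?thesis
        by (rule exI[of _ "diag_form d q r (\<lambda>l. [:a l $ i:])"])
          (simp add: 3 hf_def diag_form_def q r poly_prod poly_sum power2_eq_square mult_ac)
    qed
  next
    fix f assume "f \<in> S"
    then show "\<exists>x\<in>V. f x \<noteq> 0"
      using b s i by (auto simp: S_def cf'_def sf_def split: if_splits)
  qed
  then obtain b where bV: "b \<in> V" and bS: "\<forall>f\<in>S. f b \<noteq> 0" by blast
  have b0: "b i \<noteq> 0" for i using bS by (force simp: S_def cf'_def)
  have s0: "sf l b \<noteq> 0" if "l < d" for l using bS that by (auto simp: S_def)
  have h0: "d = CARD('n) \<or> hf i b \<noteq> 0" using bS by (auto simp: S_def)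
  interpret o: ortho_data d a b by unfold_locales (rule b0)
  have os: "o.s l l = sf l b" for l by (simp add: o.s_def sf_def)
  show ?thesis
  proof (rule extension_exists[OF d1 b0 a0])
    show "o.s l m = 0" if "l < d" "m < d" "l \<noteq> m" for l m using bV that by (simp add: V o.s_def)
    show "o.s l l \<noteq> 0" if "l < d" for l using s0[OF that] os by simp
    have "hf i b = (b i * (\<Prod>l<d. sf l b)) * o.Q $ i $ i"
    proof -
      have "a l $ i ^ 2 * (\<Prod>m\<in>{..<d} - {l}. sf m b) = (\<Prod>l<d. sf l b) * (a l $ i * a l $ i / sf l b)" if "l < d" for l
        using that s0 by (subst prod.remove[of _ l]) (auto simp: power2_eq_square)
      then have "(\<Sum>l<d. a l $ i ^ 2 * (\<Prod>m\<in>{..<d} - {l}. sf m b)) = (\<Prod>l<d. sf l b) * (\<Sum>l<d. a l $ i * a l $ i / sf l b)"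
        by (simp add: sum_distrib_left)
      then show ?thesis using b0[of i] by (simp add: hf_def diag_form_def o.Q_def os algebra_simps)
    qed
    then show "d = CARD('n) \<or> (\<exists>i. o.Q $ i $ i \<noteq> 0)" using h0 by auto
  qed
qed

end

section \<open>Determinantal forms\<close>

definition pairs :: "nat \<Rightarrow> nat set set" where "pairs d = {T. T \<subseteq> {..<d} \<and> card T = 2}"

lemma finite_pairs: "finite (pairs d)"
  by (rule finite_subset[of _ "Pow {..<d}"]) (auto simp: pairs_def)

lemma card_pairs: "card (pairs d) = d choose 2"
  using n_subsets[of "{..<d}" 2] by (simp add: pairs_def)

lemma pairs_iff: "T \<in> pairs d \<longleftrightarrow> (\<exists>l m. l < d \<and> m < d \<and> l \<noteq> m \<and> T = {l, m})"
  by (auto simp: pairs_def card_2_iff)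

text \<open>
  If \<open>\<pi>\<close> maps \<open>S - {i0}\<close> onto the pairs, then the cofactors of the row \<open>i0\<close> solve the orthogonality
  conditions, and they vanish outside \<open>S\<close>.
\<close>

definition pair_matrix :: "'n::finite set \<Rightarrow> 'n \<Rightarrow> ('n \<Rightarrow> nat set) \<Rightarrow> (nat \<Rightarrow> 'n \<Rightarrow> 'r::comm_ring_1) \<Rightarrow> ('n \<Rightarrow> 'r) \<Rightarrow> 'r ^ 'n ^ 'n"
  where "pair_matrix S i0 \<pi> A x = (\<chi> i. if i = i0 then (\<chi> j. x j) else
    (\<chi> j. if i \<in> S then (\<Prod>l\<in>\<pi> i. A l j) else if i = j then 1 else 0))"

definition kernel_vec where "kernel_vec S i0 \<pi> A j = det (pair_matrix S i0 \<pi> A (\<lambda>j'. if j' = j then 1 else 0))"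

text \<open>Expanding along the row \<open>i0\<close> shows that this is \<open>s l l\<close> for
  the weights \<open>kernel_vec\<close>; the determinant form makes its degree easy to read
  off.\<close>

definition kernel_norm where "kernel_norm S i0 \<pi> A l = det (pair_matrix S i0 \<pi> A (\<lambda>j. A l j * A l j))"

lemma det_pair_matrix: "det (pair_matrix S i0 \<pi> A x) = (\<Sum>j\<in>UNIV. kernel_vec S i0 \<pi> A j * x j)"
proof -
  let ?c = "\<lambda>i. (\<chi> j. if i \<in> S then (\<Prod>l\<in>\<pi> i. A l j) else if i = j then 1 else 0)"
  have "(\<chi> j. x j) = (\<Sum>j\<in>UNIV. x j *s (\<chi> j'. if j' = j then 1 else 0))"
    by (simp add: vec_eq_iff if_distrib cong: if_cong)
  then have "pair_matrix S i0 \<pi> A x = (\<chi> i. if i = i0 then (\<Sum>j\<in>UNIV. x j *s (\<chi> j'. if j' = j then 1 else 0)) else ?c i)"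
    unfolding pair_matrix_def by (rule arg_cong[of _ _ "\<lambda>u. (\<chi> i. if i = i0 then u else ?c i)"])
  then have "det (pair_matrix S i0 \<pi> A x) = (\<Sum>j\<in>UNIV. det (\<chi> i. if i = i0 then x j *s (\<chi> j'. if j' = j then 1 else 0) else ?c i))"
    by (simp only:) (rule det_linear_row_sum, simp)
  also have "\<dots> = (\<Sum>j\<in>UNIV. x j * det (\<chi> i. if i = i0 then (\<chi> j'. if j' = j then 1 else 0) else ?c i))"
    by (simp only: det_row_mul)
  finally show ?thesis by (simp add: kernel_vec_def pair_matrix_def mult.commute)
qed

lemma kernel_vec_orth:
  assumes "i \<in> S" "i \<noteq> i0"
  shows "(\<Sum>j\<in>UNIV. kernel_vec S i0 \<pi> A j * (\<Prod>l\<in>\<pi> i. A l j)) = 0"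
proof -
  have "det (pair_matrix S i0 \<pi> A (\<lambda>j. \<Prod>l\<in>\<pi> i. A l j)) = 0"
    by (rule det_identical_rows[OF assms(2)]) (use assms in \<open>simp add: pair_matrix_def row_def vec_eq_iff\<close>)
  then show ?thesis by (simp add: det_pair_matrix)
qed

text \<open>The row of an index outside \<open>S\<close> is a unit vector, and it coincides with the
  row \<open>i0\<close> of the cofactor determinant.\<close>

lemma kernel_vec_outside:
  assumes "i \<notin> S" "i \<noteq> i0"
  shows "kernel_vec S i0 \<pi> A i = 0"
  unfolding kernel_vec_def
  by (rule det_identical_rows[OF assms(2)]) (use assms in \<open>auto simp: pair_matrix_def row_def vec_eq_iff\<close>)

lemma kernel_norm_sum: "kernel_norm S i0 \<pi> A l = (\<Sum>j\<in>UNIV. kernel_vec S i0 \<pi> A j * (A l j * A l j))"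
  by (simp add: kernel_norm_def det_pair_matrix)

lemma det_nonzeroI:
  fixes M :: "'K::field ^ 'n::finite ^ 'n"
  assumes "\<And>x. M *v x = 0 \<Longrightarrow> x = 0"
  shows "det M \<noteq> 0"
proof -
  have "\<exists>B. B ** M = mat 1" unfolding matrix_left_invertible_ker using assms by blast
  then have "invertible M" using invertible_left_inverse by blast
  then show ?thesis by (simp add: invertible_det_nz)
qed

lemma det_nonzeroD:
  fixes M :: "'K::field ^ 'n::finite ^ 'n"
  assumes "det M \<noteq> 0" "M *v x = 0"
  shows "x = 0"
  using assms invertible_det_nz[of M] invertible_left_inverse[of M] matrix_left_invertible_ker[of M] by blast

lemma pair_matrix_mult_nth:
  "(pair_matrix S i0 \<pi> A x *v y) $ i = (if i = i0 then (\<Sum>j\<in>UNIV. x j * y $ j)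
     else if i \<in> S then (\<Sum>j\<in>UNIV. (\<Prod>l\<in>\<pi> i. A l j) * y $ j) else y $ i)"
  by (simp add: pair_matrix_def matrix_vector_mult_def if_distrib[of "\<lambda>x. x * _"] cong: if_cong)

text \<open>The pattern \<open>A l i = 1\<close> if and only if \<open>l \<in> \<sigma> i\<close>: the column \<open>i\<close> only sees the pair \<open>\<sigma> i\<close>.\<close>

lemma prod_pattern:
  assumes "T \<in> pairs d" "T' \<in> pairs d"
  shows "(\<Prod>l\<in>T. if l \<in> T' then 1 else 0 :: 'r::comm_ring_1) = (if T = T' then 1 else 0)"
proof (cases "T = T'")
  case False
  have fin: "finite T" "finite T'" using assms by (auto simp: pairs_def intro: finite_subset)
  have "\<not> T \<subseteq> T'"
  proof
    assume "T \<subseteq> T'"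
    then have "T = T'" using card_subset_eq[OF fin(2)] assms by (auto simp: pairs_def)
    then show False using False by simp
  qed
  then obtain l where "l \<in> T" "l \<notin> T'" by auto
  then have "(\<Prod>l\<in>T. if l \<in> T' then 1 else 0 :: 'r) = 0" using fin by (intro prod_zero) auto
  then show ?thesis using False by simp
qed auto

text \<open>The bijections \<pi> and \<sigma> match rows with columns, and column \<open>j\<close>
  is met only by row \<open>i0\<close>. The matrix is a permutation matrix.\<close>

lemma kernel_vec_pattern:
  fixes A :: "nat \<Rightarrow> 'n::finite \<Rightarrow> 'K::field"
  assumes i0: "i0 \<in> S" and j: "j \<in> S"
    and \<pi>: "bij_betw \<pi> (S - {i0}) (pairs d)" and \<sigma>: "bij_betw \<sigma> (S - {j}) (pairs d)"
    and A: "\<And>l i. A l i = (if i \<in> S - {j} \<and> l \<in> \<sigma> i then 1 else 0)"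
  shows "kernel_vec S i0 \<pi> A j \<noteq> 0"
  unfolding kernel_vec_def
proof (rule det_nonzeroI)
  fix y assume e: "pair_matrix S i0 \<pi> A (\<lambda>j'. if j' = j then 1 else 0) *v y = 0"
  note M = pair_matrix_mult_nth[of S i0 \<pi> A "\<lambda>j'. if j' = j then 1 else 0" y, unfolded e, simplified]
  have "y $ j = 0" using M[of i0] by (simp add: if_distrib[of "\<lambda>x. x * _"] cong: if_cong)
  moreover have "y $ i = 0" if "i \<notin> S" for i
  proof -
    have "i \<noteq> i0" using that i0 by auto
    then show ?thesis using M[of i] that by simp
  qed
  moreover have "y $ k = 0" if k: "k \<in> S - {j}" for k
  proof -
    have "\<sigma> k \<in> \<pi> ` (S - {i0})" using \<pi> \<sigma> k by (auto simp: bij_betw_def)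
    then obtain i where i: "i \<in> S - {i0}" "\<pi> i = \<sigma> k" by auto
    have pr: "(\<Prod>l\<in>\<pi> i. A l k') = (if k' = k then 1 else 0)" for k'
    proof (cases "k' \<in> S - {j}")
      case True
      have "(\<Prod>l\<in>\<pi> i. A l k') = (\<Prod>l\<in>\<pi> i. if l \<in> \<sigma> k' then 1 else 0)" using True by (simp add: A)
      also have "\<dots> = (if \<pi> i = \<sigma> k' then 1 else 0)"
        by (rule prod_pattern[OF bij_betw_apply[OF \<pi> i(1)] bij_betw_apply[OF \<sigma> True]])
      also have "\<pi> i = \<sigma> k' \<longleftrightarrow> k' = k" unfolding i(2) using \<sigma> k True by (auto simp: bij_betw_def inj_on_def)
      finally show ?thesis .
    next
      case False
      have "\<pi> i \<in> pairs d" using \<pi> i by (auto simp: bij_betw_def)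
      then have "finite (\<pi> i)" "\<pi> i \<noteq> {}" by (auto simp: pairs_iff)
      then have "(\<Prod>l\<in>\<pi> i. A l k') = 0" using False by (simp add: A card_gt_0_iff ex_in_conv)
      then show ?thesis using False k by auto
    qed
    show ?thesis using M[of i] i(1) unfolding pr by (simp add: if_distrib[of "\<lambda>x. x * _"] cong: if_cong)
  qed
  ultimately have "y $ i = 0" for i by blast
  then show "y = 0" by (simp add: vec_eq_iff)
qed

text \<open>All columns except \<open>i0\<close> follow the pattern, so a row in \<open>S\<close> is
  a unit vector up to its entry in column \<open>i0\<close>.\<close>

lemma sum_with_pattern:
  fixes A :: "nat \<Rightarrow> 'n::finite \<Rightarrow> 'K::field"
  assumes i0: "i0 \<in> S" and \<pi>: "bij_betw \<pi> (S - {i0}) (pairs d)" and i: "i \<in> S" "i \<noteq> i0"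
    and A: "\<And>l i. i \<noteq> i0 \<Longrightarrow> A l i = (if i \<in> S \<and> l \<in> \<pi> i then 1 else 0)"
  shows "(\<Sum>k\<in>UNIV. (\<Prod>l\<in>\<pi> i. A l k) * y k) = y i + (\<Prod>l\<in>\<pi> i. A l i0) * y i0"
proof -
  have Ti: "\<pi> i \<in> pairs d" using \<pi> i by (auto simp: bij_betw_def)
  have pr: "(\<Prod>l\<in>\<pi> i. A l k) = (if k = i then 1 else 0)" if "k \<noteq> i0" for k
  proof (cases "k \<in> S")
    case True
    have "(\<Prod>l\<in>\<pi> i. A l k) = (\<Prod>l\<in>\<pi> i. if l \<in> \<pi> k then 1 else 0)" using True that by (simp add: A)
    also have "\<dots> = (if \<pi> i = \<pi> k then 1 else 0)"
      by (rule prod_pattern[OF Ti, of _]) (use \<pi> True that in \<open>auto simp: bij_betw_def\<close>)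
    also have "\<pi> i = \<pi> k \<longleftrightarrow> k = i" using \<pi> i True that by (auto simp: bij_betw_def inj_on_def)
    finally show ?thesis .
  next
    case False
    have "finite (\<pi> i)" "\<pi> i \<noteq> {}" using Ti by (auto simp: pairs_iff)
    then have "(\<Prod>l\<in>\<pi> i. A l k) = 0" using False that by (simp add: A card_gt_0_iff ex_in_conv)
    then show ?thesis using False i by auto
  qed
  have "(\<Sum>k\<in>UNIV. (\<Prod>l\<in>\<pi> i. A l k) * y k) = (\<Prod>l\<in>\<pi> i. A l i0) * y i0 + (\<Sum>k\<in>UNIV - {i0}. (\<Prod>l\<in>\<pi> i. A l k) * y k)"
    by (rule sum.remove) auto
  also have "(\<Sum>k\<in>UNIV - {i0}. (\<Prod>l\<in>\<pi> i. A l k) * y k) = (\<Sum>k\<in>UNIV - {i0}. if k = i then y k else 0)"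
    by (rule sum.cong) (auto simp: pr)
  also have "\<dots> = y i" using i(2) by (subst sum.delta) auto
  finally show ?thesis by simp
qed

text \<open>Column \<open>i0\<close> of \<open>A\<close> is supported at \<open>l\<close> alone, so
  every product over a pair vanishes there. A kernel vector is therefore zero away from
  \<open>i0\<close>, and the row of squares kills its last entry.\<close>

lemma kernel_norm_pattern:
  fixes A :: "nat \<Rightarrow> 'n::finite \<Rightarrow> 'K::field"
  assumes i0: "i0 \<in> S" and \<pi>: "bij_betw \<pi> (S - {i0}) (pairs d)" and l: "l < d"
    and A: "\<And>l i. i \<noteq> i0 \<Longrightarrow> A l i = (if i \<in> S \<and> l \<in> \<pi> i then 1 else 0)"
    and Ai0: "\<And>l'. A l' i0 = (if l' = l then 1 else 0)"
  shows "kernel_norm S i0 \<pi> A l \<noteq> 0"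
  unfolding kernel_norm_def
proof (rule det_nonzeroI)
  fix y assume e: "pair_matrix S i0 \<pi> A (\<lambda>j. A l j * A l j) *v y = 0"
  note M = pair_matrix_mult_nth[of S i0 \<pi> A "\<lambda>j. A l j * A l j" y, unfolded e, simplified]
  have out: "y $ i = 0" if "i \<notin> S" for i
  proof -
    have "i \<noteq> i0" using that i0 by auto
    then show ?thesis using M[of i] that by simp
  qed
  have ins: "y $ i = 0" if i: "i \<in> S" "i \<noteq> i0" for i
  proof -
    have "\<pi> i \<in> pairs d" using \<pi> i by (auto simp: bij_betw_def)
    then obtain p q where "p \<noteq> q" "\<pi> i = {p, q}" by (auto simp: pairs_iff)
    then have "(\<Prod>l\<in>\<pi> i. A l i0) = 0" by (auto simp: Ai0)
    then show ?thesis
      using M[of i] i sum_with_pattern[OF i0 \<pi> i A, of "($) y"] by simp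
  qed
  have "0 = (\<Sum>j\<in>UNIV. A l j * A l j * y $ j)" using M[of i0] by simp
  also have "\<dots> = (\<Sum>j\<in>UNIV. if j = i0 then y $ j else 0)"
    by (rule sum.cong) (use out ins in \<open>auto simp: Ai0\<close>)
  finally have "y $ i0 = 0" by simp
  then show "y = 0" using out ins by (metis vec_fun_eqI zero_index)
qed

lemma sum_pairs_containing:
  fixes z :: "nat \<Rightarrow> 'r::comm_ring_1"
  assumes "l < d"
  shows "(\<Sum>T | T \<in> pairs d \<and> l \<in> T. \<Prod>m\<in>T. z m) = z l * (\<Sum>m\<in>{..<d} - {l}. z m)"
proof -
  have "{T. T \<in> pairs d \<and> l \<in> T} = (\<lambda>m. {l, m}) ` ({..<d} - {l})"
  proof (intro equalityI subsetI)
    fix T assume T: "T \<in> {T. T \<in> pairs d \<and> l \<in> T}"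
    then obtain p q where "p < d" "q < d" "p \<noteq> q" "T = {p, q}" by (auto simp: pairs_iff)
    then show "T \<in> (\<lambda>m. {l, m}) ` ({..<d} - {l})" using T by (auto simp: insert_commute)
  qed (use assms in \<open>auto simp: pairs_iff\<close>)
  moreover have "inj_on (\<lambda>m. {l, m}) ({..<d} - {l})" by (auto simp: inj_on_def doubleton_eq_iff)
  ultimately have "(\<Sum>T | T \<in> pairs d \<and> l \<in> T. \<Prod>m\<in>T. z m) = (\<Sum>m\<in>{..<d} - {l}. \<Prod>m\<in>{l, m}. z m)"
    by (simp add: sum.reindex)
  also have "\<dots> = z l * (\<Sum>m\<in>{..<d} - {l}. z m)"
    unfolding sum_distrib_left by (rule sum.cong) auto
  finally show ?thesis .
qed

text \<open>
  In the pattern with last column \<open>z\<close> the kernel is spanned by the vector with last entry \<open>1\<close> and entry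
  \<open>- z p * z q\<close> at the column of the pair \<open>{p, q}\<close>.
\<close>

lemma diag_form_pattern:
  fixes A :: "nat \<Rightarrow> 'n::finite \<Rightarrow> 'K::field" and z :: "nat \<Rightarrow> 'K"
  assumes \<pi>: "bij_betw \<pi> (UNIV - {i0}) (pairs d)" and d: "3 \<le> d"
    and i1: "i1 \<noteq> i0" "\<pi> i1 = {0, 1}"
    and A: "\<And>l i. i \<noteq> i0 \<Longrightarrow> A l i = (if l \<in> \<pi> i then 1 else 0)"
    and Ai0: "\<And>l. A l i0 = z l"
    and z: "z 0 = 1" "z 1 = 1" "\<And>l. l < d \<Longrightarrow> z l \<noteq> 0"
    "\<And>l. l < d \<Longrightarrow> 2 * z l - (\<Sum>m<d. z m) \<noteq> 0" "4 - (\<Sum>m<d. z m) \<noteq> 0"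
  shows "diag_form d (kernel_norm UNIV i0 \<pi> A) (kernel_vec UNIV i0 \<pi> A i1) (\<lambda>l. A l i1) \<noteq> 0"
proof -
  let ?b = "kernel_vec UNIV i0 \<pi> A"
  have A': "\<And>l i. i \<noteq> i0 \<Longrightarrow> A l i = (if i \<in> UNIV \<and> l \<in> \<pi> i then 1 else 0)" using A by simp
  note swp = sum_with_pattern[OF UNIV_I \<pi> UNIV_I _ A']
  define \<delta> where "\<delta> = ?b i0"
  define \<sigma> where "\<sigma> = (\<Sum>m<d. z m)"
  have \<delta>0: "\<delta> \<noteq> 0"
    unfolding \<delta>_def kernel_vec_def
  proof (rule det_nonzeroI)
    fix y assume e: "pair_matrix UNIV i0 \<pi> A (\<lambda>j'. if j' = i0 then 1 else 0) *v y = 0"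
    note M = pair_matrix_mult_nth[of UNIV i0 \<pi> A "\<lambda>j'. if j' = i0 then 1 else 0" y, unfolded e, simplified]
    have y0: "y $ i0 = 0" using M[of i0] by (simp add: if_distrib[of "\<lambda>x. x * _"] cong: if_cong)
    have "y $ i = 0" for i
      using M[of i] y0 swp[of i "($) y"] by (cases "i = i0") simp_all
    then show "y = 0" by (simp add: vec_eq_iff)
  qed
  have bi: "?b i = - (\<Prod>l\<in>\<pi> i. z l) * \<delta>" if "i \<noteq> i0" for i
  proof -
    have "(\<Sum>k\<in>UNIV. (\<Prod>l\<in>\<pi> i. A l k) * ?b k) = 0"
      using kernel_vec_orth[OF UNIV_I that, of \<pi> A] by (simp add: mult.commute)
    then have "?b i + (\<Prod>l\<in>\<pi> i. z l) * \<delta> = 0" using swp[OF that, of ?b] by (simp add: Ai0 \<delta>_def)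
    then show ?thesis by (simp add: eq_neg_iff_add_eq_0)
  qed
  \<comment> \<open>Only pairs containing \<open>l\<close> contribute, each with weight
    \<open>- z l * z m\<close>; up to \<delta> the sum is the square of \<open>z l\<close> minus
    \<open>z l * (\<sigma> - z l)\<close>.\<close>
  have s: "kernel_norm UNIV i0 \<pi> A l = \<delta> * (z l * (2 * z l - \<sigma>))" if l: "l < d" for l
  proof -
    have "kernel_norm UNIV i0 \<pi> A l = ?b i0 * (A l i0 * A l i0) + (\<Sum>j\<in>UNIV - {i0}. ?b j * (A l j * A l j))"
      unfolding kernel_norm_sum by (rule sum.remove) auto
    also have "(\<Sum>j\<in>UNIV - {i0}. ?b j * (A l j * A l j)) = (\<Sum>j\<in>UNIV - {i0}. if l \<in> \<pi> j then - (\<Prod>l\<in>\<pi> j. z l) * \<delta> else 0)"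
      by (rule sum.cong) (auto simp: bi A)
    also have "\<dots> = (\<Sum>T\<in>pairs d. if l \<in> T then - (\<Prod>l\<in>T. z l) * \<delta> else 0)"
      by (rule sum.reindex_bij_betw[OF \<pi>])
    also have "\<dots> = (\<Sum>T | T \<in> pairs d \<and> l \<in> T. - (\<Prod>l\<in>T. z l) * \<delta>)"
      by (rule sum.inter_filter[OF finite_pairs, symmetric])
    also have "\<dots> = - (z l * (\<Sum>m\<in>{..<d} - {l}. z m)) * \<delta>"
      by (simp only: sum_distrib_right[symmetric] sum_negf sum_pairs_containing[OF l])
    also have "(\<Sum>m\<in>{..<d} - {l}. z m) = \<sigma> - z l" using l by (simp add: \<sigma>_def sum_diff1)
    finally show ?thesis by (simp add: Ai0 \<delta>_def[symmetric] algebra_simps)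
  qed
  have s0: "kernel_norm UNIV i0 \<pi> A l \<noteq> 0" if "l < d" for l
    unfolding s[OF that] using \<delta>0 z(3,4)[OF that] by (simp add: \<sigma>_def)
  let ?s = "kernel_norm UNIV i0 \<pi> A"
  \<comment> \<open>Since \<open>z 0 = z 1 = 1\<close>, the norms at 0 and 1 agree, and
    \<open>X\<close> is the product of all norms with either of them left out. With entry
    \<open>- \<delta>\<close> of the kernel vector at \<open>i1\<close>, the two terms add up to
    \<open>\<delta> * X * ((2 - \<sigma>) + 2)\<close>.\<close>
  define X where "X = (\<Prod>m\<in>{..<d} - {0, 1}. ?s m) * (\<delta> * (2 - \<sigma>))"
  have s01: "?s 0 = \<delta> * (2 - \<sigma>)" "?s 1 = \<delta> * (2 - \<sigma>)" using s[of 0] s[of 1] d z by auto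
  have P0: "(\<Prod>m\<in>{..<d} - {0}. ?s m) = X"
  proof -
    have e: "{..<d} - {0} = insert 1 ({..<d} - {0, 1})" using d by auto
    show ?thesis unfolding e X_def s01(2)[symmetric] by (subst prod.insert) (simp, simp, rule mult.commute)
  qed
  have P1: "(\<Prod>m\<in>{..<d} - {1}. ?s m) = X"
  proof -
    have e: "{..<d} - {1} = insert 0 ({..<d} - {0, 1})" using d by auto
    show ?thesis unfolding e X_def s01(1)[symmetric] by (subst prod.insert) (simp, simp, rule mult.commute)
  qed
  have PP: "(\<Prod>m<d. ?s m) = \<delta> * (2 - \<sigma>) * X"
    using prod.remove[of "{..<d}" 0 ?s] P0 s01 d by simp
  have X0: "X \<noteq> 0"
  proof -
    have "{..<d} - {0} \<subseteq> {..<d}" by auto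
    then have "(\<Prod>m\<in>{..<d} - {0}. ?s m) \<noteq> 0" using s0 by (auto simp: prod_zero_iff)
    then show ?thesis using P0 by simp
  qed
  have "(\<Sum>l<d. A l i1 ^ 2 * (\<Prod>m\<in>{..<d} - {l}. ?s m)) = (\<Sum>l\<in>{0, 1}. A l i1 ^ 2 * (\<Prod>m\<in>{..<d} - {l}. ?s m))"
    by (rule sum.mono_neutral_right) (use d i1 in \<open>auto simp: A\<close>)
  also have "\<dots> = X + X" using i1 P0 P1 by (simp add: A)
  finally have "diag_form d ?s (?b i1) (\<lambda>l. A l i1) = \<delta> * (2 - \<sigma>) * X + \<delta> * (X + X)"
    using bi[OF i1(1)] i1(2) z by (simp add: diag_form_def PP)
  also have "\<dots> = \<delta> * X * (4 - \<sigma>)" by (simp add: algebra_simps)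
  finally show ?thesis using \<delta>0 X0 z(5) by (simp add: \<sigma>_def)
qed

section \<open>Multihomogeneous forms\<close>

text \<open>Degrees are integers so that a factor can have negative degree in a block when it is zero.\<close>

definition multidegree :: "('g \<Rightarrow> int) \<Rightarrow> ('g \<times> 'n::finite, 'k::zero) mpoly \<Rightarrow> bool"
  where "multidegree e f \<longleftrightarrow> (\<forall>m\<in>Poly_Mapping.keys f. \<forall>j. int (\<Sum>i\<in>UNIV. Poly_Mapping.lookup m (j, i)) = e j)"

lemma multidegree_zero: "multidegree e 0"
  by (simp add: multidegree_def)

lemma multidegree_one: "multidegree (\<lambda>_. 0) (1 :: ('g \<times> 'n::finite, 'k::comm_ring_1) mpoly)"
  by (simp add: multidegree_def)

lemma multidegree_add: "multidegree e f \<Longrightarrow> multidegree e g \<Longrightarrow> multidegree e (f + g)"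
  unfolding multidegree_def using keys_add[of f g] by blast

lemma multidegree_uminus: "multidegree e f \<Longrightarrow> multidegree e (- f)" for f :: "('g \<times> 'n::finite, 'k::comm_ring_1) mpoly"
  by (simp add: multidegree_def)

lemma multidegree_diff: "multidegree e f \<Longrightarrow> multidegree e g \<Longrightarrow> multidegree e (f - g)" for f :: "('g \<times> 'n::finite, 'k::comm_ring_1) mpoly"
  using multidegree_add[of e f "- g"] multidegree_uminus[of e g] by simp

lemma multidegree_mult:
  assumes "multidegree e f" "multidegree e' g"
  shows "multidegree (\<lambda>j. e j + e' j) (f * g)"
  unfolding multidegree_def
proof (intro ballI allI)
  fix m j assume "m \<in> Poly_Mapping.keys (f * g)"
  then obtain a b where "m = a + b" "a \<in> Poly_Mapping.keys f" "b \<in> Poly_Mapping.keys g"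
    using keys_mult[of f g] by blast
  then show "int (\<Sum>i\<in>UNIV. Poly_Mapping.lookup m (j, i)) = e j + e' j"
    using assms by (simp add: multidegree_def lookup_add sum.distrib)
qed

lemma multidegree_cong: "multidegree e f \<Longrightarrow> (\<And>j. e j = e' j) \<Longrightarrow> multidegree e' f"
  by (simp add: multidegree_def)

lemma multidegree_sum: "(\<And>i. i \<in> I \<Longrightarrow> multidegree e (f i)) \<Longrightarrow> multidegree e (sum f I)"
  by (induction I rule: infinite_finite_induct) (auto intro: multidegree_zero multidegree_add)

lemma multidegree_prod:
  fixes f :: "'i \<Rightarrow> ('g \<times> 'n::finite, 'k::comm_ring_1) mpoly"
  assumes "finite I"
  shows "(\<And>i. i \<in> I \<Longrightarrow> multidegree (e i) (f i)) \<Longrightarrow> multidegree (\<lambda>j. \<Sum>i\<in>I. e i j) (prod f I)"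
  using assms
proof (induction I)
  case empty
  then show ?case using multidegree_one by simp
next
  case (insert x I)
  then show ?case using multidegree_mult[of "e x" "f x" "\<lambda>j. \<Sum>i\<in>I. e i j" "prod f I"] by simp
qed

text \<open>If the degree of an entry is a row weight plus a column weight, every permutation term
  has the same degree, since it meets each row and each column once.\<close>

lemma multidegree_det:
  fixes M :: "('g \<times> 'n::finite, 'k::comm_ring_1) mpoly ^ 'n ^ 'n"
  assumes "\<And>i j. multidegree (\<lambda>b. \<omega> i b + \<tau> j b) (M $ i $ j)"
  shows "multidegree (\<lambda>b. (\<Sum>i\<in>UNIV. \<omega> i b) + (\<Sum>i\<in>UNIV. \<tau> i b)) (det M)"
  unfolding det_def
proof (rule multidegree_sum)
  fix p :: "'n \<Rightarrow> 'n" assume "p \<in> {p. p permutes UNIV}"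
  then have p: "p permutes UNIV" by simp
  have "multidegree (\<lambda>b. \<Sum>i\<in>UNIV. \<omega> i b + \<tau> (p i) b) (\<Prod>i\<in>UNIV. M $ i $ p i)"
    by (rule multidegree_prod) (use assms in auto)
  moreover have "(\<Sum>i\<in>UNIV. \<omega> i b + \<tau> (p i) b) = (\<Sum>i\<in>UNIV. \<omega> i b) + (\<Sum>i\<in>UNIV. \<tau> i b)" for b
    using sum.permute[OF p, of "\<lambda>i. \<tau> i b"] by (simp add: sum.distrib o_def)
  ultimately have "multidegree (\<lambda>b. (\<Sum>i\<in>UNIV. \<omega> i b) + (\<Sum>i\<in>UNIV. \<tau> i b)) (\<Prod>i\<in>UNIV. M $ i $ p i)"
    by simp
  then show "multidegree (\<lambda>b. (\<Sum>i\<in>UNIV. \<omega> i b) + (\<Sum>i\<in>UNIV. \<tau> i b)) (of_int (sign p) * (\<Prod>i\<in>UNIV. M $ i $ p i))"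
    by (cases p rule: sign_cases) (auto intro: multidegree_uminus)
qed

lemma multidegree_imp_multihomogeneous: "multidegree e f \<Longrightarrow> multihomogeneous f"
proof (cases "Poly_Mapping.keys f = {}")
  case False
  assume multidegree: "multidegree e f"
  obtain m0 where m0: "m0 \<in> Poly_Mapping.keys f" using False by blast
  have "(\<Sum>i\<in>UNIV. Poly_Mapping.lookup m (j, i)) = (\<Sum>i\<in>UNIV. Poly_Mapping.lookup m0 (j, i))"
    if "m \<in> Poly_Mapping.keys f" for m j
    using multidegree that m0 unfolding multidegree_def by (metis of_nat_eq_iff)
  then show ?thesis unfolding multihomogeneous_def
    by (intro exI[of _ "\<lambda>j. \<Sum>i\<in>UNIV. Poly_Mapping.lookup m0 (j, i)"]) blast
qed (auto simp: multihomogeneous_def)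

definition Var :: "'g \<Rightarrow> 'n \<Rightarrow> ('g \<times> 'n::finite, 'k::comm_ring_1) mpoly"
  where "Var j i = Poly_Mapping.single (Poly_Mapping.single (j, i) 1) 1"

lemma multidegree_Var: "multidegree (\<lambda>b. if b = j then 1 else 0) (Var j i :: ('g \<times> 'n::finite, 'k::comm_ring_1) mpoly)"
proof -
  have "(\<Sum>k\<in>UNIV. Poly_Mapping.lookup (Poly_Mapping.single (j, i) (1::nat)) (b, k)) = (\<Sum>k\<in>UNIV. if k = i then (if b = j then 1 else 0) else 0)" for b
    by (rule sum.cong) (auto simp: lookup_single when_def)
  then show ?thesis by (simp add: multidegree_def Var_def)
qed

locale field_hom = coeff_hom \<phi> for \<phi> :: "'k::field \<Rightarrow> 'K::field"
begin

definition eval_at :: "('g::finite \<times> 'n::finite, 'k) mpoly \<Rightarrow> ('g \<Rightarrow> 'K ^ 'n) \<Rightarrow> 'K"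
  where "eval_at f v = eval_mpoly \<phi> f (\<lambda>(j, i). v j $ i)"

lemma eval_at_simps: "eval_at 0 v = 0" "eval_at 1 v = 1" "eval_at (f + g) v = eval_at f v + eval_at g v" "eval_at (f * g) v = eval_at f v * eval_at g v"
  by (simp_all add: eval_at_def eval_zero eval_one eval_add eval_mult)

lemma eval_at_uminus: "eval_at (- f) v = - eval_at f v"
  using eval_at_simps(3)[of f "- f" v] by (simp add: eval_at_simps(1) eq_neg_iff_add_eq_0 add.commute)

lemma eval_at_diff: "eval_at (f - g) v = eval_at f v - eval_at g v"
  using eval_at_simps(3)[of f "- g" v] by (simp add: eval_at_uminus)

lemma eval_at_sum: "eval_at (sum f I) v = (\<Sum>i\<in>I. eval_at (f i) v)"
  by (induction I rule: infinite_finite_induct) (simp_all add: eval_at_simps)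

lemma eval_at_prod: "eval_at (prod f I) v = (\<Prod>i\<in>I. eval_at (f i) v)"
  by (induction I rule: infinite_finite_induct) (simp_all add: eval_at_simps)

lemma eval_at_det: "eval_at (det M) v = det (\<chi> i j. eval_at (M $ i $ j) v)"
proof -
  have "eval_at (of_int (sign p)) v = of_int (sign p)" for p :: "'c \<Rightarrow> 'c"
    by (cases p rule: sign_cases) (simp_all add: eval_at_simps eval_at_uminus)
  then show ?thesis by (simp add: det_def eval_at_sum eval_at_simps eval_at_prod)
qed

lemma eval_at_Var: "eval_at (Var j i) v = v j $ i"
proof -
  have "(\<Prod>x\<in>UNIV. (case x of (j, i) \<Rightarrow> v j $ i) ^ Poly_Mapping.lookup (Poly_Mapping.single (j, i) (1::nat)) x)
    = (\<Prod>x\<in>UNIV. if x = (j, i) then v j $ i else 1)"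
    by (rule prod.cong) (auto simp: lookup_single when_def)
  then show ?thesis by (simp add: eval_at_def Var_def eval_single one)
qed

lemma eval_at_pair_matrix: "(\<chi> i j. eval_at (pair_matrix S i0 \<pi> A x $ i $ j) v) = pair_matrix S i0 \<pi> (\<lambda>l j. eval_at (A l j) v) (\<lambda>j. eval_at (x j) v)"
  by (simp add: vec_eq_iff pair_matrix_def eval_at_prod eval_at_simps)

lemma eval_at_kernel_vec: "eval_at (kernel_vec S i0 \<pi> A j) v = kernel_vec S i0 \<pi> (\<lambda>l j. eval_at (A l j) v) j"
proof -
  have "(\<lambda>j'. eval_at (if j' = j then 1 else 0) v) = (\<lambda>j'. if j' = j then 1 else 0)"
    by (auto simp: eval_at_simps)
  then show ?thesis by (simp add: kernel_vec_def eval_at_det eval_at_pair_matrix)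
qed

lemma eval_at_kernel_norm: "eval_at (kernel_norm S i0 \<pi> A l) v = kernel_norm S i0 \<pi> (\<lambda>l j. eval_at (A l j) v) l"
  by (simp add: kernel_norm_def eval_at_det eval_at_pair_matrix eval_at_simps)

lemma eval_at_diag_form: "eval_at (diag_form d s b a) v = diag_form d (\<lambda>l. eval_at (s l) v) (eval_at b v) (\<lambda>l. eval_at (a l) v)"
  by (simp add: diag_form_def eval_at_diff eval_at_simps eval_at_sum eval_at_prod power2_eq_square)

lemma eval_at_line:
  "\<exists>q. \<forall>t. eval_at f (\<lambda>j. x j + t *s (y j - x j)) = poly q t"
proof (intro exI allI)
  fix t
  show "eval_at f (\<lambda>j. x j + t *s (y j - x j)) =
    poly (\<Sum>m\<in>Poly_Mapping.keys f. [:\<phi> (Poly_Mapping.lookup f m):] *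
      (\<Prod>u\<in>UNIV. (case u of (j, i) \<Rightarrow> [:x j $ i, (y j - x j) $ i:]) ^ Poly_Mapping.lookup m u)) t"
    unfolding eval_at_def eval_mpoly_def poly_sum
    by (rule sum.cong) (auto simp: poly_prod poly_power split: prod.splits intro!: prod.cong arg_cong2[of _ _ _ _ "(*)"])
qed

lemma eval_at_common:
  assumes inf: "infinite (UNIV :: 'K set)" and "finite S" "\<And>f. f \<in> S \<Longrightarrow> \<exists>v. eval_at f v \<noteq> 0"
  shows "\<exists>v. \<forall>f\<in>S. eval_at f v \<noteq> 0"
proof -
  have "\<exists>v\<in>UNIV. \<forall>F\<in>eval_at ` S. F v \<noteq> 0"
    by (rule common_nonzero[where L = "\<lambda>x y t j. x j + t *s (y j - x j)", OF inf])
      (use assms(2,3) eval_at_line in auto)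
  then show ?thesis by auto
qed

text \<open>The open set is given by the product of the forms. A nonzero value at a tuple over
  \<open>K\<close> shows that the product is a nonzero polynomial over \<open>k\<close>.\<close>

lemma dense_open_of_forms:
  fixes S :: "('g::finite \<times> 'n::finite, 'k) mpoly set"
  assumes inf: "infinite (UNIV :: 'K set)" and S: "finite S" "\<And>f. f \<in> S \<Longrightarrow> \<exists>e. multidegree e f"
    "\<And>f. f \<in> S \<Longrightarrow> \<exists>v. eval_at f v \<noteq> 0"
  obtains U where "zariski_dense_open \<phi> U"
    "\<And>p. p \<in> U \<Longrightarrow> \<exists>v. (\<forall>j. v j \<noteq> 0 \<and> p j = vec.span {v j}) \<and> (\<forall>f\<in>S. eval_at f v \<noteq> 0)"
proof -
  let ?F = "\<Prod>f\<in>S. f"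
  obtain v where v: "\<forall>f\<in>S. eval_at f v \<noteq> 0" using eval_at_common[OF inf S(1,3)] by blast
  have "eval_at ?F v \<noteq> 0" using v S(1) by (simp add: eval_at_prod)
  then have F0: "?F \<noteq> 0" using eval_at_simps(1) by metis
  have "\<forall>f. \<exists>e. f \<in> S \<longrightarrow> multidegree e f" using S(2) by blast
  then obtain e where "\<And>f. f \<in> S \<Longrightarrow> multidegree (e f) f" by metis
  then have "multidegree (\<lambda>j. \<Sum>f\<in>S. e f j) ?F" by (rule multidegree_prod[OF S(1)])
  then have F: "multihomogeneous ?F" by (rule multidegree_imp_multihomogeneous)
  show ?thesis
  proof (rule that[of "nonvanishing_locus \<phi> {?F}"])
    show "zariski_dense_open \<phi> (nonvanishing_locus \<phi> {?F})"
      unfolding zariski_dense_open_def by (intro exI[of _ "{?F}"]) (use F F0 in simp)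
  next
    fix p assume "p \<in> nonvanishing_locus \<phi> {?F}"
    then obtain v where p: "\<forall>j. p j \<in> proj_points" and v: "\<forall>j. v j \<in> p j \<and> v j \<noteq> 0" and nz: "eval_at ?F v \<noteq> 0"
      by (auto simp: nonvanishing_locus_def eval_at_def)
    have "\<forall>f\<in>S. eval_at f v \<noteq> 0" using nz S(1) by (simp add: eval_at_prod)
    moreover have "p j = vec.span {v j}" for j
    proof -
      obtain w where w: "w \<noteq> 0" "p j = vec.span {w}" using p by (auto simp: proj_points_def)
      obtain t where t: "v j = t *s w" using v[rule_format, of j] unfolding w(2) by (auto simp: vec.span_singleton)
      have "t \<noteq> 0" using t v[rule_format, of j] by auto
      then have "vec.span {t *s w} = vec.span {w}" using vec.span_image_scale[of "{w}" "\<lambda>_. t"] by simp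
      then show ?thesis using w t by simp
    qed
    ultimately show "\<exists>v. (\<forall>j. v j \<noteq> 0 \<and> p j = vec.span {v j}) \<and> (\<forall>f\<in>S. eval_at f v \<noteq> 0)"
      using v by blast
  qed
qed

end

section \<open>Frame coordinates as multihomogeneous forms\<close>

locale point_config = field_hom \<phi> for \<phi> :: "'k::field \<Rightarrow> 'K::field" +
  fixes \<kappa> :: "'n::finite + nat \<Rightarrow> 'g::finite" and d :: nat
  assumes \<kappa>: "bij_betw \<kappa> (UNIV <+> {..<d}) UNIV"
begin

definition frame_det :: "('g \<times> 'n, 'k) mpoly" where "frame_det = det (\<chi> x i. Var (\<kappa> (Inl i)) x)"

text \<open>By Cramer's rule this is the coordinate \<open>k\<close> of the point \<open>l\<close>
  in the frame, multiplied by \<open>frame_det\<close> to clear the denominator.\<close>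

definition cramer :: "nat \<Rightarrow> 'n \<Rightarrow> ('g \<times> 'n, 'k) mpoly"
  where "cramer l k = det (\<chi> x i. if i = k then Var (\<kappa> (Inr l)) x else Var (\<kappa> (Inl i)) x)"

definition block_deg :: "'n + nat \<Rightarrow> 'g \<Rightarrow> int" where "block_deg k b = (if b = \<kappa> k then 1 else 0)"

definition basis_deg :: "'g \<Rightarrow> int" where "basis_deg b = (\<Sum>i\<in>UNIV. block_deg (Inl i) b)"

lemma multidegree_frame_det: "multidegree basis_deg frame_det"
proof -
  have "multidegree (\<lambda>b. (\<Sum>x\<in>(UNIV :: 'n set). 0) + (\<Sum>i\<in>UNIV. block_deg (Inl i) b)) frame_det"
    unfolding frame_det_def by (rule multidegree_det) (simp add: block_deg_def multidegree_Var)
  then show ?thesis by (rule multidegree_cong) (simp add: basis_deg_def)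
qed

text \<open>The degree is split into a part depending on \<open>l\<close> and a part depending on
  \<open>k\<close>, to serve as row and column weights in \<open>multidegree_det\<close>.\<close>

lemma multidegree_cramer: "multidegree (\<lambda>b. (block_deg (Inr l) b + basis_deg b) + - block_deg (Inl k) b) (cramer l k)"
proof -
  have "multidegree (\<lambda>b. (\<Sum>x\<in>(UNIV :: 'n set). 0) + (\<Sum>i\<in>UNIV. if i = k then block_deg (Inr l) b else block_deg (Inl i) b)) (cramer l k)"
    unfolding cramer_def by (rule multidegree_det) (auto simp: block_deg_def multidegree_Var)
  moreover have "(\<Sum>i\<in>UNIV. if i = k then block_deg (Inr l) b else block_deg (Inl i) b) = block_deg (Inr l) b + basis_deg b - block_deg (Inl k) b" for b
  proof -
    have "(\<Sum>i\<in>UNIV. if i = k then block_deg (Inr l) b else block_deg (Inl i) b) =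
        block_deg (Inr l) b + (\<Sum>i\<in>UNIV - {k}. if i = k then block_deg (Inr l) b else block_deg (Inl i) b)"
      by (subst sum.remove[of _ k]) auto
    also have "(\<Sum>i\<in>UNIV - {k}. if i = k then block_deg (Inr l) b else block_deg (Inl i) b) = (\<Sum>i\<in>UNIV - {k}. block_deg (Inl i) b)"
      by (rule sum.cong) auto
    also have "\<dots> = basis_deg b - block_deg (Inl k) b" by (simp add: basis_deg_def sum_diff1)
    finally show ?thesis by simp
  qed
  ultimately show ?thesis by simp
qed

lemma multidegree_cramer_prod:
  assumes "finite T" "card T = 2"
  shows "multidegree (\<lambda>b. (\<Sum>l\<in>T. block_deg (Inr l) b + basis_deg b) + - 2 * block_deg (Inl j) b) (\<Prod>l\<in>T. cramer l j)"
proof -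
  have "multidegree (\<lambda>b. \<Sum>l\<in>T. (block_deg (Inr l) b + basis_deg b) + - block_deg (Inl j) b) (\<Prod>l\<in>T. cramer l j)"
    by (rule multidegree_prod[OF assms(1) multidegree_cramer])
  then show ?thesis by (rule multidegree_cong) (simp add: sum.distrib sum_subtractf assms)
qed

text \<open>The weights of all rows except \<open>i0\<close> and of all columns. A row outside
  \<open>S\<close> gets the weight that cancels its column weight, so that its diagonal entry 1 has
  degree zero.\<close>

definition row_weight :: "'n set \<Rightarrow> 'n \<Rightarrow> ('n \<Rightarrow> nat set) \<Rightarrow> 'g \<Rightarrow> int"
  where "row_weight S i0 \<pi> b = (\<Sum>i\<in>UNIV - {i0}. if i \<in> S then (\<Sum>l\<in>\<pi> i. block_deg (Inr l) b + basis_deg b) else 2 * block_deg (Inl i) b)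
    + (\<Sum>j\<in>UNIV. - 2 * block_deg (Inl j) b)"

lemma multidegree_det_pair_matrix:
  assumes \<pi>: "\<And>i. i \<in> S \<Longrightarrow> i \<noteq> i0 \<Longrightarrow> finite (\<pi> i) \<and> card (\<pi> i) = 2"
    and x: "\<And>j. multidegree (\<lambda>b. w b + - 2 * block_deg (Inl j) b) (x j)"
  shows "multidegree (\<lambda>b. w b + row_weight S i0 \<pi> b) (det (pair_matrix S i0 \<pi> cramer x))"
proof -
  let ?o = "\<lambda>i b. if i = i0 then w b else if i \<in> S then (\<Sum>l\<in>\<pi> i. block_deg (Inr l) b + basis_deg b) else 2 * block_deg (Inl i) b"
  have "multidegree (\<lambda>b. (\<Sum>i\<in>UNIV. ?o i b) + (\<Sum>j\<in>UNIV. - 2 * block_deg (Inl j) b)) (det (pair_matrix S i0 \<pi> cramer x))"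
  proof (rule multidegree_det)
    fix i j
    consider "i = i0" | "i \<noteq> i0" "i \<in> S" | "i \<noteq> i0" "i \<notin> S" "i = j" | "i \<noteq> i0" "i \<notin> S" "i \<noteq> j" by blast
    then show "multidegree (\<lambda>b. ?o i b + - 2 * block_deg (Inl j) b) (pair_matrix S i0 \<pi> cramer x $ i $ j)"
    proof cases
      case 1
      then show ?thesis using x by (simp add: pair_matrix_def)
    next
      case 2
      then show ?thesis using multidegree_cramer_prod[of "\<pi> i" j] \<pi>[of i] by (simp add: pair_matrix_def)
    next
      case 3
      then show ?thesis using multidegree_cong[OF multidegree_one, of "\<lambda>b. 2 * block_deg (Inl i) b + - 2 * block_deg (Inl j) b"] by (simp add: pair_matrix_def)
    next
      case 4
      then show ?thesis by (simp add: pair_matrix_def multidegree_zero)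
    qed
  qed
  moreover have "(\<Sum>i\<in>UNIV. ?o i b) + (\<Sum>j\<in>UNIV. - 2 * block_deg (Inl j) b) = w b + row_weight S i0 \<pi> b" for b
  proof -
    have "(\<Sum>i\<in>UNIV. ?o i b) = w b + (\<Sum>i\<in>UNIV - {i0}. ?o i b)" by (subst sum.remove[of _ i0]) auto
    also have "(\<Sum>i\<in>UNIV - {i0}. ?o i b) = (\<Sum>i\<in>UNIV - {i0}. if i \<in> S then (\<Sum>l\<in>\<pi> i. block_deg (Inr l) b + basis_deg b) else 2 * block_deg (Inl i) b)"
      by (rule sum.cong) auto
    finally show ?thesis by (simp add: row_weight_def)
  qed
  ultimately show ?thesis by (metis (no_types, lifting) multidegree_cong)
qed

lemma multidegree_kernel_vec:
  assumes \<pi>: "\<And>i. i \<in> S \<Longrightarrow> i \<noteq> i0 \<Longrightarrow> finite (\<pi> i) \<and> card (\<pi> i) = 2"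
  shows "multidegree (\<lambda>b. 2 * block_deg (Inl j) b + row_weight S i0 \<pi> b) (kernel_vec S i0 \<pi> cramer j)"
  unfolding kernel_vec_def
proof (rule multidegree_det_pair_matrix[OF \<pi>])
  fix j'
  show "multidegree (\<lambda>b. 2 * block_deg (Inl j) b + - 2 * block_deg (Inl j') b) (if j' = j then 1 else 0 :: ('g \<times> 'n, 'k) mpoly)"
    using multidegree_cong[OF multidegree_one, of "\<lambda>b. 2 * block_deg (Inl j) b + - 2 * block_deg (Inl j') b"]
    by (cases "j' = j") (simp_all add: multidegree_zero)
qed auto

lemma multidegree_sq: "multidegree (\<lambda>b. 2 * (block_deg (Inr l) b + basis_deg b) + - 2 * block_deg (Inl j) b) (cramer l j * cramer l j)"
  by (rule multidegree_cong[OF multidegree_mult[OF multidegree_cramer multidegree_cramer]]) simp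

lemma multidegree_kernel_norm:
  assumes \<pi>: "\<And>i. i \<in> S \<Longrightarrow> i \<noteq> i0 \<Longrightarrow> finite (\<pi> i) \<and> card (\<pi> i) = 2"
  shows "multidegree (\<lambda>b. 2 * (block_deg (Inr l) b + basis_deg b) + row_weight S i0 \<pi> b) (kernel_norm S i0 \<pi> cramer l)"
  unfolding kernel_norm_def by (rule multidegree_det_pair_matrix[OF \<pi> multidegree_sq]) auto

text \<open>Every term has the degree of the product of all norms: the weight of
  \<open>kernel_vec\<close> at \<open>k\<close> cancels against that of the square of
  \<open>cramer l k\<close>, and what remains is the degree of the omitted norm.\<close>

lemma multidegree_diag_form:
  assumes \<pi>: "\<And>i. i \<in> S \<Longrightarrow> i \<noteq> i0 \<Longrightarrow> finite (\<pi> i) \<and> card (\<pi> i) = 2"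
  shows "\<exists>e. multidegree e (diag_form d (kernel_norm S i0 \<pi> cramer) (kernel_vec S i0 \<pi> cramer k) (\<lambda>l. cramer l k))"
proof -
  let ?w = "\<lambda>l b. 2 * (block_deg (Inr l) b + basis_deg b) + row_weight S i0 \<pi> b"
  have 1: "multidegree (\<lambda>b. \<Sum>l<d. ?w l b) (\<Prod>l<d. kernel_norm S i0 \<pi> cramer l)"
    by (rule multidegree_prod[OF finite_lessThan multidegree_kernel_norm[OF \<pi>]]) auto
  have 2: "multidegree (\<lambda>b. \<Sum>l<d. ?w l b) (kernel_vec S i0 \<pi> cramer k * (cramer l k ^ 2 * (\<Prod>m\<in>{..<d} - {l}. kernel_norm S i0 \<pi> cramer m)))" if l: "l < d" for l
  proof -
    have "multidegree (\<lambda>b. \<Sum>m\<in>{..<d} - {l}. ?w m b) (\<Prod>m\<in>{..<d} - {l}. kernel_norm S i0 \<pi> cramer m)"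
      by (rule multidegree_prod[OF _ multidegree_kernel_norm[OF \<pi>]]) auto
    then have "multidegree (\<lambda>b. (2 * block_deg (Inl k) b + row_weight S i0 \<pi> b) + ((2 * (block_deg (Inr l) b + basis_deg b) + - 2 * block_deg (Inl k) b) + (\<Sum>m\<in>{..<d} - {l}. ?w m b)))
      (kernel_vec S i0 \<pi> cramer k * (cramer l k ^ 2 * (\<Prod>m\<in>{..<d} - {l}. kernel_norm S i0 \<pi> cramer m)))"
      unfolding power2_eq_square by (intro multidegree_mult[OF multidegree_kernel_vec[OF \<pi>]] multidegree_mult[OF multidegree_sq]) auto
    then show ?thesis
    proof (rule multidegree_cong)
      fix b
      show "(2 * block_deg (Inl k) b + row_weight S i0 \<pi> b) + ((2 * (block_deg (Inr l) b + basis_deg b) + - 2 * block_deg (Inl k) b) + (\<Sum>m\<in>{..<d} - {l}. ?w m b))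
         = (\<Sum>l<d. ?w l b)"
        using l by (subst sum.remove[of "{..<d}" l]) auto
    qed
  qed
  have "multidegree (\<lambda>b. \<Sum>l<d. ?w l b) (\<Sum>l<d. kernel_vec S i0 \<pi> cramer k * (cramer l k ^ 2 * (\<Prod>m\<in>{..<d} - {l}. kernel_norm S i0 \<pi> cramer m)))"
    by (rule multidegree_sum) (use 2 in auto)
  then have "multidegree (\<lambda>b. \<Sum>l<d. ?w l b) (diag_form d (kernel_norm S i0 \<pi> cramer) (kernel_vec S i0 \<pi> cramer k) (\<lambda>l. cramer l k))"
    unfolding diag_form_def sum_distrib_left by (rule multidegree_diff[OF 1])
  then show ?thesis by blast
qed

lemma eval_at_frame_det: "eval_at frame_det v = det (\<chi> x i. v (\<kappa> (Inl i)) $ x)"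
  by (simp add: frame_det_def eval_at_det eval_at_Var)

lemma eval_at_cramer:
  assumes "(\<chi> x i. v (\<kappa> (Inl i)) $ x) *v y = v (\<kappa> (Inr l))"
  shows "eval_at (cramer l k) v = y $ k * eval_at frame_det v"
proof -
  let ?P = "\<chi> x i. v (\<kappa> (Inl i)) $ x"
  have "eval_at (cramer l k) v = det (\<chi> x i. if i = k then v (\<kappa> (Inr l)) $ x else v (\<kappa> (Inl i)) $ x)"
    unfolding cramer_def eval_at_det by (rule arg_cong[of _ _ det]) (simp add: vec_eq_iff eval_at_Var)
  also have "(\<chi> x i. if i = k then v (\<kappa> (Inr l)) $ x else v (\<kappa> (Inl i)) $ x) =
      (\<chi> x i. if i = k then (?P *v y) $ x else ?P $ x $ i)"
    unfolding assms by (simp add: vec_eq_iff)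
  also have "det \<dots> = y $ k * det ?P" by (rule cramer_lemma)
  finally show ?thesis by (simp add: eval_at_frame_det)
qed

text \<open>The test tuple in the standard frame with prescribed coordinates \<open>A\<close>, used
  to show that forms do not vanish identically.\<close>

definition point :: "(nat \<Rightarrow> 'n \<Rightarrow> 'K) \<Rightarrow> 'g \<Rightarrow> 'K ^ 'n"
  where "point A j = (case inv_into (UNIV <+> {..<d}) \<kappa> j of Inl i \<Rightarrow> axis i 1 | Inr l \<Rightarrow> (\<chi> i. A l i))"

lemma point_Inl: "point A (\<kappa> (Inl i)) = axis i 1"
proof -
  have "inv_into (UNIV <+> {..<d}) \<kappa> (\<kappa> (Inl i)) = Inl i"
    by (rule inv_into_f_f[OF bij_betw_imp_inj_on[OF \<kappa>] InlI[OF UNIV_I]])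
  then show ?thesis by (simp add: point_def)
qed

lemma point_Inr: "l < d \<Longrightarrow> point A (\<kappa> (Inr l)) = (\<chi> i. A l i)"
proof -
  assume "l < d"
  then have "inv_into (UNIV <+> {..<d}) \<kappa> (\<kappa> (Inr l)) = Inr l"
    by (intro inv_into_f_f[OF bij_betw_imp_inj_on[OF \<kappa>]] InrI) simp
  then show ?thesis by (simp add: point_def)
qed

lemma eval_at_frame_det_point: "eval_at frame_det (point A) = 1"
proof -
  have "(\<chi> x i. point A (\<kappa> (Inl i)) $ x) = (mat 1 :: 'K ^ 'n ^ 'n)"
    by (simp add: vec_eq_iff point_Inl axis_def mat_def)
  then show ?thesis by (simp add: eval_at_frame_det)
qed

lemma eval_at_cramer_point: "l < d \<Longrightarrow> eval_at (cramer l k) (point A) = A l k"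
proof -
  assume l: "l < d"
  have m: "(\<chi> x i. point A (\<kappa> (Inl i)) $ x) = (mat 1 :: 'K ^ 'n ^ 'n)"
    by (simp add: vec_eq_iff point_Inl axis_def mat_def)
  have "eval_at (cramer l k) (point A) = (\<chi> i. A l i) $ k * eval_at frame_det (point A)"
    by (rule eval_at_cramer) (simp only: m matrix_vector_mul_lid point_Inr[OF l])
  then show ?thesis by (simp add: eval_at_frame_det_point)
qed

end

section \<open>Extensions of general frames\<close>

lemma exists_pairing:
  fixes S :: "'n::finite set"
  assumes "card S = Suc (d choose 2)" "i0 \<in> S"
  shows "\<exists>\<pi>. bij_betw \<pi> (S - {i0}) (pairs d)"
  by (rule finite_same_card_bij) (use assms in \<open>simp_all add: finite_pairs card_pairs\<close>)

lemma kernel_vec_pair_orth: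
  assumes \<pi>: "bij_betw \<pi> (S - {i0}) (pairs d)" and lm: "l < d" "m < d" "l \<noteq> m"
  shows "(\<Sum>i\<in>UNIV. kernel_vec S i0 \<pi> A i * (A l i * A m i)) = 0"
proof -
  have "{l, m} \<in> pairs d" using lm by (auto simp: pairs_iff)
  then have "{l, m} \<in> \<pi> ` (S - {i0})" using \<pi> by (simp add: bij_betw_def)
  then obtain i where i: "i \<in> S" "i \<noteq> i0" "\<pi> i = {l, m}" by auto
  show ?thesis using kernel_vec_orth[OF i(1,2), of \<pi> A] lm(3) by (simp add: i(3))
qed

text \<open>Over a field, the nonzero cofactor at \<open>i0\<close> says that the orthogonality
  conditions are independent on weights supported in \<open>S\<close>; so one such weight vector
  exists up to scalars. It is required to have full support in \<open>S\<close> and nonzero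
  norms.\<close>

definition independent_pairs :: "nat \<Rightarrow> (nat \<Rightarrow> 'n::finite \<Rightarrow> 'r::comm_ring_1) \<Rightarrow> 'n set \<Rightarrow> bool"
  where "independent_pairs d A S \<longleftrightarrow> (\<exists>i0 \<pi>. i0 \<in> S \<and> bij_betw \<pi> (S - {i0}) (pairs d) \<and>
    (\<forall>j\<in>S. kernel_vec S i0 \<pi> A j \<noteq> 0) \<and> (\<forall>l\<in>{..<d}. kernel_norm S i0 \<pi> A l \<noteq> 0))"

context frame
begin

text \<open>Nonzero entries keep \<open>a l\<close> away from the axis points, because there are at
  least two coordinates, and a nonzero minor tells \<open>a l\<close> from
  \<open>a m\<close>.\<close>

lemma card_\<Gamma>:
  assumes a0: "\<And>l i. l < d \<Longrightarrow> a l $ i \<noteq> 0"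
    and minors: "\<And>l m. l < d \<Longrightarrow> m < d \<Longrightarrow> l \<noteq> m \<Longrightarrow> \<exists>i j. a l $ i * a m $ j - a l $ j * a m $ i \<noteq> 0"
  shows "card \<Gamma> = CARD('n) + d"
proof -
  have other: "\<exists>j. j \<noteq> i" for i :: 'n
  proof (rule ccontr)
    assume "\<nexists>j. j \<noteq> i"
    then have "(UNIV :: 'n set) = {i}" by auto
    then have "CARD('n) = 1" by (metis card_1_singleton_iff One_nat_def)
    then show False using n2 by simp
  qed
  have 1: "i = j" if "axis i (1::'K) = t *s axis j 1" for i j and t
  proof (rule ccontr)
    assume "i \<noteq> j"
    then show False using arg_cong[OF that, of "\<lambda>v. v $ i"] by (simp add: axis_def)
  qed
  have 2: "axis i (1::'K) \<noteq> t *s a l" if l: "l < d" for i l t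
  proof
    assume e: "axis i (1::'K) = t *s a l"
    obtain j where "j \<noteq> i" using other by blast
    then have "t = 0" using arg_cong[OF e, of "\<lambda>v. v $ j"] a0[OF l, of j] by (simp add: axis_def)
    then show False using arg_cong[OF e, of "\<lambda>v. v $ i"] by simp
  qed
  have 3: "l = m" if lm: "l < d" "m < d" and e: "a l = t *s a m" for l m t
  proof (rule ccontr)
    assume "l \<noteq> m"
    then obtain i j where "a l $ i * a m $ j - a l $ j * a m $ i \<noteq> 0" using minors lm by blast
    then show False unfolding e by simp
  qed
  have "inj_on (\<lambda>k. pt (G k)) I0"
  proof (rule inj_onI)
    fix k k' assume k: "k \<in> I0" "k' \<in> I0" and e: "pt (G k) = pt (G k')"
    obtain t where t: "G k = t *s G k'" using e by (rule pt_eq)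
    obtain t' where t': "G k' = t' *s G k" using e[symmetric] by (rule pt_eq)
    show "k = k'"
    proof (cases k)
      case (Inl i)
      note ki = Inl
      show ?thesis
      proof (cases k')
        case (Inl j)
        then show ?thesis using 1[of i t j] t ki by (simp add: G_def)
      next
        case (Inr m)
        then show ?thesis using 2[of m i t] t ki k by (auto simp: G_def)
      qed
    next
      case (Inr l)
      note kl = Inr
      show ?thesis
      proof (cases k')
        case (Inl j)
        then show ?thesis using 2[of l j t'] t' kl k by (auto simp: G_def)
      next
        case (Inr m)
        then show ?thesis using 3[of l m t] t kl k by (auto simp: G_def)
      qed
    qed
  qed
  then show ?thesis unfolding \<Gamma>_def by (simp add: card_image card_index)
qed

text \<open>An extension would provide nonzero weights orthogonal to all pair products, but
  \<open>CARD('n)\<close> of these already have an invertible matrix.\<close>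

lemma no_extension:
  assumes a_nz: "\<And>l. l < d \<Longrightarrow> a l \<noteq> 0" and card: "card \<Gamma> = CARD('n) + d"
    and \<pi>: "\<And>i. \<pi> i \<in> pairs d" and det: "det (\<chi> i j. \<Prod>l\<in>\<pi> i. a l $ j) \<noteq> 0"
  shows "\<not> gorenstein_extension (2 * CARD('n)) \<Gamma> \<Gamma>'"
proof
  assume ext: "gorenstein_extension (2 * CARD('n)) \<Gamma> \<Gamma>'"
  obtain b where b: "\<And>i. b i \<noteq> 0"
    and orth: "\<And>l m. l < d \<Longrightarrow> m < d \<Longrightarrow> l \<noteq> m \<Longrightarrow> ortho_data.s a b l m = 0"
    and "\<And>l. l < d \<Longrightarrow> ortho_data.s a b l l \<noteq> 0"
    and "proj_span \<Gamma>' = (*v) P ` range ((*v) (ortho_data.Q d a b))"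
    using extension_structure[OF a_nz card ext] by blast
  interpret o: ortho_data d a b by unfold_locales (rule b)
  have "((\<chi> i j. \<Prod>l\<in>\<pi> i. a l $ j) *v (\<chi> j. b j)) $ i = 0" for i
  proof -
    obtain l m where lm: "l < d" "m < d" "l \<noteq> m" "\<pi> i = {l, m}" using \<pi>[of i] by (auto simp: pairs_iff)
    have "(\<Sum>j\<in>UNIV. b j * (a l $ j * a m $ j)) = 0" using orth[OF lm(1-3)] by (simp add: o.s_def)
    then show ?thesis using lm(3) by (simp add: matrix_vector_mult_def lm(4) mult.commute)
  qed
  then have "(\<chi> j. b j) = 0" by - (rule det_nonzeroD[OF det], simp add: vec_eq_iff)
  then show False using b by (simp add: vec_eq_iff)
qed

lemma extension_of_independent_pairs:
  assumes d1: "1 \<le> d" and a0: "\<And>l i. l < d \<Longrightarrow> a l $ i \<noteq> 0" and N: "Suc (d choose 2) \<le> CARD('n)"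
    and gen: "\<And>S. card S = Suc (d choose 2) \<Longrightarrow> independent_pairs d (\<lambda>l i. a l $ i) S"
    and H: "Suc (d choose 2) = CARD('n) \<Longrightarrow> d \<noteq> CARD('n) \<Longrightarrow> \<exists>i0 \<pi> i1. bij_betw \<pi> (UNIV - {i0}) (pairs d) \<and>
      diag_form d (kernel_norm UNIV i0 \<pi> (\<lambda>l i. a l $ i)) (kernel_vec UNIV i0 \<pi> (\<lambda>l i. a l $ i) i1) (\<lambda>l. a l $ i1) \<noteq> 0"
  shows "\<exists>\<Gamma>'. gorenstein_extension (2 * CARD('n)) \<Gamma> \<Gamma>'"
proof (rule extension_exists_generic[OF d1 a0 refl], assumption)
  let ?A = "\<lambda>l i. a l $ i"
  let ?V = "{b. \<forall>l<d. \<forall>m<d. l \<noteq> m \<longrightarrow> (\<Sum>i\<in>UNIV. b i * (a l $ i * a m $ i)) = 0}"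
  have V: "kernel_vec S i0 \<pi> ?A \<in> ?V" if "bij_betw \<pi> (S - {i0}) (pairs d)" for S i0 \<pi>
    using kernel_vec_pair_orth[OF that, of _ _ ?A] by simp
  \<comment> \<open>Every index \<open>i\<close> lies in some \<open>S\<close> of the right size,
    whose kernel vector has full support there.\<close>
  show "\<exists>b\<in>?V. b i \<noteq> 0" for i
  proof -
    have "d choose 2 \<le> card (UNIV - {i})" using N by simp
    then obtain S where S: "S \<subseteq> UNIV - {i}" "card S = d choose 2" "finite S" by (rule obtain_subset_with_card_n)
    then have "card (insert i S) = Suc (d choose 2)" by (subst card_insert_disjoint) auto
    then obtain i0 \<pi> where "bij_betw \<pi> (insert i S - {i0}) (pairs d)" "kernel_vec (insert i S) i0 \<pi> ?A i \<noteq> 0"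
      using gen unfolding independent_pairs_def by blast
    then show ?thesis using V by blast
  qed
  obtain S :: "'n set" where S: "card S = Suc (d choose 2)" using N by (rule obtain_subset_with_card_n)
  obtain i0 \<pi> where i0: "i0 \<in> S" and \<pi>: "bij_betw \<pi> (S - {i0}) (pairs d)" and kernel_norm: "\<And>l. l < d \<Longrightarrow> kernel_norm S i0 \<pi> ?A l \<noteq> 0"
    using gen[OF S] unfolding independent_pairs_def by auto
  show "\<exists>b\<in>?V. (\<Sum>i\<in>UNIV. b i * (a l $ i * a l $ i)) \<noteq> 0" if "l < d" for l
    using kernel_norm[OF that] V[OF \<pi>] unfolding kernel_norm_sum by blast
  show "d = CARD('n) \<or> (\<exists>i. \<exists>b\<in>?V. diag_form d (\<lambda>l. \<Sum>i\<in>UNIV. b i * (a l $ i * a l $ i)) (b i) (\<lambda>l. a l $ i) \<noteq> 0)"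
  proof (cases "Suc (d choose 2) = CARD('n)")
    case True
    show ?thesis
    proof (cases "d = CARD('n)")
      case False
      obtain i0 \<pi> i1 where "bij_betw \<pi> (UNIV - {i0}) (pairs d)"
        "diag_form d (\<lambda>l. kernel_norm UNIV i0 \<pi> ?A l) (kernel_vec UNIV i0 \<pi> ?A i1) (\<lambda>l. a l $ i1) \<noteq> 0"
        using H[OF True False] by blast
      then show ?thesis using V unfolding kernel_norm_sum by blast
    qed simp
  next
    case False
    then have "S \<noteq> UNIV" using S by auto
    then obtain i where i: "i \<notin> S" by auto
    \<comment> \<open>With weights to spare, an index outside \<open>S\<close> has weight zero, and
      the diagonal form there reduces to the product of the norms.\<close>
    then have "kernel_vec S i0 \<pi> ?A i = 0" using i0 by (intro kernel_vec_outside) auto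
    then have "diag_form d (\<lambda>l. kernel_norm S i0 \<pi> ?A l) (kernel_vec S i0 \<pi> ?A i) (\<lambda>l. a l $ i) = (\<Prod>l<d. kernel_norm S i0 \<pi> ?A l)"
      by (simp add: diag_form_def)
    also have "\<dots> \<noteq> 0" using kernel_norm by simp
    finally show ?thesis using V[OF \<pi>] unfolding kernel_norm_sum by blast
  qed
qed

text \<open>The indecomposability of the extended set rests on a point \<open>a 0\<close> without
  zero coordinates. For \<open>d = 0\<close> the point with all coordinates 1 is adjoined first, and
  then counted among the new points.\<close>

lemma extension_of_simplex:
  assumes d0: "d = 0"
  shows "\<exists>\<Gamma>'. gorenstein_extension (2 * CARD('n)) \<Gamma> \<Gamma>'"
proof -
  let ?u = "(\<chi> i. 1) :: 'K ^ 'n"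
  interpret f: frame P R 1 "\<lambda>_. ?u" by unfold_locales (use RP PR inf n2 in auto)
  obtain i j :: 'n where ij: "i \<noteq> j"
  proof -
    have "\<not> is_singleton (UNIV :: 'n set)" using n2 by (simp add: is_singleton_altdef)
    then show ?thesis using that is_singletonI'[of "UNIV :: 'n set"] by blast
  qed
  let ?V = "{b :: 'n \<Rightarrow> 'K. \<forall>l<1::nat. \<forall>m<1::nat. l \<noteq> m \<longrightarrow> (\<Sum>i\<in>UNIV. b i * (?u $ i * ?u $ i)) = 0}"
  have V: "b \<in> ?V" for b by simp
  have one: "(\<Sum>i\<in>UNIV. (if i = j then 1 else 0) * (?u $ i * ?u $ i)) \<noteq> 0" by simp
  have "\<exists>\<Gamma>'. gorenstein_extension (2 * CARD('n)) f.\<Gamma> \<Gamma>'"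
  proof (rule f.extension_exists_generic[OF _ _ refl])
    show "\<exists>b\<in>?V. b i \<noteq> 0" for i by (rule bexI[of _ "\<lambda>_. 1"]) simp_all
    show "\<exists>b\<in>?V. (\<Sum>i\<in>UNIV. b i * (?u $ i * ?u $ i)) \<noteq> 0" by (rule bexI[OF _ V[of "\<lambda>i. if i = j then 1 else 0"]]) (rule one)
    \<comment> \<open>For the weight supported at \<open>j\<close>, the entry at another index
      \<open>i\<close> is \<open>1 - 0\<close>.\<close>
    have "diag_form 1 (\<lambda>l. \<Sum>i\<in>UNIV. (if i = j then 1 else 0) * (?u $ i * ?u $ i)) (if i = j then 1 else 0) (\<lambda>l. ?u $ i) \<noteq> 0"
      using ij by (simp add: diag_form_def)
    then show "1 = CARD('n) \<or> (\<exists>i. \<exists>b\<in>?V. diag_form 1 (\<lambda>l. \<Sum>i\<in>UNIV. b i * (?u $ i * ?u $ i)) (b i) (\<lambda>l. ?u $ i) \<noteq> 0)"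
      by (intro disjI2 exI[of _ i] bexI[OF _ V[of "\<lambda>i. if i = j then 1 else 0"]])
  qed simp_all
  then obtain \<Gamma>' where ext: "gorenstein_extension (2 * CARD('n)) f.\<Gamma> \<Gamma>'" by blast
  have I1: "UNIV <+> {..<1::nat} = insert (Inr 0) (Inl ` (UNIV :: 'n set))" by auto
  have I0: "I0 = Inl ` (UNIV :: 'n set)" using d0 by auto
  have \<Gamma>f: "f.\<Gamma> = insert (pt ?u) \<Gamma>"
    unfolding f.\<Gamma>_def \<Gamma>_def I0 I1 by (simp add: f.G_def G_def image_image)
  have "pt ?u \<notin> \<Gamma>"
  proof
    assume "pt ?u \<in> \<Gamma>"
    then obtain i where "pt ?u = pt (axis i 1)" unfolding \<Gamma>_def I0 by (auto simp: G_def)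
    then obtain t where t: "?u = t *s axis i 1" by (rule pt_eq)
    obtain j' where "j' \<noteq> i" using ij by metis
    then show False using arg_cong[OF t, of "\<lambda>v. v $ j'"] by (simp add: axis_def)
  qed
  moreover have "pt ?u \<in> proj_points" by (rule pt_point) (simp add: vec_eq_iff)
  ultimately have "gorenstein_extension (2 * CARD('n)) \<Gamma> (insert (pt ?u) \<Gamma>')"
    using ext unfolding gorenstein_extension_def \<Gamma>f by (auto simp: insert_absorb)
  then show ?thesis by blast
qed

text \<open>Both extensions give nonzero weights in a one-dimensional solution space. Proportional
  weights give proportional forms, and these have the same image.\<close>

lemma extension_span_unique:
  assumes a_nz: "\<And>l. l < d \<Longrightarrow> a l \<noteq> 0" and card: "card \<Gamma> = CARD('n) + d"
    and \<pi>: "bij_betw \<pi> (UNIV - {i0}) (pairs d)" and b0: "kernel_vec UNIV i0 \<pi> (\<lambda>l i. a l $ i) i0 \<noteq> 0"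
    and ext1: "gorenstein_extension (2 * CARD('n)) \<Gamma> \<Gamma>1" and ext2: "gorenstein_extension (2 * CARD('n)) \<Gamma> \<Gamma>2"
  shows "proj_span \<Gamma>1 = proj_span \<Gamma>2"
proof -
  obtain b where b: "\<And>i. b i \<noteq> 0"
    and orth: "\<And>l m. l < d \<Longrightarrow> m < d \<Longrightarrow> l \<noteq> m \<Longrightarrow> ortho_data.s a b l m = 0"
    and "\<And>l. l < d \<Longrightarrow> ortho_data.s a b l l \<noteq> 0"
    and sp: "proj_span \<Gamma>1 = (*v) P ` range ((*v) (ortho_data.Q d a b))"
    using extension_structure[OF a_nz card ext1] by blast
  obtain c where c: "\<And>i. c i \<noteq> 0"
    and corth: "\<And>l m. l < d \<Longrightarrow> m < d \<Longrightarrow> l \<noteq> m \<Longrightarrow> ortho_data.s a c l m = 0"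
    and "\<And>l. l < d \<Longrightarrow> ortho_data.s a c l l \<noteq> 0"
    and csp: "proj_span \<Gamma>2 = (*v) P ` range ((*v) (ortho_data.Q d a c))"
    using extension_structure[OF a_nz card ext2] by blast
  interpret o: ortho_data d a b by unfold_locales (rule b)
  interpret oc: ortho_data d a c by unfold_locales (rule c)
  let ?M = "pair_matrix UNIV i0 \<pi> (\<lambda>l i. a l $ i) (\<lambda>j. if j = i0 then 1 else 0)"
  \<comment> \<open>This combination of the two solutions vanishes at \<open>i0\<close>, so the
    invertible matrix with unit row \<open>i0\<close> annihilates it.\<close>
  let ?y = "\<chi> j. c i0 * b j - b i0 * c j"
  have "(?M *v ?y) $ i = 0" for i
  proof (cases "i = i0")
    case True
    then show ?thesis by (simp add: pair_matrix_mult_nth if_distrib[of "\<lambda>x. x * _"] cong: if_cong)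
  next
    case False
    have "\<pi> i \<in> pairs d" using \<pi> False by (auto simp: bij_betw_def)
    then obtain l m where lm: "l < d" "m < d" "l \<noteq> m" "\<pi> i = {l, m}" by (auto simp: pairs_iff)
    have "(\<Sum>j\<in>UNIV. (\<Prod>l\<in>\<pi> i. a l $ j) * (c i0 * b j - b i0 * c j)) = c i0 * o.s l m - b i0 * oc.s l m"
      using lm(3) by (simp add: lm(4) o.s_def oc.s_def sum_distrib_left sum_subtractf algebra_simps)
    then show ?thesis using False by (simp add: pair_matrix_mult_nth orth[OF lm(1-3)] corth[OF lm(1-3)])
  qed
  then have "?y = 0" by - (rule det_nonzeroD[OF b0[unfolded kernel_vec_def]], simp add: vec_eq_iff)
  then have cb: "c i0 * b j = b i0 * c j" for j by (simp add: vec_eq_iff)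
  define t where "t = c i0 / b i0"
  have t0: "t \<noteq> 0" using b c by (simp add: t_def)
  have ct: "c j = t * b j" for j using cb[of j] b[of i0] by (simp add: t_def field_simps)
  have st: "oc.s l m = t * o.s l m" for l m by (simp add: o.s_def oc.s_def ct sum_distrib_left mult.assoc)
  have Q: "oc.Q = (\<chi> x y. (1 / t) * o.Q $ x $ y)"
    by (simp add: vec_eq_iff oc.Q_def o.Q_def ct st right_diff_distrib sum_distrib_left)
  have Qx: "oc.Q *v x = o.Q *v ((1 / t) *s x)" for x
    unfolding Q by (simp add: vec_eq_iff matrix_vector_mult_def sum_distrib_left mult_ac)
  have Qx': "o.Q *v x = oc.Q *v (t *s x)" for x unfolding Qx using t0 by simp
  have "range ((*v) oc.Q) = range ((*v) o.Q)"
  proof (intro equalityI subsetI)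
    fix z assume "z \<in> range ((*v) oc.Q)"
    then show "z \<in> range ((*v) o.Q)" unfolding Qx by auto
  next
    fix z assume "z \<in> range ((*v) o.Q)"
    then show "z \<in> range ((*v) oc.Q)" unfolding Qx' by auto
  qed
  then show ?thesis unfolding sp csp by simp
qed

lemma extension_span_dim:
  assumes a_nz: "\<And>l. l < d \<Longrightarrow> a l \<noteq> 0" and card: "card \<Gamma> = CARD('n) + d"
    and ext: "gorenstein_extension (2 * CARD('n)) \<Gamma> \<Gamma>'"
  shows "proj_subspace (proj_span \<Gamma>') (int CARD('n) - 1 - int d)"
proof -
  obtain b where b: "\<And>i. b i \<noteq> 0"
    and orth: "\<And>l m. l < d \<Longrightarrow> m < d \<Longrightarrow> l \<noteq> m \<Longrightarrow> ortho_data.s a b l m = 0"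
    and s0: "\<And>l. l < d \<Longrightarrow> ortho_data.s a b l l \<noteq> 0"
    and sp: "proj_span \<Gamma>' = (*v) P ` range ((*v) (ortho_data.Q d a b))"
    using extension_structure[OF a_nz card ext] by blast
  interpret o: ortho_data d a b by unfold_locales (rule b)
  have inj: "inj ((*v) P)" by (rule inj_on_inverseI[of _ "(*v) R"]) (rule RP_cancel)
  have "vec.dim (proj_span \<Gamma>') = vec.dim (range ((*v) o.Q))"
    unfolding sp by (rule vec.dim_image_eq[OF matrix_vector_mul_linear_gen inj_on_subset[OF inj subset_UNIV]])
  also have "\<dots> = CARD('n) - d" using o.dim_range[OF orth s0 d_le] by blast
  finally show ?thesis using d_le by (simp add: proj_subspace_def proj_span_def vec.subspace_span of_nat_diff)
qed

end

section \<open>General tuples\<close>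

context field_hom
begin

text \<open>Each form may use its own tuple to be seen nonzero, so conditions can be tested
  separately; over an infinite \<open>K\<close> the finitely many forms still define a common dense
  open set.\<close>

definition generic :: "(('g::finite \<Rightarrow> 'K ^ 'n::finite) \<Rightarrow> bool) \<Rightarrow> bool"
  where "generic Q \<longleftrightarrow> (\<exists>S :: ('g \<times> 'n, 'k) mpoly set. finite S \<and>
    (\<forall>f\<in>S. (\<exists>e. multidegree e f) \<and> (\<exists>v. eval_at f v \<noteq> 0)) \<and> (\<forall>v. (\<forall>f\<in>S. eval_at f v \<noteq> 0) \<longrightarrow> Q v))"

lemma generic_form: "multidegree e f \<Longrightarrow> eval_at f v \<noteq> 0 \<Longrightarrow> generic (\<lambda>v. eval_at f v \<noteq> 0)"
  unfolding generic_def by (intro exI[of _ "{f}"]) auto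

lemma generic_mono: "generic Q \<Longrightarrow> (\<And>v. Q v \<Longrightarrow> Q' v) \<Longrightarrow> generic Q'"
  unfolding generic_def by (erule exE, rule exI, fast)

lemma generic_Ball:
  assumes "finite I" "\<And>i. i \<in> I \<Longrightarrow> generic (Q i)"
  shows "generic (\<lambda>v. \<forall>i\<in>I. Q i v)"
proof -
  have "\<forall>i\<in>I. \<exists>S. finite S \<and> (\<forall>f\<in>S. (\<exists>e. multidegree e f) \<and> (\<exists>v. eval_at f v \<noteq> 0)) \<and> (\<forall>v. (\<forall>f\<in>S. eval_at f v \<noteq> 0) \<longrightarrow> Q i v)"
    using assms(2) unfolding generic_def by blast
  then obtain S where "\<forall>i\<in>I. finite (S i) \<and> (\<forall>f\<in>S i. (\<exists>e. multidegree e f) \<and> (\<exists>v. eval_at f v \<noteq> 0)) \<and> (\<forall>v. (\<forall>f\<in>S i. eval_at f v \<noteq> 0) \<longrightarrow> Q i v)"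
    by (rule bchoice[THEN exE])
  then show ?thesis
    unfolding generic_def by (intro exI[of _ "\<Union>i\<in>I. S i"]) (use assms(1) in auto)
qed

lemma generic_conj: "generic Q \<Longrightarrow> generic Q' \<Longrightarrow> generic (\<lambda>v. Q v \<and> Q' v)"
  by (rule generic_mono[OF generic_Ball[of "{True, False}" "\<lambda>b. if b then Q else Q'"]]) (auto split: if_splits)

lemma generic_if: "(P \<Longrightarrow> generic Q) \<Longrightarrow> generic (\<lambda>v. P \<longrightarrow> Q v)"
  by (rule generic_mono[OF generic_Ball[of "if P then {()} else {}" "\<lambda>_. Q"]]) (auto split: if_splits)

lemma generic_dense:
  assumes inf: "infinite (UNIV :: 'K set)" and "generic Q"
  shows "\<exists>U. zariski_dense_open \<phi> U \<and>
    (\<forall>p\<in>U. \<exists>v. (\<forall>j. v j \<noteq> 0 \<and> p j = vec.span {v j}) \<and> Q v)"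
proof -
  obtain S where S: "finite S" "\<And>f. f \<in> S \<Longrightarrow> \<exists>e. multidegree e f" "\<And>f. f \<in> S \<Longrightarrow> \<exists>v. eval_at f v \<noteq> 0"
    and Q: "\<And>v. (\<forall>f\<in>S. eval_at f v \<noteq> 0) \<Longrightarrow> Q v"
    using assms(2) unfolding generic_def by blast
  obtain U where U: "zariski_dense_open \<phi> U"
    "\<And>p. p \<in> U \<Longrightarrow> \<exists>v. (\<forall>j. v j \<noteq> 0 \<and> p j = vec.span {v j}) \<and> (\<forall>f\<in>S. eval_at f v \<noteq> 0)"
    using dense_open_of_forms[OF inf S] by blast
  show ?thesis by (intro exI[of _ U] conjI U(1) ballI) (use U(2) Q in blast)
qed

end

text \<open>A test tuple prescribes \<open>A l\<close> only for \<open>l < d\<close>, so agreement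
  can be asked only on members of the pairs.\<close>

lemma pair_matrix_cong:
  assumes "\<And>i l. i \<in> S \<Longrightarrow> i \<noteq> i0 \<Longrightarrow> l \<in> \<pi> i \<Longrightarrow> A l = A' l" and "x = y"
  shows "pair_matrix S i0 \<pi> A x = pair_matrix S i0 \<pi> A' y"
  using assms by (auto simp: pair_matrix_def vec_eq_iff intro!: prod.cong)

lemma kernel_vec_cong:
  assumes "\<And>i l. i \<in> S \<Longrightarrow> i \<noteq> i0 \<Longrightarrow> l \<in> \<pi> i \<Longrightarrow> A l = A' l"
  shows "kernel_vec S i0 \<pi> A j = kernel_vec S i0 \<pi> A' j"
  unfolding kernel_vec_def by (intro arg_cong[of _ _ det] pair_matrix_cong refl assms)

lemma kernel_norm_cong:
  assumes "\<And>i l. i \<in> S \<Longrightarrow> i \<noteq> i0 \<Longrightarrow> l \<in> \<pi> i \<Longrightarrow> A l = A' l" and "A l = A' l"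
  shows "kernel_norm S i0 \<pi> A l = kernel_norm S i0 \<pi> A' l"
  unfolding kernel_norm_def assms(2) by (intro arg_cong[of _ _ det] pair_matrix_cong refl assms(1))

lemma diag_form_cong:
  assumes "\<And>l. l < d \<Longrightarrow> s l = s' l" "b = b'" "\<And>l. l < d \<Longrightarrow> a l = a' l"
  shows "diag_form d s b a = diag_form d s' b' a'"
  using assms by (simp add: diag_form_def)

context point_config
begin

abbreviation coord :: "('g \<Rightarrow> 'K ^ 'n) \<Rightarrow> nat \<Rightarrow> 'n \<Rightarrow> 'K"
  where "coord v l i \<equiv> eval_at (cramer l i) v"

lemma coord_point: "l < d \<Longrightarrow> coord (point A) l = A l"
  by (rule ext) (rule eval_at_cramer_point)

lemma pairs_sub: "T \<in> pairs d \<Longrightarrow> l \<in> T \<Longrightarrow> l < d"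
  by (auto simp: pairs_def)

lemma pairs_card: "T \<in> pairs d \<Longrightarrow> finite T \<and> card T = 2"
  by (auto simp: pairs_def intro: finite_subset)

lemma generic_frame_det: "generic (\<lambda>v. eval_at frame_det v \<noteq> 0)"
  by (rule generic_form[OF multidegree_frame_det, where v = "point (\<lambda>_ _. 0)"]) (simp add: eval_at_frame_det_point)

lemma generic_coord: "l < d \<Longrightarrow> generic (\<lambda>v. coord v l i \<noteq> 0)"
  by (rule generic_form[OF multidegree_cramer, where v = "point (\<lambda>_ _. 1)"]) (simp add: eval_at_cramer_point)

lemma generic_minor:
  assumes lm: "l < d" "m < d" "l \<noteq> m" and ij: "i \<noteq> j"
  shows "generic (\<lambda>v. coord v l i * coord v m j - coord v l j * coord v m i \<noteq> 0)"
proof -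
  let ?f = "cramer l i * cramer m j - cramer l j * cramer m i"
  let ?e = "\<lambda>b. (block_deg (Inr l) b + basis_deg b + - block_deg (Inl i) b) + (block_deg (Inr m) b + basis_deg b + - block_deg (Inl j) b)"
  have "multidegree ?e (cramer l j * cramer m i)" by (rule multidegree_cong[OF multidegree_mult[OF multidegree_cramer multidegree_cramer]]) simp
  then have multidegree: "multidegree ?e ?f" by (rule multidegree_diff[OF multidegree_mult[OF multidegree_cramer multidegree_cramer]])
  \<comment> \<open>Point \<open>l\<close> sits at the axis point \<open>i\<close> and all others at
    the axis point \<open>j\<close>, so the minor is 1.\<close>
  let ?A = "\<lambda>l' k. if l' = l then (if k = i then 1 else 0) else if k = j then 1 else 0 :: 'K"
  have "eval_at ?f (point ?A) \<noteq> 0"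
    using lm ij by (simp add: eval_at_diff eval_at_simps(4) eval_at_cramer_point)
  then have "generic (\<lambda>v. eval_at ?f v \<noteq> 0)" by (rule generic_form[OF multidegree])
  then show ?thesis by (simp add: eval_at_diff eval_at_simps(4))
qed

lemma generic_det_pairs:
  assumes le: "CARD('n) \<le> d choose 2"
  shows "generic (\<lambda>v. \<exists>\<pi>. (\<forall>i. \<pi> i \<in> pairs d) \<and> det (\<chi> i j. \<Prod>l\<in>\<pi> i. coord v l j) \<noteq> 0)"
proof -
  obtain \<pi> :: "'n \<Rightarrow> nat set" where \<pi>: "range \<pi> \<subseteq> pairs d" "inj \<pi>"
    using card_le_inj[of "UNIV :: 'n set" "pairs d"] le by (auto simp: finite_pairs card_pairs)
  have \<pi>p: "\<pi> i \<in> pairs d" for i using \<pi>(1) by auto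
  let ?f = "det (\<chi> i j. \<Prod>l\<in>\<pi> i. cramer l j)"
  have multidegree: "multidegree (\<lambda>b. (\<Sum>i\<in>UNIV. \<Sum>l\<in>\<pi> i. block_deg (Inr l) b + basis_deg b) + (\<Sum>i\<in>UNIV. - 2 * block_deg (Inl i) b)) ?f"
    by (rule multidegree_det) (simp only: vec_lambda_beta, rule multidegree_cramer_prod; use pairs_card[OF \<pi>p] in blast)
  \<comment> \<open>With column \<open>j\<close> supported on the pair of \<open>j\<close>, and
    distinct pairs for distinct rows, the matrix is the identity.\<close>
  let ?A = "\<lambda>l j. if l \<in> \<pi> j then 1 else 0 :: 'K"
  have "(\<Prod>l\<in>\<pi> i. coord (point ?A) l j) = (if i = j then 1 else 0)" for i j
  proof -
    have "(\<Prod>l\<in>\<pi> i. coord (point ?A) l j) = (\<Prod>l\<in>\<pi> i. if l \<in> \<pi> j then 1 else 0)"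
      by (rule prod.cong[OF refl]) (simp add: eval_at_cramer_point pairs_sub[OF \<pi>p])
    also have "\<dots> = (if \<pi> i = \<pi> j then 1 else 0)" by (rule prod_pattern[OF \<pi>p \<pi>p])
    finally show ?thesis by (simp only: inj_eq[OF \<pi>(2)])
  qed
  then have "eval_at ?f (point ?A) = det (mat 1 :: 'K ^ 'n ^ 'n)"
    unfolding eval_at_det by (intro arg_cong[of _ _ det]) (simp add: vec_eq_iff eval_at_prod mat_def)
  then have "generic (\<lambda>v. eval_at ?f v \<noteq> 0)" by (intro generic_form[OF multidegree, of "point ?A"]) simp
  then show ?thesis
    by (rule generic_mono) (use \<pi>p in \<open>auto simp: eval_at_det eval_at_prod intro!: exI[of _ \<pi>]\<close>)
qed

lemma generic_independent_pairs:
  assumes S: "card S = Suc (d choose 2)"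
  shows "generic (\<lambda>v. independent_pairs d (coord v) S)"
proof -
  obtain i0 where i0: "i0 \<in> S" using S by (metis card.empty ex_in_conv nat.distinct(1))
  obtain \<pi> where \<pi>: "bij_betw \<pi> (S - {i0}) (pairs d)" using exists_pairing[OF S i0] by blast
  have \<pi>p: "\<pi> i \<in> pairs d" if "i \<in> S" "i \<noteq> i0" for i using \<pi> that by (auto simp: bij_betw_def)
  have fin: "finite (\<pi> i) \<and> card (\<pi> i) = 2" if "i \<in> S" "i \<noteq> i0" for i using pairs_card[OF \<pi>p[OF that]] .
  have cp: "coord (point A) l = A l" if "i \<in> S" "i \<noteq> i0" "l \<in> \<pi> i" for A i l
    by (rule coord_point[OF pairs_sub[OF \<pi>p[OF that(1,2)] that(3)]])
  have "generic (\<lambda>v. kernel_vec S i0 \<pi> (coord v) j \<noteq> 0)" if j: "j \<in> S" for j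
  proof -
    obtain \<sigma> where \<sigma>: "bij_betw \<sigma> (S - {j}) (pairs d)" using exists_pairing[OF S j] by blast
    let ?A = "\<lambda>l i. if i \<in> S - {j} \<and> l \<in> \<sigma> i then 1 else 0 :: 'K"
    have "kernel_vec S i0 \<pi> (coord (point ?A)) j = kernel_vec S i0 \<pi> ?A j" by (rule kernel_vec_cong) (rule cp)
    also have "\<dots> \<noteq> 0" by (rule kernel_vec_pattern[OF i0 j \<pi> \<sigma>]) simp
    finally have "eval_at (kernel_vec S i0 \<pi> cramer j) (point ?A) \<noteq> 0" by (simp add: eval_at_kernel_vec)
    moreover obtain e where "multidegree e (kernel_vec S i0 \<pi> cramer j)" using multidegree_kernel_vec[of S i0 \<pi> j] fin by blast
    ultimately have "generic (\<lambda>v. eval_at (kernel_vec S i0 \<pi> cramer j) v \<noteq> 0)" by (rule generic_form[rotated])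
    then show ?thesis by (simp add: eval_at_kernel_vec)
  qed
  then have 1: "generic (\<lambda>v. \<forall>j\<in>S. kernel_vec S i0 \<pi> (coord v) j \<noteq> 0)" by (intro generic_Ball) auto
  have "generic (\<lambda>v. kernel_norm S i0 \<pi> (coord v) l \<noteq> 0)" if l: "l < d" for l
  proof -
    let ?A = "\<lambda>l' i. if i = i0 then (if l' = l then 1 else 0) else if i \<in> S \<and> l' \<in> \<pi> i then 1 else 0 :: 'K"
    have "kernel_norm S i0 \<pi> (coord (point ?A)) l = kernel_norm S i0 \<pi> ?A l"
      by (rule kernel_norm_cong) (rule cp, assumption+, rule coord_point[OF l])
    also have "\<dots> \<noteq> 0" by (rule kernel_norm_pattern[OF i0 \<pi> l]) simp_all
    finally have "eval_at (kernel_norm S i0 \<pi> cramer l) (point ?A) \<noteq> 0" by (simp add: eval_at_kernel_norm)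
    moreover obtain e where "multidegree e (kernel_norm S i0 \<pi> cramer l)" using multidegree_kernel_norm[of S i0 \<pi> l] fin by blast
    ultimately have "generic (\<lambda>v. eval_at (kernel_norm S i0 \<pi> cramer l) v \<noteq> 0)" by (rule generic_form[rotated])
    then show ?thesis by (simp add: eval_at_kernel_norm)
  qed
  then have 2: "generic (\<lambda>v. \<forall>l\<in>{..<d}. kernel_norm S i0 \<pi> (coord v) l \<noteq> 0)" by (intro generic_Ball) auto
  show ?thesis
    by (rule generic_mono[OF generic_conj[OF 1 2]]) (use i0 \<pi> in \<open>auto simp: independent_pairs_def\<close>)
qed

text \<open>In this case the weights are unique up to scalars for general points, so no freedom is
  left to make a diagonal entry of \<open>Q\<close> nonzero. One explicit tuple with such an entry
  is needed.\<close>

lemma generic_diag_form: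
  assumes inf: "infinite (UNIV :: 'K set)" and N: "Suc (d choose 2) = CARD('n)" and d: "3 \<le> d"
  shows "generic (\<lambda>v. \<exists>i0 \<pi> i1. bij_betw \<pi> (UNIV - {i0}) (pairs d) \<and>
      diag_form d (kernel_norm UNIV i0 \<pi> (coord v)) (kernel_vec UNIV i0 \<pi> (coord v) i1) (\<lambda>l. coord v l i1) \<noteq> 0)"
proof -
  fix i0 :: 'n
  obtain \<pi> where \<pi>: "bij_betw \<pi> (UNIV - {i0}) (pairs d)"
    using exists_pairing[of "UNIV :: 'n set" d i0] N by auto
  have \<pi>p: "\<pi> i \<in> pairs d" if "i \<noteq> i0" for i using \<pi> that by (auto simp: bij_betw_def)
  have fin: "finite (\<pi> i) \<and> card (\<pi> i) = 2" if "i \<noteq> i0" for i using pairs_card[OF \<pi>p[OF that]] .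
  have "{0, 1} \<in> pairs d" using d by (simp add: pairs_def)
  then have "{0, 1} \<in> \<pi> ` (UNIV - {i0})" using \<pi> by (simp add: bij_betw_def)
  then obtain i1 where i1: "i1 \<noteq> i0" "\<pi> i1 = {0, 1}" by auto
  let ?d = "of_nat d :: 'K"
  \<comment> \<open>With all \<open>z l\<close> equal to 1 except \<open>z 2 = y\<close>, the sum is
    \<open>?d + y - 1\<close>. The excluded values are the zeros of \<open>z 2\<close>, of
    \<open>2 * z l\<close> minus the sum for \<open>l\<close> different from 2 and for
    \<open>l = 2\<close>, and of 4 minus the sum.\<close>
  obtain y :: 'K where y: "y \<notin> {0, 3 - ?d, ?d - 1, 5 - ?d}"
    using ex_new_if_finite[OF inf, of "{0, 3 - ?d, ?d - 1, 5 - ?d}"] by auto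
  define z where "z l = (if l = 2 then y else 1)" for l :: nat
  have "(\<Sum>m<d. z m) = (\<Sum>m<d. 1 + (if m = 2 then y - 1 else 0))" by (rule sum.cong) (auto simp: z_def)
  also have "\<dots> = ?d + y - 1" using d by (simp add: sum.distrib)
  finally have sz: "(\<Sum>m<d. z m) = ?d + y - 1" .
  let ?A = "\<lambda>l i. if i = i0 then z l else if l \<in> \<pi> i then 1 else 0"
  have nz: "diag_form d (kernel_norm UNIV i0 \<pi> ?A) (kernel_vec UNIV i0 \<pi> ?A i1) (\<lambda>l. ?A l i1) \<noteq> 0"
  proof (rule diag_form_pattern[OF \<pi> d i1, where z = z])
    show "2 * z l - (\<Sum>m<d. z m) \<noteq> 0" for l
      unfolding sz using y by (auto simp: z_def algebra_simps)
    show "4 - (\<Sum>m<d. z m) \<noteq> 0" unfolding sz using y by (auto simp: algebra_simps)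
  qed (use y in \<open>auto simp: z_def\<close>)
  have cp: "coord (point A) l = A l" if "i \<noteq> i0" "l \<in> \<pi> i" for A i l
    by (rule coord_point[OF pairs_sub[OF \<pi>p[OF that(1)] that(2)]])
  let ?f = "diag_form d (kernel_norm UNIV i0 \<pi> cramer) (kernel_vec UNIV i0 \<pi> cramer i1) (\<lambda>l. cramer l i1)"
  have "eval_at ?f (point ?A) = diag_form d (kernel_norm UNIV i0 \<pi> ?A) (kernel_vec UNIV i0 \<pi> ?A i1) (\<lambda>l. ?A l i1)"
    unfolding eval_at_diag_form eval_at_kernel_vec eval_at_kernel_norm
  proof (rule diag_form_cong)
    show "kernel_norm UNIV i0 \<pi> (coord (point ?A)) l = kernel_norm UNIV i0 \<pi> ?A l" if "l < d" for l
      by (rule kernel_norm_cong) (rule cp, assumption+, rule coord_point[OF that])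
    show "kernel_vec UNIV i0 \<pi> (coord (point ?A)) i1 = kernel_vec UNIV i0 \<pi> ?A i1"
      by (rule kernel_vec_cong) (rule cp)
    show "coord (point ?A) l i1 = ?A l i1" if "l < d" for l by (rule eval_at_cramer_point[OF that])
  qed
  then have E0: "eval_at ?f (point ?A) \<noteq> 0" using nz by simp
  obtain e where "multidegree e ?f" using multidegree_diag_form[of UNIV i0 \<pi>] fin by blast
  then have "generic (\<lambda>v. eval_at ?f v \<noteq> 0)" by (rule generic_form[OF _ E0])
  then show ?thesis
  proof (rule generic_mono)
    fix v assume "eval_at ?f v \<noteq> 0"
    then show "\<exists>i0 \<pi> i1. bij_betw \<pi> (UNIV - {i0}) (pairs d) \<and>
        diag_form d (kernel_norm UNIV i0 \<pi> (coord v)) (kernel_vec UNIV i0 \<pi> (coord v) i1) (\<lambda>l. coord v l i1) \<noteq> 0"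
      unfolding eval_at_diag_form eval_at_kernel_vec eval_at_kernel_norm using \<pi> by blast
  qed
qed

lemma frame_of_tuple:
  assumes inf: "infinite (UNIV :: 'K set)" and n2: "CARD('n) \<ge> 2" and d_le: "d \<le> CARD('n)"
    and frame_det: "eval_at frame_det v \<noteq> 0"
  shows "\<exists>P R. frame P R d \<and> frame.\<Gamma> P d (\<lambda>l. \<chi> i. coord v l i) = range (\<lambda>j. vec.span {v j})"
proof -
  let ?P = "\<chi> x i. v (\<kappa> (Inl i)) $ x"
  let ?a = "\<lambda>l. \<chi> i. coord v l i"
  have "invertible ?P" using frame_det by (simp add: eval_at_frame_det invertible_det_nz)
  then obtain R where R: "?P ** R = mat 1" "R ** ?P = mat 1" unfolding invertible_def by blast
  interpret f: frame ?P R d ?a by unfold_locales (fact R(2) R(1) inf n2 d_le)+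
  have scale: "vec.span {t *s w} = vec.span {w}" if "t \<noteq> 0" for t :: 'K and w :: "'K ^ 'n"
    using vec.span_image_scale[of "{w}" "\<lambda>_. t"] that by simp
  have "f.pt (f.G k) = vec.span {v (\<kappa> k)}" for k
  proof (cases k)
    case (Inl i)
    have "?P *v axis i 1 = v (\<kappa> (Inl i))"
      by (simp add: matrix_vector_mult_def axis_def vec_eq_iff if_distrib cong: if_cong)
    then show ?thesis by (simp add: f.pt_def f.G_def Inl)
  next
    case (Inr l)
    let ?y = "R *v v (\<kappa> (Inr l))"
    have y: "?P *v ?y = v (\<kappa> (Inr l))" by (rule f.PR_cancel)
    \<comment> \<open>The Cramer coordinates are the frame coordinates multiplied by
      \<open>frame_det\<close>, which does not change the projective point.\<close>
    have "?a l = eval_at frame_det v *s ?y" by (simp add: vec_eq_iff eval_at_cramer[OF y] mult.commute)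
    then have "?P *v ?a l = eval_at frame_det v *s v (\<kappa> (Inr l))" by (simp only: vector_scalar_commute y)
    then show ?thesis by (simp only: f.pt_def f.G_def Inr sum.case scale[OF frame_det])
  qed
  then have "f.\<Gamma> = (\<lambda>j. vec.span {v j}) ` (\<kappa> ` f.I0)" by (simp add: f.\<Gamma>_def image_image)
  also have "\<kappa> ` f.I0 = UNIV" using \<kappa> by (simp add: bij_betw_def)
  finally show ?thesis using f.frame_axioms by blast
qed

theorem general_tuple:
  assumes inf: "infinite (UNIV :: 'K set)" and r: "r \<ge> 1" and n: "CARD('n) = r + 1" and d_le: "d \<le> r + 1"
  shows "\<exists>U :: ('g \<Rightarrow> ('K ^ 'n) set) set. zariski_dense_open \<phi> U \<and>
    (\<forall>p \<in> U. let \<Gamma> = range p in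
       card \<Gamma> = r + 1 + d \<and>
       ((\<exists>\<Gamma>'. gorenstein_extension (2 * r + 2) \<Gamma> \<Gamma>') \<longleftrightarrow> d choose 2 \<le> r) \<and>
       (d choose 2 = r \<longrightarrow>
         (\<exists>!L. proj_subspace L (int r - int d) \<and>
               (\<forall>\<Gamma>'. gorenstein_extension (2 * r + 2) \<Gamma> \<Gamma>' \<longrightarrow> proj_span \<Gamma>' = L))))"
proof -
  have n2: "CARD('n) \<ge> 2" using n r by simp
  obtain i j :: 'n where ij: "i \<noteq> j"
  proof -
    have "\<not> is_singleton (UNIV :: 'n set)" using n2 by (simp add: is_singleton_altdef)
    then show ?thesis using that is_singletonI'[of "UNIV :: 'n set"] by blast
  qed
  \<comment> \<open>\<open>?co\<close> and \<open>?mi\<close> keep the points distinct,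
    \<open>?no\<close> excludes extensions when there are too many pairs, \<open>?in\<close> and
    \<open>?H\<close> provide them otherwise, and \<open>?in\<close> also gives uniqueness.\<close>
  let ?co = "\<lambda>v :: 'g \<Rightarrow> 'K ^ 'n. \<forall>l\<in>{..<d}. \<forall>i\<in>UNIV. coord v l i \<noteq> 0"
  let ?mi = "\<lambda>v. \<forall>l\<in>{..<d}. \<forall>m\<in>{..<d}. l \<noteq> m \<longrightarrow> coord v l i * coord v m j - coord v l j * coord v m i \<noteq> 0"
  let ?no = "\<lambda>v. CARD('n) \<le> d choose 2 \<longrightarrow> (\<exists>\<pi>. (\<forall>i. \<pi> i \<in> pairs d) \<and> det (\<chi> i j. \<Prod>l\<in>\<pi> i. coord v l j) \<noteq> 0)"
  let ?in = "\<lambda>v. \<forall>S\<in>{S. card S = Suc (d choose 2)}. independent_pairs d (coord v) S"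
  let ?H = "\<lambda>v. Suc (d choose 2) = CARD('n) \<longrightarrow> 3 \<le> d \<longrightarrow> (\<exists>i0 \<pi> i1. bij_betw \<pi> (UNIV - {i0}) (pairs d) \<and>
      diag_form d (kernel_norm UNIV i0 \<pi> (coord v)) (kernel_vec UNIV i0 \<pi> (coord v) i1) (\<lambda>l. coord v l i1) \<noteq> 0)"
  have "generic ?co" by (intro generic_Ball generic_coord) auto
  moreover have "generic ?mi" by (intro generic_Ball generic_if generic_minor ij) auto
  moreover have "generic ?no" by (intro generic_if generic_det_pairs)
  moreover have "generic ?in" by (intro generic_Ball generic_independent_pairs) auto
  moreover have "generic ?H" by (intro generic_if generic_diag_form inf)
  ultimately have "generic (\<lambda>v. eval_at frame_det v \<noteq> 0 \<and> ?co v \<and> ?mi v \<and> ?no v \<and> ?in v \<and> ?H v)"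
    by (intro generic_conj generic_frame_det)
  then obtain U where U: "zariski_dense_open \<phi> U \<and> (\<forall>p\<in>U. \<exists>v. (\<forall>j. v j \<noteq> 0 \<and> p j = vec.span {v j}) \<and>
      eval_at frame_det v \<noteq> 0 \<and> ?co v \<and> ?mi v \<and> ?no v \<and> ?in v \<and> ?H v)"
    by (rule generic_dense[OF inf, THEN exE]) (rule that)
  have main: "card (range p) = r + 1 + d \<and>
       ((\<exists>\<Gamma>'. gorenstein_extension (2 * r + 2) (range p) \<Gamma>') \<longleftrightarrow> d choose 2 \<le> r) \<and>
       (d choose 2 = r \<longrightarrow>
         (\<exists>!L. proj_subspace L (int r - int d) \<and>
               (\<forall>\<Gamma>'. gorenstein_extension (2 * r + 2) (range p) \<Gamma>' \<longrightarrow> proj_span \<Gamma>' = L)))"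
    if pU: "p \<in> U" for p
  proof -
    obtain v where p: "\<forall>j. v j \<noteq> 0 \<and> p j = vec.span {v j}" and frame_det: "eval_at frame_det v \<noteq> 0"
      and co: "?co v" and mi: "?mi v" and no: "?no v" and ind: "?in v" and H: "?H v"
      using bspec[OF conjunct2[OF U] pU] by (elim exE conjE) (rule that)
    let ?a = "\<lambda>l. \<chi> i. coord v l i"
    obtain P R where fr: "frame P R d" and \<Gamma>: "frame.\<Gamma> P d ?a = range (\<lambda>j. vec.span {v j})"
      using frame_of_tuple[OF inf n2 _ frame_det] d_le n by auto
    interpret f: frame P R d ?a by (rule fr)
    have rp: "range p = f.\<Gamma>" unfolding \<Gamma> using p by auto
    have N: "2 * r + 2 = 2 * CARD('n)" and e: "int r - int d = int CARD('n) - 1 - int d" using n by auto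
    have a0: "?a l $ i \<noteq> 0" if "l < d" for l i using co that by simp
    have a_nz: "?a l \<noteq> 0" if "l < d" for l using a0[OF that] by (metis zero_index)
    have card: "card f.\<Gamma> = CARD('n) + d"
    proof (rule f.card_\<Gamma>[OF a0])
      show "\<exists>i j. ?a l $ i * ?a m $ j - ?a l $ j * ?a m $ i \<noteq> 0" if "l < d" "m < d" "l \<noteq> m" for l m
        by (rule exI[of _ i], rule exI[of _ j]) (use mi that in simp)
    qed
    have ex: "\<exists>\<Gamma>'. gorenstein_extension (2 * CARD('n)) f.\<Gamma> \<Gamma>'" if le: "d choose 2 \<le> r"
    proof (cases "d = 0")
      case False
      show ?thesis
      proof (rule f.extension_of_independent_pairs[OF _ a0])
        show "independent_pairs d (\<lambda>l i. ?a l $ i) S" if "card S = Suc (d choose 2)" for S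
          using ind that by simp
        assume c: "Suc (d choose 2) = CARD('n)" and d: "d \<noteq> CARD('n)"
        \<comment> \<open>For \<open>d = 1\<close> the equation \<open>c\<close> would give
          \<open>CARD('n) = 1\<close>, and for \<open>d = 2\<close> it would give
          \<open>CARD('n) = d\<close>.\<close>
        have "d \<noteq> 1" "d \<noteq> 2" using c d n r by (auto simp: numeral_2_eq_2)
        then have "3 \<le> d" using False by simp
        then show "\<exists>i0 \<pi> i1. bij_betw \<pi> (UNIV - {i0}) (pairs d) \<and>
          diag_form d (kernel_norm UNIV i0 \<pi> (\<lambda>l i. ?a l $ i)) (kernel_vec UNIV i0 \<pi> (\<lambda>l i. ?a l $ i) i1) (\<lambda>l. ?a l $ i1) \<noteq> 0"
          using H c by simp
      qed (use False le n in auto)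
    qed (rule f.extension_of_simplex)
    have nex: "\<not> gorenstein_extension (2 * CARD('n)) f.\<Gamma> \<Gamma>'" if "\<not> d choose 2 \<le> r" for \<Gamma>'
    proof -
      have "CARD('n) \<le> d choose 2" using that n by simp
      then obtain \<pi> where \<pi>: "\<And>i. \<pi> i \<in> pairs d" "det (\<chi> i j. \<Prod>l\<in>\<pi> i. ?a l $ j) \<noteq> 0"
        using no by auto
      show ?thesis by (rule f.no_extension[OF a_nz card \<pi>])
    qed
    have uniq: "\<exists>!L. proj_subspace L (int CARD('n) - 1 - int d) \<and>
        (\<forall>\<Gamma>'. gorenstein_extension (2 * CARD('n)) f.\<Gamma> \<Gamma>' \<longrightarrow> proj_span \<Gamma>' = L)" if eq: "d choose 2 = r"
    proof -
      have "independent_pairs d (coord v) UNIV" using ind eq n by simp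
      then obtain i0 \<pi> where \<pi>: "bij_betw \<pi> (UNIV - {i0}) (pairs d)" "kernel_vec UNIV i0 \<pi> (\<lambda>l i. ?a l $ i) i0 \<noteq> 0"
        unfolding independent_pairs_def by auto
      obtain \<Gamma>0 where \<Gamma>0: "gorenstein_extension (2 * CARD('n)) f.\<Gamma> \<Gamma>0" using ex eq by blast
      show ?thesis
      proof (rule ex1I[of _ "proj_span \<Gamma>0"])
        show "proj_subspace (proj_span \<Gamma>0) (int CARD('n) - 1 - int d) \<and>
          (\<forall>\<Gamma>'. gorenstein_extension (2 * CARD('n)) f.\<Gamma> \<Gamma>' \<longrightarrow> proj_span \<Gamma>' = proj_span \<Gamma>0)"
          using f.extension_span_dim[OF a_nz card \<Gamma>0] f.extension_span_unique[OF a_nz card \<pi> _ \<Gamma>0] by blast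
      qed (use \<Gamma>0 in blast)
    qed
    show ?thesis
      unfolding rp N e
    proof (intro conjI iffI impI)
      show "card f.\<Gamma> = r + 1 + d" using card n by simp
      show "d choose 2 \<le> r" if "\<exists>\<Gamma>'. gorenstein_extension (2 * CARD('n)) f.\<Gamma> \<Gamma>'"
        using nex that by blast
    qed (rule ex uniq, assumption)+
  qed
  show ?thesis
    unfolding Let_def by (rule exI[of _ U], rule conjI[OF conjunct1[OF U]], rule ballI, rule main)
qed

end

text \<open>By the pigeonhole principle a nonzero element has a positive exponent at most
  \<open>N\<close> with power 1, and such an exponent divides \<open>fact N\<close>; hence
  \<open>q\<close> can be \<open>Suc (fact N)\<close>.\<close>

lemma finite_field_power:
  assumes "finite (UNIV :: 'K::field set)"
  shows "\<exists>q\<ge>2. \<forall>x :: 'K. x ^ q = x"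
proof -
  define N where "N = CARD('K)"
  have "x ^ Suc (fact N) = x" for x :: 'K
  proof (cases "x = 0")
    case False
    have "card ((\<lambda>i. x ^ i) ` {..N}) \<le> N" unfolding N_def by (rule card_mono[OF assms]) simp
    then have "\<not> inj_on (\<lambda>i. x ^ i) {..N}" using card_image[of "\<lambda>i. x ^ i" "{..N}"] by auto
    then obtain i j where "i \<le> N" "j \<le> N" "i < j" "x ^ i = x ^ j"
      unfolding inj_on_def by (metis atMost_iff linorder_neqE_nat)
    then have m: "x ^ (j - i) = 1" "j - i > 0" "j - i \<le> N"
      using False power_diff[of x i j] by auto
    then have "j - i dvd fact N" by (intro dvd_fact) auto
    then obtain c where "fact N = (j - i) * c" by (rule dvdE)
    then have "x ^ fact N = 1" using m(1) by (simp add: power_mult)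
    then show ?thesis by simp
  qed simp
  moreover have "Suc (fact N) \<ge> 2" using fact_ge_1[of N, where ?'a = nat] by simp
  ultimately show ?thesis by blast
qed

text \<open>
  Over a finite field of coordinates a nonempty open set need not have rational points: the form
  \<open>x^q y - x y^q\<close> vanishes at all of them.
\<close>

lemma (in field_hom) finite_dense_open:
  assumes fin: "finite (UNIV :: 'K set)" and ij: "i1 \<noteq> (i2 :: 'n::finite)"
  shows "zariski_dense_open \<phi> ({} :: ('g::finite \<Rightarrow> ('K ^ 'n) set) set)"
proof -
  obtain q where q: "q \<ge> 2" "\<And>x :: 'K. x ^ q = x" using finite_field_power[OF fin] by blast
  fix j :: 'g
  define mo where "mo i i' = Poly_Mapping.single (j, i) q + Poly_Mapping.single (j, i') (1::nat)" for i i' :: 'n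
  define f :: "('g \<times> 'n, 'k) mpoly" where "f = Poly_Mapping.single (mo i1 i2) 1 - Poly_Mapping.single (mo i2 i1) 1"
  have "Poly_Mapping.lookup (mo i1 i2) (j, i1) = q" "Poly_Mapping.lookup (mo i2 i1) (j, i1) = 1"
    using ij by (simp_all add: mo_def lookup_add lookup_single when_def)
  then have "mo i1 i2 \<noteq> mo i2 i1" using q(1) by auto
  then have "Poly_Mapping.lookup f (mo i1 i2) = 1" by (simp add: f_def lookup_minus lookup_single when_def)
  then have f0: "f \<noteq> 0" by auto
  have deg: "(\<Sum>i\<in>UNIV. Poly_Mapping.lookup (mo k k') (b, i)) = (if b = j then Suc q else 0)" for k k' b
    by (simp add: mo_def lookup_add lookup_single when_def sum.distrib)
  have multidegree: "multidegree (\<lambda>b. int (if b = j then Suc q else 0)) (Poly_Mapping.single (mo k k') (1 :: 'k))" for k k'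
    unfolding multidegree_def by (simp add: deg)
  have "multihomogeneous f" unfolding f_def by (rule multidegree_imp_multihomogeneous[OF multidegree_diff[OF multidegree multidegree]])
  have ev: "eval_at (Poly_Mapping.single (mo k k') 1) v = v j $ k * v j $ k'" for k k' v
  proof -
    have pw: "(\<Prod>x\<in>UNIV. (case x of (j, i) \<Rightarrow> v j $ i) ^ Poly_Mapping.lookup (Poly_Mapping.single (j, i) n) x) = v j $ i ^ n" for i n
    proof -
      have "(\<Prod>x\<in>UNIV. (case x of (j, i) \<Rightarrow> v j $ i) ^ Poly_Mapping.lookup (Poly_Mapping.single (j, i) n) x)
        = (\<Prod>x\<in>UNIV. if x = (j, i) then v j $ i ^ n else 1)"
        by (rule prod.cong) (auto simp: lookup_single when_def)
      then show ?thesis by simp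
    qed
    show ?thesis
      by (simp only: eval_at_def eval_single one mo_def lookup_add power_add prod.distrib pw q(2) power_one_right mult_1_left)
  qed
  have "eval_at f v = 0" for v by (simp add: f_def eval_at_diff ev mult.commute)
  then have "nonvanishing_locus \<phi> {f} = {}" by (simp add: nonvanishing_locus_def eval_at_def)
  then show ?thesis
    unfolding zariski_dense_open_def using f0 \<open>multihomogeneous f\<close> by (intro exI[of _ "{f}"]) simp
qed

theorem theorem8p6:
  fixes \<phi> :: "'k::field \<Rightarrow> 'K::field" and r d :: nat
  assumes "\<phi> \<in> ring_hom type_ring type_ring"
    and "r \<ge> 1" and "r + 1 + d \<le> 2 * r + 2"
    and "CARD('n::finite) = r + 1" and "CARD('g::finite) = r + 1 + d"
  shows "\<exists>U :: ('g \<Rightarrow> ('K ^ 'n) set) set. zariski_dense_open \<phi> U \<and>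
    (\<forall>p \<in> U. let \<Gamma> = range p in
       card \<Gamma> = r + 1 + d \<and>
       ((\<exists>\<Gamma>'. gorenstein_extension (2 * r + 2) \<Gamma> \<Gamma>') \<longleftrightarrow> d choose 2 \<le> r) \<and>
       (d choose 2 = r \<longrightarrow>
         (\<exists>!L. proj_subspace L (int r - int d) \<and>
               (\<forall>\<Gamma>'. gorenstein_extension (2 * r + 2) \<Gamma> \<Gamma>' \<longrightarrow> proj_span \<Gamma>' = L))))"
proof -
  have hom: "\<phi> (a + b) = \<phi> a + \<phi> b" "\<phi> (a * b) = \<phi> a * \<phi> b" "\<phi> 1 = 1" for a b
    using ring_hom_add[OF assms(1)] ring_hom_mult[OF assms(1)] ring_hom_one[OF assms(1)]
    by (simp_all add: type_ring_def)
  have zero: "\<phi> 0 = 0" using hom(1)[of 0 0] by (metis add.right_neutral add_left_cancel)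
  interpret field_hom \<phi> by unfold_locales (use hom zero in auto)
  show ?thesis
  proof (cases "finite (UNIV :: 'K set)")
    case True
    obtain i j :: 'n where "i \<noteq> j"
    proof -
      have "\<not> is_singleton (UNIV :: 'n set)" using assms(2,4) by (simp add: is_singleton_altdef)
      then show ?thesis using that is_singletonI'[of "UNIV :: 'n set"] by blast
    qed
    \<comment> \<open>Over a finite field the dense open set can be chosen without rational points,
      and the claim about its points is vacuous.\<close>
    then have "zariski_dense_open \<phi> ({} :: ('g \<Rightarrow> ('K ^ 'n) set) set)" by (rule finite_dense_open[OF True])
    then show ?thesis by blast
  next
    case False
    have "card ((UNIV :: 'n set) <+> {..<d}) = card (UNIV :: 'g set)" using assms(4,5) by (simp add: card_index)
    then obtain \<kappa> :: "'n + nat \<Rightarrow> 'g" where \<kappa>: "bij_betw \<kappa> (UNIV <+> {..<d}) UNIV"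
      using finite_same_card_bij[of "(UNIV :: 'n set) <+> {..<d}" "UNIV :: 'g set"] by auto
    interpret point_config \<phi> \<kappa> d by unfold_locales (rule \<kappa>)
    show ?thesis by (rule general_tuple[OF False assms(2,4)]) (use assms(3) in simp)
  qed
qed

end
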